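(* There exist infinitely many (pairwise non-homeomorphic) achiral 1-cusped hyperbolic 3-manifolds each of which admits chirally cosmetic Dehn fillings along distance one slopes; that is, each is the interior of a compact oriented 3-manifold $M$ with boundary a single torus such that there are two slopes $\gamma_1, \gamma_2$ on $\partial M$ at distance one for which the Dehn fillings on $M$ along $\gamma_1$ and along $\gamma_2$ are chirally cosmetic.
   Context: All 3-manifolds are connected and oriented. An oriented 3-manifold is achiral if it admits an orientation-reversing self-homeomorphism. A 1-cusped hyperbolic 3-manifold is a complete hyperbolic 3-manifold of finite volume with exactly one cusp, i.e. one that is homeomorphic to the interior of a compact 3-manifold $M$ whose boundary is a single torus. A slope is an isotopy class of a non-trivial simple closed curve on a torus; the distance of two slopes is the minimal intersection number between their representatives. Given a compact oriented 3-manifold $M$ with a torus boundary $\partial M$ and a slope $\gamma$ on $\partial M$, the Dehn filling on $M$ along $\gamma$ is the operation of gluing a solid torus $V$ to $M$ along the boundary so that a simple closed curve representing $\gamma$ bounds a meridian disk in $V$; the resulting closed 3-manifold carries the orientation extending that of $M$. Dehn fillings of a cusped hyperbolic 3-manifold mean Dehn fillings of the corresponding compact manifold $M$. Two Dehn fillings on $M$ along two slopes are chirally cosmetic if the resulting closed oriented 3-manifolds are orientation-reversingly homeomorphic. *)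

theory Defs
  imports "HOL-Analysis.Analysis" "HOL-Homology.Homology"
begin

section \<open>Topological 3-manifolds with boundary\<close>

definition half_space3 :: "(real ^ 3) set" where
  "half_space3 = {x. 0 \<le> x $ 3}"

definition three_manifold :: "'a topology \<Rightarrow> bool" where
  "three_manifold X \<longleftrightarrow>
     topspace X \<noteq> {} \<and> connected_space X \<and> Hausdorff_space X \<and> second_countable X \<and>
     (\<forall>x\<in>topspace X. \<exists>U V. openin X U \<and> x \<in> U \<and> openin (top_of_set half_space3) V \<and>
        subtopology X U homeomorphic_space top_of_set V)"

definition manifold_interior :: "'a topology \<Rightarrow> 'a set" where
  "manifold_interior X =
     {x \<in> topspace X. \<exists>U (V :: (real ^ 3) set). openin X U \<and> x \<in> U \<and> open V \<and>
        subtopology X U homeomorphic_space top_of_set V}"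

definition manifold_boundary :: "'a topology \<Rightarrow> 'a set" where
  "manifold_boundary X = topspace X - manifold_interior X"

abbreviation boundary_space :: "'a topology \<Rightarrow> 'a topology" where
  "boundary_space X \<equiv> subtopology X (manifold_boundary X)"

section \<open>Orientations\<close>

text \<open>An orientation is a locally constant choice of generators of the local homology groups
  at the interior points. Values at other points are irrelevant.\<close>

type_synonym 'a orientation = "'a \<Rightarrow> 'a chain set"

type_synonym 'a oriented = "'a topology \<times> 'a orientation"

abbreviation local_homology :: "'a topology \<Rightarrow> 'a \<Rightarrow> 'a chain set monoid" where
  "local_homology X x \<equiv> relative_homology_group 3 X (topspace X - {x})"

definition is_orientation :: "'a topology \<Rightarrow> 'a orientation \<Rightarrow> bool" where
  "is_orientation X \<omega> \<longleftrightarrow>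
     (\<forall>x\<in>manifold_interior X.
        \<omega> x \<in> carrier (local_homology X x) \<and>
        generate (local_homology X x) {\<omega> x} = carrier (local_homology X x)) \<and>
     (\<forall>x\<in>manifold_interior X. \<exists>U a. openin X U \<and> x \<in> U \<and> U \<subseteq> manifold_interior X \<and>
        a \<in> carrier (relative_homology_group 3 X (topspace X - U)) \<and>
        (\<forall>y\<in>U. hom_induced 3 X (topspace X - U) X (topspace X - {y}) id a = \<omega> y))"

definition oriented_three_manifold :: "'a oriented \<Rightarrow> bool" where
  "oriented_three_manifold X \<longleftrightarrow> three_manifold (fst X) \<and> is_orientation (fst X) (snd X)"

text \<open>Both notions are meant for embeddings of 3-manifolds mapping interior to interior.\<close>

definition preserves_orientation :: "'a oriented \<Rightarrow> 'b oriented \<Rightarrow> ('a \<Rightarrow> 'b) \<Rightarrow> bool" where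
  "preserves_orientation X Y f \<longleftrightarrow>
     (\<forall>x\<in>manifold_interior (fst X).
        hom_induced 3 (fst X) (topspace (fst X) - {x}) (fst Y) (topspace (fst Y) - {f x}) f
          (snd X x) = snd Y (f x))"

definition reverses_orientation :: "'a oriented \<Rightarrow> 'b oriented \<Rightarrow> ('a \<Rightarrow> 'b) \<Rightarrow> bool" where
  "reverses_orientation X Y f \<longleftrightarrow>
     (\<forall>x\<in>manifold_interior (fst X).
        hom_induced 3 (fst X) (topspace (fst X) - {x}) (fst Y) (topspace (fst Y) - {f x}) f
          (snd X x) = inv\<^bsub>local_homology (fst Y) (f x)\<^esub> (snd Y (f x)))"

definition orientation_reversingly_homeomorphic :: "'a oriented \<Rightarrow> 'b oriented \<Rightarrow> bool" where
  "orientation_reversingly_homeomorphic X Y \<longleftrightarrow>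
     (\<exists>f. homeomorphic_map (fst X) (fst Y) f \<and> reverses_orientation X Y f)"

definition achiral :: "'a oriented \<Rightarrow> bool" where
  "achiral X \<longleftrightarrow> orientation_reversingly_homeomorphic X X"

section \<open>Complete hyperbolic 3-manifolds of finite volume\<close>

text \<open>The upper half-space model, with its distance and its volume form
  \<open>dx dy dz / z^3\<close>.\<close>

definition hyp3 :: "(real ^ 3) set" where
  "hyp3 = {x. 0 < x $ 3}"

definition hyp_dist :: "real ^ 3 \<Rightarrow> real ^ 3 \<Rightarrow> real" where
  "hyp_dist x y = arcosh (1 + (dist x y)\<^sup>2 / (2 * x $ 3 * y $ 3))"

definition hyp_volume :: "(real ^ 3) set \<Rightarrow> ennreal" where
  "hyp_volume A = (\<integral>\<^sup>+x\<in>A. ennreal (1 / (x $ 3) ^ 3) \<partial>lborel)"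

definition hyperbolic_chart ::
  "'a topology \<Rightarrow> ('a \<Rightarrow> 'a \<Rightarrow> real) \<Rightarrow> 'a set \<Rightarrow> ('a \<Rightarrow> real ^ 3) \<Rightarrow> bool" where
  "hyperbolic_chart X d U \<phi> \<longleftrightarrow>
     openin X U \<and> open (\<phi> ` U) \<and> \<phi> ` U \<subseteq> hyp3 \<and>
     (\<forall>x\<in>U. \<forall>y\<in>U. hyp_dist (\<phi> x) (\<phi> y) = d x y)"

text \<open>The hyperbolic structure is encoded by a distance function that is locally isometric to
  hyperbolic space. It need not be the path metric, but it agrees with it locally, and if it is
  complete then so is the path metric.\<close>

definition complete_hyperbolic_metric :: "'a topology \<Rightarrow> ('a \<Rightarrow> 'a \<Rightarrow> real) \<Rightarrow> bool" where
  "complete_hyperbolic_metric X d \<longleftrightarrow>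
     Metric_space (topspace X) d \<and> Metric_space.mtopology (topspace X) d = X \<and>
     Metric_space.mcomplete (topspace X) d \<and>
     (\<forall>x\<in>topspace X. \<exists>U \<phi>. x \<in> U \<and> hyperbolic_chart X d U \<phi>)"

text \<open>The volume measure is the Borel measure that every isometric chart carries to hyperbolic
  volume; it is unique on a second countable space.\<close>

definition is_volume_measure :: "'a topology \<Rightarrow> ('a \<Rightarrow> 'a \<Rightarrow> real) \<Rightarrow> 'a measure \<Rightarrow> bool" where
  "is_volume_measure X d m \<longleftrightarrow>
     space m = topspace X \<and> sets m = sigma_sets (topspace X) {U. openin X U} \<and>
     (\<forall>U \<phi> B. hyperbolic_chart X d U \<phi> \<and> B \<in> sets m \<and> B \<subseteq> U \<longrightarrow>
        emeasure m B = hyp_volume (\<phi> ` B))"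

definition finite_volume_hyperbolic :: "'a topology \<Rightarrow> bool" where
  "finite_volume_hyperbolic X \<longleftrightarrow>
     (\<exists>d m. complete_hyperbolic_metric X d \<and> is_volume_measure X d m \<and>
        emeasure m (topspace X) < \<infinity>)"

abbreviation circle_space :: "complex topology" where
  "circle_space \<equiv> top_of_set (sphere 0 1)"

definition torus_space :: "(complex \<times> complex) topology" where
  "torus_space = prod_topology circle_space circle_space"

definition compact_with_torus_boundary :: "'a oriented \<Rightarrow> bool" where
  "compact_with_torus_boundary M \<longleftrightarrow>
     oriented_three_manifold M \<and> compact_space (fst M) \<and>
     boundary_space (fst M) homeomorphic_space torus_space"

definition oriented_interior_of :: "'a oriented \<Rightarrow> 'b oriented \<Rightarrow> bool" where
  "oriented_interior_of W M \<longleftrightarrow>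
     (\<exists>f. embedding_map (fst W) (fst M) f \<and> f ` topspace (fst W) = manifold_interior (fst M) \<and>
        preserves_orientation W M f)"

text \<open>Here, as for the Dehn fillings below, an auxiliary manifold lives on the type of the given
  one. No generality is lost: all manifolds of positive dimension (connected, second countable and
  Hausdorff) have the cardinality of the continuum.\<close>

definition one_cusped_hyperbolic :: "'a oriented \<Rightarrow> bool" where
  "one_cusped_hyperbolic W \<longleftrightarrow>
     oriented_three_manifold W \<and> finite_volume_hyperbolic (fst W) \<and>
     (\<exists>M :: 'a oriented. compact_with_torus_boundary M \<and> oriented_interior_of W M)"

section \<open>Slopes on a torus\<close>

definition simple_closed_curve :: "'a topology \<Rightarrow> 'a set \<Rightarrow> bool" where
  "simple_closed_curve T C \<longleftrightarrow>
     C \<subseteq> topspace T \<and> subtopology T C homeomorphic_space circle_space"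

definition nontrivial_curve :: "'a topology \<Rightarrow> 'a set \<Rightarrow> bool" where
  "nontrivial_curve T C \<longleftrightarrow>
     \<not> (\<exists>a. homotopic_with (\<lambda>_. True) (subtopology T C) T id (\<lambda>_. a))"

text \<open>Ambient isotopy of (unoriented) curves.\<close>

definition isotopic_in :: "'a topology \<Rightarrow> 'a set \<Rightarrow> 'a set \<Rightarrow> bool" where
  "isotopic_in T C C' \<longleftrightarrow>
     (\<exists>g. homotopic_with (homeomorphic_map T T) T T id g \<and> g ` C = C')"

definition is_slope :: "'a topology \<Rightarrow> 'a set set \<Rightarrow> bool" where
  "is_slope T \<gamma> \<longleftrightarrow>
     (\<exists>C. simple_closed_curve T C \<and> nontrivial_curve T C \<and> \<gamma> = {C'. isotopic_in T C C'})"

definition slope_distance :: "'a set set \<Rightarrow> 'a set set \<Rightarrow> nat" where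
  "slope_distance \<gamma> \<gamma>' =
     (LEAST n. \<exists>C\<in>\<gamma>. \<exists>C'\<in>\<gamma>'. finite (C \<inter> C') \<and> card (C \<inter> C') = n)"

section \<open>Dehn filling\<close>

definition solid_torus :: "(complex \<times> complex) topology" where
  "solid_torus = prod_topology (top_of_set (cball 0 1)) circle_space"

text \<open>The boundary of the meridian disk \<open>cball 0 1 \<times> {1}\<close>.\<close>

definition meridian :: "(complex \<times> complex) set" where
  "meridian = sphere 0 1 \<times> {1}"

text \<open>\<open>N\<close> is a Dehn filling of \<open>M\<close> along \<open>\<gamma>\<close>: it is the quotient of the disjoint union of
  \<open>M\<close> and the solid torus that identifies each boundary point \<open>y\<close> of the solid torus with \<open>h y\<close>.
  The maps \<open>f\<close> and \<open>g\<close> are the canonical maps into the quotient.\<close>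

definition dehn_filling :: "'a oriented \<Rightarrow> 'a set set \<Rightarrow> 'b oriented \<Rightarrow> bool" where
  "dehn_filling M \<gamma> N \<longleftrightarrow>
     oriented_three_manifold N \<and> compact_space (fst N) \<and> manifold_boundary (fst N) = {} \<and>
     (\<exists>h f g.
        homeomorphic_map torus_space (boundary_space (fst M)) h \<and> h ` meridian \<in> \<gamma> \<and>
        inj_on f (topspace (fst M)) \<and> inj_on g (topspace solid_torus) \<and>
        (\<forall>x\<in>topspace (fst M). \<forall>y\<in>topspace solid_torus.
           f x = g y \<longleftrightarrow> y \<in> topspace torus_space \<and> x = h y) \<and>
        topspace (fst N) = f ` topspace (fst M) \<union> g ` topspace solid_torus \<and>
        (\<forall>U\<subseteq>topspace (fst N). openin (fst N) U \<longleftrightarrow>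
           openin (fst M) {x \<in> topspace (fst M). f x \<in> U} \<and>
           openin solid_torus {y \<in> topspace solid_torus. g y \<in> U}) \<and>
        preserves_orientation M N f)"

definition chirally_cosmetic :: "'a oriented \<Rightarrow> 'a set set \<Rightarrow> 'a set set \<Rightarrow> bool" where
  "chirally_cosmetic M \<gamma> \<gamma>' \<longleftrightarrow>
     (\<exists>(N :: 'a oriented) (N' :: 'a oriented). dehn_filling M \<gamma> N \<and> dehn_filling M \<gamma>' N' \<and>
        orientation_reversingly_homeomorphic N N')"

end

theory Submission
 imports Defs "HOL-Number_Theory.Fib" "HOL-Number_Theory.Cong"
begin

text \<open>The group \<open>Gam\<close> is a torsion-free lattice of Eisenstein matrices with one cusp; its quotient fibres over the circle
with fibre a punctured torus. The covers of odd degree \<open>n\<close> dual to the class \<open>chi\<close> of the fibration have one cusp again,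
with peripheral lattice spanned by \<open>n \<plusminus> \<i> \<surd>3\<close>. The reflection \<open>z \<mapsto> cnj z + \<omega>\<close> normalises the group, preserves
\<open>chi\<close> and exchanges the two basis vectors. Hence the corresponding slopes have distance one, and the reflection
extends to an orientation-reversing homeomorphism between the fillings. The covers are told apart by homomorphisms to
\<open>Z/p\<close>: for prime \<open>n\<close>, besides \<open>chi\<close> there is a second one, coming from a companion of \<open>chi\<close> twisted by powers of the
golden ratio, only if \<open>p\<close> divides the \<open>n\<close>-th Fibonacci number.\<close>

text \<open>Odd degree matters because the translations in \<open>Gam\<close> are the numbers
  \<open>k + l i sqrt 3\<close> with \<open>k\<close> and \<open>l\<close> of equal parity,
  \<open>chi\<close> being the real part \<open>k\<close>. For odd \<open>n\<close> the condition
  \<open>n dvd k\<close> leaves a rhombic lattice, whose two sides complex conjugation exchanges;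
  for even \<open>n\<close> it would be rectangular. The monodromy has the eigenvalues
  \<open>- \<phi>^2\<close> and \<open>- \<phi>^(-2)\<close>, \<phi> the golden ratio, so the
  torsion of the homology of the cover has order \<open>5 F^2\<close>, \<open>F\<close> the
  \<open>n\<close>-th Fibonacci number. This is the origin of the exception \<open>p = 5\<close>;
  different primes \<open>n\<close> have coprime Fibonacci numbers. No presentation of the group
  occurs: homomorphisms are prescribed on pairs of adjacent cusps and extended by Euclidean descent.
  All manifolds are quotients of open subsets of Euclidean space, and orientations are tracked by
  the local degree \<open>lsg\<close> of transition maps. The filling is such a quotient too, of
  hyperbolic space together with a half-cylinder covering a solid torus. One closed space serves
  both fillings: the second has the opposite orientation and receives the compact core through the
  inverse reflection, so that the identity reverses orientation.\<close>

abbreviation "tos == top_of_set"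
abbreviation "lhom == local_homology"
abbreviation "hi3 == hom_induced 3"
abbreviation "rh3 == relative_homology_group 3"
type_synonym R3 = "real ^ 3"
lemmas p2_sq = power2_eq_square
lemmas alg = algebra_simps
lemmas grp_rel = group_relative_homology_group
lemmas cm_sub = continuous_map_in_subtopology

section \<open>Eisenstein integers and two-by-two matrices\<close>

text \<open>\<open>Eis x y\<close> is \<open>x + y \<omega>\<close> with \<open>\<omega>\<^sup>2 + \<omega> + 1 = 0\<close>.\<close>

datatype eis = Eis (ea: int) (eb: int)

lemma eis_eq_iff: "x = y \<longleftrightarrow> ea x = ea y & eb x = eb y" by (cases x; cases y) auto

instantiation eis :: comm_ring_1
begin
definition "0 = Eis 0 0"
definition "1 = Eis 1 0"
definition "x + y = Eis (ea x + ea y) (eb x + eb y)"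
definition "x - y = Eis (ea x - ea y) (eb x - eb y)"
definition "- x = Eis (- ea x) (- eb x)"
definition "x * y = Eis (ea x * ea y - eb x * eb y) (ea x * eb y + eb x * ea y - eb x * eb y)"
instance by intro_classes (auto simp: zero_eis_def one_eis_def plus_eis_def minus_eis_def uminus_eis_def
   times_eis_def eis_eq_iff alg)
end

lemma eis_sel [simp]:
 "ea 0 = 0" "eb 0 = 0" "ea 1 = 1" "eb 1 = 0"
 "ea (x + y) = ea x + ea y" "eb (x + y) = eb x + eb y"
 "ea (x - y) = ea x - ea y" "eb (x - y) = eb x - eb y"
 "ea (- x) = - ea x" "eb (- x) = - eb x"
 "ea (x * y) = ea x * ea y - eb x * eb y"
 "eb (x * y) = ea x * eb y + eb x * ea y - eb x * eb y" by (simp_all add: zero_eis_def one_eis_def plus_eis_def minus_eis_def uminus_eis_def times_eis_def)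

lemma eis_sel_numeral [simp]: "ea (numeral k) = numeral k" "eb (numeral k) = 0"
proof -
 have "ea (of_nat n) = int n & eb (of_nat n) = 0" for n by (induction n) auto
 from this[of "numeral k"] show "ea (numeral k) = numeral k" "eb (numeral k) = 0" by simp_all
qed

lemma eis_sel_of_int [simp]: "ea (of_int k) = k" "eb (of_int k) = 0"
proof -
 have n: "ea (of_nat n) = int n & eb (of_nat n) = 0" for n by (induction n) auto
 show "ea (of_int k) = k" "eb (of_int k) = 0" using n by (cases k; simp)+
qed

definition ecnj :: "eis => eis" where "ecnj x = Eis (ea x - eb x) (- eb x)"
definition enorm :: "eis => int" where "enorm x = ea x * ea x - ea x * eb x + eb x * eb x"
definition etr :: "eis => int" where "etr x = 2 * ea x - eb x"
definition om :: eis where "om = Eis 0 1"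
definition ev :: "eis => bool" where "ev x \<longleftrightarrow> even (ea x) & even (eb x)"

lemma ecnj_sel [simp]: "ea (ecnj x) = ea x - eb x" "eb (ecnj x) = - eb x" by (simp_all add: ecnj_def)

lemma om_sel [simp]: "ea om = 0" "eb om = 1" by (simp_all add: om_def)

lemma ecnj_mult [simp]: "ecnj (x * y) = ecnj x * ecnj y" by (simp add: eis_eq_iff alg)

lemma ecnj_add [simp]: "ecnj (x + y) = ecnj x + ecnj y" by (simp add: eis_eq_iff)

lemma ecnj_minus [simp]: "ecnj (- x) = - ecnj x" by (simp add: eis_eq_iff)

lemma ecnj_diff [simp]: "ecnj (x - y) = ecnj x - ecnj y" by (simp add: eis_eq_iff)

lemma ecnj_ecnj [simp]: "ecnj (ecnj x) = x" by (simp add: eis_eq_iff)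

lemma ecnj_1 [simp]: "ecnj 1 = 1" by (simp add: eis_eq_iff)

lemma ecnj_0 [simp]: "ecnj 0 = 0" by (simp add: eis_eq_iff)

lemma enorm_mult [simp]: "enorm (x * y) = enorm x * enorm y" by (simp add: enorm_def alg)

lemma enorm_ecnj [simp]: "enorm (ecnj x) = enorm x" by (simp add: enorm_def alg)

lemma enorm_minus [simp]: "enorm (- x) = enorm x" by (simp add: enorm_def)

lemma enorm_0 [simp]: "enorm 0 = 0" and enorm_1 [simp]: "enorm 1 = 1" by (simp_all add: enorm_def)

lemma enorm_4: "4 * enorm x = (etr x)^2 + 3 * (eb x)^2" by (simp add: enorm_def etr_def p2_sq alg)

lemma enorm_nonneg [simp]: "0 <= enorm x" using enorm_4[of x] zero_le_power2[of "etr x"] zero_le_power2[of "eb x"] by linarith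

lemma enorm_eq_0 [simp]: "enorm x = 0 \<longleftrightarrow> x = 0"
proof
 assume "enorm x = 0"
 hence "(etr x)^2 + 3 * (eb x)^2 = 0" using enorm_4[of x] by simp
 hence "(etr x)^2 = 0" "(eb x)^2 = 0" using zero_le_power2[of "etr x"] zero_le_power2[of "eb x"] by linarith+
 thus "x = 0" by (simp add: etr_def eis_eq_iff)
qed simp

lemma enorm_pos: "x ~= 0 ==> 0 < enorm x" using enorm_nonneg[of x] enorm_eq_0[of x] by linarith

lemma mult_ecnj: "x * ecnj x = of_int (enorm x)" by (simp add: eis_eq_iff enorm_def alg)

lemma unit_ecnj: "enorm u = 1 ==> u * ecnj u = 1" "enorm u = 1 ==> ecnj u * u = 1" using mult_ecnj[of u] by (simp_all add: mult.commute)

instance eis :: idom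
proof
 fix a b :: eis assume "a ~= 0" "b ~= 0"
 hence "enorm (a * b) ~= 0" by simp
 thus "a * b ~= 0" by (metis enorm_0)
qed

definition eunits :: "eis set" where
 "eunits = {Eis 1 0, Eis (-1) 0, Eis 0 1, Eis 0 (-1), Eis 1 1, Eis (-1) (-1)}"

lemma enorm_1_iff: "enorm u = 1 \<longleftrightarrow> u : eunits"
proof
 assume u: "enorm u = 1"
 have "3 * (eb u)^2 <= 4" using enorm_4[of u] u zero_le_power2[of "etr u"] by linarith
 hence "(eb u)^2 < 2^2" by simp
 hence b: "\<bar>eb u\<bar> < 2" using power2_less_imp_less[of "\<bar>eb u\<bar>" 2] by simp
 have "4 * enorm u = (2 * eb u - ea u)^2 + 3 * (ea u)^2" by (simp add: enorm_def p2_sq alg)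
 hence "3 * (ea u)^2 <= 4" using u zero_le_power2[of "2 * eb u - ea u"] by linarith
 hence "(ea u)^2 < 2^2" by simp
 hence a: "\<bar>ea u\<bar> < 2" using power2_less_imp_less[of "\<bar>ea u\<bar>" 2] by simp
 have "ea u = -1 | ea u = 0 | ea u = 1" "eb u = -1 | eb u = 0 | eb u = 1" using a b by linarith+
 with u show "u : eunits" by (elim disjE) (simp_all add: eunits_def eis_eq_iff enorm_def)
qed (auto simp: eunits_def enorm_def)

lemma ev_add: "ev x ==> ev y ==> ev (x + y)" and ev_diff: "ev x ==> ev y ==> ev (x - y)"
 and ev_minus [simp]: "ev (- x) = ev x" and ev_mult: "ev x ==> ev (x * y)" and ev_0 [simp]: "ev 0"
 and ev_mult': "ev x ==> ev (y * x)" by (simp_all add: ev_def)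

lemma even_etr: "ev x ==> even (etr x)" by (simp add: ev_def etr_def)

lemma etr_linear [simp]: "etr (x + y) = etr x + etr y" "etr (x - y) = etr x - etr y" "etr (- x) = - etr x"
 "etr 0 = 0" "etr (ecnj x) = etr x" by (simp_all add: etr_def)

text \<open>Round to the nearest lattice point.\<close>

lemma eis_division:
 assumes "c ~= 0"
 obtains z where "enorm (c * z + d) < enorm c"
proof -
 define N where "N = enorm c"
 have N: "0 < N" using assms enorm_pos N_def by simp
 define t where "t = - d * ecnj c"
 define r where "r k = (2 * k + N) div (2 * N)" for k
 have r: "\<bar>2 * (k - N * r k)\<bar> <= N" for k
 proof -
  have "2 * k + N = 2 * N * r k + (2 * k + N) mod (2 * N)" unfolding r_def by simp
  moreover have "0 <= (2 * k + N) mod (2 * N)" "(2 * k + N) mod (2 * N) < 2 * N" using N by simp_all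
  ultimately show ?thesis by (auto simp: alg)
 qed
 define z where "z = Eis (r (ea t)) (r (eb t))"
 define e where "e = Eis (ea t - N * r (ea t)) (eb t - N * r (eb t))"
 have e: "e = t - of_int N * z" unfolding e_def z_def by (simp add: eis_eq_iff)
 have bnd: "4 * enorm e <= 3 * N^2"
 proof -
  have a: "\<bar>2 * ea e\<bar> <= N" and b: "\<bar>2 * eb e\<bar> <= N" using r unfolding e_def by simp_all
  have "\<bar>2 * ea e\<bar>^2 <= N^2" "\<bar>2 * eb e\<bar>^2 <= N^2" using power_mono[OF a, of 2] power_mono[OF b, of 2] by simp_all
  moreover have "\<bar>2 * ea e\<bar> * \<bar>2 * eb e\<bar> <= N * N" using a b by (intro mult_mono) auto
  hence "- (2 * ea e * (2 * eb e)) <= N * N" unfolding abs_mult[symmetric] by linarith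
  ultimately show ?thesis unfolding enorm_def p2_sq by (simp add: alg)
 qed
 have "- ecnj c * (c * z + d) = e" unfolding e t_def N_def mult_ecnj[symmetric] by (simp add: alg)
 hence "N * enorm (c * z + d) = enorm e" by (metis N_def enorm_ecnj enorm_minus enorm_mult)
 hence "4 * (N * enorm (c * z + d)) <= 3 * N^2" using bnd by simp
 also have "... < 4 * (N * N)" using N by (simp add: p2_sq)
 finally have "enorm (c * z + d) < N" using N by simp
 thus thesis using that N_def by blast
qed

text \<open>The three traces of \<open>y\<close> against the units sum to zero and have square sum \<open>6 |y|\<^sup>2\<close>.\<close>

lemma exists_unit_trace:
 assumes "enorm y = L^2" "0 < L"
 obtains u where "u : eunits" "etr (y * u) < - L"
proof -
 define p q r where "p = etr y" and "q = etr (y * om)" and "r = etr (y * (-1 - om))"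
 have s2: "p^2 + q^2 + r^2 = 6 * L^2" unfolding assms(1)[symmetric] p_def q_def r_def etr_def enorm_def by (simp add: p2_sq alg)
 have "~ (\<bar>p\<bar> <= L & \<bar>q\<bar> <= L & \<bar>r\<bar> <= L)"
 proof
  assume "\<bar>p\<bar> <= L & \<bar>q\<bar> <= L & \<bar>r\<bar> <= L"
  hence "p^2 <= L^2" "q^2 <= L^2" "r^2 <= L^2" using power_mono[of "\<bar>p\<bar>" L 2] power_mono[of "\<bar>q\<bar>" L 2] power_mono[of "\<bar>r\<bar>" L 2] by simp_all
  hence "6 * L^2 <= 3 * L^2" using s2 by linarith
  moreover have "0 < L^2" using assms by simp
  ultimately show False by linarith
 qed
 moreover have "etr (y * Eis 1 0) = p" "etr (y * Eis (-1) 0) = - p" "etr (y * Eis 0 1) = q"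
  "etr (y * Eis 0 (-1)) = - q" "etr (y * Eis (-1) (-1)) = r" "etr (y * Eis 1 1) = - r" unfolding p_def q_def r_def etr_def by (simp_all)
 ultimately show thesis using that[of "Eis 1 0"] that[of "Eis (-1) 0"] that[of "Eis 0 1"] that[of "Eis 0 (-1)"]
   that[of "Eis (-1) (-1)"] that[of "Eis 1 1"] unfolding eunits_def by (auto simp: abs_if split: if_splits)
qed

lemma enorm_add: "enorm (x + y) = enorm x + enorm y + etr (x * ecnj y)" by (simp add: enorm_def etr_def alg)

text \<open>Norm 2 does not occur, so the six elements of norm 3 remain, and each is the long
  diagonal of a rhombus made of two unit triangles. The vertices \<open>u\<close> and
  \<open>v\<close> on the short diagonal serve as intermediate cusps in the descent below.\<close>

lemma enorm_less_4:
 assumes "enorm x < 4" "x ~= 0" "x \<notin> eunits"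
 obtains u v where "u : eunits" "v : eunits" "x = u + v" "enorm (u - v) = 1"
proof -
 have "enorm x ~= 1" using assms enorm_1_iff by blast
 hence n: "enorm x = 2 | enorm x = 3" using assms(1,2) enorm_pos[of x] by linarith
 have "3 * (eb x)^2 <= 12" using enorm_4[of x] n zero_le_power2[of "etr x"] by linarith
 hence "(eb x)^2 < 3^2" by simp
 hence b: "\<bar>eb x\<bar> < 3" using power2_less_imp_less[of "\<bar>eb x\<bar>" 3] by simp
 have "4 * enorm x = (2 * eb x - ea x)^2 + 3 * (ea x)^2" by (simp add: enorm_def p2_sq alg)
 hence "3 * (ea x)^2 <= 12" using n zero_le_power2[of "2 * eb x - ea x"] by linarith
 hence "(ea x)^2 < 3^2" by simp
 hence a: "\<bar>ea x\<bar> < 3" using power2_less_imp_less[of "\<bar>ea x\<bar>" 3] by simp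
 have "ea x = -2 | ea x = -1 | ea x = 0 | ea x = 1 | ea x = 2"
  "eb x = -2 | eb x = -1 | eb x = 0 | eb x = 1 | eb x = 2" using a b by linarith+
 hence "x : {Eis 1 2, Eis 2 1, Eis 1 (-1), Eis (-1) 1, Eis (-1) (-2), Eis (-2) (-1)}" using n by (elim disjE) (simp_all add: eis_eq_iff enorm_def)
 hence "EX u:eunits. EX v:eunits. x = u + v & enorm (u - v) = 1"
  unfolding eunits_def by (elim insertE emptyE) (auto simp: enorm_def eis_eq_iff intro: exI[of _ "Eis (-1) (-1)"])
 thus thesis using that by blast
qed

section \<open>Two-by-two matrices over a commutative ring\<close>

datatype 'a mat2 = Mat (m11: 'a) (m12: 'a) (m21: 'a) (m22: 'a)

lemma mat2_eq_iff: "g = h \<longleftrightarrow> m11 g = m11 h & m12 g = m12 h & m21 g = m21 h & m22 g = m22 h" by (cases g; cases h) auto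

instantiation mat2 :: (comm_ring_1) "{monoid_mult, uminus}"
begin
definition "1 = Mat 1 0 0 1"
definition "- g = Mat (- m11 g) (- m12 g) (- m21 g) (- m22 g)"
definition "g * h = Mat (m11 g * m11 h + m12 g * m21 h) (m11 g * m12 h + m12 g * m22 h)
  (m21 g * m11 h + m22 g * m21 h) (m21 g * m12 h + m22 g * m22 h)"
instance by intro_classes (auto simp: one_mat2_def times_mat2_def mat2_eq_iff alg)
end

lemma mat2_sel [simp]:
 "m11 1 = 1" "m12 1 = 0" "m21 1 = 0" "m22 1 = 1"
 "m11 (- g) = - m11 g" "m12 (- g) = - m12 g" "m21 (- g) = - m21 g" "m22 (- g) = - m22 g"
 "m11 (g * h) = m11 g * m11 h + m12 g * m21 h"
 "m12 (g * h) = m11 g * m12 h + m12 g * m22 h"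
 "m21 (g * h) = m21 g * m11 h + m22 g * m21 h"
 "m22 (g * h) = m21 g * m12 h + m22 g * m22 h" by (simp_all add: one_mat2_def times_mat2_def uminus_mat2_def)

definition det2 :: "'a::comm_ring_1 mat2 => 'a" where "det2 g = m11 g * m22 g - m12 g * m21 g"
definition inv2 :: "'a::comm_ring_1 mat2 => 'a mat2" where "inv2 g = Mat (m22 g) (- m12 g) (- m21 g) (m11 g)"

lemma inv2_sel [simp]: "m11 (inv2 g) = m22 g" "m12 (inv2 g) = - m12 g" "m21 (inv2 g) = - m21 g" "m22 (inv2 g) = m11 g" by (simp_all add: inv2_def)

lemma det2_mult [simp]: "det2 (g * h) = det2 g * det2 h" by (simp add: det2_def alg)

lemma inv2_mult: "det2 g = 1 ==> g * inv2 g = 1" "det2 g = 1 ==> inv2 g * g = 1" by (simp_all add: det2_def mat2_eq_iff alg)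

lemma mat2_minus_mult [simp]: "(- g) * h = - (g * h)" "g * (- h) = - (g * h)" "- (- g) = (g :: 'a::comm_ring_1 mat2)" by (simp_all add: mat2_eq_iff)

section \<open>The arithmetic group\<close>

text \<open>Modulo 2 the conditions say that the matrix commutes with an element of order five of
  \<open>SL\<^sub>2(F\<^sub>4)\<close>. The group is the fundamental group of the sister of the figure eight knot
  complement (up to sign).\<close>

definition Gam :: "eis mat2 set" where
 "Gam = {g. det2 g = 1 & ev (m12 g - om * m21 g) & ev (m22 g - m11 g - m21 g)}"

lemma Gam_1: "1 : Gam" by (simp add: Gam_def det2_def ev_def)

lemma Gam_minus: "g : Gam ==> - g : Gam" by (simp add: Gam_def det2_def ev_def)

lemma Gam_mult:
 assumes "g : Gam" "h : Gam"
 shows "g * h : Gam"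
proof -
 have d: "det2 (g * h) = 1" using assms by (simp add: Gam_def)
 define p q where "p = m12 g - om * m21 g" and "q = m22 g - m11 g - m21 g"
 define r s where "r = m12 h - om * m21 h" and "s = m22 h - m11 h - m21 h"
 have e: "ev p" "ev q" "ev r" "ev s" using assms unfolding p_def q_def r_def s_def Gam_def by auto
 have g: "m12 g = om * m21 g + p" "m22 g = m11 g + m21 g + q" unfolding p_def q_def by auto
 have h: "m12 h = om * m21 h + r" "m22 h = m11 h + m21 h + s" unfolding r_def s_def by auto
 have "m12 (g * h) - om * m21 (g * h) = m11 g * r + om * m21 g * s + p * m22 h - om * q * m21 h" unfolding mat2_sel g h by (simp add: alg)
 moreover have "ev ..." using e by (intro ev_add ev_diff) (auto intro: ev_mult ev_mult' simp: mult.assoc)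
 moreover have "m22 (g * h) - m11 (g * h) - m21 (g * h)
   = m21 g * r + m11 g * s + m21 g * s + q * (m11 h + s) - p * m21 h" unfolding mat2_sel g h by (simp add: alg)
 moreover have "ev ..." using e by (intro ev_add ev_diff) (auto intro: ev_mult ev_mult' simp: mult.assoc)
 ultimately have "ev (m12 (g * h) - om * m21 (g * h))" "ev (m22 (g * h) - m11 (g * h) - m21 (g * h))" by simp_all
 thus ?thesis using d unfolding Gam_def by blast
qed

lemma Gam_inv: "g : Gam ==> inv2 g : Gam" unfolding Gam_def det2_def ev_def by (auto simp: alg)

lemma Gam_det: "g : Gam ==> det2 g = 1" by (simp add: Gam_def)

definition tmat :: "eis => eis mat2" where "tmat b = Mat 1 b 0 1"

text \<open>If the lower left entry of a matrix in \<open>Gam\<close> mapping infinity to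
  \<open>z\<close> is a unit, the congruences modulo 2 determine it up to sign, and only the parity
  of the \<omega>-coordinate of \<open>z\<close> enters. The proof is in
  \<open>Gam_N_cases\<close>.\<close>

definition cl :: "eis => eis" where "cl z = (if even (eb z) then Eis 0 1 else Eis (-1) (-1))"

text \<open>\<open>nmat z z'\<close> maps \<open>\<infinity>\<close> to \<open>z\<close> and \<open>z'\<close> to \<open>\<infinity>\<close>.\<close>

definition nmat :: "eis => eis => eis mat2" where
 "nmat z z' = Mat (cl z * z) (- (cl z * z * z') - ecnj (cl z)) (cl z) (- (cl z * z'))"

lemma enorm_cl [simp]: "enorm (cl z) = 1" by (simp add: cl_def enorm_def)

lemma tmat_Gam: "ev b ==> tmat b : Gam" by (simp add: tmat_def Gam_def det2_def ev_def)

lemma nmat_Gam: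
 assumes "ev (z' - z - 1)"
 shows "nmat z z' : Gam"
proof -
 have "det2 (nmat z z') = ecnj (cl z) * cl z" unfolding det2_def nmat_def by (simp add: alg)
 hence d: "det2 (nmat z z') = 1" using unit_ecnj by simp
 define p where "p = z' - z - 1"
 have z': "z' = z + 1 + p" unfolding p_def by simp
 have "ev p" using assms p_def by simp
 thus ?thesis using d unfolding Gam_def nmat_def z' ev_def cl_def by auto
qed

text \<open>The diagonal entries are a unit and its conjugate, and they agree modulo 2; among the
  six units only 1 and -1 pass. So the stabiliser of infinity is a group of translations up to sign,
  and the cusp has a torus as its cross-section.\<close>

lemma Gam_P_cases:
 assumes "g : Gam" "m21 g = 0"
 obtains b where "ev b" "g = tmat b | g = - tmat b"
proof -
 have d: "m11 g * m22 g = 1" and e: "ev (m12 g)" "ev (m22 g - m11 g)" using assms by (auto simp: Gam_def det2_def)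
 have "enorm (m11 g) * enorm (m22 g) = 1" using d by (metis enorm_1 enorm_mult)
 hence "enorm (m11 g) = 1" "enorm (m22 g) = 1" using enorm_nonneg[of "m11 g"] enorm_nonneg[of "m22 g"] by (auto simp: zmult_eq_1_iff)
 hence u: "m11 g : eunits" "m22 g : eunits" by (simp_all add: enorm_1_iff)
 have "m22 g = ecnj (m11 g)" using d unit_ecnj(2)[of "m11 g"] \<open>enorm (m11 g) = 1\<close> by (metis mult.assoc mult.left_neutral mult.right_neutral)
 hence "m11 g = 1 & m22 g = 1 | m11 g = -1 & m22 g = -1" using u(1) e(2) unfolding eunits_def by (elim insertE) (auto simp: eis_eq_iff ev_def)
 thus thesis using that[of "m12 g"] that[of "- m12 g"] e(1) assms(2) by (auto simp: tmat_def mat2_eq_iff)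
qed

text \<open>With a unit \<open>c = m21 g\<close>, \<open>m11 g = c z\<close> and
  \<open>m22 g = - c z'\<close>, the determinant fixes the remaining entry. The second congruence
  then reads \<open>z' = z + 1\<close> modulo 2, and inserting this into the first leaves only
  \<open>cl z\<close> and its negative for \<open>c\<close>.\<close>

lemma Gam_N_cases:
 assumes "g : Gam" "enorm (m21 g) = 1"
 obtains z z' where "ev (z' - z - 1)" "g = nmat z z' | g = - nmat z z'"
proof -
 define c z z' where "c = m21 g" and "z = m11 g * ecnj c" and "z' = - m22 g * ecnj c"
 have c: "c * ecnj c = 1" using assms(2) unit_ecnj c_def by blast
 have a: "m11 g = c * z" and d: "m22 g = - (c * z')" unfolding z_def z'_def using c by (simp_all add: mult.left_commute)
 have det: "m11 g * m22 g - m12 g * c = 1" using Gam_det[OF assms(1)] by (simp add: det2_def c_def)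
 have b: "m12 g = - (c * z * z') - ecnj c"
 proof -
  have "m12 g * (c * ecnj c) = (m11 g * m22 g - 1) * ecnj c" by (smt (verit, best) det eis_eq_iff eis_sel(7,8) mult.assoc)
  also have "... = - (c * ecnj c) * (c * z * z') - ecnj c" unfolding a d by (simp add: alg)
  finally show ?thesis using c by simp
 qed
 have e: "ev (m12 g - om * c)" "ev (m22 g - m11 g - c)" using assms(1) unfolding Gam_def c_def by auto
 have cu: "c : eunits" using assms(2) enorm_1_iff c_def by blast
 have "ev (c * (z' - z - 1))"
 proof -
  have "c * (z' - z - 1) = - (m22 g - m11 g - c) - (c * z + c * z) - (c + c)" unfolding a d by (simp add: alg)
  moreover have "ev (c * z + c * z)" "ev (c + c)" by (simp_all add: ev_def)
  ultimately show ?thesis using e(2) by (metis ev_diff ev_minus)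
 qed
 hence "ev (ecnj c * (c * (z' - z - 1)))" by (rule ev_mult')
 hence ez: "ev (z' - z - 1)" using c by (metis mult.assoc mult.commute mult_1)
 have "ev (- (c * z * (z + 1)) - ecnj c - om * c)"
 proof -
  have "- (c * z * (z + 1)) - ecnj c - om * c = (m12 g - om * c) + (z' - z - 1) * (c * z)" unfolding b by (simp add: alg)
  thus ?thesis using e(1) ez by (metis ev_add ev_mult)
 qed
 hence "c = cl z | c = - cl z" using cu unfolding eunits_def cl_def by (elim insertE) (auto simp: eis_eq_iff ev_def)
 hence "g = nmat z z' | g = - nmat z z'" using a b d unfolding nmat_def mat2_eq_iff c_def[symmetric] by auto
 thus thesis using that ez by blast
qed

section \<open>Homomorphisms from local data on cusps\<close>

text \<open>The elements that move infinity to itself or to an adjacent cusp, cusps being adjacent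
  when the determinant of their coordinates is a unit. They play the part of generators, with the
  triangles of cusps as relations.\<close>

definition Gam1 :: "eis mat2 set" where "Gam1 = {g : Gam. enorm (m21 g) <= 1}"

lemma Gam1_Gam: "g : Gam1 ==> g : Gam" by (simp add: Gam1_def)

lemma Gam1_inv: "g : Gam1 ==> inv2 g : Gam1" by (simp add: Gam1_def Gam_inv)

lemma Gam1_minus [simp]: "- g : Gam1 \<longleftrightarrow> g : Gam1" using Gam_minus[of g] Gam_minus[of "- g"] by (auto simp: Gam1_def)

lemma Gam1_1: "1 : Gam1" by (simp add: Gam1_def Gam_1)

lemma nmat_Gam1: "ev (z' - z - 1) ==> nmat z z' : Gam1" unfolding Gam1_def by (simp add: nmat_Gam) (simp add: nmat_def)

lemma tmat_Gam1: "ev b ==> tmat b : Gam1" unfolding Gam1_def by (simp add: tmat_Gam) (simp add: tmat_def)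

text \<open>A right neighbour of the cusp \<open>g \<infinity>\<close>: the cusp \<open>g z\<close> with denominator \<open>c z + d\<close>.\<close>

lemma m21_nmat_mult: "m21 (g * nmat z z') = (m21 g * z + m22 g) * cl z" by (simp add: nmat_def alg)

lemma enorm_nmat_mult: "enorm (m21 (g * nmat z z')) = enorm (m21 g * z + m22 g)" unfolding m21_nmat_mult by simp

text \<open>The lower left entry of the product is a unit multiple of \<open>z - w\<close>, so
  neighbours of one cusp are adjacent to each other when their positions differ by a unit.\<close>

lemma nmat_inv_mult_Gam1:
 assumes "ev (z' - z - 1)" "ev (w' - w - 1)" "enorm (z - w) <= 1"
 shows "inv2 (nmat z z') * nmat w w' : Gam1"
proof -
 have "m21 (inv2 (nmat z z') * nmat w w') = cl z * cl w * (z - w)" by (simp add: nmat_def alg)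
 hence "enorm (m21 (inv2 (nmat z z') * nmat w w')) <= 1" using assms(3) by simp
 thus ?thesis unfolding Gam1_def using assms by (auto intro: Gam_mult Gam_inv nmat_Gam)
qed

lemma inv2_cancel: "det2 h = 1 ==> g * h * inv2 h = g" "det2 h = 1 ==> g * inv2 h * h = g"
 "det2 h = 1 ==> h * (inv2 h * g) = g" "det2 h = 1 ==> inv2 h * (h * g) = g" using inv2_mult[of h] by (metis mult.assoc mult.right_neutral mult.left_neutral)+

text \<open>To be read with the parallelogram law: \<open>a\<close> and \<open>b\<close> are the
  norms of \<open>c x + d\<close> and \<open>c y + d\<close>, \<open>n\<close> that of
  \<open>c\<close>, \<open>k\<close> that of \<open>x - y\<close> and \<open>r\<close> that of the
  sum. Two positions of cusps with smaller denominator are thus less than 2 apart.\<close>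

lemma lens_arith1:
 fixes a b n k r :: int
 assumes "2 * (a + b) = n * k + r" "a < n" "b < n" "0 <= r" "0 <= n"
 shows "k < 4"
proof (rule ccontr)
 assume "~ k < 4"
 hence "n * 4 <= n * k" using assms by (intro mult_left_mono) auto
 thus False using assms unfolding distrib_left by linarith
qed

text \<open>Both diagonals of the rhombus have the same midpoint, so the parallelogram law compares
  the short diagonal with the long one: at least one end of the short diagonal has a smaller
  denominator as well.\<close>

lemma lens_arith2:
 fixes a b c d n :: int
 shows "2 * (a + b) <= 2 * (c + d) - n ==> c < n ==> d < n ==> 0 <= n ==> a < n | b < n" unfolding distrib_left by linarith

lemma enorm_neg_mult: "enorm (m21 (g * - h)) = enorm (m21 (g * h))" by (simp only: mat2_minus_mult mat2_sel(7) enorm_minus)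

text \<open>The cusps form a simply connected complex: vertices are cusps, edges join cusps with
  determinant a unit, and every loop contracts because the neighbours of a cusp that have
  smaller denominator are connected to each other.  This is what makes the recursion below
  well defined.\<close>

context
 fixes ps :: "eis mat2 => 's => 's"
 assumes psi: "!!g h. g : Gam1 ==> h : Gam1 ==> g * h : Gam1 ==> ps (g * h) = ps g o ps h"
  and psi_1: "ps 1 = id"
begin

abbreviation lev :: "eis mat2 => nat" where "lev g \<equiv> nat (enorm (m21 g))"

text \<open>Any neighbour with smaller denominator will do; that the recursion does not depend on
  the choice is the content of \<open>ext_step_down\<close>.\<close>

definition down :: "eis mat2 => eis mat2" where
 "down g = (SOME h. h : Gam1 & lev (g * h) < lev g)"

lemma down_exists:
 assumes "m21 g ~= 0"
 shows "EX z z'. ev (z' - z - 1) & lev (g * nmat z z') < lev g"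
proof -
 obtain z where "enorm (m21 g * z + m22 g) < enorm (m21 g)" using eis_division[OF assms] by blast
 hence "enorm (m21 (g * nmat z (z + 1))) < enorm (m21 g)" unfolding enorm_nmat_mult .
 hence "lev (g * nmat z (z + 1)) < lev g" using assms enorm_pos[of "m21 g"] by simp
 thus ?thesis by (intro exI[of _ z] exI[of _ "z + 1"]) simp
qed

lemma down: "m21 g ~= 0 ==> down g : Gam1 & lev (g * down g) < lev g"
 unfolding down_def using down_exists nmat_Gam1 someI_ex[of "%h. h : Gam1 & lev (g * h) < lev g"] by blast

function ext :: "eis mat2 => 's => 's" where
 "ext g = (if lev g <= 1 then ps g else ext (g * down g) o ps (inv2 (down g)))" by auto
termination
proof (relation "Wellfounded.measure lev")
 fix g assume "~ lev g <= 1"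
 hence "m21 g ~= 0" by auto
 thus "(g * down g, g) : Wellfounded.measure lev" using down by simp
qed simp

declare ext.simps [simp del]

lemma psi_inv: "h : Gam1 ==> ps h o ps (inv2 h) = id" "h : Gam1 ==> ps (inv2 h) o ps h = id"
 using psi[of h "inv2 h"] psi[of "inv2 h" h] Gam1_inv[of h] Gam1_1 psi_1 inv2_mult[of h] Gam_det[OF Gam1_Gam] by metis+

text \<open>A translation leaves the lower left entry unchanged up to sign, so an element that
  lowers the level belongs to the other class of \<open>Gam1\<close>.\<close>

lemma Gam1_level_drop:
 assumes "g : Gam" "1 < lev g" "h : Gam1" "lev (g * h) < lev g"
 obtains z z' where "ev (z' - z - 1)" "h = nmat z z' | h = - nmat z z'"
proof -
 have "m21 h ~= 0"
 proof
  assume "m21 h = 0"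
  then obtain b where "h = tmat b | h = - tmat b" using Gam_P_cases Gam1_Gam assms(3) by metis
  hence "m21 (g * h) = m21 g | m21 (g * h) = - m21 g" by (auto simp: tmat_def)
  thus False using assms(4) by auto
 qed
 hence "enorm (m21 h) = 1" using assms(3) enorm_pos[of "m21 h"] unfolding Gam1_def by auto
 thus thesis using Gam_N_cases assms(3) Gam1_Gam that by metis
qed

text \<open>The smaller neighbours of a cusp are the integers in an open unit disc around
  \<open>- d / c\<close>. Two of them coincide, are adjacent, or are sqrt 3 apart, and in the last
  case the disc contains a third one adjacent to both. Passing from \<open>down g\<close> to
  \<open>h\<close> through it keeps all levels below \<open>L\<close>, where the induction
  hypothesis applies.\<close>

lemma ext_step_down:
 assumes IH: "!!g h. g : Gam ==> h : Gam1 ==> lev g < L ==> lev (g * h) < L ==> ext (g * h) = ext g o ps h"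
  and L: "1 < L" and g: "g : Gam" "lev g = L" and h: "h : Gam1" "lev (g * h) < L"
 shows "ext g = ext (g * h) o ps (inv2 h)"
proof -
 define k where "k = down g"
 have nz: "m21 g ~= 0" using L g by auto
 have k: "k : Gam1" "lev (g * k) < L" using down[OF nz] g k_def by auto
 have ext_g: "ext g = ext (g * k) o ps (inv2 k)" using ext.simps[of g] L g k_def by simp
 \<comment> \<open>One move between adjacent smaller neighbours: both ends have level below
   \<open>L\<close>, so \<open>IH\<close> relates them.\<close>
 have adj: "ext (g * h) o ps (inv2 h) = ext (g * m) o ps (inv2 m)"
  if m: "m : Gam1" "lev (g * m) < L" and hm: "inv2 m * h : Gam1" and h: "h : Gam1" "lev (g * h) < L" for h m
 proof -
  have dm: "det2 m = 1" using m Gam1_Gam Gam_det by blast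
  have "g * h = g * m * (inv2 m * h)" by (simp only: mult.assoc inv2_cancel(3)[OF dm])
  hence "ext (g * h) = ext (g * m) o ps (inv2 m * h)" using IH[of "g * m" "inv2 m * h"] m h hm g Gam_mult Gam1_Gam by metis
  also have "ps (inv2 m * h) = ps (inv2 m) o ps h" using psi hm m h Gam1_inv by blast
  finally have "ext (g * h) o ps (inv2 h) = ext (g * m) o ps (inv2 m) o (ps h o ps (inv2 h))" by (metis comp_assoc)
  thus ?thesis using psi_inv h by simp
 qed
 have pm: "inv2 m * - n : Gam1 \<longleftrightarrow> inv2 m * n : Gam1" "inv2 (- m) * n : Gam1 \<longleftrightarrow> inv2 m * n : Gam1" for m n
 proof -
  have "inv2 (- m) = - inv2 m" by (simp add: mat2_eq_iff)
  thus "inv2 m * - n : Gam1 \<longleftrightarrow> inv2 m * n : Gam1" "inv2 (- m) * n : Gam1 \<longleftrightarrow> inv2 m * n : Gam1" by simp_all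
 qed
 obtain z z' where z: "ev (z' - z - 1)" "h = nmat z z' | h = - nmat z z'" using Gam1_level_drop[OF g(1) _ h(1)] g(2) h(2) L by metis
 obtain w w' where w: "ev (w' - w - 1)" "k = nmat w w' | k = - nmat w w'" using Gam1_level_drop[OF g(1) _ k(1)] g(2) k(2) L by metis
 let ?N = "%x. enorm (m21 g * x + m22 g)"
 have Nz: "?N z < enorm (m21 g)" and Nw: "?N w < enorm (m21 g)"
 proof -
  have "enorm (m21 (g * h)) = ?N z" "enorm (m21 (g * k)) = ?N w" using z(2) w(2) enorm_nmat_mult[of g] enorm_neg_mult by metis+
  thus "?N z < enorm (m21 g)" "?N w < enorm (m21 g)" using h k g L by auto
 qed
 have id: "2 * (?N x + ?N y) = enorm (m21 g) * enorm (x - y) + enorm (m21 g * (x + y) + 2 * m22 g)" for x y by (simp add: enorm_def alg)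
 show ?thesis
 proof (cases "enorm (w - z) <= 1")
  case True
  hence "inv2 k * h : Gam1" using nmat_inv_mult_Gam1[OF w(1) z(1)] z(2) w(2) pm by auto
  thus ?thesis using adj[OF k _ h] ext_g by simp
 next
  case False
  have "enorm (w - z) < 4" by (rule lens_arith1[OF id[of w z] Nw Nz]) simp_all
  moreover have "w - z ~= 0" "w - z \<notin> eunits" using False enorm_1_iff by force+
  ultimately obtain u v where uv: "u : eunits" "v : eunits" "w - z = u + v" "enorm (u - v) = 1" using enorm_less_4 by blast
  have sum: "(z + u) + (z + v) = w + z" using uv(3) by (simp add: alg)
  have "enorm (w - z) \<ge> 2" using False by simp
  hence "enorm (m21 g) * 2 <= enorm (m21 g) * enorm (w - z)" by (rule mult_left_mono) simp
  hence "2 * (?N (z + u) + ?N (z + v)) <= 2 * (?N w + ?N z) - enorm (m21 g)" using id[of "z + u" "z + v"] id[of w z] sum uv(4) by simp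
  hence "?N (z + u) < enorm (m21 g) | ?N (z + v) < enorm (m21 g)" by (rule lens_arith2[OF _ Nw Nz]) simp
  then obtain x where x: "?N x < enorm (m21 g)" "x - z : eunits" "w - x : eunits" by (metis add_diff_cancel_left' add_implies_diff diff_diff_eq uv(1,2,3))
  define m where "m = nmat x (x + 1)"
  have m: "m : Gam1" unfolding m_def by (rule nmat_Gam1) simp
  have "enorm (m21 (g * m)) < enorm (m21 g)" using x(1) enorm_nmat_mult[of g x "x + 1"] m_def by simp
  hence lm: "lev (g * m) < L" using g L by auto
  have "inv2 k * m : Gam1" "inv2 m * h : Gam1" using nmat_inv_mult_Gam1[OF w(1), of "x + 1" x] nmat_inv_mult_Gam1[OF _ z(1), of "x + 1" x] x(2,3) z(2) w(2) pm
   unfolding m_def by (auto simp: enorm_1_iff[symmetric])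
  thus ?thesis using adj[OF k _ m lm] adj[OF m lm _ h] ext_g by simp
 qed
qed

text \<open>Induction on a strict bound for both levels. The new case is that of two ends on the top
  level: the step is replaced by two steps through a common neighbour \<open>k\<close> of smaller
  level.\<close>

lemma ext_step:
 "g : Gam ==> h : Gam1 ==> lev g < L ==> lev (g * h) < L ==> ext (g * h) = ext g o ps h"
proof (induction L arbitrary: g h)
 case (Suc L)
 show ?case
 proof (cases "L <= 1")
  case True
  hence "lev g <= 1" "lev (g * h) <= 1" using Suc by simp_all
  hence "g : Gam1" "g * h : Gam1" using Suc.prems Gam_mult[OF _ Gam1_Gam] unfolding Gam1_def by auto
  moreover have "ext g = ps g" "ext (g * h) = ps (g * h)" using \<open>lev g <= 1\<close> \<open>lev (g * h) <= 1\<close> by (subst ext.simps; simp only: if_True)+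
  ultimately show ?thesis using psi Suc.prems by simp
 next
  case False
  hence L: "1 < L" by simp
  have IH: "!!g h. g : Gam ==> h : Gam1 ==> lev g < L ==> lev (g * h) < L ==> ext (g * h) = ext g o ps h"
   using Suc.IH by blast
  have sd: "ext g = ext (g * h) o ps (inv2 h)" if "g : Gam" "lev g = L" "h : Gam1" "lev (g * h) < L" for g h using ext_step_down[OF IH L that] by blast
  have sd': "ext (g * h) = ext g o ps h" if "g : Gam" "lev g = L" "h : Gam1" "lev (g * h) < L" for g h
  proof -
   have "ext g o ps h = ext (g * h) o (ps (inv2 h) o ps h)" using sd[OF that] by (metis comp_assoc)
   thus ?thesis using psi_inv that by simp
  qed
  have sd'': "ext (g * h) = ext g o ps h" if "g : Gam" "lev g < L" "h : Gam1" "lev (g * h) = L" for g h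
  proof -
   have "det2 h = 1" using that Gam1_Gam Gam_det by blast
   hence "g * h * inv2 h = g" "inv2 (inv2 h) = h" using inv2_cancel by (auto simp: mat2_eq_iff)
   thus ?thesis using sd[of "g * h" "inv2 h"] that Gam_mult Gam1_Gam Gam1_inv by metis
  qed
  consider "lev g < L" "lev (g * h) < L" | "lev g = L" "lev (g * h) < L" | "lev g < L" "lev (g * h) = L"
   | "lev g = L" "lev (g * h) = L" using Suc by linarith
  thus ?thesis
  proof cases
   case 1 thus ?thesis using IH Suc by blast
  next
   case 2 thus ?thesis using sd' Suc by blast
  next
   case 3 thus ?thesis using sd'' Suc by blast
  next
   case 4
   have nz: "m21 g ~= 0" using L 4 by auto
   have "EX k. k : Gam1 & inv2 k * h : Gam1 & lev (g * k) < L"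
   proof (cases "m21 h = 0")
    case True
    \<comment> \<open>Both ends are the same cusp, so any smaller neighbour of it is a common
      one.\<close>
    obtain z z' where k: "ev (z' - z - 1)" "lev (g * nmat z z') < lev g" using down_exists[OF nz] by blast
    have "enorm (m21 (inv2 (nmat z z') * h)) <= 1"
    proof -
     obtain b where "h = tmat b | h = - tmat b" using Gam_P_cases[OF _ True] Suc Gam1_Gam by metis
     hence "m21 (inv2 (nmat z z') * h) = - cl z | m21 (inv2 (nmat z z') * h) = cl z" by (auto simp: tmat_def nmat_def)
     thus ?thesis by auto
    qed
    hence "inv2 (nmat z z') * h : Gam1" using Gam_mult Gam_inv nmat_Gam[OF k(1)] Suc Gam1_Gam unfolding Gam1_def by blast
    thus ?thesis using k nmat_Gam1 4 by metis
   next
    case False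
    hence "enorm (m21 h) = 1" using Suc(3) enorm_pos[of "m21 h"] by (simp add: Gam1_def)
    then obtain z z' where z: "ev (z' - z - 1)" "h = nmat z z' | h = - nmat z z'" using Gam_N_cases Suc Gam1_Gam by metis
    define N where "N = enorm (m21 g)"
    have N: "0 < N" using nz enorm_pos N_def by simp
    define X where "X = m21 g * z + m22 g"
    have "enorm X = N" by (metis "4"(1,2) N_def X_def enorm_neg_mult enorm_nmat_mult enorm_nonneg int_nat_eq z(2))
    hence "enorm (ecnj X * m21 g) = N^2" using N_def by (simp add: p2_sq)
    \<comment> \<open>For a suitable unit the cross term is below \<open>- N\<close>, hence
      \<open>|X + c u|^2 < N + N - N\<close>: the edge is completed to a triangle by a cusp of
      smaller level.\<close>
    then obtain u where u: "u : eunits" "etr (ecnj X * m21 g * u) < - N" using exists_unit_trace N by blast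
    have "etr (X * ecnj (m21 g * u)) = etr (ecnj X * m21 g * u)" using etr_linear(5)[of "ecnj X * m21 g * u"] by (simp add: mult.assoc)
    hence "enorm (X + m21 g * u) < N" using enorm_add[of X "m21 g * u"] u \<open>enorm X = N\<close> N_def enorm_1_iff[of u] by simp
    hence lt: "enorm (m21 g * (z + u) + m22 g) < N" unfolding X_def by (simp add: alg)
    define k where "k = nmat (z + u) (z + u + 1)"
    have e: "ev (z + u + 1 - (z + u) - 1)" by simp
    have k: "k : Gam1" unfolding k_def by (rule nmat_Gam1[OF e])
    have "lev (g * k) < L" using lt N 4 unfolding k_def enorm_nmat_mult N_def by auto
    moreover have "inv2 k * nmat z z' : Gam1" unfolding k_def by (rule nmat_inv_mult_Gam1[OF e z(1)]) (use u enorm_1_iff[of u] in simp)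
    hence "inv2 k * h : Gam1" using z(2) by auto
    ultimately show ?thesis using k by blast
   qed
   then obtain k where k: "k : Gam1" "inv2 k * h : Gam1" "lev (g * k) < L" by blast
   have dk: "det2 k = 1" using k Gam1_Gam Gam_det by blast
   have eq: "g * h = g * k * (inv2 k * h)" by (simp only: mult.assoc inv2_cancel(3)[OF dk])
   have "ext (g * h) = ext (g * k) o ps (inv2 k * h)" unfolding eq by (rule sd'') (use k 4 Suc(2) Gam_mult Gam1_Gam eq in auto)
   also have "ext (g * k) = ext g o ps k" using sd'[of g k] Suc 4 k by blast
   also have "ext g o ps k o ps (inv2 k * h) = ext g o ps h" by (metis (no_types, opaque_lifting) Suc.prems(2) dk inv2_cancel(3) k(1,2) o_assoc psi)
   finally show ?thesis .
  qed
 qed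
qed simp

lemma Gam_generated:
 "g : Gam ==> EX h k. h : Gam & k : Gam1 & g = h * k & (g : Gam1 & h = 1 | lev h < lev g)"
by (smt (verit, ccfv_threshold) Gam1_def Gam1_inv Gam_det Gam_mult down enorm_0 inv2_mult(1) mem_Collect_eq mult.assoc mult.right_neutral zero_le_one)

lemma Gam_induct_aux:
 assumes "!!k. k : Gam1 ==> P k"
  and "!!h k. h : Gam ==> P h ==> k : Gam1 ==> P (h * k)"
 shows "g : Gam ==> P g"
proof (induction "lev g" arbitrary: g rule: less_induct)
 case less
 thus ?case using Gam_generated[of g] assms by blast
qed

lemma ext_mult: "g : Gam ==> h : Gam ==> ext (g * h) = ext g o ext h"
 and ext_Gam1: "h : Gam1 ==> ext h = ps h"
proof -
 have s: "ext (g * h) = ext g o ps h" if "g : Gam" "h : Gam1" for g h using ext_step[OF that, of "Suc (max (lev g) (lev (g * h)))"] by simp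
 show e: "ext h = ps h" if "h : Gam1" for h
 proof -
  have "lev h <= 1" using that unfolding Gam1_def nat_le_iff by simp
  thus ?thesis by (subst ext.simps) (simp only: if_True)
 qed
 assume g: "g : Gam" and "h : Gam"
 have "ALL g:Gam. ext (g * h) = ext g o ext h" by (rule Gam_induct_aux[OF _ _ \<open>h : Gam\<close>]; (simp add: s e Gam_mult mult.assoc[symmetric] comp_assoc))
 thus "ext (g * h) = ext g o ext h" using g by blast
qed

end

text \<open>A substitute for a presentation: the relations to check are the products of two local
  elements that are local again. Values are self-maps of an arbitrary type, so that affine actions,
  and with them twisted cocycles, can be extended too.\<close>

theorem Gam_hom_extension:
 fixes ps :: "eis mat2 => 's => 's"
 assumes "!!g h. g : Gam1 ==> h : Gam1 ==> g * h : Gam1 ==> ps (g * h) = ps g o ps h" "ps 1 = id"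
 obtains \<Psi> where "!!g h. g : Gam ==> h : Gam ==> \<Psi> (g * h) = \<Psi> g o \<Psi> h" "!!g. g : Gam1 ==> \<Psi> g = ps g"
 using ext_mult[of ps, OF assms] ext_Gam1[of ps, OF assms] by blast

lemma Gam_induct [consumes 1, case_names gen mult]:
 assumes "g : Gam" "!!k. k : Gam1 ==> P k"
  and "!!h k. h : Gam ==> P h ==> k : Gam1 ==> P (h * k)"
 shows "P g" by (rule Gam_induct_aux[where ps = "%_. id" and P = P]) (use assms in auto)

section \<open>The fibration class and its twisted companion\<close>

text \<open>\<open>Gold i j\<close> is \<open>i + j \<phi>\<close> with \<open>\<phi>\<^sup>2 = \<phi> + 1\<close>.\<close>

datatype gold = Gold (ga: int) (gb: int)

lemma gold_eq_iff: "x = y \<longleftrightarrow> ga x = ga y & gb x = gb y" by (cases x; cases y) auto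

instantiation gold :: comm_ring_1
begin
definition "0 = Gold 0 0"
definition "1 = Gold 1 0"
definition "x + y = Gold (ga x + ga y) (gb x + gb y)"
definition "x - y = Gold (ga x - ga y) (gb x - gb y)"
definition "- x = Gold (- ga x) (- gb x)"
definition "x * y = Gold (ga x * ga y + gb x * gb y) (ga x * gb y + gb x * ga y + gb x * gb y)"
instance by intro_classes (auto simp: zero_gold_def one_gold_def plus_gold_def minus_gold_def uminus_gold_def
   times_gold_def gold_eq_iff alg)
end

lemma gold_sel [simp]:
 "ga 0 = 0" "gb 0 = 0" "ga 1 = 1" "gb 1 = 0"
 "ga (x + y) = ga x + ga y" "gb (x + y) = gb x + gb y"
 "ga (x - y) = ga x - ga y" "gb (x - y) = gb x - gb y"
 "ga (- x) = - ga x" "gb (- x) = - gb x"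
 "ga (x * y) = ga x * ga y + gb x * gb y"
 "gb (x * y) = ga x * gb y + gb x * ga y + gb x * gb y" by (simp_all add: zero_gold_def one_gold_def plus_gold_def minus_gold_def uminus_gold_def times_gold_def)

lemma gold_sel_of_int [simp]: "ga (of_int k) = k" "gb (of_int k) = 0"
proof -
 have n: "ga (of_nat n) = int n & gb (of_nat n) = 0" for n by (induction n) auto
 show "ga (of_int k) = k" "gb (of_int k) = 0" using n by (cases k; simp)+
qed

text \<open>\<open>Gold (-1) 1\<close> is \<open>\<phi> - 1\<close>, the inverse of the golden
  ratio.\<close>

definition gpow :: "int => gold" where
 "gpow k = (if 0 <= k then Gold 0 1^nat k else Gold (-1) 1^nat (- k))"

lemma gpow_simps [simp]: "gpow 0 = 1" "gpow 1 = Gold 0 1" "gpow 2 = Gold 1 1"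
 "gpow (-1) = Gold (-1) 1" "gpow (-2) = Gold 2 (-1)" by (simp_all add: gpow_def gold_eq_iff p2_sq)

lemma gpow_Suc: "gpow (k + 1) = Gold 0 1 * gpow k"
proof (cases "0 <= k")
 case True
 hence "nat (k + 1) = Suc (nat k)" by simp
 thus ?thesis using True by (simp add: gpow_def)
next
 case False
 hence "nat (- k) = Suc (nat (- (k + 1)))" by simp
 moreover have "Gold 0 1 * (Gold (-1) 1 * x) = x" for x by (simp add: gold_eq_iff alg)
 ultimately show ?thesis using False by (simp add: gpow_def)
qed

lemma gpow_add: "gpow (j + k) = gpow j * gpow k"
proof (induction j rule: int_induct[where k = 0])
 case base thus ?case by simp
next
 case (step1 i) thus ?case using gpow_Suc[of "i + k"] gpow_Suc[of i] by (simp add: alg)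
next
 case (step2 i)
 have "Gold 0 1 * gpow (i - 1 + k) = Gold 0 1 * (gpow (i - 1) * gpow k)" using gpow_Suc[of "i - 1 + k"] gpow_Suc[of "i - 1"] step2 by (simp add: alg)
 moreover have "Gold (-1) 1 * (Gold 0 1 * x) = x" for x by (simp add: gold_eq_iff alg)
 ultimately show ?case by metis
qed

definition psgn :: "int => gold" where "psgn k = (if even k then 1 else - 1)"

lemma psgn_add: "psgn (j + k) = psgn j * psgn k" by (simp add: psgn_def)

text \<open>The powers of \<open>- \<phi>^2\<close>, a root of \<open>t^2 + 3 t + 1\<close>. This is
  the characteristic polynomial of the monodromy on the homology of the fibre, which is why a
  cocycle twisted by this character exists.\<close>

definition rho :: "int => gold" where "rho k = psgn k * gpow (2 * k)"

lemma rho_0 [simp]: "rho 0 = 1" by (simp add: rho_def psgn_def)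

lemma rho_add: "rho (j + k) = rho j * rho k" by (simp add: rho_def psgn_add gpow_add alg)

text \<open>A sign of period 4 that changes under a shift by 2. It supplies the factor
  \<open>psgn\<close> of \<open>rho\<close> for translations, whose \<omega>-coordinate is even and
  enters by its half.\<close>

definition qsgn :: "int => gold" where "qsgn y = (if y mod 4 < 2 then 1 else - 1)"

lemma qsgn_shift: "qsgn (y + 2 * q) = psgn q * qsgn y"
proof (cases "even q")
 case True
 then obtain r where "q = 2 * r" by blast
 thus ?thesis by (simp add: qsgn_def psgn_def)
next
 case False
 then obtain r where r: "q = 2 * r + 1" by (elim oddE) simp
 have "(y + 2 * q) mod 4 = (y + 2 + 4 * r) mod 4" unfolding r by (simp add: alg)
 also have "... = (y + 2) mod 4" by simp
 finally have "(y + 2 * q) mod 4 = (y + 2) mod 4" .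
 moreover have "((y + 2) mod 4 < 2) = (~ y mod 4 < 2)" by presburger
 ultimately show ?thesis using False by (simp add: qsgn_def psgn_def)
qed

text \<open>\<open>cl z\<close> is a cube root of unity, so the square of its conjugate is
  \<open>cl z\<close> again, see \<open>cj_eq\<close>. In the form given it arises from the product
  of two matrices \<open>nmat\<close>.\<close>

definition cj :: "eis => eis" where "cj z = ecnj (cl z) * ecnj (cl z)"

lemma cj_eq: "cj z = (if even (eb z) then Eis 0 1 else Eis (-1) (-1))" by (simp add: cj_def cl_def eis_eq_iff)

text \<open>The cocycle rule for a triangle of cusps, freed of a common power of \<phi>. The residue
  of \<open>eb z\<close> modulo 4 and the six units leave finitely many cases, decided by
  \<open>\<phi>^2 = \<phi> + 1\<close>.\<close>

lemma qsgn_gpow_triangle: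
 assumes "u : eunits"
 shows "qsgn (eb (z - cj z * ecnj u)) * gpow (- etr (cj z * ecnj u))
  = qsgn (eb z) - qsgn (eb z + eb u) * gpow (etr u)"
proof -
 have *: "qsgn (y - eb d) * gpow (- etr d) = qsgn y - qsgn (y + eb u) * gpow (etr u)"
  if "d = (if even y then Eis 0 1 else Eis (-1) (-1)) * ecnj u" for y d
 proof -
  define r k where "r = y mod 4" and "k = y div 4"
  have y: "y = r + 4 * k" unfolding r_def k_def by simp
  have r: "r = 0 | r = 1 | r = 2 | r = 3" unfolding r_def by presburger
  have q: "qsgn (y + a) = qsgn (r + a)" for a
  proof -
   have "y + a = r + a + 4 * k" unfolding y by simp
   hence "(y + a) mod 4 = (r + a) mod 4" by (metis mod_mult_self2)
   thus ?thesis by (simp add: qsgn_def)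
  qed
  have "even y \<longleftrightarrow> even r" unfolding y by simp
  thus ?thesis using that q[of "- eb d"] q[of 0] q[of "eb u"] r assms unfolding eunits_def by (elim insertE emptyE disjE) (simp_all add: etr_def qsgn_def gold_eq_iff)
 qed
 show ?thesis using *[of "cj z * ecnj u" "eb z"] by (simp add: cj_eq)
qed

text \<open>Since \<open>etr\<close> is twice the real part and \<open>ecnj (m21 g)\<close> inverts
  a unit \<open>m21 g\<close>, this is the real part of a translation, and that of
  \<open>z - z'\<close> for \<open>nmat z z'\<close>.\<close>

definition chi0 :: "eis mat2 => int" where
 "chi0 g = (if m21 g = 0 then etr (m11 g * m12 g) div 2 else etr ((m11 g + m22 g) * ecnj (m21 g)) div 2)"

text \<open>Normalised to vanish on translations. The cocycle rule then makes it invariant under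
  translations on the right, hence a function of the image \<open>z\<close> of infinity, and
  multiplies it by \<open>rho\<close> under translations on the left; \<open>qsgn\<close> times a
  power of \<phi> behaves like this.\<close>

definition co0 :: "eis mat2 => gold" where
 "co0 g = (if m21 g = 0 then 0
   else qsgn (eb (m11 g * ecnj (m21 g))) * gpow (etr (m11 g * ecnj (m21 g))))"

lemma chi0_minus [simp]: "chi0 (- g) = chi0 g" and co0_minus [simp]: "co0 (- g) = co0 g"
proof -
 have "(- m11 g - m22 g) * - ecnj (m21 g) = (m11 g + m22 g) * ecnj (m21 g)" by (simp add: alg)
 thus "chi0 (- g) = chi0 g" "co0 (- g) = co0 g" by (simp_all add: chi0_def co0_def alg)
qed

lemma cl_nz: "cl z ~= 0" by (auto simp: cl_def eis_eq_iff)

lemma cl_ecnj: "cl z * ecnj (cl z) = 1" by (rule unit_ecnj) simp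

lemma nmat_sel [simp]: "m11 (nmat z z') = cl z * z" "m12 (nmat z z') = - (cl z * z * z') - ecnj (cl z)"
 "m21 (nmat z z') = cl z" "m22 (nmat z z') = - (cl z * z')" by (simp_all add: nmat_def)

lemma tmat_sel [simp]: "m11 (tmat b) = 1" "m12 (tmat b) = b" "m21 (tmat b) = 0" "m22 (tmat b) = 1" by (simp_all add: tmat_def)

lemma chi0_tmat [simp]: "chi0 (tmat b) = etr b div 2" and co0_tmat [simp]: "co0 (tmat b) = 0" by (simp_all add: chi0_def co0_def)

lemma cl_cancel: "cl z * x * ecnj (cl z) = x" using cl_ecnj[of z] by (metis mult.assoc mult.commute mult.left_neutral)

lemma chi0_nmat [simp]: "chi0 (nmat z z') = (etr z - etr z') div 2"
proof -
 have "(cl z * z - cl z * z') * ecnj (cl z) = cl z * (z - z') * ecnj (cl z)" by (simp add: alg)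
 hence "(cl z * z - cl z * z') * ecnj (cl z) = z - z'" by (simp only: cl_cancel)
 thus ?thesis by (simp add: chi0_def cl_nz)
qed

lemma co0_nmat [simp]: "co0 (nmat z z') = qsgn (eb z) * gpow (etr z)" unfolding co0_def nmat_sel cl_cancel using cl_nz by simp

lemma cl_ev: "ev b ==> cl (z + b) = cl z" by (simp add: cl_def ev_def)

lemma tmat_tmat: "tmat a * tmat b = tmat (a + b)" by (simp add: mat2_eq_iff)

lemma tmat_nmat: "ev b ==> tmat b * nmat z z' = nmat (z + b) z'" using cl_ev[of b z] by (simp add: mat2_eq_iff alg)

lemma nmat_tmat: "nmat z z' * tmat b = nmat z (z' - b)" by (simp add: mat2_eq_iff alg)

lemma nmat_nmat_0:
 assumes "ev (z' - z - 1)"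
 shows "nmat z z' * nmat z' w' = - tmat (z - w')"
proof -
 have c: "cl z' = cl z" using assms by (auto simp: cl_def ev_def)
 have c2: "cl z * (ecnj (cl z) * x) = x" for x using cl_cancel[of z x] by (simp add: mult_ac)
 show ?thesis unfolding mat2_eq_iff using cl_ecnj[of z] by (simp add: c c2 alg)
qed

lemma nmat_nmat:
 fixes z z' w w' u g
 assumes "w - z' = u" "enorm u = 1"
 defines "g \<equiv> nmat z z' * nmat w w'"
 shows "m21 g = cl z * cl w * u" "m11 g * ecnj (m21 g) = z - cj z * ecnj u"
  "m22 g * ecnj (m21 g) = - w' - cj w * ecnj u"
proof -
 have w: "w = z' + u" using assms(1) by (simp add: alg)
 show 1: "m21 g = cl z * cl w * u" unfolding g_def w by (simp add: alg)
 have "m11 g * ecnj (m21 g)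
   = z * (cl z * ecnj (cl z)) * (cl w * ecnj (cl w)) * (u * ecnj u) - cj z * ecnj u * (cl w * ecnj (cl w))" unfolding 1 cj_def unfolding g_def w by (simp add: alg)
 thus "m11 g * ecnj (m21 g) = z - cj z * ecnj u" by (simp add: cl_ecnj unit_ecnj(1)[OF assms(2)])
 have "m22 g * ecnj (m21 g)
   = - w' * (cl z * ecnj (cl z)) * (cl w * ecnj (cl w)) * (u * ecnj u) - cj w * ecnj u * (cl z * ecnj (cl z))" unfolding 1 cj_def unfolding g_def w by (simp add: alg)
 thus "m22 g * ecnj (m21 g) = - w' - cj w * ecnj u" by (simp add: cl_ecnj unit_ecnj(1)[OF assms(2)])
qed

lemma ev_decompose:
 assumes "ev b" obtains p q where "b = Eis (2 * p) (2 * q)" using assms that unfolding ev_def by (metis eis.collapse evenE)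

lemma half_trace_diff:
 assumes "ev (z' - z - 1)"
 obtains p q where "z' = z + 1 + Eis (2 * p) (2 * q)" "(etr z - etr z') div 2 = q - 2 * p - 1"
  "etr z' = etr z + 2 * (1 + 2 * p - q)"
proof -
 obtain p q where pq: "z' - z - 1 = Eis (2 * p) (2 * q)" using assms ev_decompose by blast
 hence z': "z' = z + 1 + Eis (2 * p) (2 * q)" by (simp add: alg)
 have t: "etr z' = etr z + 2 * (1 + 2 * p - q)" unfolding z' by (simp add: etr_def)
 show thesis by (rule that[OF z' _ t]) (simp add: t)
qed

text \<open>The relation of a triangle of mutually adjacent cusps. For \<open>chi0\<close> three
  traces cancel; for \<open>co0\<close> it is \<open>qsgn_gpow_triangle\<close> multiplied by
  \<open>gpow (etr z)\<close>.\<close>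

lemma nmat_nmat_unit:
 fixes z z' w w' u g
 assumes z: "ev (z' - z - 1)" and w: "ev (w' - w - 1)" and u: "w - z' = u" "u : eunits"
 defines "g \<equiv> nmat z z' * nmat w w'"
 shows "chi0 g = chi0 (nmat z z') + chi0 (nmat w w')"
  and "co0 g = co0 (nmat z z') + rho (chi0 (nmat z z')) * co0 (nmat w w')"
proof -
 have u1: "enorm u = 1" using u enorm_1_iff by blast
 note P = nmat_nmat[OF u(1) u1, of z w', folded g_def]
 have nz: "m21 g ~= 0" using P(1) cl_nz u1 by auto
 obtain p q where pq: "z' = z + 1 + Eis (2 * p) (2 * q)" "(etr z - etr z') div 2 = q - 2 * p - 1"
  "etr z' = etr z + 2 * (1 + 2 * p - q)" using half_trace_diff[OF z] by blast
 obtain r s where rs: "w' = w + 1 + Eis (2 * r) (2 * s)" "(etr w - etr w') div 2 = s - 2 * r - 1"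
  "etr w' = etr w + 2 * (1 + 2 * r - s)" using half_trace_diff[OF w] by blast
 have wz: "w = z' + u" using u(1) by (simp add: alg)
 have ebw: "eb w = eb z + eb u + 2 * q" unfolding wz pq(1) by simp
 have trw: "etr w = etr z' + etr u" unfolding wz by simp
 have "etr u + etr (cj z * ecnj u) + etr (cj w * ecnj u) = 0" using u(2) unfolding cj_eq ebw eunits_def by (elim insertE emptyE) (auto simp: etr_def)
 hence T: "etr ((m11 g + m22 g) * ecnj (m21 g)) = 2 * ((q - 2 * p - 1) + (s - 2 * r - 1))" using P pq(3) rs(3) trw by (simp add: distrib_right)
 show "chi0 g = chi0 (nmat z z') + chi0 (nmat w w')" unfolding chi0_nmat pq(2) rs(2) unfolding chi0_def T using nz by simp
 have c: "co0 g = qsgn (eb (z - cj z * ecnj u)) * gpow (etr (z - cj z * ecnj u))" unfolding co0_def P(2) using nz by simp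
 have "gpow (etr (z - cj z * ecnj u)) = gpow (etr z) * gpow (- etr (cj z * ecnj u))" using gpow_add[of "etr z" "- etr (cj z * ecnj u)"] by simp
 hence "co0 g = gpow (etr z) * (qsgn (eb z) - qsgn (eb z + eb u) * gpow (etr u))" using c qsgn_gpow_triangle[OF u(2), of z] by (simp add: mult_ac)
 also have "... = qsgn (eb z) * gpow (etr z) + rho (q - 2 * p - 1) * (qsgn (eb w) * gpow (etr w))"
 proof -
  have "gpow (2 * (q - 2 * p - 1)) * gpow (etr w) = gpow (etr z) * gpow (etr u)" unfolding gpow_add[symmetric] trw pq(3) by simp
  moreover have "psgn (q - 2 * p - 1) * qsgn (eb w) = - qsgn (eb z + eb u)" unfolding ebw qsgn_shift by (simp add: psgn_def)
  ultimately have "rho (q - 2 * p - 1) * (qsgn (eb w) * gpow (etr w)) = - qsgn (eb z + eb u) * (gpow (etr z) * gpow (etr u))"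
   unfolding rho_def by (metis (no_types, lifting) mult.assoc mult.left_commute)
  thus ?thesis by (simp add: alg)
 qed
 finally show "co0 g = co0 (nmat z z') + rho (chi0 (nmat z z')) * co0 (nmat w w')" using pq(2) by simp
qed

lemma Gam1_cases:
 assumes "g : Gam1"
 obtains b where "ev b" "g = tmat b | g = - tmat b"
 | z z' where "ev (z' - z - 1)" "g = nmat z z' | g = - nmat z z'" by (smt (verit, best) Gam1_def Gam_N_cases Gam_P_cases assms enorm_pos mem_Collect_eq)

text \<open>The first component adds up values of \<open>chi0\<close>, the second undergoes an
  affine map with linear part \<open>rho\<close> and translation part \<open>co0\<close>.
  Composition of maps thus expresses the additivity of one and the cocycle rule of the other at
  once.\<close>

definition psi0 :: "eis mat2 => int \<times> gold => int \<times> gold" where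
 "psi0 g = (%(k, w). (k + chi0 g, rho (chi0 g) * w + co0 g))"

lemma psi0_eqI:
 "chi0 f = chi0 g + chi0 h ==> co0 f = co0 g + rho (chi0 g) * co0 h ==> psi0 f = psi0 g o psi0 h" by (auto simp: psi0_def fun_eq_iff rho_add alg)

text \<open>With T for translations and N for the other class, products TT, TN and NT are always
  local. A product NN is local when the inner positions coincide, giving a translation, or differ by
  a unit, giving a triangle.\<close>

lemma psi0_mult:
 assumes "g : Gam1" "h : Gam1" "g * h : Gam1"
 shows "psi0 (g * h) = psi0 g o psi0 h"
proof -
 have m: "psi0 (- f) = psi0 f" for f by (simp add: psi0_def)
 have gen: "psi0 (g * h) = psi0 g o psi0 h"
  if "psi0 (g' * h') = psi0 g' o psi0 h'" "g = g' | g = - g'" "h = h' | h = - h'" for g' h' using that m by auto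
 show ?thesis using assms(1)
 proof (cases rule: Gam1_cases)
  case (1 b)
  from assms(2) show ?thesis
  proof (cases rule: Gam1_cases)
   case (1 b')
   have "psi0 (tmat b * tmat b') = psi0 (tmat b) o psi0 (tmat b')" using even_etr \<open>ev b\<close> \<open>ev b'\<close> by (intro psi0_eqI) (simp_all add: tmat_tmat)
   thus ?thesis using gen 1 \<open>g = tmat b | g = - tmat b\<close> by blast
  next
   case (2 z z')
   obtain p q where pq: "b = Eis (2 * p) (2 * q)" using \<open>ev b\<close> ev_decompose by blast
   obtain r s where rs: "(etr z - etr z') div 2 = s - 2 * r - 1" "etr z' = etr z + 2 * (1 + 2 * r - s)" using half_trace_diff[OF 2(1)] by blast
   have tb: "etr b = 2 * (2 * p - q)" unfolding pq by (simp add: etr_def)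
   have "psi0 (tmat b * nmat z z') = psi0 (tmat b) o psi0 (nmat z z')"
   proof (rule psi0_eqI)
    show "chi0 (tmat b * nmat z z') = chi0 (tmat b) + chi0 (nmat z z')" unfolding tmat_nmat[OF \<open>ev b\<close>] chi0_nmat chi0_tmat etr_linear rs(2) tb by simp
    have "qsgn (eb (z + b)) * gpow (etr (z + b)) = psgn q * gpow (etr b) * (qsgn (eb z) * gpow (etr z))" unfolding pq using qsgn_shift[of "eb z" q] gpow_add[of "etr z"] by (simp add: mult_ac)
    moreover have "rho (etr b div 2) = psgn q * gpow (etr b)" unfolding rho_def tb by (simp add: psgn_def)
    ultimately show "co0 (tmat b * nmat z z') = co0 (tmat b) + rho (chi0 (tmat b)) * co0 (nmat z z')" unfolding tmat_nmat[OF \<open>ev b\<close>] co0_nmat co0_tmat chi0_tmat by simp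
   qed
   thus ?thesis using gen 2 \<open>g = tmat b | g = - tmat b\<close> by blast
  qed
 next
  case (2 z z')
  from assms(2) show ?thesis
  proof (cases rule: Gam1_cases)
   case (1 b)
   obtain p q where pq: "b = Eis (2 * p) (2 * q)" using \<open>ev b\<close> ev_decompose by blast
   have tb: "etr b = 2 * (2 * p - q)" unfolding pq by (simp add: etr_def)
   have "psi0 (nmat z z' * tmat b) = psi0 (nmat z z') o psi0 (tmat b)" by (intro psi0_eqI) (simp_all add: nmat_tmat tb)
   thus ?thesis using gen 1 2 by blast
  next
   case (2 w w')
   note z = \<open>ev (z' - z - 1)\<close> and w = \<open>ev (w' - w - 1)\<close>
   have "psi0 (nmat z z' * nmat w w') = psi0 (nmat z z') o psi0 (nmat w w')"
   proof (cases "w - z' = 0")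
    case True
    hence wz: "w = z'" by simp
    obtain p q where pq: "z' = z + 1 + Eis (2 * p) (2 * q)" "(etr z - etr z') div 2 = q - 2 * p - 1"
     "etr z' = etr z + 2 * (1 + 2 * p - q)" using half_trace_diff[OF z] by blast
    obtain r s where rs: "w' = w + 1 + Eis (2 * r) (2 * s)" "(etr w - etr w') div 2 = s - 2 * r - 1"
     "etr w' = etr w + 2 * (1 + 2 * r - s)" using half_trace_diff[OF w] by blast
    have "eb z' = eb z + 2 * q" unfolding pq(1) by simp
    hence "qsgn (eb z') = psgn q * qsgn (eb z)" using qsgn_shift by simp
    moreover have "gpow (2 * (q - 2 * p - 1)) * gpow (etr z') = gpow (etr z)" unfolding gpow_add[symmetric] pq(3) by simp
    ultimately have "rho (q - 2 * p - 1) * (qsgn (eb z') * gpow (etr z'))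
      = psgn (q - 2 * p - 1) * psgn q * (qsgn (eb z) * gpow (etr z))" unfolding rho_def by (metis (no_types, lifting) mult.assoc mult.left_commute)
    moreover have "psgn (q - 2 * p - 1) * psgn q = - 1" by (simp add: psgn_def)
    ultimately show ?thesis unfolding wz nmat_nmat_0[OF z] using pq(2,3) rs(2,3) wz by (intro psi0_eqI) (simp_all)
   next
    case False
    have "m21 (nmat z z' * nmat w w') = cl z * cl w * (w - z')" by (simp add: alg)
    moreover have "enorm (m21 (nmat z z' * nmat w w')) <= 1"
    proof -
     have "nmat z z' * nmat w w' = g * h | nmat z z' * nmat w w' = - (g * h)" using \<open>g = nmat z z' | g = - nmat z z'\<close> 2 by auto
     thus ?thesis using assms(3) unfolding Gam1_def by (metis (no_types, lifting) enorm_minus mat2_sel(7) mem_Collect_eq)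
    qed
    ultimately have "enorm (w - z') = 1" using False enorm_pos[of "w - z'"] by simp
    thus ?thesis using nmat_nmat_unit[OF z w refl] enorm_1_iff by (intro psi0_eqI) auto
   qed
   thus ?thesis using gen 2 \<open>g = nmat z z' | g = - nmat z z'\<close> by blast
  qed
 qed
qed

lemma chi_co_exist:
 "EX xj c. (ALL g:Gam. ALL h:Gam. xj (g * h) = xj g + xj h & c (g * h) = c g + rho (xj g) * c h) &
   (ALL g:Gam1. xj g = chi0 g & c g = co0 g)"
proof -
 have p1: "psi0 1 = id" using chi0_tmat[of 0] co0_tmat[of 0] by (simp add: psi0_def fun_eq_iff chi0_def co0_def)
 obtain \<Psi> where P: "!!g h. g : Gam ==> h : Gam ==> \<Psi> (g * h) = \<Psi> g o \<Psi> h" "!!g. g : Gam1 ==> \<Psi> g = psi0 g"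
  using Gam_hom_extension[of psi0] psi0_mult p1 by blast
 \<comment> \<open>The image of the origin is the translation part; that the extended maps remain
   affine with linear part \<open>rho\<close> is shown next by induction.\<close>
 define xj c where "xj g = fst (\<Psi> g (0, 0))" and "c g = snd (\<Psi> g (0, 0))" for g
 have f: "\<Psi> g = (%(k, w). (k + xj g, rho (xj g) * w + c g))" if "g : Gam" for g using that
 proof (induction rule: Gam_induct)
  case (gen k)
  thus ?case using P(2) by (simp add: xj_def c_def psi0_def)
 next
  case (mult h k)
  have k: "\<Psi> k = (%(j, w). (j + xj k, rho (xj k) * w + c k))" using mult P(2) by (simp add: xj_def c_def psi0_def)
  have hk: "\<Psi> (h * k) = \<Psi> h o \<Psi> k" using P(1) mult Gam1_Gam by blast
  hence "xj (h * k) = xj h + xj k" "c (h * k) = c h + rho (xj h) * c k" using mult.IH k unfolding xj_def[of "h * k"] c_def[of "h * k"] by simp_all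
  thus ?case unfolding hk using mult.IH k by (auto simp: fun_eq_iff rho_add alg)
 qed
 have "xj (g * h) = xj g + xj h & c (g * h) = c g + rho (xj g) * c h" if "g : Gam" "h : Gam" for g h
  using P(1)[OF that] f[OF that(1)] f[OF that(2)] unfolding xj_def[of "g * h"] c_def[of "g * h"] by simp
 moreover have "xj g = chi0 g & c g = co0 g" if "g : Gam1" for g using P(2)[OF that] by (simp add: xj_def c_def psi0_def)
 ultimately show ?thesis by blast
qed

definition chi_co :: "(eis mat2 => int) \<times> (eis mat2 => gold)" where
 "chi_co = (SOME p. (ALL g:Gam. ALL h:Gam. fst p (g * h) = fst p g + fst p h &
   snd p (g * h) = snd p g + rho (fst p g) * snd p h) &
   (ALL g:Gam1. fst p g = chi0 g & snd p g = co0 g))"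

definition chi :: "eis mat2 => int" where "chi = fst chi_co"
definition co :: "eis mat2 => gold" where "co = snd chi_co"

lemma chi_mult: "g : Gam ==> h : Gam ==> chi (g * h) = chi g + chi h"
 and co_mult: "g : Gam ==> h : Gam ==> co (g * h) = co g + rho (chi g) * co h"
 and chi_Gam1: "g : Gam1 ==> chi g = chi0 g"
 and co_Gam1: "g : Gam1 ==> co g = co0 g"
proof -
 have "EX p. (ALL g:Gam. ALL h:Gam. fst p (g * h) = fst p g + fst p h &
   snd p (g * h) = snd p g + rho (fst p g) * snd p h) &
   (ALL g:Gam1. fst p g = chi0 g & snd p g = co0 g)" using chi_co_exist by simp
 from someI_ex[OF this, folded chi_co_def]
 show "g : Gam ==> h : Gam ==> chi (g * h) = chi g + chi h"
  "g : Gam ==> h : Gam ==> co (g * h) = co g + rho (chi g) * co h"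
  "g : Gam1 ==> chi g = chi0 g" "g : Gam1 ==> co g = co0 g" unfolding chi_def co_def by blast+
qed

lemma eis_sel_of_nat [simp]: "ea (of_nat n) = int n" "eb (of_nat n) = 0" by (induction n) auto

lemma chi_minus [simp]: "g : Gam ==> chi (- g) = chi g" and co_minus: "g : Gam ==> co (- g) = co g"
proof -
 assume g: "g : Gam"
 have m: "- 1 : Gam1" using Gam1_1 by simp
 have 0: "chi (- 1) = 0" "co (- 1) = 0" unfolding chi_Gam1[OF m] co_Gam1[OF m] by (simp_all add: chi0_def co0_def)
 have e: "- g = - 1 * g" by simp
 show "chi (- g) = chi g" "co (- g) = co g" unfolding e using chi_mult[OF Gam1_Gam[OF m] g] co_mult[OF Gam1_Gam[OF m] g] 0 by auto
qed

lemma chi_1 [simp]: "chi 1 = 0" using chi_mult[OF Gam_1 Gam_1] by simp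

lemma chi_inv: "g : Gam ==> chi (inv2 g) = - chi g" using chi_mult[of g "inv2 g"] Gam_inv[of g] inv2_mult(1)[OF Gam_det] by simp

lemma chi_tmat: "ev b ==> chi (tmat b) = etr b div 2" using chi_Gam1[OF tmat_Gam1] by simp

definition Gn :: "nat => eis mat2 set" where "Gn n = {g : Gam. int n dvd chi g}"

lemma Gn_Gam: "g : Gn n ==> g : Gam" by (simp add: Gn_def)
lemma Gn_1: "1 : Gn n" by (simp add: Gn_def Gam_1)
lemma Gn_mult: "g : Gn n ==> h : Gn n ==> g * h : Gn n" by (simp add: Gn_def Gam_mult chi_mult)
lemma Gn_inv: "g : Gn n ==> inv2 g : Gn n" by (simp add: Gn_def Gam_inv chi_inv)
lemma Gn_minus: "g : Gn n ==> - g : Gn n" by (simp add: Gn_def Gam_minus)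

text \<open>Torsion would show as a real trace of absolute value at most 1. Trace 0 makes the
  off-diagonal entries even and -1 a square modulo 4; trace 1 or -1 gives
  \<open>a^2 + a = \<omega> + 1\<close> in the field with four elements, where
  \<open>a^2 + a\<close> is 0 or 1.\<close>

lemma Gam_trace:
 assumes "g : Gam" "m11 g + m22 g = of_int t"
 shows "1 < \<bar>t\<bar>"
proof (rule ccontr)
 assume "~ 1 < \<bar>t\<bar>"
 hence t: "t = 0 | \<bar>t\<bar> = 1" by linarith
 define p q where "p = m12 g - om * m21 g" and "q = m22 g - m11 g - m21 g"
 have e: "ev p" "ev q" using assms unfolding p_def q_def Gam_def by auto
 have b: "m12 g = om * m21 g + p" and d: "m22 g = m11 g + m21 g + q" unfolding p_def q_def by auto
 have c: "m21 g = of_int t - 2 * m11 g - q" using assms(2) unfolding d by (simp add: alg)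
 have det: "m11 g * m22 g - m12 g * m21 g = 1" using Gam_det[OF assms(1)] by (simp add: det2_def)
 show False using t
 proof
  assume t: "t = 0"
  have ec: "ev (m21 g)" using e(2) unfolding c t by (simp add: ev_def)
  have eb: "ev (m12 g)" unfolding b using ec e(1) by (simp add: ev_add ev_mult')
  obtain r s where r: "m21 g = Eis (2 * r) (2 * s)" using ev_decompose[OF ec] by blast
  obtain v w where v: "m12 g = Eis (2 * v) (2 * w)" using ev_decompose[OF eb] by blast
  define x y where "x = ea (m11 g)" and "y = eb (m11 g)"
  have "m22 g = - m11 g" using assms(2) t by (simp add: eq_neg_iff_add_eq_0 add.commute)
  hence "- (m11 g * m11 g) - m12 g * m21 g = 1" using det by simp
  hence 1: "x * x - y * y + 4 * (v * r - w * s) = - 1"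
   and 2: "2 * x * y - y * y + 4 * (v * s + w * r - w * s) = 0" unfolding r v eis_eq_iff x_def y_def by (simp_all add: alg)
  have "even y"
  proof (rule ccontr)
   assume "odd y"
   hence "odd (2 * x * y - y * y + 4 * (v * s + w * r - w * s))" by simp
   thus False unfolding 2 by simp
  qed
  then obtain j where j: "y = 2 * j" by blast
  have "x * x = 4 * (j * j - (v * r - w * s)) - 1" using 1 unfolding j by simp
  hence "x * x mod 4 = 3" by presburger
  moreover have "x * x mod 4 = 0 | x * x mod 4 = 1"
  proof (cases "even x")
   case True
   then obtain k where "x = 2 * k" by blast
   thus ?thesis by simp
  next
   case False
   then obtain k where "x = 2 * k + 1" by (elim oddE)
   hence "x * x = 4 * (k * k + k) + 1" by (simp add: alg)
   thus ?thesis by presburger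
  qed
  ultimately show False by linarith
 next
  assume "\<bar>t\<bar> = 1"
  hence "t = 1 | t = - 1" by linarith
  hence t: "odd t" by auto
  have "ev (m11 g * (m11 g + 1) - om - 1)"
  proof -
   define c' where "c' = m21 g - 1"
   have c': "m21 g = 1 + c'" unfolding c'_def by simp
   have "ev c'" using e(2) t unfolding c'_def c ev_def by simp
   have "m11 g * (m11 g + 1) - om - 1
    = - (m11 g * c') - m11 g * q + om * (c' + c' + c' * c') + p * (1 + c')" using det unfolding b d c' by (simp add: alg)
   thus ?thesis using e \<open>ev c'\<close> by (simp add: ev_add ev_diff ev_mult ev_mult')
  qed
  thus False by (cases "even (ea (m11 g))"; cases "even (eb (m11 g))"; simp add: ev_def)
 qed
qed

section \<open>Homomorphisms to cyclic groups of prime order\<close>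

definition hom_mod :: "int => nat => (eis mat2 => int) => bool" where
 "hom_mod p n th \<longleftrightarrow> (ALL g:Gn n. ALL h:Gn n. [th (g * h) = th g + th h] (mod p))"

text \<open>A surjection of \<open>Gn n\<close> onto the square of Z/p, written with congruences and
  with preimages \<open>a\<close> and \<open>b\<close> of the standard basis.\<close>

definition two_homs :: "int => nat => bool" where
 "two_homs p n \<longleftrightarrow> (\<exists>th\<^sub>1 th\<^sub>2 a b. hom_mod p n th\<^sub>1 & hom_mod p n th\<^sub>2 & a : Gn n & b : Gn n &
   [th\<^sub>1 a = 1] (mod p) & [th\<^sub>1 b = 0] (mod p) & [th\<^sub>2 a = 0] (mod p) & [th\<^sub>2 b = 1] (mod p))"

lemma gpow_fib: "gpow (int (Suc n)) = Gold (int (fib n)) (int (fib (Suc n)))"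
proof (induction n)
 case 0 thus ?case by simp
next
 case (Suc n)
 have "gpow (int (Suc (Suc n))) = Gold 0 1 * gpow (int (Suc n))" using gpow_Suc[of "int (Suc n)"] by (simp add: add.commute)
 thus ?case unfolding Suc by (simp add: gold_eq_iff)
qed

definition gdvd :: "int => gold => bool" where "gdvd p x \<longleftrightarrow> p dvd ga x & p dvd gb x"

lemma gdvd_add: "gdvd p x ==> gdvd p y ==> gdvd p (x + y)" and gdvd_mult: "gdvd p x ==> gdvd p (x * y)"
 and gdvd_minus: "gdvd p x ==> gdvd p (- x)" by (simp_all add: gdvd_def)

text \<open>For odd \<open>n\<close> the base value is \<open>- \<phi>^(2 n)\<close>, and
  \<open>\<phi>^n = F(n-1) + F(n) \<phi>\<close>. Modulo \<open>F(n)\<close> this is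
  \<open>- F(n-1)^2\<close>, which Cassini's identity turns into 1 because \<open>n - 1\<close> is
  even.\<close>

lemma rho_cong_1:
 assumes "odd n" "p dvd int (fib n)"
 shows "gdvd p (rho (int n * k) - 1)"
proof -
 obtain m where m: "n = Suc m" "even m" using assms(1) by (cases n) auto
 define F G where "F = int (fib n)" and "G = int (fib m)"
 have "rho (int n) = - (gpow (int n) * gpow (int n))" unfolding rho_def gpow_add[symmetric] using assms(1) by (simp add: psgn_def)
 also have "gpow (int n) = Gold G F" unfolding m F_def G_def by (rule gpow_fib)
 finally have r: "rho (int n) - 1 = Gold (- (G * G + 1) - F * F) (- F * (2 * G + F))" by (simp add: gold_eq_iff alg)
 have "int (fib (Suc (Suc m)) * fib m) - int ((fib (Suc m))^2) = - ((-1)^m)" by (rule fib_Cassini_int)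
 hence "(F + G) * G - F * F = - 1" unfolding F_def G_def m using m(2) by (simp add: p2_sq alg)
 hence "G * G + 1 = F * (F - G)" by (simp add: alg)
 hence n: "gdvd p (rho (int n) - 1)" unfolding r gdvd_def using assms(2) F_def by simp
 show ?thesis
 proof (induction k rule: int_induct[where k = 0])
  case base thus ?case by (simp add: gdvd_def)
 next
  case (step1 i)
  have id: "A * X - 1 = (A - 1) * X + (X - 1)" for A X :: gold by (simp add: alg)
  have "rho (int n * (i + 1)) = rho (int n) * rho (int n * i)" unfolding rho_add[symmetric] by (simp add: alg)
  hence "rho (int n * (i + 1)) - 1 = (rho (int n) - 1) * rho (int n * i) + (rho (int n * i) - 1)" by (simp only: id[symmetric])
  moreover have "gdvd p ..." using n step1 by (intro gdvd_add gdvd_mult)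
  ultimately show ?case by (simp only:)
 next
  case (step2 i)
  have id: "X - 1 = - ((A - 1) * X) + (A * X - 1)" for A X :: gold by (simp add: alg)
  have "rho (int n * i) = rho (int n) * rho (int n * (i - 1))" unfolding rho_add[symmetric] by (simp add: alg)
  hence "rho (int n * (i - 1)) - 1 = - ((rho (int n) - 1) * rho (int n * (i - 1))) + (rho (int n * i) - 1)" using id by metis
  moreover have "gdvd p ..." using n step2 by (intro gdvd_add gdvd_mult gdvd_minus)
  ultimately show ?case by (simp only:)
 qed
qed

text \<open>The number n + i sqrt 3, one of the two basis vectors of the peripheral lattice.\<close>

definition bper :: "nat => eis" where "bper n = Eis (int n + 1) 2"

lemma bper: "odd n ==> ev (bper n)" "etr (bper n) = 2 * int n" by (simp_all add: bper_def ev_def etr_def)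

text \<open>On \<open>Gn n\<close> the twist \<open>rho\<close> is trivial modulo \<open>p\<close>,
  so the companion \<open>co\<close> becomes an ordinary homomorphism there; its coordinate
  \<open>ga\<close> joins \<open>chi div n\<close>.\<close>

lemma two_homs_if:
 assumes "odd n" "p dvd int (fib n)"
 shows "two_homs p n" unfolding two_homs_def
proof (intro exI conjI)
 have n: "n ~= 0" using odd_pos[OF assms(1)] by simp
 show "hom_mod p n (%g. chi g div int n)" unfolding hom_mod_def by (simp add: Gn_def chi_mult)
 show "hom_mod p n (%g. ga (co g))" unfolding hom_mod_def
 proof (intro ballI)
  fix g h assume g: "g : Gn n" and h: "h : Gn n"
  then obtain k where k: "chi g = int n * k" unfolding Gn_def by blast
  have "co (g * h) - (co g + co h) = (rho (int n * k) - 1) * co h" using co_mult g h Gn_Gam k by (simp add: alg)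
  hence "gdvd p (co (g * h) - (co g + co h))" using rho_cong_1[OF assms] gdvd_mult by metis
  thus "[ga (co (g * h)) = ga (co g) + ga (co h)] (mod p)" by (simp add: gdvd_def cong_iff_dvd_diff)
 qed
 define a where "a = tmat (bper n)"
 have a1: "a : Gam1" unfolding a_def using bper assms by (simp add: tmat_Gam1)
 have ca: "chi a = int n" "co a = 0" unfolding chi_Gam1[OF a1] co_Gam1[OF a1] unfolding a_def using bper by simp_all
 show "a : Gn n" using a1 Gam1_Gam ca by (simp add: Gn_def)
 show "[chi a div int n = 1] (mod p)" "[ga (co a) = 0] (mod p)" using ca n by simp_all
 \<comment> \<open>\<open>Eis 1 2\<close> is i sqrt 3 and has trace 0, so \<open>chi\<close>
   vanishes, while \<open>co0\<close> equals 1 at \<open>z = 0\<close>.\<close>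
 define b where "b = nmat 0 (Eis 1 2)"
 have b1: "b : Gam1" unfolding b_def by (rule nmat_Gam1) (simp add: ev_def)
 have cb: "chi b = 0" "co b = 1" unfolding chi_Gam1[OF b1] co_Gam1[OF b1] unfolding b_def by (simp_all add: etr_def qsgn_def)
 show "b : Gn n" using b1 Gam1_Gam cb by (simp add: Gn_def)
 show "[chi b div int n = 0] (mod p)" "[ga (co b) = 1] (mod p)" using cb by simp_all
qed

text \<open>Fibonacci recurrences satisfy
  \<open>X(k+j) - (-1)^j X(k-j) = F(j) (X(k+1) + X(k-1))\<close>. For \<open>j = m\<close> the left
  side vanishes by antiperiodicity, so \<open>p\<close> divides \<open>X(k+1) + X(k-1)\<close>; the
  recurrence then leaves \<open>5 X(k)\<close>, 5 being the discriminant of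
  \<open>t^2 - t - 1\<close>.\<close>

lemma fib_recurrence_mod:
 fixes X :: "int => int"
 assumes rec: "!!k. p dvd X (k + 2) - X (k + 1) - X k"
  and per: "!!k. p dvd X (k + 2 * int m) + X k"
  and p: "prime p" "~ p dvd int (fib m)" "p ~= 5" and m: "odd m"
 shows "p dvd X k"
proof -
 have key: "p dvd X (k + int j) - (-1)^j * X (k - int j) - int (fib j) * (X (k + 1) + X (k - 1)) &
   p dvd X (k + int (Suc j)) - (-1)^(Suc j) * X (k - int (Suc j)) - int (fib (Suc j)) * (X (k + 1) + X (k - 1))" for k j
 proof (induction j)
  case 0 show ?case by simp
 next
  case (Suc j)
  let ?D = "%j. X (k + int j) - (-1)^j * X (k - int j) - int (fib j) * (X (k + 1) + X (k - 1))"
  let ?E = "%k. X (k + 2) - X (k + 1) - X k"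
  have "?D (Suc (Suc j)) = ?D (Suc j) + ?D j + ?E (k + int j) + (-1)^j * ?E (k - int j - 2)" by (simp add: alg)
  moreover have "p dvd ?D (Suc j) + ?D j + ?E (k + int j) + (-1)^j * ?E (k - int j - 2)" by (intro dvd_add dvd_mult rec conjunct1[OF Suc] conjunct2[OF Suc])
  ultimately show ?case using Suc by (simp only:)
 qed
 have s: "p dvd X (k + 1) + X (k - 1)" for k
 proof -
  have "p dvd X (k + int m) - (-1)^m * X (k - int m) - int (fib m) * (X (k + 1) + X (k - 1))" using key by blast
  moreover have "p dvd X (k + int m) + X (k - int m)" using per[of "k - int m"] by (simp add: alg)
  ultimately have "p dvd int (fib m) * (X (k + 1) + X (k - 1))" using m by (simp add: dvd_diff_right_iff)
  thus ?thesis using p by (simp add: prime_dvd_mult_iff)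
 qed
 have a: "p dvd X (k + 2) + X k" for k using s[of "k + 1"] by (simp add: add.assoc)
 have b: "p dvd X (k + 1) + 2 * X k" for k by (smt (verit, ccfv_SIG) a dvd_add_left_iff local.rec)
 have "5 * X k = (X (k + 2) + X k) - (X (k + 2) + 2 * X (k + 1)) + 2 * (X (k + 1) + 2 * X k)" by simp
 moreover have "p dvd X (k + 2) + 2 * X (k + 1)" using b[of "k + 1"] by (simp add: add.assoc)
 hence "p dvd (X (k + 2) + X k) - (X (k + 2) + 2 * X (k + 1)) + 2 * (X (k + 1) + 2 * X k)" by (rule dvd_add[OF dvd_diff[OF a] dvd_mult[OF b]])
 ultimately have "p dvd 5 * X k" by (simp only:)
 moreover have "~ p dvd 5" using p primes_dvd_imp_eq[of p 5] by auto
 ultimately show ?thesis using p by (simp add: prime_dvd_mult_iff)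
qed

section \<open>Homomorphisms modulo p vanish on the kernel of the fibration class\<close>

context
 fixes p :: int and m :: nat and th :: "eis mat2 => int"
 assumes p: "prime p" "odd p" "p ~= 5" "~ p dvd int (fib m)" and m: "odd m" and hom: "hom_mod p m th"
begin

abbreviation eqp :: "int => int => bool" (infix "~~" 50) where "a ~~ b \<equiv> p dvd a - b"

lemma th_mult: "g : Gn m ==> h : Gn m ==> th (g * h) ~~ th g + th h" using hom unfolding hom_mod_def cong_iff_dvd_diff by blast

lemma th_1: "th 1 ~~ 0" using th_mult[OF Gn_1 Gn_1] by (simp add: dvd_minus_iff[of p "th 1"])

text \<open>The matrix -1 has square 1 and \<open>p\<close> is odd, so its value vanishes.\<close>

lemma th_minus: "g : Gn m ==> th (- g) ~~ th g"
proof -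
 assume g: "g : Gn m"
 have m1: "- 1 : Gn m" using Gn_1 Gn_minus by blast
 have "p dvd th 1 - (th (- 1) + th (- 1))" using th_mult[OF m1 m1] by simp
 hence "p dvd 2 * th (- 1)" using th_1 by (simp add: dvd_diff_right_iff)
 moreover have "~ p dvd 2" using p primes_dvd_imp_eq[of p 2] by auto
 ultimately have "p dvd th (- 1)" using p by (simp add: prime_dvd_mult_iff)
 moreover have "th (- g) ~~ th (- 1) + th g" using th_mult[OF m1 g] by simp
 moreover have "th (- g) - th g = (th (- g) - (th (- 1) + th g)) + th (- 1)" by simp
 ultimately show ?thesis by (metis dvd_add)
qed

text \<open>\<open>Eis 1 2\<close> is i sqrt 3. Up to sign, an element of \<open>Gam1\<close> in the
  kernel of \<open>chi\<close> is a translation of trace 0 or one of these matrices times such a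
  translation.\<close>

definition kz :: "eis => eis mat2" where "kz z = nmat z (z + Eis 1 2)"

lemma kz_Gam1: "kz z : Gam1" unfolding kz_def by (rule nmat_Gam1) (simp add: ev_def)

lemma kz_Gn: "kz z : Gn m" using kz_Gam1[of z] Gam1_Gam unfolding Gn_def chi_Gam1[OF kz_Gam1, of z] by (simp add: kz_def etr_def chi_Gam1)

lemma tm_Gn: "ev b ==> etr b = 0 ==> tmat b : Gn m" using tmat_Gam chi_tmat by (simp add: Gn_def)

abbreviation "xx z \<equiv> th (kz z)"
text \<open>Translation by 2 i sqrt 3 generates the translations in the kernel of
  \<open>chi\<close>: it is the boundary curve of the fibre.\<close>

definition "ll = th (tmat (Eis 2 4))"

lemma th_inv: "g : Gn m ==> th (inv2 g) ~~ - th g"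
proof -
 assume g: "g : Gn m"
 have "th 1 ~~ th g + th (inv2 g)" using th_mult[OF g Gn_inv[OF g]] inv2_mult(1)[OF Gam_det[OF Gn_Gam[OF g]]] by simp
 hence "p dvd th g + th (inv2 g)" using th_1 by (simp add: dvd_diff_right_iff)
 thus ?thesis by (simp add: add.commute)
qed

lemma th_tmat_neg: "ev b ==> tmat b : Gn m ==> th (tmat (- b)) ~~ - th (tmat b)" using th_inv[of "tmat b"] by (simp add: inv2_def tmat_def)

lemma eqp_trans: "a ~~ b ==> b ~~ c ==> a ~~ c" using dvd_add[of p "a - b" "b - c"] by simp

lemma eqp_sym: "a ~~ b ==> b ~~ a" by (simp add: dvd_diff_commute)

lemma th_ll_neg: "th (tmat (Eis (-2) (-4))) ~~ - ll"
proof -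
 have "- Eis 2 4 = Eis (-2) (-4)" by (simp add: eis_eq_iff)
 thus ?thesis using th_tmat_neg[of "Eis 2 4"] tm_Gn[of "Eis 2 4"] by (simp add: ll_def ev_def etr_def)
qed

lemma xx_flip: "xx z + xx (z + Eis 1 2) + ll ~~ 0"
proof -
 have "kz z * kz (z + Eis 1 2) = - tmat (- Eis 2 4)" unfolding kz_def using nmat_nmat_0[of "z + Eis 1 2" z "z + Eis 1 2 + Eis 1 2"] by (simp add: ev_def mat2_eq_iff tmat_def eis_eq_iff)
 moreover have t: "tmat (- Eis 2 4) : Gn m" by (rule tm_Gn) (simp_all add: ev_def etr_def)
 ultimately have "th (- tmat (- Eis 2 4)) ~~ xx z + xx (z + Eis 1 2)" using th_mult[OF kz_Gn kz_Gn, of z "z + Eis 1 2"] by simp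
 moreover have "th (- tmat (- Eis 2 4)) ~~ th (tmat (- Eis 2 4))" using th_minus[OF t] .
 moreover have "th (tmat (- Eis 2 4)) ~~ - ll" using th_tmat_neg[of "Eis 2 4"] tm_Gn[of "Eis 2 4"] by (simp add: ll_def ev_def etr_def)
 ultimately have "xx z + xx (z + Eis 1 2) ~~ - ll" by (meson eqp_sym eqp_trans)
 thus ?thesis by simp
qed

text \<open>Over a triangle the product of two kernel elements is local again. Its two ends come
  from \<open>nmat_nmat\<close>, and the translation \<open>d\<close> measures the deviation from
  the standard form \<open>kz\<close>.\<close>

lemma xx_triangle:
 assumes u: "u : eunits" and w: "w = z + Eis 1 2 + u"
  and b: "b = cj z * ecnj u" "c = w + Eis 1 2 + cj w * ecnj u" "d = z - b + Eis 1 2 - c" and d: "ev d" "etr d = 0"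
 shows "xx z + xx w ~~ xx (z - b) + th (tmat d)"
proof -
 define g where "g = kz z * kz w"
 have u1: "enorm u = 1" using u enorm_1_iff by blast
 have wu: "w - (z + Eis 1 2) = u" using w by simp
 note P = nmat_nmat[OF wu u1, of z "w + Eis 1 2", folded kz_def g_def]
 have gG: "g : Gn m" unfolding g_def using kz_Gn Gn_mult by blast
 have "enorm (m21 g) = 1" unfolding P(1) using u1 by simp
 then obtain y y' where y: "ev (y' - y - 1)" "g = nmat y y' | g = - nmat y y'" using Gam_N_cases Gn_Gam gG by blast
 have "m11 g * ecnj (m21 g) = y" "m22 g * ecnj (m21 g) = - y'" using y(2) cl_cancel[of y y] cl_cancel[of y y'] by auto
 hence yy: "y = z - b" "y' = c" using P(2,3) b by (simp_all add: alg)
 have "nmat y y' = kz y * tmat d" unfolding kz_def nmat_tmat yy b(3) by (simp add: alg)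
 hence "g = kz y * tmat d | g = - (kz y * tmat d)" using y(2) by simp
 moreover have "kz y * tmat d : Gn m" using Gn_mult kz_Gn tm_Gn[OF d] by blast
 ultimately have "th g ~~ th (kz y * tmat d)" using th_minus by auto
 hence "th g ~~ xx y + th (tmat d)" using th_mult[OF kz_Gn tm_Gn[OF d], of y] eqp_trans by blast
 moreover have "th g ~~ xx z + xx w" unfolding g_def using th_mult kz_Gn by blast
 ultimately show ?thesis unfolding yy using eqp_sym eqp_trans by blast
qed

text \<open>A zigzag between two neighbouring rows of integers, with real parts
  \<open>k / 2\<close>. Shifts by i sqrt 3, under which \<open>xx\<close> changes sign once
  \<open>ll\<close> vanishes, carry it to all other integers.\<close>

definition "Zk k = (if even k then Eis (k div 2) 0 else Eis ((k + 1) div 2) 1)"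

abbreviation "XX k \<equiv> xx (Zk k)"

lemma xx_shift: "z' = z + Eis 1 2 ==> xx z' + xx z + ll ~~ 0" using xx_flip[of z] by (simp add: add.commute)

text \<open>The triangle with \<open>u = 1\<close>. The one with \<open>u = Eis 0 1\<close> in
  \<open>XX_rec_even2\<close> yields the same recurrence without the summand \<open>ll\<close>,
  which is how \<open>ll\<close> is seen to vanish.\<close>

lemma XX_rec_even1: "even k ==> XX (k + 2) ~~ XX (k + 1) + XX k + ll"
proof -
 assume k: "even k"
 hence Z: "Zk k = Eis (k div 2) 0" "Zk (k + 1) = Eis (k div 2 + 1) 1" "Zk (k + 2) = Eis (k div 2 + 1) 0" by (auto simp: Zk_def)
 define z where "z = Zk k"
 have 1: "xx z + xx (z + Eis 1 2 + 1) ~~ xx (z - Eis 0 1) + th (tmat (Eis (-2) (-4)))" by (rule xx_triangle[where u = 1 and c = "z + Eis 3 5"])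
    (simp_all add: z_def Z cj_eq eunits_def eis_eq_iff ev_def etr_def)
 have 2: "xx (z + Eis 1 2 + 1) + XX (k + 2) + ll ~~ 0" by (rule xx_shift) (simp add: z_def Z eis_eq_iff)
 have 3: "XX (k + 1) + xx (z - Eis 0 1) + ll ~~ 0" by (rule xx_shift) (simp add: z_def Z eis_eq_iff)
 let ?A = "xx (z + Eis 1 2 + 1)" and ?B = "xx (z - Eis 0 1)" and ?C = "th (tmat (Eis (-2) (-4)))"
 have "XX (k + 2) - (XX (k + 1) + XX k + ll)
  = (?A + XX (k + 2) + ll - 0) - (XX k + ?A - (?B + ?C)) - (XX (k + 1) + ?B + ll - 0) - (?C - - ll)" by simp
 thus ?thesis using 1 2 3 th_ll_neg unfolding z_def by (metis dvd_diff)
qed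

lemma XX_rec_odd: "odd k ==> XX (k + 2) ~~ XX (k + 1) + XX k"
proof -
 assume "odd k"
 then obtain j where j: "k = 2 * j + 1" by (elim oddE)
 have Z: "Zk k = Eis (j + 1) 1" "Zk (k + 1) = Eis (j + 1) 0" "Zk (k + 2) = Eis (j + 2) 1" unfolding j by (auto simp: Zk_def)
 define z where "z = Zk k"
 have 1: "xx z + xx (z + Eis 1 2 + 1) ~~ xx (z - Eis (-1) (-1)) + th (tmat 0)" by (rule xx_triangle[where u = 1 and c = "z + Eis 2 3"])
    (simp_all add: z_def Z cj_eq eunits_def eis_eq_iff)
 have 2: "xx (z + Eis 1 2 + 1) + XX (k + 2) + ll ~~ 0" by (rule xx_shift) (simp add: z_def Z eis_eq_iff)
 have 3: "xx (z - Eis (-1) (-1)) + XX (k + 1) + ll ~~ 0" by (rule xx_shift) (simp add: z_def Z eis_eq_iff)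
 have "tmat 0 = 1" by (simp add: mat2_eq_iff)
 hence 4: "th (tmat 0) ~~ 0" using th_1 by simp
 let ?A = "xx (z + Eis 1 2 + 1)" and ?B = "xx (z - Eis (-1) (-1))" and ?C = "th (tmat 0)"
 have "XX (k + 2) - (XX (k + 1) + XX k)
  = (?A + XX (k + 2) + ll - 0) - (XX k + ?A - (?B + ?C)) - (?B + XX (k + 1) + ll - 0) - (?C - 0)" by simp
 thus ?thesis using 1 2 3 4 unfolding z_def by (metis dvd_diff)
qed

lemma XX_rec_even2: "even k ==> XX (k + 2) ~~ XX (k + 1) + XX k"
proof -
 assume "even k"
 then obtain j where j: "k = 2 * j" by blast
 have Z: "Zk k = Eis j 0" "Zk (k + 1) = Eis (j + 1) 1" "Zk (k + 2) = Eis (j + 1) 0" unfolding j by (auto simp: Zk_def)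
 define z where "z = Zk (k + 2)"
 have 1: "xx z + xx (z + Eis 1 2 + Eis 0 1) ~~ xx (z - 1) + th (tmat (Eis (-2) (-4)))" by (rule xx_triangle[where u = "Eis 0 1" and c = "z + Eis 2 6"])
    (simp_all add: z_def Z cj_eq eunits_def eis_eq_iff ev_def etr_def)
 have 2: "xx (z + Eis 1 2 + Eis 0 1) + XX (k + 1) + ll ~~ 0" by (rule xx_shift) (simp add: z_def Z eis_eq_iff)
 have 3: "z - 1 = Zk k" by (simp add: z_def Z eis_eq_iff)
 let ?A = "xx (z + Eis 1 2 + Eis 0 1)" and ?C = "th (tmat (Eis (-2) (-4)))"
 have "XX (k + 2) - (XX (k + 1) + XX k)
  = (XX (k + 2) + ?A - (XX k + ?C)) - (?A + XX (k + 1) + ll - 0) + (?C - - ll)" by simp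
 thus ?thesis using 1 2 th_ll_neg unfolding 3 unfolding z_def by (metis dvd_diff dvd_add)
qed

lemma ll_0: "ll ~~ 0"
proof -
 have "ll - 0 = (XX (0 + 2) - (XX (0 + 1) + XX 0)) - (XX (0 + 2) - (XX (0 + 1) + XX 0 + ll))" by simp
 thus ?thesis using XX_rec_even1[of 0] XX_rec_even2[of 0] by (metis dvd_diff even_zero)
qed

lemma xx_shift': "z' = z + Eis 1 2 ==> p dvd xx z' + xx z" using xx_shift[of z' z] ll_0 by (simp add: dvd_add_left_iff)

text \<open>Conjugation by a translation of the cover is invisible to a homomorphism into an abelian
  group.\<close>

lemma xx_period:
 assumes b: "ev b" "tmat b : Gn m"
 shows "xx (z + b) ~~ xx z"
proof -
 have e: "kz (z + b) = tmat b * kz z * tmat (- b)" unfolding kz_def tmat_nmat[OF b(1)] nmat_tmat by (simp add: alg)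
 have t: "tmat (- b) = inv2 (tmat b)" by (simp add: mat2_eq_iff)
 have "th (kz (z + b)) ~~ th (tmat b * kz z) + th (tmat (- b))" unfolding e using th_mult[of "tmat b * kz z" "tmat (- b)"] b kz_Gn Gn_mult Gn_inv t by auto
 moreover have "th (tmat b * kz z) ~~ th (tmat b) + xx z" using th_mult b kz_Gn by blast
 moreover have "th (tmat (- b)) ~~ - th (tmat b)" using th_tmat_neg b by blast
 moreover have "th (kz (z + b)) - xx z = (th (kz (z + b)) - (th (tmat b * kz z) + th (tmat (- b))))
   + (th (tmat b * kz z) - (th (tmat b) + xx z)) + (th (tmat (- b)) - - th (tmat b))" by simp
 ultimately show ?thesis by (metis dvd_add)
qed

lemma tm_bper: "tmat (bper m) : Gn m" using bper m tmat_Gam chi_tmat by (simp add: Gn_def)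

lemma XX_0: "p dvd XX k"
proof (rule fib_recurrence_mod[where m = m and X = "%k. XX k"])
 fix k
 show "p dvd XX (k + 2) - XX (k + 1) - XX k" using XX_rec_odd[of k] XX_rec_even2[of k] by (cases "even k") (simp_all add: alg)
 \<comment> \<open>Going on by \<open>2 m\<close> steps is a shift by \<open>m\<close>, that is, by
   the period \<open>bper m\<close> less i sqrt 3. The latter changes the sign, whence the
   antiperiodicity.\<close>
 have "Zk (k + 2 * int m) = Zk k + of_int (int m)" by (auto simp: Zk_def eis_eq_iff)
 hence s: "Zk k + bper m = Zk (k + 2 * int m) + Eis 1 2" unfolding bper_def by (simp add: eis_eq_iff)
 have 1: "p dvd xx (Zk k + bper m) + XX (k + 2 * int m)" using xx_shift'[OF s] .
 have 2: "xx (Zk k + bper m) ~~ XX k" using xx_period bper m tm_bper by blast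
 have "XX (k + 2 * int m) + XX k
  = (xx (Zk k + bper m) + XX (k + 2 * int m)) - (xx (Zk k + bper m) - XX k)" by simp
 thus "p dvd XX (k + 2 * int m) + XX k" using dvd_diff[OF 1 2] by simp
qed (use p m in auto)

lemma xx_0: "p dvd xx z"
proof -
 have shift: "p dvd xx (z + of_int j * Eis 1 2)" if "p dvd xx z" for z j
 proof (induction j rule: int_induct[where k = 0])
  case base thus ?case using that by simp
 next
  case (step1 i)
  have "z + of_int (i + 1) * Eis 1 2 = (z + of_int i * Eis 1 2) + Eis 1 2" by (simp add: eis_eq_iff alg)
  from xx_shift'[OF this] step1 show ?case by (simp add: dvd_add_left_iff)
 next
  case (step2 i)
  have "z + of_int i * Eis 1 2 = (z + of_int (i - 1) * Eis 1 2) + Eis 1 2" by (simp add: eis_eq_iff alg)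
  from xx_shift'[OF this] step2 show ?case by (simp add: dvd_add_right_iff)
 qed
 define j where "j = eb z div 2"
 show ?thesis
 proof (cases "even (eb z)")
  case True
  hence "z = Zk (2 * (ea z - j)) + of_int j * Eis 1 2" by (simp add: Zk_def eis_eq_iff j_def)
  thus ?thesis using shift[OF XX_0] by metis
 next
  case False
  hence "eb z = 2 * j + 1" unfolding j_def by simp
  moreover have "(2 * (ea z - j) - 1 + 1) div 2 = ea z - j" by simp
  ultimately have "z = Zk (2 * (ea z - j) - 1) + of_int j * Eis 1 2" by (simp add: Zk_def eis_eq_iff)
  thus ?thesis using shift[OF XX_0] by metis
 qed
qed

lemma th_tmat_mult:
 assumes "ev b" "tmat b : Gn m"
 shows "tmat (of_int j * b) : Gn m & th (tmat (of_int j * b)) ~~ j * th (tmat b)"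
proof (induction j rule: int_induct[where k = 0])
 case base
 have "tmat 0 = 1" by (simp add: mat2_eq_iff)
 thus ?case using th_1 Gn_1 by simp
next
 case (step1 i)
 have e: "tmat (of_int (i + 1) * b) = tmat (of_int i * b) * tmat b" by (simp add: tmat_tmat alg)
 have "th (tmat (of_int i * b) * tmat b) ~~ th (tmat (of_int i * b)) + th (tmat b)" using th_mult step1 assms by blast
 hence "p dvd (th (tmat (of_int i * b) * tmat b) - (th (tmat (of_int i * b)) + th (tmat b)))
  + (th (tmat (of_int i * b)) - i * th (tmat b))" using step1 by (intro dvd_add) auto
 thus ?case unfolding e using step1 assms Gn_mult by (simp add: alg)
next
 case (step2 i)
 have e: "tmat (of_int (i - 1) * b) = tmat (of_int i * b) * tmat (- b)" by (simp add: tmat_tmat alg)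
 have t: "tmat (- b) = inv2 (tmat b)" by (simp add: mat2_eq_iff)
 have nb: "tmat (- b) : Gn m" unfolding t using assms Gn_inv by blast
 have "th (tmat (of_int i * b) * tmat (- b)) ~~ th (tmat (of_int i * b)) + th (tmat (- b))" using th_mult step2 nb by blast
 hence "p dvd (th (tmat (of_int i * b) * tmat (- b)) - (th (tmat (of_int i * b)) + th (tmat (- b))))
  + (th (tmat (of_int i * b)) - i * th (tmat b)) + (th (tmat (- b)) - - th (tmat b))" using step2 th_tmat_neg assms by (intro dvd_add) auto
 thus ?case unfolding e using step2 nb Gn_mult by (simp add: alg)
qed

lemma th_kernel_Gam1:
 assumes "g : Gam1" "chi g = 0"
 shows "p dvd th g"
proof -
 have T: "tmat b : Gn m & p dvd th (tmat b)" if b: "ev b" "etr b = 0" for b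
 proof -
  obtain r s where "b = Eis (2 * r) (2 * s)" using ev_decompose b by blast
  hence "b = of_int r * Eis 2 4" using b(2) by (simp add: etr_def eis_eq_iff)
  moreover have "th (tmat (of_int r * Eis 2 4)) ~~ r * ll" using th_tmat_mult[of "Eis 2 4" r] tm_Gn[of "Eis 2 4"] by (simp add: ll_def ev_def etr_def)
  ultimately have "p dvd (th (tmat b) - r * ll) + r * (ll - 0)" using ll_0 by (intro dvd_add dvd_mult) simp_all
  thus ?thesis using tm_Gn[OF b] by simp
 qed
 have fin: "p dvd th g" if "h : Gn m" "p dvd th h" "g = h | g = - h" for h by (smt (verit, ccfv_SIG) dvd_diff_right_iff th_minus that(1,2,3))
 show ?thesis using assms(1)
 proof (cases rule: Gam1_cases)
  case (1 b)
  hence "chi (tmat b) = 0" using assms(2) tmat_Gam by auto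
  hence "etr b = 0" using chi_tmat[OF 1(1)] even_etr[OF 1(1)] by auto
  thus ?thesis using fin T 1 by blast
 next
  case (2 z z')
  hence "chi (nmat z z') = 0" using assms(2) nmat_Gam by auto
  hence "(etr z - etr z') div 2 = 0" using chi_Gam1[OF nmat_Gam1[OF 2(1)]] by simp
  moreover obtain r s where "(etr z - etr z') div 2 = s - 2 * r - 1" "etr z' = etr z + 2 * (1 + 2 * r - s)" using half_trace_diff[OF 2(1)] by blast
  ultimately have tz: "etr z = etr z'" by simp
  define b where "b = z + Eis 1 2 - z'"
  have "ev b"
  proof -
   have "b = - (z' - z - 1) + Eis 0 2" by (simp add: b_def eis_eq_iff)
   moreover have "ev (Eis 0 2)" by (simp add: ev_def)
   ultimately show ?thesis using 2(1) by (metis ev_add ev_minus)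
  qed
  moreover have "etr b = 0" using tz unfolding b_def by (simp add: etr_def)
  ultimately have t: "tmat b : Gn m" "p dvd th (tmat b)" using T by auto
  have "nmat z z' = kz z * tmat b" unfolding kz_def nmat_tmat b_def by simp
  moreover have "p dvd th (kz z * tmat b)" using dvd_add[OF th_mult[OF kz_Gn t(1), of z] dvd_add[OF xx_0[of z] t(2)]] by simp
  ultimately show ?thesis using fin[of "nmat z z'"] 2 Gn_mult[OF kz_Gn t(1)] by metis
 qed
qed

text \<open>Partial products of local elements leave the kernel, so each is corrected by a
  translation with the opposite value of \<open>chi\<close>. Claiming the result for all
  \<open>tmat b\<close> at once lets this correction pass through the induction.\<close>

lemma th_kernel:
 assumes "g : Gam" "chi g = 0"
 shows "p dvd th g"
proof -
 have "ALL b. ev b --> chi (g * tmat b) = 0 --> p dvd th (g * tmat b)" using assms(1)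
 proof (induction rule: Gam_induct)
  case (gen k)
  have "k * tmat b : Gam1" if "ev b" for b
  proof -
   have "m21 (k * tmat b) = m21 k" by simp
   thus ?thesis using gen that Gam_mult[OF Gam1_Gam[OF gen] tmat_Gam[OF that]] unfolding Gam1_def by simp
  qed
  thus ?case using th_kernel_Gam1 by blast
 next
  case (mult h k)
  note hG = \<open>h : Gam\<close> and k1 = \<open>k : Gam1\<close>
  show ?case
  proof (intro allI impI)
   fix b assume b: "ev b" "chi (h * k * tmat b) = 0"
   define j where "j = - chi h"
   define b' where "b' = Eis (2 * j) (2 * j)"
   have b': "ev b'" "ev (- b')" "etr b' = 2 * j" by (simp_all add: b'_def ev_def etr_def)
   define h' k' where "h' = h * tmat b'" and "k' = tmat (- b') * (k * tmat b)"
   have kb: "k * tmat b : Gam" using mult b Gam_mult Gam1_Gam tmat_Gam by blast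
   have k'G: "k' : Gam" unfolding k'_def using kb Gam_mult tmat_Gam b'(2) by blast
   have h'G: "h' : Gam" unfolding h'_def using mult Gam_mult tmat_Gam b'(1) by blast
   have "m21 k' = m21 k" unfolding k'_def by simp
   hence k'1: "k' : Gam1" using k'G k1 unfolding Gam1_def by simp
   have "tmat b' * (tmat (- b') * x) = x" for x unfolding mult.assoc[symmetric] tmat_tmat by (simp add: mat2_eq_iff)
   hence e: "h * k * tmat b = h' * k'" unfolding h'_def k'_def by (simp only: mult.assoc)
   have ch: "chi h' = 0" unfolding h'_def using chi_mult[OF hG tmat_Gam[OF b'(1)]] chi_tmat[OF b'(1)] b'(3) j_def by simp
   have ck: "chi k' = 0" using b(2) chi_mult[OF h'G k'G] ch unfolding e by simp
   have "p dvd th h'" using mult.IH ch b'(1) unfolding h'_def by blast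
   moreover have "p dvd th k'" using th_kernel_Gam1 k'1 ck by blast
   moreover have "th (h' * k') ~~ th h' + th k'" by (rule th_mult) (simp_all add: Gn_def h'G k'G ch ck)
   ultimately have "p dvd (th (h' * k') - (th h' + th k')) + (th h' + th k')" by (intro dvd_add)
   thus "p dvd th (h * k * tmat b)" unfolding e by simp
  qed
 qed
 moreover have "g * tmat 0 = g" by (simp add: mat2_eq_iff)
 ultimately show ?thesis using assms(2) by (metis ev_0)
qed

text \<open>Dividing \<open>g\<close> by the multiple of the peripheral translation
  \<open>bper m\<close> with the same value of \<open>chi\<close> leaves an element of the
  kernel.\<close>

lemma th_chi:
 assumes "g : Gn m"
 shows "th g ~~ (chi g div int m) * th (tmat (bper m))"
proof -
 define j where "j = chi g div int m"
 have j: "chi g = int m * j" using assms by (simp add: Gn_def j_def)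
 have T: "tmat (of_int j * bper m) : Gn m" "th (tmat (of_int j * bper m)) ~~ j * th (tmat (bper m))" using th_tmat_mult[OF bper(1)[OF m] tm_bper] by auto
 define t where "t = tmat (of_int j * bper m)"
 have tG: "t : Gn m" unfolding t_def using T by blast
 have "ev (of_int j * bper m)" using bper m ev_mult' by blast
 moreover have "etr (of_int j * bper m) = 2 * (int m * j)" by (simp add: bper_def etr_def alg)
 ultimately have ct: "chi t = int m * j" unfolding t_def using chi_tmat by simp
 define k where "k = g * inv2 t"
 have kG: "k : Gn m" unfolding k_def using assms tG Gn_mult Gn_inv by blast
 have "chi k = 0" unfolding k_def using chi_mult chi_inv ct j assms tG Gn_Gam Gam_inv by simp
 hence "p dvd th k" using th_kernel Gn_Gam kG by blast
 moreover have "g = k * t" unfolding k_def using inv2_cancel(2)[OF Gam_det[OF Gn_Gam[OF tG]]] by simp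
 hence "th g ~~ th k + th t" using th_mult kG tG by simp
 moreover have "th g - j * th (tmat (bper m)) = (th g - (th k + th t)) + th k + (th t - j * th (tmat (bper m)))" by simp
 ultimately have "p dvd th g - j * th (tmat (bper m))" using T(2) unfolding t_def by (simp only: dvd_add)
 thus ?thesis unfolding j_def .
qed

end

text \<open>By \<open>th_chi\<close> both homomorphisms are multiples of \<open>chi div m\<close>
  modulo \<open>p\<close>, and multiples of a single homomorphism cannot take the values of an
  identity matrix on two elements.\<close>

lemma not_two_homs:
 assumes "prime p" "odd p" "p ~= 5" "~ p dvd int (fib m)" "odd m"
 shows "~ two_homs p m"
proof
 assume "two_homs p m"
 then obtain th1 th2 a b where h: "hom_mod p m th1" "hom_mod p m th2" "a : Gn m" "b : Gn m"
  and v: "[th1 a = 1] (mod p)" "[th1 b = 0] (mod p)" "[th2 a = 0] (mod p)" "[th2 b = 1] (mod p)" unfolding two_homs_def by blast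
 define s t x y where "s = th1 (tmat (bper m))" and "t = th2 (tmat (bper m))"
  and "x = chi a div int m" and "y = chi b div int m"
 have c: "[th1 a = x * s] (mod p)" "[th1 b = y * s] (mod p)" "[th2 b = y * t] (mod p)" unfolding cong_iff_dvd_diff s_def t_def x_def y_def using th_chi assms h by blast+
 have "[x * s = 1] (mod p)" "[y * s = 0] (mod p)" "[y * t = 1] (mod p)" using v c by (meson cong_sym cong_trans)+
 hence "p dvd y * s" "~ p dvd s" "~ p dvd y" using assms(1) by (auto simp: cong_0_iff dest!: cong_dvd_iff[of "_ * _"] intro: dvd_mult dvd_mult2)
 thus False using assms(1) by (simp add: prime_dvd_mult_iff)
qed

text \<open>Take a prime factor of \<open>fib n\<close>. Because
  \<open>gcd (fib i) (fib j) = fib (gcd i j)\<close>, it divides no \<open>fib j\<close> with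
  \<open>j\<close> prime to \<open>n\<close>: for \<open>j = 3\<close> and \<open>j = 5\<close> this
  rules out 2 and 5, and for \<open>j = m\<close> it makes the distinction.\<close>

lemma two_homs_distinguish:
 assumes "prime n" "prime m" "7 <= n" "7 <= m" "n ~= m"
 shows "EX p. odd p & two_homs p n & ~ two_homs p m"
proof -
 have odd: "odd n" "odd m" using assms prime_odd_nat by auto
 have "fib 7 <= fib n" using assms by (intro fib_mono) simp
 hence "1 < fib n" by (simp add: eval_nat_numeral)
 then obtain q where q: "prime q" "q dvd fib n" using prime_factor_nat by (metis less_irrefl)
 have g: "gcd (fib n) (fib j) = 1" if "coprime n j" for j using fib_gcd[of n j] that by simp
 have c: "coprime n m" using assms primes_coprime by blast
 have "n ~= 3" "n ~= 5" using assms by auto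
 moreover have "prime (3::nat)" "prime (5::nat)" by simp_all
 ultimately have c35: "coprime n 3" "coprime n 5" using assms(1) primes_coprime by blast+
 have n: "~ q dvd fib j" if "coprime n j" for j using g[OF that] q by (metis gcd_greatest_iff not_prime_unit is_unit_gcd)
 have "fib 3 = 2" "fib 5 = 5" by (simp_all add: eval_nat_numeral)
 hence q2: "q ~= 2" "q ~= 5" "~ q dvd fib m" using n[OF c35(1)] n[OF c35(2)] n[OF c] by auto
 have "odd q" using prime_odd_nat[of q] prime_ge_2_nat[OF q(1)] q q2 by linarith
 show ?thesis
 proof (intro exI conjI)
  show "odd (int q)" using \<open>odd q\<close> by simp
  show "two_homs (int q) n" using two_homs_if odd q by simp
  show "~ two_homs (int q) m" using not_two_homs[of "int q" m] odd q q2 \<open>odd q\<close> by simp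
 qed
qed

section \<open>The orientation-reversing symmetry of the arithmetic group\<close>

text \<open>Conjugation by the anti-holomorphic map \<open>z \<mapsto> cnj z + \<omega>\<close>.\<close>

definition smat :: "eis mat2 => eis mat2" where
 "smat g = Mat (ecnj (m11 g) + om * ecnj (m21 g))
   (ecnj (m12 g) + om * ecnj (m22 g) - om * (ecnj (m11 g) + om * ecnj (m21 g)))
   (ecnj (m21 g)) (ecnj (m22 g) - om * ecnj (m21 g))"

lemma smat_sel [simp]: "m11 (smat g) = ecnj (m11 g) + om * ecnj (m21 g)"
 "m12 (smat g) = ecnj (m12 g) + om * ecnj (m22 g) - om * (ecnj (m11 g) + om * ecnj (m21 g))"
 "m21 (smat g) = ecnj (m21 g)" "m22 (smat g) = ecnj (m22 g) - om * ecnj (m21 g)" by (simp_all add: smat_def)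

lemma smat_mult: "smat (g * h) = smat g * smat h" unfolding mat2_eq_iff by (simp add: alg)

lemma smat_Gam:
 assumes "g : Gam" shows "smat g : Gam"
proof -
 have "det2 (smat g) = ecnj (det2 g)" by (simp add: det2_def alg)
 hence d: "det2 (smat g) = 1" using Gam_det[OF assms] by simp
 define p q where "p = m12 g - om * m21 g" and "q = m22 g - m11 g - m21 g"
 have e: "ev p" "ev q" using assms unfolding p_def q_def Gam_def by auto
 have b: "m12 g = om * m21 g + p" and dd: "m22 g = m11 g + m21 g + q" unfolding p_def q_def by auto
 show ?thesis using d e unfolding Gam_def mem_Collect_eq smat_sel b dd ev_def by (simp; cases "even (ea (m11 g))"; cases "even (eb (m11 g))"; cases "even (ea (m21 g))"; simp)
qed

text \<open>Conjugation preserves real parts, and adding \<omega> shifts \<open>z\<close> and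
  \<open>z'\<close> alike, so \<open>z - z'\<close> keeps its real part.\<close>

lemma chi_smat_Gam1:
 assumes k: "k : Gam1" shows "chi (smat k) = chi k"
proof -
 have s1: "smat k : Gam1" using k smat_Gam unfolding Gam1_def by simp
 have "chi0 (smat k) = chi0 k"
 proof (cases "m21 k = 0")
  case True
  then obtain b where "k = tmat b | k = - tmat b" using Gam_P_cases k Gam1_Gam by metis
  thus ?thesis by (auto simp: chi0_def)
 next
  case False
  have "ecnj (m21 k) ~= 0" using False by (metis ecnj_0 ecnj_ecnj)
  moreover have "(ecnj (m11 k) + om * ecnj (m21 k) + (ecnj (m22 k) - om * ecnj (m21 k))) * m21 k
    = ecnj ((m11 k + m22 k) * ecnj (m21 k))" by (simp add: alg)
  ultimately show ?thesis using False etr_linear(5)[of "(m11 k + m22 k) * ecnj (m21 k)"] by (simp add: chi0_def)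
 qed
 thus ?thesis using chi_Gam1 s1 k by simp
qed

lemma chi_smat: "g : Gam ==> chi (smat g) = chi g"
proof (induction rule: Gam_induct)
 case (mult h k)
 thus ?case using chi_smat_Gam1[of k] smat_mult chi_mult smat_Gam Gam1_Gam by simp
qed (rule chi_smat_Gam1)

lemma smat_Gn: "g : Gn n ==> smat g : Gn n" by (simp add: Gn_def smat_Gam chi_smat)

text \<open>The elements of \<open>Gn n\<close> that map \<open>\<infinity>\<close> to an integral point are plentiful: any integer
  is the pole of one of them. Hence \<open>Gn n\<close> has a single cusp.\<close>

lemma Gn_pole:
 assumes "odd n"
 obtains g where "g : Gn n" "enorm (m21 g) = 1" "m22 g = - (m21 g * z')"
proof -
 define z where "z = z' - 1"
 have e: "ev (z' - z - 1)" by (simp add: z_def)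
 define k where "k = chi (nmat z z')"
 define b where "b = Eis (- 2 * k) (- 2 * k)"
 have b: "ev b" "etr b = - 2 * k" by (simp_all add: b_def ev_def etr_def)
 have "chi (tmat b * nmat z z') = 0" using chi_mult[OF tmat_Gam[OF b(1)] nmat_Gam[OF e]] chi_tmat[OF b(1)] b(2) k_def by simp
 hence "tmat b * nmat z z' : Gn n" using Gam_mult tmat_Gam[OF b(1)] nmat_Gam[OF e] by (simp add: Gn_def)
 moreover have "tmat b * nmat z z' = nmat (z + b) z'" using tmat_nmat b by blast
 ultimately show thesis using that[of "nmat (z + b) z'"] by simp
qed

section \<open>Local homology and orientation characters\<close>

definition is_gen :: "('a, 'b) monoid_scheme => 'a => bool" where
 "is_gen G g \<longleftrightarrow> g : carrier G & generate G {g} = carrier G"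

lemma is_gen_integer: "is_gen integer_group k \<longleftrightarrow> k = 1 | k = -1"
proof -
 interpret group integer_group by simp
 have g: "generate integer_group {k} = {k [^]\<^bsub>integer_group\<^esub> (j::int) |j. j : UNIV}" by (rule generate_pow) simp
 show ?thesis
 proof
  assume "is_gen integer_group k"
  hence "1 : {k [^]\<^bsub>integer_group\<^esub> (j::int) |j. j : UNIV}" using g by (simp add: is_gen_def)
  then obtain j where "j * k = 1" by auto
  hence "k dvd 1" by (metis dvd_triv_right)
  thus "k = 1 | k = -1" using zdvd1_eq[of k] by linarith
 next
  assume k: "k = 1 | k = -1"
  have "x : {k [^]\<^bsub>integer_group\<^esub> (j::int) |j. j : UNIV}" for x using k by (intro CollectI exI[of _ "k * x"]) auto
  thus "is_gen integer_group k" using g by (auto simp: is_gen_def)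
 qed
qed

lemma iso_generate:
 assumes "group G" "group H" "h : iso G H" "A <= carrier G"
 shows "h ` generate G A = generate H (h ` A)"
proof -
 interpret group_hom G H h using assms by (simp add: group_hom_def group_hom_axioms_def iso_def)
 show ?thesis using generate_img[OF assms(4)] by simp
qed

lemma iso_is_gen:
 assumes "group G" "group H" "h : iso G H" "is_gen G g"
 shows "is_gen H (h g)" using iso_generate[OF assms(1-3), of "{g}"] assms(3,4) by (auto simp: is_gen_def iso_def bij_betw_def)

lemma iso_inv:
 assumes "group G" "group H" "h : hom G H" "g : carrier G"
 shows "h (inv\<^bsub>G\<^esub> g) = inv\<^bsub>H\<^esub> (h g)" by (metis assms(1,2,3,4) group.int_pow_1 group.int_pow_neg hom_in_carrier hom_int_pow)

lemma is_gen_unique: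
 assumes G: "group G" "G \<cong> integer_group" and g: "is_gen G g" "is_gen G h"
 shows "h = g | h = inv\<^bsub>G\<^esub> g"
proof -
 obtain f where f: "f : iso G integer_group" using G by (auto simp: is_iso_def)
 have inj: "inj_on f (carrier G)" using f by (simp add: iso_def bij_betw_def)
 have k: "f g = 1 | f g = -1" "f h = 1 | f h = -1" using iso_is_gen[OF G(1) group_integer_group f] g is_gen_integer by blast+
 have gc: "g : carrier G" "h : carrier G" using g by (simp_all add: is_gen_def)
 have fi: "f (inv\<^bsub>G\<^esub> g) = - f g" using iso_inv[OF G(1) group_integer_group _ gc(1), of f] f by (simp add: iso_def)
 have "f h = f g | f h = f (inv\<^bsub>G\<^esub> g)" unfolding fi using k by auto
 thus ?thesis using inj gc group.inv_closed[OF G(1)] by (auto simp: inj_on_def)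
qed

lemma is_gen_exists:
 assumes "group G" "G \<cong> integer_group"
 shows "EX g. is_gen G g"
proof -
 obtain f where f: "f : iso integer_group G" using group.iso_sym[OF assms] by (auto simp: is_iso_def)
 have "is_gen G (f 1)" by (rule iso_is_gen[OF group_integer_group assms(1) f]) (simp add: is_gen_integer)
 thus ?thesis by blast
qed

lemma is_gen_inv:
 assumes "group G" "G \<cong> integer_group" "is_gen G g"
 shows "is_gen G (inv\<^bsub>G\<^esub> g)"
proof -
 obtain f where f: "f : iso integer_group G" using group.iso_sym[OF assms(1,2)] by (auto simp: is_iso_def)
 have "is_gen G (f 1)" "is_gen G (f (-1))" by (rule iso_is_gen[OF group_integer_group assms(1) f]; simp add: is_gen_integer)+
 moreover have fi: "f (-1) = inv\<^bsub>G\<^esub> (f 1)" using iso_inv[OF group_integer_group assms(1), of f 1] f by (simp add: iso_def)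
 moreover have "inv\<^bsub>G\<^esub> (f (-1)) = f 1" unfolding fi using calculation(1) assms(1) by (simp add: is_gen_def group.inv_inv)
 ultimately show ?thesis using is_gen_unique[OF assms(1,2) _ assms(3), of "f 1"] by auto
qed

section \<open>Local homology at the origin and the effect of a reflection\<close>

lemma continuous_map_vec:
 assumes "!!i. continuous_map X euclideanreal (%x. f x$i)"
 shows "continuous_map X euclidean (f :: 'a => real ^ 'n)" using assms by (auto simp: continuous_map_atin limitin_canonical_iff intro: vec_tendstoI)

text \<open>The first two coordinates are exchanged because the reflection of \<open>nsphere\<close>
  whose degree is known negates coordinate 0, whereas \<open>refl2\<close> negates the second
  coordinate, the imaginary part in the half-space model.\<close>

definition sph_in :: "(nat => real) => R3" where
 "sph_in x = vector [x 1, x 0, x 2]"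

definition sph_out :: "R3 => nat => real" where
 "sph_out v i = (if i = 0 then v$2 else if i = 1 then v$1 else if i = 2 then v$3 else 0)/norm v"

definition refl2 :: "R3 => R3" where "refl2 v = vector [v$1, - v$2, v$3]"

lemma norm_vec3: "norm (v :: R3) = sqrt ((v$1)^2 + (v$2)^2 + (v$3)^2)" by (simp add: norm_vec_def L2_set_def sum_3)

lemma nsphere2: "topspace (nsphere 2) = {x. (x 0)^2 + (x 1)^2 + (x 2)^2 = 1 & (\<forall>i\<ge>3. x i = 0)}"
 by (auto simp: nsphere topspace_Euclidean_space eval_nat_numeral atMost_Suc Suc_le_eq)

lemma continuous_sph_in: "continuous_map (nsphere 2) euclidean sph_in"
proof (rule continuous_map_vec)
 fix i :: 3
 have p: "continuous_map (nsphere 2) euclideanreal (%x. x k)" for k unfolding nsphere by (intro continuous_map_from_subtopology continuous_map_product_projection) simp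
 show "continuous_map (nsphere 2) euclideanreal (%x. sph_in x$i)" using exhaust_3[of i] p unfolding sph_in_def by auto
qed

lemma sph_in_nz: "x : topspace (nsphere 2) ==> norm (sph_in x) = 1" by (simp add: nsphere2 norm_vec3 sph_in_def add.commute add.left_commute)

abbreviation "punct3 \<equiv> subtopology euclidean (UNIV - {0 :: R3})"

lemma sph_in_iso:
 "hom_induced 2 (nsphere 2) {} punct3 {} sph_in
  : iso (reduced_homology_group 2 (nsphere 2)) (reduced_homology_group 2 punct3)"
proof (rule homotopy_equivalence_reduced_homology_group_isomorphism)
 show ci: "continuous_map (nsphere 2) punct3 sph_in" unfolding cm_sub using continuous_sph_in sph_in_nz by force
 show co: "continuous_map punct3 (nsphere 2) sph_out" unfolding nsphere cm_sub
 proof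
  show "continuous_map punct3 (powertop_real UNIV) sph_out" unfolding continuous_map_componentwise_UNIV
  proof
   fix k
   show "continuous_map punct3 euclideanreal (%x. sph_out x k)" unfolding sph_out_def by (cases "k = 0"; cases "k = 1"; cases "k = 2"; auto intro!: continuous_intros)
  qed
  show "sph_out : topspace punct3 \<rightarrow> {x. (\<Sum>i\<le>2. (x i)^2) = 1 & (\<forall>i>2. x i = 0)}"
  proof
   fix v :: "R3" assume "v : topspace punct3"
   hence v: "v ~= 0" by simp
   have "(\<Sum>i\<le>2. (sph_out v i)^2) = ((v$1)^2 + (v$2)^2 + (v$3)^2)/(norm v)^2" by (simp add: sph_out_def eval_nat_numeral add_divide_distrib power_divide p2_sq)
   also have "(v$1)^2 + (v$2)^2 + (v$3)^2 = (norm v)^2" by (simp add: norm_vec3)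
   finally show "sph_out v : {x. (\<Sum>i\<le>2. (x i)^2) = 1 & (\<forall>i>2. x i = 0)}" using v by (simp add: sph_out_def)
  qed
 qed
 have "sph_out (sph_in x) = x" if "x : topspace (nsphere 2)" for x
 proof
  fix i
  consider "i = (0::nat)" | "i = 1" | "i = 2" | "i \<ge> 3" by linarith
  thus "sph_out (sph_in x) i = x i" using that sph_in_nz[OF that] by cases (auto simp: sph_out_def sph_in_def nsphere2)
 qed
 thus "homotopic_with (%h. True) (nsphere 2) (nsphere 2) (sph_out o sph_in) id" using ci co by (intro homotopic_with_equal) (auto intro: continuous_map_compose)
 have oi: "sph_in (sph_out v) = v /\<^sub>R norm v" for v by (simp add: vec_eq_iff forall_3 sph_in_def sph_out_def divide_inverse mult.commute)
 show "homotopic_with (%k. True) punct3 punct3 (sph_in o sph_out) id"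
 proof -
  have "homotopic_with_canon (%k. True) (UNIV - {0}) (UNIV - {0}) (sph_in o sph_out) id"
  proof (rule homotopic_with_linear)
   show "continuous_on (UNIV - {0}) (sph_in o sph_out)" unfolding o_def oi by (intro continuous_intros) auto
   fix v :: "R3" assume "v : UNIV - {0}"
   hence v: "v ~= 0" by simp
   show "closed_segment ((sph_in o sph_out) v) (id v) <= UNIV - {0}"
   proof
    fix w assume "w : closed_segment ((sph_in o sph_out) v) (id v)"
    then obtain u where u: "0 <= u" "u <= 1" "w = (1 - u) *\<^sub>R (v /\<^sub>R norm v) + u *\<^sub>R v" by (auto simp: closed_segment_def oi)
    hence w: "w = ((1 - u)/norm v + u) *\<^sub>R v" by (simp add: scaleR_left_distrib divide_inverse)
    have "0 < (1 - u)/norm v + u" using u v by (cases "u = 0") (auto intro: add_nonneg_pos)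
    thus "w : UNIV - {0}" unfolding w using v by simp
   qed
  qed simp
  thus ?thesis by simp
 qed
qed

text \<open>Space is contractible, so the boundary map identifies local homology with the second
  homology of the punctured space, hence of the sphere. By naturality the reflection acts as it does
  on the sphere, with degree -1.\<close>

lemma local_homology_0:
 shows "lhom (euclidean :: R3 topology) 0 \<cong> integer_group"
  and "!!x. x : carrier (lhom (euclidean :: R3 topology) 0) ==>
   hi3 euclidean (UNIV - {0}) euclidean (UNIV - {0}) refl2 x = inv\<^bsub>lhom euclidean 0\<^esub> x"
proof -
 let ?E = "euclidean :: R3 topology" and ?P = "UNIV - {0 :: R3}"
 let ?L = "lhom ?E 0" and ?H = "reduced_homology_group 2 punct3" and ?S = "reduced_homology_group 2 (nsphere 2)"
 have cE: "contractible_space ?E" using convex_imp_contractible[OF convex_UNIV, where 'a = "R3"] contractible_space_top_of_set[of "UNIV :: R3 set"] by simp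
 have "axis 1 1 : ?P" by simp
 hence "?P ~= {}" by blast
 hence b: "hom_boundary 3 ?E ?P : iso ?L ?H" using iso_relative_homology_of_contractible[OF cE, of ?P 3] by simp
 have "?L \<cong> ?H" using b is_isoI by blast
 also have "?H \<cong> ?S" using sph_in_iso is_isoI group.iso_sym[OF group_reduced_homology_group] by blast
 also have "?S \<cong> integer_group" using reduced_homology_group_nsphere(1)[of 2] by simp
 finally show "?L \<cong> integer_group" .
 fix x assume x: "x : carrier ?L"
 let ?r = "%x i. if i = 0 then - x i else x i :: real"
 define y where "y = hom_boundary 3 ?E ?P x"
 have yH: "y : carrier ?H" using b x unfolding y_def by (auto simp: iso_def bij_betw_def)
 then obtain s where s: "s : carrier ?S" "y = hom_induced 2 (nsphere 2) {} punct3 {} sph_in s" using sph_in_iso by (auto simp: iso_def bij_betw_def)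
 have cr: "continuous_map (nsphere 2) (nsphere 2) ?r" by (rule continuous_map_nsphere_reflection)
 have ci: "continuous_map (nsphere 2) punct3 sph_in" unfolding cm_sub using continuous_sph_in sph_in_nz by force
 have crefl: "continuous_map ?E ?E refl2"
 proof (rule continuous_map_vec)
  fix i :: 3
  show "continuous_map ?E euclideanreal (%x. refl2 x$i)" using exhaust_3[of i] unfolding refl2_def by (elim disjE; simp; intro continuous_intros)
 qed
 have rnz: "refl2 v ~= 0" if "v ~= 0" for v using that by (auto simp: refl2_def vec_eq_iff forall_3)
 have crp: "continuous_map punct3 punct3 refl2" unfolding cm_sub
 proof
  show "refl2 : topspace punct3 \<rightarrow> UNIV - {0}" by (rule Pi_I) (use rnz in simp)
 qed (rule continuous_map_from_subtopology[OF crefl])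
 have sy: "hom_induced 2 punct3 {} punct3 {} refl2 y = inv\<^bsub>?H\<^esub> y"
 proof -
  have "hom_induced 2 punct3 {} punct3 {} refl2 y = hom_induced 2 (nsphere 2) {} punct3 {} (refl2 o sph_in) s" unfolding s(2) by (rule hom_induced_compose') (use ci crp in auto)
  also have "refl2 o sph_in = sph_in o ?r" by (auto simp: fun_eq_iff refl2_def sph_in_def)
  also have "hom_induced 2 (nsphere 2) {} punct3 {} (sph_in o ?r) s
   = hom_induced 2 (nsphere 2) {} punct3 {} sph_in (hom_induced 2 (nsphere 2) {} (nsphere 2) {} ?r s)" by (rule hom_induced_compose'[symmetric]) (use ci cr in auto)
  also have "hom_induced 2 (nsphere 2) {} (nsphere 2) {} ?r s = inv\<^bsub>?S\<^esub> s" using Brouwer_degree2[of s 2 ?r] s(1) unfolding Brouwer_degree2_reflection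
   by (simp add: group.int_pow_neg group.int_pow_1 group_reduced_homology_group)
  also have "hom_induced 2 (nsphere 2) {} punct3 {} sph_in (inv\<^bsub>?S\<^esub> s) = inv\<^bsub>?H\<^esub> y" unfolding s(2) by (rule iso_inv) (use hom_induced_reduced_hom s(1) in auto)
  finally show ?thesis .
 qed
 have nat: "hom_boundary 3 ?E ?P (hi3 ?E ?P ?E ?P refl2 x) = hom_induced 2 punct3 {} punct3 {} refl2 y"
  using naturality_hom_induced[OF crefl, of ?P ?P 3] rnz unfolding y_def by (auto simp: fun_eq_iff)
 have "hom_boundary 3 ?E ?P (inv\<^bsub>?L\<^esub> x) = inv\<^bsub>?H\<^esub> y" unfolding y_def by (rule iso_inv) (use b x in "auto simp: iso_def")
 hence eq: "hom_boundary 3 ?E ?P (hi3 ?E ?P ?E ?P refl2 x) = hom_boundary 3 ?E ?P (inv\<^bsub>?L\<^esub> x)" using nat sy by simp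
 have inj: "inj_on (hom_boundary 3 ?E ?P) (carrier ?L)" using b by (simp add: iso_def bij_betw_def)
 have "hi3 ?E ?P ?E ?P refl2 x : carrier ?L" "inv\<^bsub>?L\<^esub> x : carrier ?L" using x by (simp_all add: hom_induced_carrier group.inv_closed)
 thus "hi3 ?E ?P ?E ?P refl2 x = inv\<^bsub>?L\<^esub> x" by (rule inj_onD[OF inj eq])
qed

section \<open>Induced maps of local homology and excision\<close>

abbreviation E3 :: "R3 topology" where "E3 \<equiv> euclidean"
abbreviation "hU A B \<equiv> hi3 E3 (UNIV - A) E3 (UNIV - B) id"
abbreviation "rU A \<equiv> rh3 E3 (UNIV - A)"

definition hl :: "'a topology => 'a => 'b topology => ('a => 'b) => 'a chain set => 'b chain set" where
 "hl X x Y f = hi3 X (topspace X - {x}) Y (topspace Y - {f x}) f"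

abbreviation "lT S \<equiv> lhom (tos S)"
abbreviation "hT S \<equiv> hl (tos S)"

lemma hl_carrier: "hl X x Y f a : carrier (lhom Y (f x))" by (simp add: hl_def hom_induced_carrier)

lemma hl_hom: "hl X x Y f : hom (lhom X x) (lhom Y (f x))" by (simp add: hl_def hom_induced_hom)

lemma hl_inv:
 "a : carrier (lhom X x) ==>
  hl X x Y f (inv\<^bsub>lhom X x\<^esub> a) = inv\<^bsub>lhom Y (f x)\<^esub> (hl X x Y f a)"
 by (rule iso_inv[OF grp_rel grp_rel hl_hom])

lemma hl_comp:
 assumes "continuous_map X Y f" "continuous_map Y Z g"
  and "!!z. z : topspace X ==> z ~= x ==> f z ~= f x"
  and "!!z. z : topspace Y ==> z ~= f x ==> g z ~= g (f x)"
 shows "hl Y (f x) Z g (hl X x Y f a) = hl X x Z (g o f) a" unfolding hl_def comp_def by (subst hom_induced_compose')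
  (use assms in "auto simp: comp_def Pi_iff dest: continuous_map_image_subset_topspace")

lemma hl_cong: "(!!z. z : topspace X ==> f z = g z) ==> x : topspace X ==> hl X x Y f = hl X x Y g"
 unfolding hl_def using hom_induced_eq[of X f g] by simp

lemma hl_id: "a : carrier (lhom X x) ==> hl X x X id a = a" by (simp add: hl_def hom_induced_id)

lemma excision_open_set:
 assumes "openin X U" "X closure_of B <= U" "B <= topspace X"
 shows "hi3 (subtopology X U) (U - B) X (topspace X - B) id
   : iso (rh3 (subtopology X U) (U - B)) (rh3 X (topspace X - B))"
proof -
 have U: "U <= topspace X" using assms(1) by (rule openin_subset)
 have c: "X closure_of (topspace X - U) = topspace X - U" using assms(1) by (simp add: closure_of_eq openin_closedin_eq)
 have i: "X interior_of (topspace X - B) = topspace X - X closure_of B" by (simp add: interior_of_complement)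
 have "hi3 (subtopology X (topspace X - (topspace X - U))) ((topspace X - B) - (topspace X - U))
   (subtopology X (topspace X)) (topspace X - B) id
  : iso (rh3 (subtopology X (topspace X - (topspace X - U))) ((topspace X - B) - (topspace X - U)))
     (rh3 (subtopology X (topspace X)) (topspace X - B))" by (rule homology_excision_axiom) (use assms c i U in auto)
 moreover have "topspace X - (topspace X - U) = U" "(topspace X - B) - (topspace X - U) = U - B" using U by auto
 ultimately show ?thesis by simp
qed

lemma excision_open:
 assumes "t1_space X" "openin X U" "x : U"
 shows "hl (subtopology X U) x X id : iso (lhom (subtopology X U) x) (lhom X x)"
proof -
 have x: "x : topspace X" using assms openin_subset by blast
 hence "X closure_of {x} = {x}" using assms(1) by (simp add: t1_space_closedin_singleton closure_of_eq)
 moreover have "topspace (subtopology X U) = U" using openin_subset[OF assms(2)] by auto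
 ultimately show ?thesis using excision_open_set[OF assms(2), of "{x}"] assms(3) x by (simp add: hl_def)
qed

lemma hl_homeomorphic:
 assumes "homeomorphic_map X Y f" "x : topspace X"
 shows "hl X x Y f : iso (lhom X x) (lhom Y (f x))" unfolding hl_def
proof (rule homeomorphic_map_relative_homology_iso[OF assms(1)])
 show "f ` (topspace X - {x}) = topspace Y - {f x}" using homeomorphic_imp_surjective_map[OF assms(1)] homeomorphic_imp_injective_map[OF assms(1)] assms(2) by (auto simp: inj_on_def)
qed auto

lemma hl_open_embedding:
 assumes Y: "t1_space Y" and f: "continuous_map X Y f" "open_map X Y f" "inj_on f (topspace X)" and x: "x : topspace X"
 shows "hl X x Y f : iso (lhom X x) (lhom Y (f x))"
proof -
 define U where "U = f ` topspace X"
 have U: "openin Y U" using f(2) unfolding U_def open_map_def by blast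
 have h: "homeomorphic_map X (subtopology Y U) f" using U_def assms(2,3,4) embedding_map_def injective_open_imp_embedding_map by blast
 have "hl X x Y f a = hl (subtopology Y U) (f x) Y id (hl X x (subtopology Y U) f a)" for a using hl_comp[of X "subtopology Y U" f Y id x a] homeomorphic_imp_continuous_map[OF h]
   inj_onD[OF f(3)] x by auto
 hence "hl X x Y f = hl (subtopology Y U) (f x) Y id o hl X x (subtopology Y U) f" by auto
 moreover have "f x : U" using x U_def by blast
 ultimately show ?thesis using iso_set_trans[OF hl_homeomorphic[OF h x]] excision_open[OF Y U] by auto
qed

subsection \<open>The orientation of Euclidean space\<close>

definition e_or :: "R3 => R3 chain set" where
 "e_or x = hl E3 0 E3 (%v. v + x) (SOME g. is_gen (lhom E3 0) g)"

lemma translation_homeo: "homeomorphic_map E3 E3 (%v. v + w)"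
proof -
 have "homeomorphic_maps E3 E3 (%v. v + w) (%v. v - w)" unfolding homeomorphic_maps_def by (auto intro!: continuous_intros)
 thus ?thesis using homeomorphic_maps_imp_map by blast
qed

lemma local_homology_E3: "lhom E3 x \<cong> integer_group"
proof -
 have "hl E3 0 E3 (%v. v + x) : iso (lhom E3 0) (lhom E3 (0 + x))" by (rule hl_homeomorphic[OF translation_homeo]) simp
 hence "lhom E3 0 \<cong> lhom E3 x" using is_isoI by simp
 hence "lhom E3 x \<cong> lhom E3 0" by (simp add: group.iso_sym)
 thus ?thesis by (rule iso_trans[OF _ local_homology_0(1)])
qed

lemma e_or_gen: "is_gen (lhom E3 x) (e_or x)"
proof -
 have "hl E3 0 E3 (%v. v + x) : iso (lhom E3 0) (lhom E3 (0 + x))" by (rule hl_homeomorphic[OF translation_homeo]) simp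
 moreover have "is_gen (lhom E3 0) (SOME g. is_gen (lhom E3 0) g)" by (rule someI_ex) (rule is_gen_exists[OF grp_rel local_homology_E3])
 ultimately show ?thesis unfolding e_or_def using iso_is_gen[of "lhom E3 0" "lhom E3 (0 + x)"] by simp
qed

lemma e_or_carrier: "e_or x : carrier (lhom E3 x)" using e_or_gen by (simp add: is_gen_def)

lemma e_or_translation: "hl E3 x E3 (%v. v + w) (e_or x) = e_or (x + w)"
proof -
 have "hl E3 (0 + x) E3 (%v. v + w) (hl E3 0 E3 (%v. v + x) a) = hl E3 0 E3 ((%v. v + w) o (%v. v + x)) a" for a
  by (rule hl_comp[of _ _ "%v. v + x"]) (auto intro!: continuous_intros)
 moreover have "(%v. v + w) o (%v. v + x) = (%v. v + (x + w))" by (auto simp: add.assoc)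
 ultimately show ?thesis by (simp add: e_or_def)
qed

definition eor :: "bool => R3 => R3 chain set" where
 "eor b x = (if b then e_or x else inv\<^bsub>lhom E3 x\<^esub> (e_or x))"

lemma eor_gen: "is_gen (lhom E3 x) (eor b x)" using e_or_gen is_gen_inv[OF _ local_homology_E3] by (simp add: eor_def)

lemma eor_carrier: "eor b x : carrier (lhom E3 x)" using eor_gen by (simp add: is_gen_def)

lemma is_gen_neq_inv:
 assumes "group G" "G \<cong> integer_group" "is_gen G g"
 shows "g ~= inv\<^bsub>G\<^esub> g"
proof
 assume eq: "g = inv\<^bsub>G\<^esub> g"
 obtain f where f: "f : iso G integer_group" using assms by (auto simp: is_iso_def)
 have "f (inv\<^bsub>G\<^esub> g) = - f g" using iso_inv[OF assms(1) group_integer_group, of f g] f assms(3) by (simp add: iso_def is_gen_def)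
 hence "f g = 0" using eq by simp
 moreover have "is_gen integer_group (f g)" using iso_is_gen[OF assms(1) group_integer_group f assms(3)] .
 ultimately show False by (simp add: is_gen_integer)
qed

text \<open>A chain has finitely many simplices, and their compact images have positive distance
  from \<open>x\<close>.\<close>

lemma singular_chain_avoids_ball:
 assumes "singular_chain p (subtopology E3 (UNIV - {x})) c"
 shows "EX e>0. singular_chain p (subtopology E3 (UNIV - ball x e)) c"
proof -
 have "EX e>0. singular_simplex p (subtopology E3 (UNIV - ball x e)) s"
  if "s : Poly_Mapping.keys c" for s
 proof -
  have s: "singular_simplex p (subtopology E3 (UNIV - {x})) s" using assms that by (auto simp: singular_chain_def)
  let ?D = "subtopology (powertop_real UNIV) (standard_simplex p)"
  have cs: "continuous_map ?D (subtopology E3 (UNIV - {x})) s" using s by (simp add: singular_simplex_def)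
  have t: "topspace ?D = standard_simplex p" by simp
  have "compactin ?D (standard_simplex p)" unfolding compactin_subtopology using compactin_standard_simplex by simp
  hence "compactin (subtopology E3 (UNIV - {x})) (s ` topspace ?D)" unfolding t by (rule image_compactin[OF _ cs])
  hence k: "compact (s ` topspace ?D)" "x \<notin> s ` topspace ?D" unfolding compactin_subtopology by auto
  hence "open (- (s ` topspace ?D))" "x : - (s ` topspace ?D)" using compact_imp_closed by blast+
  then obtain e where e: "e > 0" "ball x e <= - (s ` topspace ?D)" by (meson openE)
  have "continuous_map ?D (subtopology E3 (UNIV - ball x e)) s" using cs e(2) unfolding cm_sub by blast
  thus ?thesis using s e(1) by (auto simp: singular_simplex_def)
 qed
 then obtain e where e: "!!s. s : Poly_Mapping.keys c ==> e s > 0 & singular_simplex p (subtopology E3 (UNIV - ball x (e s))) s" by metis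
 define d where "d = Min (insert 1 (e ` Poly_Mapping.keys c))"
 have d: "d > 0" unfolding d_def using e by (subst Min_gr_iff) auto
 have "singular_simplex p (subtopology E3 (UNIV - ball x d)) s" if "s : Poly_Mapping.keys c" for s
 proof -
  have "d <= e s" unfolding d_def using that by (intro Min_le) auto
  hence "UNIV - ball x (e s) <= UNIV - ball x d" by auto
  thus ?thesis using e[OF that] by (auto simp: singular_simplex_def cm_sub)
 qed
 thus ?thesis using d by (auto simp: singular_chain_def)
qed

text \<open>A cycle representing \<open>e_or x\<close> has its boundary outside a ball around
  \<open>x\<close>, so it defines a class relative to the complement of the ball. For
  \<open>y\<close> in the ball, sliding along \<open>y - x\<close> is a homotopy of pairs from the
  identity to a translation, by convexity of the ball; hence the class restricts to
  \<open>e_or y\<close>.\<close>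

lemma e_or_local: "EX r>0. EX a:carrier (rU (ball x r)).
  ALL y:ball x r. hU (ball x r) {y} a = e_or y"
proof -
 obtain c where c: "singular_relcycle 3 E3 (UNIV - {x}) c" "e_or x = homologous_rel_set 3 E3 (UNIV - {x}) c"
  using e_or_carrier[of x] carrier_relative_homology_group[of 3 E3 "UNIV - {x}"] by auto
 have "singular_chain 2 (subtopology E3 (UNIV - {x})) (chain_boundary 3 c)" using c(1) by (simp add: singular_relcycle_def mod_subset_def)
 then obtain r where r: "r > 0" "singular_chain 2 (subtopology E3 (UNIV - ball x r)) (chain_boundary 3 c)" using singular_chain_avoids_ball by blast
 have rc: "singular_relcycle 3 E3 (UNIV - ball x r) c" using c(1) r(2) by (simp add: singular_relcycle_def mod_subset_def)
 define a where "a = homologous_rel_set 3 E3 (UNIV - ball x r) c"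
 have a: "a : carrier (rU (ball x r))" using carrier_relative_homology_group[of 3 E3 "UNIV - ball x r"] rc unfolding a_def by auto
 have ax: "hU (ball x r) {x} a = e_or x"
 proof -
  have im: "id : (UNIV - ball x r) \<rightarrow> (UNIV - {x})" using r(1) by auto
  show ?thesis using hom_induced_chain_map[OF _ im, of E3 E3 3 c] rc chain_map_id_gen[of 3 E3 c id] unfolding a_def c(2) by (simp add: singular_relcycle_def)
 qed
 have "hU (ball x r) {y} a = e_or y" if y: "y : ball x r" for y
 proof -
  let ?t = "%v. v + (y - x)"
  have "homotopic_with (%h. h : (UNIV - ball x r) \<rightarrow> (UNIV - {y})) E3 E3 id ?t" unfolding homotopic_with_def
  proof (intro exI conjI ballI allI)
   show "continuous_map (prod_topology (tos {0..1}) E3) E3 (%p. snd p + fst p *\<^sub>R (y - x))"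
   proof -
    have eq: "prod_topology (tos {0..1}) E3 = tos ({0..1} \<times> UNIV)" by (metis prod_topology_subtopology_eu subtopology_UNIV)
    have "continuous_on ({0..1} \<times> UNIV) (%p :: real \<times> R3. snd p + fst p *\<^sub>R (y - x))" by (intro continuous_intros)
    thus ?thesis unfolding eq by (simp only: continuous_map_subtopology_eu subtopology_UNIV continuous_map_iff_continuous)
   qed
   fix t :: real assume t: "t : {0..1}"
   show "(%v. snd (t, v) + fst (t, v) *\<^sub>R (y - x)) : (UNIV - ball x r) \<rightarrow> (UNIV - {y})"
   proof
    fix v assume v: "v : UNIV - ball x r"
    have "v + t *\<^sub>R (y - x) ~= y"
    proof
     assume "v + t *\<^sub>R (y - x) = y"
     hence "v = t *\<^sub>R x + (1 - t) *\<^sub>R y" by (simp add: alg)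
     moreover have "t *\<^sub>R x + (1 - t) *\<^sub>R y : ball x r" by (rule convexD[OF convex_ball]) (use t y r(1) in auto)
     ultimately show False using v by simp
    qed
    thus "snd (t, v) + fst (t, v) *\<^sub>R (y - x) : UNIV - {y}" by simp
   qed
  qed auto
  hence "hU (ball x r) {y} a
   = hi3 E3 (UNIV - ball x r) E3 (UNIV - {y}) ?t a" by (simp add: homology_homotopy_axiom)
  also have "... = hi3 E3 (UNIV - {x}) E3 (UNIV - {y}) ?t (hU (ball x r) {x} a)"
   by (subst hom_induced_compose') (use r(1) in "auto simp: o_def intro!: continuous_intros")
  also have "... = e_or y" unfolding ax using e_or_translation[of x "y - x"] by (simp add: hl_def)
  finally show ?thesis .
 qed
 thus ?thesis using a r(1) by blast
qed

lemma eor_local: "EX r>0. EX a:carrier (rU (ball x r)).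
  ALL y:ball x r. hU (ball x r) {y} a = eor b y"
proof -
 obtain r a where r: "r > 0" and a: "a : carrier (rU (ball x r))"
  "!!y. y : ball x r ==> hU (ball x r) {y} a = e_or y" using e_or_local[of x] by blast
 let ?G = "rU (ball x r)"
 define a' where "a' = (if b then a else inv\<^bsub>?G\<^esub> a)"
 have "a' : carrier ?G" using a(1) by (simp add: a'_def group.inv_closed)
 moreover have "hU (ball x r) {y} a' = eor b y" if "y : ball x r" for y using a(2)[OF that] iso_inv[OF grp_rel grp_rel
   hom_induced_hom[of 3 E3 "UNIV - ball x r" E3 "UNIV - {y}" id] a(1)] by (simp add: a'_def eor_def)
 ultimately show ?thesis using r by blast
qed

text \<open>Homology has compact support: a class that dies at a point dies near that point.\<close>

lemma class_dies_nearby: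
 assumes V: "open V" "x : V" and c: "c : carrier (rU V)"
  and d: "hU V {x} c = \<one>\<^bsub>rU {x}\<^esub>"
 shows "EX e>0. ball x e <= V &
  hU V (ball x e) c = \<one>\<^bsub>rU (ball x e)\<^esub>"
proof -
 obtain k where k: "singular_relcycle 3 E3 (UNIV - V) k" "c = homologous_rel_set 3 E3 (UNIV - V) k" using c carrier_relative_homology_group[of 3 E3 "UNIV - V"] by auto
 have ind: "hU V B c = homologous_rel_set 3 E3 (UNIV - B) k" if "B <= V" for B
 proof -
  have "id : UNIV - V \<rightarrow> UNIV - B" using that by auto
  thus ?thesis using hom_induced_chain_map[of E3 E3 id "UNIV - V" "UNIV - B" 3 k] k chain_map_id_gen[of 3 E3 k id] by (simp add: singular_relcycle_def)
 qed
 have one: "\<one>\<^bsub>rh3 E3 T\<^esub> = singular_relboundary_set 3 E3 T" for T using one_relative_homology_group[of 3 E3 T] by simp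
 have "homologous_rel_set 3 E3 (UNIV - {x}) k = singular_relboundary_set 3 E3 (UNIV - {x})" using d ind[of "{x}"] V one by simp
 hence "singular_relboundary 3 E3 (UNIV - {x}) k" by (simp add: homologous_rel_set_eq_relboundary)
 then obtain l where l: "singular_chain 4 E3 l" "singular_chain 3 (subtopology E3 (UNIV - {x})) (chain_boundary 4 l - k)"
  unfolding singular_relboundary_def mod_subset_def by (auto simp: numeral_eq_Suc)
 obtain e where e: "e > 0" "singular_chain 3 (subtopology E3 (UNIV - ball x e)) (chain_boundary 4 l - k)" using singular_chain_avoids_ball[OF l(2)] by blast
 obtain e' where e': "e' > 0" "ball x e' <= V" using V openE by blast
 define f where "f = min e e'"
 have f: "f > 0" "ball x f <= V" using e e' by (auto simp: f_def)
 have "UNIV - ball x e <= UNIV - ball x f" unfolding f_def by auto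
 hence "singular_chain 3 (subtopology E3 (UNIV - ball x f)) (chain_boundary 4 l - k)" using e(2) by (meson singular_chain_mono)
 hence "singular_relboundary 3 E3 (UNIV - ball x f) k" using l(1) unfolding singular_relboundary_def mod_subset_def by (auto simp: numeral_eq_Suc)
 hence "homologous_rel_set 3 E3 (UNIV - ball x f) k = singular_relboundary_set 3 E3 (UNIV - ball x f)" by (simp add: homologous_rel_set_eq_relboundary)
 thus ?thesis using f ind[OF f(2)] one by auto
qed

subsection \<open>Local orientation sign of a map\<close>

definition oc :: "R3 set => R3 => R3 chain set" where
 "oc S x = inv_into (carrier (lT S x)) (hT S x E3 id) (e_or x)"

lemma t1_E3 [simp]: "t1_space E3" by (simp add: Hausdorff_imp_t1_space)

lemma hl_incl_iso:
 assumes "open S" "x : S"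
 shows "hT S x E3 id : iso (lT S x) (lhom E3 x)" by (rule excision_open) (use assms in auto)

lemma oc:
 assumes "open S" "x : S"
 shows "oc S x : carrier (lT S x)" "hT S x E3 id (oc S x) = e_or x"
proof -
 have "bij_betw (hT S x E3 id) (carrier (lT S x)) (carrier (lhom E3 x))" using hl_incl_iso[OF assms] by (simp add: iso_def)
 hence "e_or x : hT S x E3 id ` carrier (lT S x)" using e_or_carrier by (metis bij_betw_imp_surj_on)
 thus "oc S x : carrier (lT S x)" "hT S x E3 id (oc S x) = e_or x" unfolding oc_def by (rule inv_into_into, rule f_inv_into_f)
qed

definition ocb :: "bool => R3 set => R3 => R3 chain set" where
 "ocb b S x = (if b then oc S x else inv\<^bsub>lT S x\<^esub> (oc S x))"

lemma ocb:
 assumes "open S" "x : S"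
 shows "ocb b S x : carrier (lT S x)" "hT S x E3 id (ocb b S x) = eor b x" using oc[OF assms] hl_inv[OF oc(1)[OF assms], of E3 id] by (auto simp: ocb_def eor_def group.inv_closed)

lemma ocb_unique:
 assumes "open S" "x : S" "a : carrier (lT S x)" "hT S x E3 id a = eor b x"
 shows "a = ocb b S x"
proof -
 have "inj_on (hT S x E3 id) (carrier (lT S x))" using hl_incl_iso[OF assms(1,2)] by (simp add: iso_def bij_betw_def)
 thus ?thesis using ocb[OF assms(1,2), of b] assms(3,4) by (metis inj_onD)
qed

lemma ocb_gen:
 assumes "open S" "x : S"
 shows "is_gen (lT S x) (ocb b S x)"
proof -
 have i: "inv_into (carrier (lT S x)) (hT S x E3 id)
   : iso (lhom E3 x) (lT S x)" using group.iso_set_sym[OF grp_rel hl_incl_iso[OF assms]] .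
 have inj: "inj_on (hT S x E3 id) (carrier (lT S x))" using hl_incl_iso[OF assms] by (simp add: iso_def bij_betw_def)
 have "inv_into (carrier (lT S x)) (hT S x E3 id) (eor b x) = ocb b S x" using inv_into_f_f[OF inj ocb(1)[OF assms]] ocb(2)[OF assms] by metis
 thus ?thesis using iso_is_gen[OF _ _ i eor_gen] by (metis grp_rel)
qed

lemma hl_mono:
 assumes "open T" "S <= T" "open S" "x : S"
 shows "hT S x (tos T) id (ocb b S x) = ocb b T x"
proof (rule ocb_unique)
 show "x : T" using assms by blast
 show "hT S x (tos T) id (ocb b S x) : carrier (lT T x)" using hl_carrier[of "tos S" x "tos T" id] by simp
 have "hT T (id x) E3 id (hT S x (tos T) id (ocb b S x)) = hT S x E3 (id o id) (ocb b S x)" by (rule hl_comp) (use assms in auto)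
 thus "hT T x E3 id (hT S x (tos T) id (ocb b S x)) = eor b x" using ocb(2)[OF assms(3,4)] by simp
qed (use assms in auto)

text \<open>Signs are booleans with True for 1, and equality of booleans is their product.\<close>

lemma ocb_hl_inv:
 assumes "open S" "x : S"
 shows "hT S x X f (ocb (b = c) S x) =
  (if c then hT S x X f (ocb b S x) else inv\<^bsub>lhom X (f x)\<^esub> (hT S x X f (ocb b S x)))"
proof -
 have "ocb (~ b) S x = inv\<^bsub>lT S x\<^esub> (ocb b S x)" using oc(1)[OF assms] by (simp add: ocb_def group.inv_inv)
 thus ?thesis using hl_inv[OF ocb(1)[OF assms], of X f b] by (cases b; cases c) simp_all
qed

text \<open>\<open>lsg b f x\<close>: the map \<open>f\<close> is an embedding near \<open>x\<close> and has local degree 1 (\<open>b\<close> true)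
  or \<open>-1\<close> (\<open>b\<close> false) there.\<close>

definition lsg :: "bool => (R3 => R3) => R3 => bool" where
 "lsg b f x \<longleftrightarrow> (EX S. open S & x : S & continuous_on S f & inj_on f S &
   hT S x E3 f (oc S x) = eor b (f x))"

abbreviation "loc_lift b x S p G \<equiv> EX gm T. open T & x : T & lsg b gm x & gm x : S & (ALL z:T. p (gm z) = G z)"

lemma hl_restrict:
 assumes "open T" "S <= T" "open S" "x : S" "continuous_map (tos T) X f" "inj_on f T"
 shows "hT S x X f (ocb b S x) = hT T x X f (ocb b T x)"
proof -
 have "hT T (id x) X f (hT S x (tos T) id (ocb b S x)) = hT S x X (f o id) (ocb b S x)" by (rule hl_comp) (use assms in "auto simp: inj_on_def")
 thus ?thesis using hl_mono[OF assms(1-4)] by simp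
qed

lemma lsg_iff:
 assumes "open S" "x : S" "continuous_on S f" "inj_on f S"
 shows "lsg b f x \<longleftrightarrow> hT S x E3 f (oc S x) = eor b (f x)"
proof
 assume "lsg b f x"
 then obtain T where T: "open T" "x : T" "continuous_on T f" "inj_on f T" "hT T x E3 f (oc T x) = eor b (f x)" unfolding lsg_def by blast
 have "hT (S Int T) x E3 f (ocb True (S Int T) x) = hT S x E3 f (ocb True S x)" by (rule hl_restrict) (use assms T in auto)
 moreover have "hT (S Int T) x E3 f (ocb True (S Int T) x) = hT T x E3 f (ocb True T x)" by (rule hl_restrict) (use assms T in auto)
 ultimately show "hT S x E3 f (oc S x) = eor b (f x)" using T(5) by (simp add: ocb_def)
qed (use assms in "auto simp: lsg_def")

lemma lsg_obtain:
 assumes "lsg b f x" "open T" "x : T"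
 obtains S where "open S" "x : S" "S <= T" "continuous_on S f" "inj_on f S"
proof -
 obtain S where "open S" "x : S" "continuous_on S f" "inj_on f S" using assms(1) unfolding lsg_def by blast
 thus thesis using that[of "S Int T"] assms by (meson IntI continuous_on_subset inf_le1 inf_le2 inj_on_subset open_Int)
qed

lemma open_map_E3:
 assumes "open S" "continuous_on S f" "inj_on f S"
 shows "open_map (tos S) E3 (f :: R3 => R3)" unfolding open_map_def
proof (intro allI impI)
 fix U assume "openin (tos S) U"
 hence "open U" "U <= S" using assms(1) by (auto simp: openin_open_eq)
 thus "openin E3 (f ` U)" using invariance_of_domain[of U f] assms by (auto intro: continuous_on_subset inj_on_subset)
qed

lemma lsg_cases:
 assumes "open S" "x : S" "continuous_on S f" "inj_on f S"
 shows "lsg True f x | lsg False f x"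
proof -
 have "hT S x E3 f : iso (lT S x) (lhom E3 (f x))" by (rule hl_open_embedding) (use assms open_map_E3[OF assms(1,3,4)] in auto)
 hence "is_gen (lhom E3 (f x)) (hT S x E3 f (oc S x))" using iso_is_gen[OF grp_rel grp_rel _ ocb_gen[OF assms(1,2), of True],
    of "hT S x E3 f" 3 E3 "topspace E3 - {f x}"] by (simp add: ocb_def)
 hence "hT S x E3 f (oc S x) = e_or (f x) | hT S x E3 f (oc S x) = inv\<^bsub>lhom E3 (f x)\<^esub> e_or (f x)"
  using is_gen_unique[OF grp_rel local_homology_E3 e_or_gen] by blast
 thus ?thesis unfolding lsg_iff[OF assms] by (simp add: eor_def)
qed

lemma lsg_not_both: "lsg True f x ==> ~ lsg False f x"
proof
 assume t: "lsg True f x" and f: "lsg False f x"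
 obtain S where S: "open S" "x : S" "continuous_on S f" "inj_on f S" using t unfolding lsg_def by blast
 hence "e_or (f x) = inv\<^bsub>lhom E3 (f x)\<^esub> (e_or (f x))" using t f unfolding lsg_iff[OF S] by (simp add: eor_def)
 thus False using is_gen_neq_inv[OF grp_rel local_homology_E3 e_or_gen] by blast
qed

lemma lsg_push:
 assumes "lsg b f x" "open S" "x : S" "continuous_on S f" "inj_on f S" "open T" "f ` S <= T"
 shows "hT S x (tos T) f (ocb c S x) = ocb (b = c) T (f x)"
proof (rule ocb_unique)
 show "f x : T" using assms by blast
 have cm: "continuous_map (tos S) (tos T) f" using assms by (auto simp: cm_sub)
 have "hT T (f x) E3 id (hT S x (tos T) f (ocb c S x)) = hT S x E3 (id o f) (ocb c S x)" by (rule hl_comp) (use assms cm in "auto simp: inj_on_def")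
 also have "... = eor (b = c) (f x)"
 proof -
  have 1: "hT S x E3 f (ocb True S x) = eor b (f x)" using assms(1) lsg_iff[OF assms(2-5)] by (simp add: ocb_def)
  have "inv\<^bsub>lhom E3 (f x)\<^esub> (eor b (f x)) = eor (~ b) (f x)" using e_or_carrier[of "f x"] by (simp add: eor_def group.inv_inv)
  thus ?thesis using 1 ocb_hl_inv[OF assms(2,3), of E3 f True c] by (cases c) simp_all
 qed
 finally show "hT T (f x) E3 id (hT S x (tos T) f (ocb c S x)) = eor (b = c) (f x)" .
 show "hT S x (tos T) f (ocb c S x) : carrier (lT T (f x))" by (rule hl_carrier)
qed (use assms in auto)

lemma lsg_comp:
 assumes "lsg b f x" "lsg c g (f x)"
 shows "lsg (b = c) (g o f) x"
proof -
 obtain T where T: "open T" "f x : T" "continuous_on T g" "inj_on g T" using assms(2) unfolding lsg_def by blast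
 obtain S0 where S0: "open S0" "x : S0" "continuous_on S0 f" "inj_on f S0" using assms(1) unfolding lsg_def by blast
 define S where "S = S0 Int f -` T"
 have S: "open S" "x : S" "continuous_on S f" "inj_on f S" "f ` S <= T" using S0 T continuous_open_preimage[OF S0(3,1) T(1)] unfolding S_def
  by (auto intro: continuous_on_subset inj_on_subset)
 have 1: "continuous_on S (g o f)" "inj_on (g o f) S" using continuous_on_compose[OF S(3) continuous_on_subset[OF T(3) S(5)]]
   comp_inj_on[OF S(4) inj_on_subset[OF T(4) S(5)]] by auto
 have cm: "continuous_map (tos S) (tos T) f" using S by (auto simp: cm_sub)
 have "hT S x E3 (g o f) (ocb True S x) = hT T (f x) E3 g (hT S x (tos T) f (ocb True S x))" by (rule hl_comp[symmetric]) (use S T cm in "auto simp: inj_on_def")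
 also have "... = hT T (f x) E3 g (ocb b T (f x))" using lsg_push[OF assms(1) S(1-4) T(1) S(5), of True] by simp
 also have "... = eor (b = c) (g (f x))"
 proof -
  have 2: "hT T (f x) E3 g (ocb True T (f x)) = eor c (g (f x))" using assms(2) lsg_iff[OF T] by (simp add: ocb_def)
  have "inv\<^bsub>lhom E3 (g (f x))\<^esub> (eor c (g (f x))) = eor (~ c) (g (f x))" using e_or_carrier[of "g (f x)"] by (simp add: eor_def group.inv_inv)
  thus ?thesis using 2 ocb_hl_inv[OF T(1,2), of E3 g True b] by (cases b) simp_all
 qed
 finally show ?thesis unfolding lsg_iff[OF S(1,2) 1] by (simp add: ocb_def)
qed

lemma lsg_translation: "lsg True (%v. v + w) x" unfolding lsg_def by (rule exI[of _ UNIV]) (use hl_id[OF oc(1)[OF open_UNIV UNIV_I]] oc(2)[OF open_UNIV UNIV_I] e_or_translation in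
  \<open>auto simp: eor_def intro!: continuous_intros\<close>)

lemma lsg_cong:
 assumes "lsg b f x" "open T" "x : T" "!!z. z : T ==> f z = g z"
 shows "lsg b g x"
proof -
 obtain S where S: "open S" "x : S" "S <= T" "continuous_on S f" "inj_on f S" using lsg_obtain[OF assms(1-3)] by blast
 have e: "f z = g z" if "z : S" for z using that S(3) assms(4) by blast
 have g: "continuous_on S g" "inj_on g S" using S e by (metis continuous_on_cong, metis inj_on_cong)
 have "hT S x E3 f = hT S x E3 g" by (rule hl_cong) (use e S(2) in auto)
 thus ?thesis using assms(1) lsg_iff[OF S(1,2,4,5)] lsg_iff[OF S(1,2) g] e[OF S(2)] by simp
qed

lemma lsg_id: "lsg True id x" by (rule lsg_cong[OF lsg_translation[of 0], of UNIV]) auto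

lemma ocb_local:
 assumes "open S" "x : S"
 shows "EX r>0. ball x r <= S & (EX a:carrier (rh3 (tos S) (S - ball x r)).
   ALL y:ball x r. hi3 (tos S) (S - ball x r) (tos S) (S - {y}) id a = ocb b S y)"
proof -
 obtain r0 a0 where r0: "r0 > 0" and a0: "a0 : carrier (rU (ball x r0))"
  "!!y. y : ball x r0 ==> hU (ball x r0) {y} a0 = eor b y" using eor_local[of x b] by blast
 obtain r1 where r1: "r1 > 0" "cball x r1 <= S" using assms open_contains_cball by blast
 define r where "r = min r0 r1"
 have r: "r > 0" "ball x r <= ball x r0" "cball x r <= S" using r0 r1 by (auto simp: r_def subset_iff)
 have bS: "ball x r <= S" using r(3) ball_subset_cball by blast
 let ?B = "ball x r"
 define a1 where "a1 = hU (ball x r0) ?B a0"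
 have iso: "hi3 (tos S) (S - ?B) E3 (UNIV - ?B) id
   : iso (rh3 (tos S) (S - ?B)) (rU ?B)" using excision_open_set[of E3 S ?B] assms(1) r by simp
 hence surj: "hi3 (tos S) (S - ?B) E3 (UNIV - ?B) id ` carrier (rh3 (tos S) (S - ?B))
   = carrier (rU ?B)" by (simp add: iso_def bij_betw_def)
 have "a1 : carrier (rU ?B)" unfolding a1_def by (rule hom_induced_carrier)
 then obtain a where a: "a : carrier (rh3 (tos S) (S - ?B))"
  "hi3 (tos S) (S - ?B) E3 (UNIV - ?B) id a = a1" unfolding surj[symmetric] by blast
 have "hi3 (tos S) (S - ?B) (tos S) (S - {y}) id a = ocb b S y" if y: "y : ?B" for y
 proof (rule ocb_unique[OF assms(1)])
  show "y : S" using y bS by blast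
  show "hi3 (tos S) (S - ?B) (tos S) (S - {y}) id a : carrier (lT S y)" using hom_induced_carrier[of 3 "tos S" "S - ?B" "tos S" "S - {y}"] by simp
  have "hT S y E3 id (hi3 (tos S) (S - ?B) (tos S) (S - {y}) id a)
   = hi3 (tos S) (S - ?B) E3 (UNIV - {y}) (id o id) a" unfolding hl_def topspace_euclidean_subtopology topspace_euclidean id_apply
   by (subst hom_induced_compose') (use y in auto)
  also have "... = hU ?B {y} a1" unfolding a(2)[symmetric] by (subst hom_induced_compose') (use y in auto)
  also have "... = hi3 E3 (UNIV - ball x r0) E3 (UNIV - {y}) (id o id) a0" unfolding a1_def by (subst hom_induced_compose') (use y r(2) in auto)
  also have "... = eor b y" using a0(2) y r(2) by auto
  finally show "hT S y E3 id (hi3 (tos S) (S - ?B) (tos S) (S - {y}) id a) = eor b y" .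
 qed
 thus ?thesis using r(1) bS a(1) by blast
qed

text \<open>The image of the local orientation under \<open>f\<close> and the class
  \<open>eor b\<close> both extend over a neighbourhood \<open>V\<close> of \<open>f x\<close>.
  Their quotient \<open>e\<close> dies at \<open>f x\<close>, hence at all nearby points by
  \<open>class_dies_nearby\<close>, which says that the sign is the same there.\<close>

lemma lsg_locally_constant:
 assumes S: "open S" "x : S" "continuous_on S f" "inj_on f S" and l: "lsg b f x"
 shows "EX V. open V & x : V & (ALL y:V. lsg b f y)"
proof -
 obtain r a where r: "r > 0" "ball x r <= S" and a: "a : carrier (rh3 (tos S) (S - ball x r))"
  "!!y. y : ball x r ==> hi3 (tos S) (S - ball x r) (tos S) (S - {y}) id a = ocb True S y" using ocb_local[OF S(1,2), of True] by blast
 let ?U = "ball x r"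
 have oU: "open (f ` ?U)" using invariance_of_domain[of ?U f] S r(2) by (auto intro: continuous_on_subset inj_on_subset)
 obtain s d where s: "s > 0" and d: "d : carrier (rU (ball (f x) s))"
  "!!z. z : ball (f x) s ==> hU (ball (f x) s) {z} d = eor b z" using eor_local[of "f x" b] by blast
 define V where "V = ball (f x) s Int f ` ?U"
 have V: "open V" "f x : V" using oU s r(1) by (auto simp: V_def)
 let ?G = "rU V"
 define c1 where "c1 = hi3 (tos S) (S - ?U) E3 (UNIV - V) f a"
 define c2 where "c2 = hU (ball (f x) s) V d"
 have cf: "continuous_map (tos S) E3 f" using S by simp
 have fV: "f : S - ?U \<rightarrow> UNIV - V" 
 proof (rule Pi_I)
  fix v assume "v : S - ?U"
  hence "f v \<notin> f ` ?U" using inj_on_image_mem_iff[OF S(4) _ r(2)] by blast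
  thus "f v : UNIV - V" unfolding V_def by blast
 qed
 have c: "c1 : carrier ?G" "c2 : carrier ?G" unfolding c1_def c2_def by (simp_all add: hom_induced_carrier)
 have i1: "hU V {f y} c1 = hT S y E3 f (ocb True S y)"
  if y: "y : ?U" "f y : V" for y
 proof -
  have "y : S" using y r(2) by blast
  hence fy: "f : S - {y} \<rightarrow> UNIV - {f y}" using inj_onD[OF S(4), of _ y] by auto
  have "hU V {f y} c1 = hi3 (tos S) (S - ?U) E3 (UNIV - {f y}) (id o f) a" unfolding c1_def by (subst hom_induced_compose') (use y cf fV in auto)
  also have "... = hi3 (tos S) (S - {y}) E3 (UNIV - {f y}) f (hi3 (tos S) (S - ?U) (tos S) (S - {y}) id a)"
   by (subst hom_induced_compose') (use y cf fy in auto)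
  finally show ?thesis unfolding a(2)[OF y(1)] by (simp add: hl_def)
 qed
 have i2: "hU V {z} c2 = eor b z" if z: "z : V" for z
 proof -
  have "hU V {z} c2 = hi3 E3 (UNIV - ball (f x) s) E3 (UNIV - {z}) (id o id) d" unfolding c2_def by (subst hom_induced_compose') (use z in "auto simp: V_def")
  thus ?thesis using d(2)[of z] z by (simp add: V_def)
 qed
 define e where "e = c1 \<otimes>\<^bsub>?G\<^esub> inv\<^bsub>?G\<^esub> c2"
 have e: "e : carrier ?G" unfolding e_def using c by (simp add: group.inv_closed group.is_monoid monoid.m_closed)
 have he: "hi3 E3 (UNIV - V) E3 B id e
   = hi3 E3 (UNIV - V) E3 B id c1 \<otimes>\<^bsub>rh3 E3 B\<^esub>
    inv\<^bsub>rh3 E3 B\<^esub> (hi3 E3 (UNIV - V) E3 B id c2)" for B unfolding e_def using c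
   iso_inv[OF grp_rel grp_rel hom_induced_hom[of 3 E3 "UNIV - V" E3 B id] c(2)] by (subst hom_mult[OF hom_induced_hom]) (auto simp: group.inv_closed)
 have "hU V {f x} e = \<one>\<^bsub>rU {f x}\<^esub>" unfolding he using i1[of x] i2[of "f x"] l lsg_iff[OF S] V(2) r(1) eor_carrier[of b "f x"] by (simp add: ocb_def group.r_inv)
 then obtain t where t: "t > 0" "ball (f x) t <= V"
  "hU V (ball (f x) t) e = \<one>\<^bsub>rU (ball (f x) t)\<^esub>" using class_dies_nearby[OF V e] by blast
 have "lsg b f y" if y: "y : ?U" "f y : ball (f x) t" for y
 proof -
  have yV: "f y : V" using y t by blast
  let ?L = "rU {f y}"
  have "hU V {f y} e
   = hU (ball (f x) t) {f y} (hU V (ball (f x) t) e)" by (subst hom_induced_compose') (use y t in auto)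
  also have "... = \<one>\<^bsub>?L\<^esub>" unfolding t(3) by (rule hom_one[OF hom_induced_hom]) simp_all
  finally have "hT S y E3 f (ocb True S y) \<otimes>\<^bsub>?L\<^esub> inv\<^bsub>?L\<^esub> (eor b (f y)) = \<one>\<^bsub>?L\<^esub>" unfolding he i1[OF y(1) yV] i2[OF yV] .
  hence "hT S y E3 f (oc S y) = eor b (f y)" using eor_carrier[of b "f y"] hl_carrier[of "tos S" y E3 f "oc S y"] group.inv_equality[of ?L]
   by (metis (no_types, lifting) group.inv_closed group.inv_inv grp_rel ocb_def topspace_euclidean)
  moreover have "y : S" using y r by blast
  ultimately show ?thesis using lsg_iff[OF S(1) _ S(3,4)] by blast
 qed
 moreover have "open (?U Int f -` ball (f x) t)" by (rule continuous_open_preimage) (use S r(2) in "auto intro: continuous_on_subset")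
 ultimately show ?thesis using r(1) t(1) by (intro exI[of _ "?U Int f -` ball (f x) t"]) auto
qed

lemma lsg_constant:
 assumes S: "open S" "connected S" and f: "continuous_on S f"
  and inj: "!!x. x : S ==> EX B. open B & x : B & B <= S & inj_on f B"
  and l: "lsg b f x" "x : S" "y : S"
 shows "lsg b f y"
proof (rule ccontr)
 assume n: "~ lsg b f y"
 have o: "open {z : S. lsg c f z}" for c
 proof (subst open_subopen, intro ballI)
  fix z assume "z : {z : S. lsg c f z}"
  hence z: "z : S" "lsg c f z" by auto
  obtain B where B: "open B" "z : B" "B <= S" "inj_on f B" using inj[OF z(1)] by blast
  obtain V where V: "open V" "z : V" "ALL y:V. lsg c f y" using lsg_locally_constant[OF B(1,2) continuous_on_subset[OF f B(3)] B(4) z(2)] by blast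
  show "EX T. open T & z : T & T <= {z : S. lsg c f z}" using V B by (intro exI[of _ "V Int B"]) auto
 qed
 have c: "lsg True f z | lsg False f z" if z: "z : S" for z
 proof -
  obtain B where B: "open B" "z : B" "B <= S" "inj_on f B" using inj[OF z] by blast
  show ?thesis by (rule lsg_cases[OF B(1,2) continuous_on_subset[OF f B(3)] B(4)])
 qed
 have "{z : S. lsg True f z} Int {z : S. lsg False f z} Int S = {}" using lsg_not_both by blast
 moreover have "S <= {z : S. lsg True f z} Un {z : S. lsg False f z}" using c by blast
 ultimately have "{z : S. lsg True f z} Int S = {} | {z : S. lsg False f z} Int S = {}" using connectedD[OF S(2) o o] by blast
 thus False using l n c[OF l(2)] c[OF l(3)] by (cases b) auto
qed

lemma continuous_on_vector3:
 fixes f g h :: "'a::topological_space => real"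
 assumes "continuous_on S f" "continuous_on S g" "continuous_on S h"
 shows "continuous_on S (%x. vector [f x, g x, h x] :: R3)"
proof -
 have "(%x. vector [f x, g x, h x] :: R3) = (%x. \<chi> i. (if i = 1 then f x else if i = 2 then g x else h x))" by (simp add: fun_eq_iff vec_eq_iff forall_3)
 moreover have "continuous_on S (%x. (\<chi> i. (if i = 1 then f x else if i = 2 then g x else h x)) :: R3)"
 proof (rule continuous_on_vec_lambda)
  fix i :: 3
  show "continuous_on S (%x. if i = 1 then f x else if i = 2 then g x else h x)" using assms by (cases "i = 1"; cases "i = 2"; simp)
 qed
 ultimately show ?thesis by (simp only:)
qed

text \<open>Computed at the fixed point 0 and spread by connectedness.\<close>

lemma lsg_refl2: "lsg False refl2 x"
proof -
 have cr: "continuous_on UNIV refl2" unfolding refl2_def by (rule continuous_on_vector3) (intro continuous_intros)+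
 have r2: "refl2 (refl2 v) = v" for v by (simp add: refl2_def vec_eq_iff forall_3)
 hence ir: "inj refl2" by (rule inj_on_inverseI)
 have r0: "refl2 0 = 0" by (simp add: refl2_def vec_eq_iff forall_3)
 have "hl E3 0 E3 refl2 (e_or 0) = eor False 0" using local_homology_0(2)[of "e_or 0"] e_or_carrier[of 0] r0 by (simp add: hl_def eor_def)
 hence l0: "lsg False refl2 0" using lsg_iff[of UNIV 0 refl2 False] cr ir r0 hl_id[OF oc(1)[OF open_UNIV UNIV_I]] oc(2)[OF open_UNIV UNIV_I, of 0] by simp
 show ?thesis by (rule lsg_constant[OF open_UNIV connected_UNIV cr _ l0]) (use ir in auto)
qed

subsection \<open>Orientations from local parametrisations\<close>

definition chart_on :: "'a topology => (R3 => 'a) => R3 set => bool" where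
 "chart_on X pr B \<longleftrightarrow> open B & continuous_map (tos B) X pr & inj_on pr B & open_map (tos B) X pr"

definition cc :: "'a topology => (R3 => 'a) => R3 set => R3 => 'a chain set" where
 "cc X pr B x = hT B x X pr (oc B x)"

lemma chart_on_subset:
 assumes "chart_on X pr B" "open C" "C <= B" shows "chart_on X pr C"
proof -
 have "openin (tos B) C" using assms by (auto simp: chart_on_def openin_open_eq)
 hence "open_map (tos C) X pr" using assms(1,3) unfolding chart_on_def open_map_def
  by (metis openin_subtopology_Int2 openin_trans_full subtopology_subtopology inf.absorb_iff2 openin_open_subtopology)
 moreover have "continuous_map (tos C) X pr" using assms unfolding chart_on_def by (metis continuous_map_from_subtopology_mono)
 ultimately show ?thesis using assms unfolding chart_on_def by (auto intro: inj_on_subset)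
qed

lemma cc_mono:
 assumes "chart_on X pr B" "open C" "C <= B" "x : C"
 shows "cc X pr C x = cc X pr B x" using hl_restrict[of B C x X pr True] assms by (simp add: chart_on_def cc_def ocb_def)

lemma cc_lsg:
 assumes B: "chart_on X pr B" and B': "chart_on X pr' B'" and x: "x : B'" "gm x : B"
  and l: "lsg b gm x" and O: "open T" "x : T" "!!z. z : T ==> pr (gm z) = pr' z"
 shows "cc X pr' B' x = (if b then cc X pr B (gm x) else inv\<^bsub>lhom X (pr' x)\<^esub> (cc X pr B (gm x)))"
proof -
 have oB: "open B" "open B'" using B B' by (simp_all add: chart_on_def)
 have "open (T Int B')" "x : T Int B'" using O oB x by auto
 from lsg_obtain[OF l this] obtain S0 where S0: "open S0" "x : S0" "S0 <= T Int B'" "continuous_on S0 gm" "inj_on gm S0" by blast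
 define S where "S = S0 Int gm -` B"
 have S: "open S" "x : S" "S <= T" "S <= B'" "continuous_on S gm" "inj_on gm S" "gm ` S <= B"
  using S0 x continuous_open_preimage[OF S0(4,1) oB(1)] unfolding S_def by (auto intro: continuous_on_subset inj_on_subset)
 have cm: "continuous_map (tos S) (tos B) gm" using S by (auto simp: cm_sub)
 have "cc X pr' B' x = cc X pr' S x" using cc_mono[OF B' S(1,4,2)] by simp
 also have "... = hT S x X (pr o gm) (oc S x)"
 proof -
  have "hT S x X pr' = hT S x X (pr o gm)" by (rule hl_cong) (use O(3) S(2,3) in auto)
  thus ?thesis by (simp add: cc_def)
 qed
 also have "... = hT B (gm x) X pr (hT S x (tos B) gm (oc S x))" by (rule hl_comp[symmetric]) (use B S cm x in "auto simp: inj_on_def chart_on_def")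
 also have "hT S x (tos B) gm (oc S x) = ocb b B (gm x)" using lsg_push[OF l S(1,2,5,6) oB(1) S(7), of True] by (simp add: ocb_def)
 also have "hT B (gm x) X pr (ocb b B (gm x)) = (if b then cc X pr B (gm x) else inv\<^bsub>lhom X (pr' x)\<^esub> (cc X pr B (gm x)))"
  using ocb_hl_inv[OF oB(1) x(2), of X pr True b] O(3)[OF O(2)] by (cases b) (simp_all add: cc_def ocb_def)
 finally show ?thesis .
qed

lemma cc_gen:
 assumes "t1_space X" "chart_on X pr B" "x : B"
 shows "is_gen (lhom X (pr x)) (cc X pr B x)"
proof -
 have "open B" using assms by (simp add: chart_on_def)
 hence g: "is_gen (lT B x) (oc B x)" using ocb_gen[of B x True] assms by (simp add: ocb_def)
 have i: "hT B x X pr : iso (lT B x) (lhom X (pr x))" by (rule hl_open_embedding) (use assms in "auto simp: chart_on_def")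
 show ?thesis unfolding cc_def by (rule iso_is_gen[OF grp_rel grp_rel i g])
qed

lemma cc_local:
 assumes "chart_on X pr B" "x : B"
 shows "EX U a. openin X U & pr x : U & U <= pr ` B & a : carrier (rh3 X (topspace X - U)) &
   (ALL y:B. pr y : U --> hi3 X (topspace X - U) X (topspace X - {pr y}) id a = cc X pr B y)"
proof -
 have B: "open B" "continuous_map (tos B) X pr" "inj_on pr B" "open_map (tos B) X pr" using assms(1) by (simp_all add: chart_on_def)
 obtain r a where r: "r > 0" "ball x r <= B" and a: "a : carrier (rh3 (tos B) (B - ball x r))"
  "!!y. y : ball x r ==> hi3 (tos B) (B - ball x r) (tos B) (B - {y}) id a = ocb True B y" using ocb_local[OF B(1) assms(2), of True] by blast
 define U where "U = pr ` ball x r"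
 have "openin (tos B) (ball x r)" using r by (simp add: openin_open_eq B(1))
 hence U: "openin X U" using B(4) unfolding U_def open_map_def by blast
 have im: "pr : B - ball x r \<rightarrow> topspace X - U"
 proof (rule Pi_I)
  fix v assume v: "v : B - ball x r"
  hence "pr v \<notin> U" unfolding U_def using inj_on_image_mem_iff[OF B(3) _ r(2)] by blast
  moreover have "pr v : topspace X" using v B(2) by (auto simp: continuous_map_def Pi_iff)
  ultimately show "pr v : topspace X - U" by blast
 qed
 define a' where "a' = hi3 (tos B) (B - ball x r) X (topspace X - U) pr a"
 have "hi3 X (topspace X - U) X (topspace X - {pr y}) id a' = cc X pr B y" if y: "y : B" "pr y : U" for y
 proof -
  have yb: "y : ball x r" using y inj_on_image_mem_iff[OF B(3) _ r(2)] unfolding U_def by blast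
  have im2: "pr : B - {y} \<rightarrow> topspace X - {pr y}" using y(1) inj_onD[OF B(3), of _ y] B(2) by (auto simp: continuous_map_def Pi_iff)
  have "hi3 X (topspace X - U) X (topspace X - {pr y}) id a'
   = hi3 (tos B) (B - ball x r) X (topspace X - {pr y}) (id o pr) a" unfolding a'_def by (subst hom_induced_compose') (use B im y in auto)
  also have "... = hi3 (tos B) (B - {y}) X (topspace X - {pr y}) pr
     (hi3 (tos B) (B - ball x r) (tos B) (B - {y}) id a)" by (subst hom_induced_compose') (use B im2 yb in auto)
  finally show ?thesis unfolding a(2)[OF yb] by (simp add: cc_def hl_def ocb_def)
 qed
 moreover have "a' : carrier (rh3 X (topspace X - U))" unfolding a'_def by (rule hom_induced_carrier)
 moreover have "pr x : U" "U <= pr ` B" using r unfolding U_def by auto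
 ultimately show ?thesis using U by blast
qed

text \<open>Points with the same image are related by a local map of sign 1 over the quotient. This
  makes the orientation of Euclidean space descend, independently of the choice of chart in
  \<open>cover_orientation\<close>.\<close>

definition oriented_cover :: "'a topology => (R3 => 'a) => R3 set => bool" where
 "oriented_cover X pr S \<longleftrightarrow> open S & pr ` S = manifold_interior X &
   (ALL x:S. EX B. x : B & B <= S & chart_on X pr B) &
   (ALL x:S. ALL y:S. pr x = pr y -->
    (EX gm T. open T & x : T & lsg True gm x & gm x = y & (ALL z:T. pr (gm z) = pr z)))"

definition cover_orientation :: "'a topology => (R3 => 'a) => R3 set => 'a orientation" where
 "cover_orientation X pr S p = (SOME c. EX x B. x : B & B <= S & chart_on X pr B & pr x = p & c = cc X pr B x)"

lemma cover_orientation: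
 assumes "oriented_cover X pr S" "x : B" "B <= S" "chart_on X pr B"
 shows "cover_orientation X pr S (pr x) = cc X pr B x"
proof -
 have "EX c. EX y C. y : C & C <= S & chart_on X pr C & pr y = pr x & c = cc X pr C y" using assms by blast
 from someI_ex[OF this, folded cover_orientation_def]
 obtain y C where y: "y : C" "C <= S" "chart_on X pr C" "pr y = pr x" "cover_orientation X pr S (pr x) = cc X pr C y" by blast
 have "x : S" "y : S" using y assms by auto
 then obtain gm T where g: "open T" "y : T" "lsg True gm y" "gm y = x" "ALL z:T. pr (gm z) = pr z"
  using assms(1) y(4) unfolding oriented_cover_def by metis
 have "cc X pr C y = cc X pr B (gm y)" using cc_lsg[OF assms(4) y(3,1) _ g(3,1,2)] g assms by simp
 thus ?thesis using y(5) g(4) by simp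
qed

lemma is_orientation_cover:
 assumes X: "t1_space X" and c: "oriented_cover X pr S"
 shows "is_orientation X (cover_orientation X pr S)" unfolding is_orientation_def
proof (intro conjI ballI)
 fix p assume p: "p : manifold_interior X"
 then obtain x where x: "x : S" "p = pr x" using c unfolding oriented_cover_def by blast
 obtain B where B: "x : B" "B <= S" "chart_on X pr B" using c x unfolding oriented_cover_def by blast
 have "is_gen (lhom X p) (cover_orientation X pr S p)" unfolding x(2) cover_orientation[OF c B] by (rule cc_gen[OF X B(3,1)])
 thus "cover_orientation X pr S p : carrier (lhom X p)"
  "generate (lhom X p) {cover_orientation X pr S p} = carrier (lhom X p)" by (simp_all add: is_gen_def)
 obtain U a where U: "openin X U" "pr x : U" "U <= pr ` B" "a : carrier (rh3 X (topspace X - U))"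
  "ALL y:B. pr y : U --> hi3 X (topspace X - U) X (topspace X - {pr y}) id a = cc X pr B y" using cc_local[OF B(3,1)] by blast
 have l: "hi3 X (topspace X - U) X (topspace X - {q}) id a = cover_orientation X pr S q" if q: "q : U" for q
 proof -
  obtain y where y: "y : B" "q = pr y" using q U(3) by blast
  thus ?thesis using U(5) q cover_orientation[OF c y(1) B(2,3)] by simp
 qed
 have "pr ` S = manifold_interior X" using c by (simp add: oriented_cover_def)
 hence "U <= manifold_interior X" using U(3) B(2) by blast
 thus "EX U a. openin X U & p : U & U <= manifold_interior X &
    a : carrier (rh3 X (topspace X - U)) &
    (ALL y:U. hi3 X (topspace X - U) X (topspace X - {y}) id a = cover_orientation X pr S y)" using U(1,2,4) x(2) l by (intro exI[of _ U] exI[of _ a]) simp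
qed

lemma cc_compose:
 assumes "chart_on X pr B" "x : B" "continuous_map X Y f" "inj_on f (topspace X)"
 shows "hl X (pr x) Y f (cc X pr B x) = cc Y (f o pr) B x" unfolding cc_def
proof (rule hl_comp)
 have im: "pr z : topspace X" if "z : B" for z using assms(1) that by (auto simp: chart_on_def continuous_map_def Pi_iff)
 show "f z ~= f (pr x)" if "z : topspace X" "z ~= pr x" for z using that assms(4) im[OF assms(2)] by (auto simp: inj_on_def)
 show "pr z ~= pr x" if "z : topspace (tos B)" "z ~= x" for z using that assms(1,2) by (auto simp: inj_on_def chart_on_def)
qed (use assms in "auto simp: chart_on_def")

text \<open>Serves with \<open>b\<close> true for the stretching of the cusp and the inclusion into
  the filling, and with \<open>b\<close> false for the reflection and its inverse.\<close>

lemma cover_orientation_map: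
 assumes cX: "oriented_cover X pr S" and cY: "oriented_cover Y pr' S'" and f: "continuous_map X Y f" "inj_on f (topspace X)"
  and lift: "!!x. x : S ==> loc_lift b x S' pr' (%z. f (pr z))"
  and op: "!!B. chart_on X pr B ==> B <= S ==> chart_on Y (f o pr) B"
  and p: "p : manifold_interior X"
 shows "hi3 X (topspace X - {p}) Y (topspace Y - {f p}) f (cover_orientation X pr S p)
  = (if b then cover_orientation Y pr' S' (f p)
    else inv\<^bsub>lhom Y (f p)\<^esub> (cover_orientation Y pr' S' (f p)))"
proof -
 obtain x where x: "x : S" "p = pr x" using p cX unfolding oriented_cover_def by blast
 obtain B where B: "x : B" "B <= S" "chart_on X pr B" using cX x unfolding oriented_cover_def by blast
 obtain gm T where g: "open T" "x : T" "lsg b gm x" "gm x : S'" "ALL z:T. pr' (gm z) = f (pr z)" using lift[OF x(1)] by blast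
 obtain C where C: "gm x : C" "C <= S'" "chart_on Y pr' C" using cY g(4) unfolding oriented_cover_def by blast
 have fp: "pr' (gm x) = f p" using g x by auto
 have "hi3 X (topspace X - {p}) Y (topspace Y - {f p}) f (cover_orientation X pr S p) = cc Y (f o pr) B x"
  using cc_compose[OF B(3,1) f] unfolding x(2) cover_orientation[OF cX B] by (simp add: hl_def)
 also have "... = (if b then cc Y pr' C (gm x) else inv\<^bsub>lhom Y ((f o pr) x)\<^esub> (cc Y pr' C (gm x)))"
  by (rule cc_lsg[OF C(3) op[OF B(3,2)] B(1) C(1) g(3,1,2)]) (use g(5) in auto)
 also have "cc Y pr' C (gm x) = cover_orientation Y pr' S' (f p)" using cover_orientation[OF cY C] fp by simp
 finally show ?thesis using x(2) by simp
qed

section \<open>Hyperbolic space\<close>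

definition cz :: "R3 => complex" where "cz x = Complex (x$1) (x$2)"
definition pt :: "complex => real => R3" where "pt z t = vector [Re z, Im z, t]"

lemma pt_simps [simp]: "cz (pt z t) = z" "pt z t$3 = t" "pt z t$1 = Re z" "pt z t$2 = Im z" "pt (cz x) (x$3) = x"
 "Re (cz x) = x$1" "Im (cz x) = x$2" by (simp_all add: cz_def pt_def complex_eq_iff vec_eq_iff forall_3)

lemma pt_eq_iff: "x = y \<longleftrightarrow> cz x = cz y & x$3 = y$3" by (auto simp: vec_eq_iff forall_3 complex_eq_iff)

lemma pt_hyp3 [simp]: "pt z t : hyp3 \<longleftrightarrow> 0 < t" by (simp add: hyp3_def)

lemma hyp3_pos: "x : hyp3 ==> 0 < x$3" by (simp add: hyp3_def)

lemma hyp3_convex: "convex hyp3"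
proof -
 have "hyp3 = {x. axis 3 1 \<bullet> x > 0}" by (simp add: hyp3_def inner_axis')
 thus ?thesis using convex_halfspace_gt by metis
qed

lemma hyp3_open: "open hyp3" unfolding hyp3_def by (intro open_Collect_less continuous_intros)

lemma dist_pt: "(dist x y)^2 = (cmod (cz x - cz y))^2 + (x$3 - y$3)^2" by (simp add: dist_norm norm_vec3 cmod_power2)

lemma continuous_on_cz [continuous_intros]: "continuous_on S f ==> continuous_on S (%x. cz (f x))"
proof -
 assume f: "continuous_on S f"
 have "cz (f x) = of_real (f x$1) + \<i> * of_real (f x$2)" for x by (simp add: complex_eq_iff)
 thus ?thesis by (auto intro!: continuous_intros f)
qed

lemma continuous_on_pt [continuous_intros]:
 "continuous_on S f ==> continuous_on S g ==> continuous_on S (%x. pt (f x) (g x))"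
 unfolding pt_def by (rule continuous_on_vector3) (auto intro!: continuous_intros)

text \<open>The Hermitian form of determinant one attached to a point; its values are the inverse
  heights of the point with respect to the cusps.\<close>

definition nf :: "R3 => complex => complex => real" where
 "nf x c d = ((cmod (c * cz x + d))^2 + (cmod c)^2 * (x$3)^2)/x$3"

lemma nf_pos: "x : hyp3 ==> (c, d) ~= (0, 0) ==> 0 < nf x c d"
proof -
 assume x: "x : hyp3" and cd: "(c, d) ~= (0, 0)"
 hence t: "0 < x$3" by (simp add: hyp3_pos)
 have "0 < (cmod (c * cz x + d))^2 + (cmod c)^2 * (x$3)^2"
 proof (cases "c = 0")
  case True thus ?thesis using cd by simp
 next
  case False thus ?thesis using t by (intro add_nonneg_pos) auto
 qed
 thus ?thesis using t by (simp add: nf_def)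
qed

lemma nf_nonneg: "x : hyp3 ==> 0 <= nf x c d" by (auto simp: nf_def hyp3_def)

lemma nf_expand:
 "nf x c d = ((cmod (cz x))^2 + (x$3)^2)/x$3 * (cmod c)^2 + 2 * Re (cz x * c * cnj d)/x$3 + (cmod d)^2/x$3"
proof -
 define R where "R = Re (cz x * c * cnj d)"
 have "(cmod (c * cz x + d))^2 = (cmod c)^2 * (cmod (cz x))^2 + 2 * R + (cmod d)^2" unfolding cmod_power2 R_def by (simp add: p2_sq alg)
 thus ?thesis unfolding R_def[symmetric] by (simp add: nf_def add_divide_distrib distrib_right alg)
qed

section \<open>Moebius transformations of the upper half-space\<close>

definition mden :: "complex mat2 => R3 => real" where
 "mden g x = (cmod (m21 g * cz x + m22 g))^2 + (cmod (m21 g))^2 * (x$3)^2"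

text \<open>The Poincare extension: \<open>(a w + b) (c w + d)^(-1)\<close> for the quaternion
  \<open>w = z + t j\<close>, with \<open>mden\<close> the squared norm of the denominator.\<close>

definition mob :: "complex mat2 => R3 => R3" where
 "mob g x = pt (((m11 g * cz x + m12 g) * cnj (m21 g * cz x + m22 g) + m11 g * cnj (m21 g) * (x$3)^2)/mden g x)
   (x$3/mden g x)"

lemma mden_nf: "x : hyp3 ==> mden g x = x$3 * nf x (m21 g) (m22 g)" by (simp add: mden_def nf_def hyp3_def)

lemma det2_row_nz: "det2 g = (1 :: complex) ==> (m21 g, m22 g) ~= (0, 0)" by (auto simp: det2_def)

lemma mden_pos: "x : hyp3 ==> det2 g = 1 ==> 0 < mden g x" unfolding mden_nf using nf_pos det2_row_nz hyp3_pos by simp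

lemma mob_hyp3: "x : hyp3 ==> det2 g = 1 ==> mob g x : hyp3" using mden_pos by (simp add: mob_def hyp3_pos)

text \<open>Moving the point is a linear change of variables in its form. As the form determines the
  point and the distance, the composition law and the invariance of distance follow from this one
  computation.\<close>

lemma nf_mob:
 assumes x: "x : hyp3" and g: "det2 g = 1"
 shows "nf (mob g x) p q = nf x (p * m11 g + q * m21 g) (p * m12 g + q * m22 g)"
proof -
 define a b c d z t where "a = m11 g" "b = m12 g" "c = m21 g" "d = m22 g" "z = cz x" "t = x$3"
 note defs = this
 define u v D A B where "u = a * z + b" "v = c * z + d" "D = mden g x" "A = p * u + q * v" "B = p * a + q * c"
 note defs2 = this
 have t: "0 < t" using x by (simp add: defs hyp3_pos)
 have D: "0 < D" using mden_pos[OF x g] by (simp add: defs2)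
 have Dv: "complex_of_real D = v * cnj v + c * cnj c * t^2"
 proof -
  have "D = (cmod v)^2 + (cmod c)^2 * t^2" unfolding defs2 mden_def by (simp add: defs)
  thus ?thesis unfolding complex_norm_square[symmetric] by simp
 qed
 have det: "a * d - b * c = 1" using g by (simp add: det2_def defs)
 have p: "p = B * v - A * c"
 proof -
  have "B * v - A * c = p * (a * d - b * c)" unfolding defs2 by (simp add: alg)
  thus ?thesis using det by simp
 qed
 define w where "w = A * cnj v + B * cnj c * t^2"
 have key: "(cmod w)^2 + (cmod p)^2 * t^2 = ((cmod A)^2 + (cmod B)^2 * t^2) * D"
 proof -
  have "w * cnj w + p * cnj p * t^2 = (A * cnj A + B * cnj B * t^2) * D" unfolding w_def Dv p by (simp add: alg)
  hence "complex_of_real ((cmod w)^2 + (cmod p)^2 * t^2) = complex_of_real (((cmod A)^2 + (cmod B)^2 * t^2) * D)"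
   unfolding complex_norm_square[symmetric] by simp
  thus ?thesis using of_real_eq_iff by blast
 qed
 have mob: "cz (mob g x) = (u * cnj v + a * cnj c * t^2)/D" "mob g x$3 = t/D" by (simp_all add: mob_def defs defs2)
 have "p * ((u * cnj v + a * cnj c * t^2)/D) + q = w/D"
 proof -
  have "p * (u * cnj v + a * cnj c * t^2) + q * D = w" unfolding Dv w_def defs2(4,5) by (simp add: alg)
  thus ?thesis using D by (simp add: field_simps)
 qed
 hence "nf (mob g x) p q = ((cmod w)^2/D^2 + (cmod p)^2 * (t/D)^2)/(t/D)" unfolding nf_def mob using D by (simp add: norm_divide power_divide)
 also have "... = ((cmod w)^2 + (cmod p)^2 * t^2)/(t * D)" using D t by (simp add: field_simps p2_sq)
 also have "... = ((cmod A)^2 + (cmod B)^2 * t^2)/t" unfolding key using D t by (simp add: field_simps)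
 also have "... = nf x (p * m11 g + q * m21 g) (p * m12 g + q * m22 g)"
 proof -
  have "(p * a + q * c) * z + (p * b + q * d) = A" unfolding defs2 by (simp add: alg)
  thus ?thesis unfolding nf_def defs2(5) by (simp add: defs)
 qed
 finally show ?thesis .
qed

definition hcosh :: "R3 => R3 => real" where
 "hcosh x y = 1 + (dist x y)^2/(2 * x$3 * y$3)"

lemma hyp_dist_hcosh: "hyp_dist x y = arcosh (hcosh x y)" by (simp add: hyp_dist_def hcosh_def)

lemma hcosh_ge_1: "x : hyp3 ==> y : hyp3 ==> 1 <= hcosh x y" by (simp add: hcosh_def hyp3_def)

lemma hyp_dist_nonneg: "x : hyp3 ==> y : hyp3 ==> 0 <= hyp_dist x y" using hcosh_ge_1 by (simp add: hyp_dist_hcosh arcosh_nonneg_real)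

lemma cosh_hyp_dist: "x : hyp3 ==> y : hyp3 ==> cosh (hyp_dist x y) = hcosh x y" using hcosh_ge_1 by (simp add: hyp_dist_hcosh cosh_arcosh_real)

lemma hyp_dist_commute: "hyp_dist x y = hyp_dist y x" by (simp add: hyp_dist_def dist_commute mult.commute mult.left_commute)

lemma hyp_dist_0_iff: "x : hyp3 ==> y : hyp3 ==> hyp_dist x y = 0 \<longleftrightarrow> x = y"
proof
 assume xy: "x : hyp3" "y : hyp3" and "hyp_dist x y = 0"
 hence "hcosh x y = 1" using cosh_hyp_dist by (metis cosh_0)
 hence "(dist x y)^2/(2 * x$3 * y$3) = 0" by (simp add: hcosh_def)
 thus "x = y" using xy by (simp add: hyp3_def)
qed (simp add: hyp_dist_def)

text \<open>The determinant is zero, so multiplied by \<open>dl\<close> the form is a single square.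
  Its null vector will realise the extremal ratio of two forms in
  \<open>nf_extremal\<close>.\<close>

lemma psd_form:
 fixes al dl :: real and bt :: complex
 assumes "al * dl = (cmod bt)^2" "0 <= al" "0 <= dl"
 shows "0 <= al * (cmod c)^2 + 2 * Re (bt * c * cnj d) + dl * (cmod d)^2"
  and "EX c d. (c, d) ~= (0, 0) & al * (cmod c)^2 + 2 * Re (bt * c * cnj d) + dl * (cmod d)^2 = 0"
proof -
 let ?Q = "%c d. al * (cmod c)^2 + 2 * Re (bt * c * cnj d) + dl * (cmod d)^2"
 have idQ: "dl * ?Q c d = (cmod (dl * d + bt * c))^2" for c d :: complex
 proof -
  have "(cmod (dl * d + bt * c))^2 = dl^2 * (cmod d)^2 + (cmod bt)^2 * (cmod c)^2 + 2 * dl * Re (bt * c * cnj d)"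
   unfolding cmod_power2 by (simp add: p2_sq alg)
  thus ?thesis unfolding assms(1)[symmetric] by (simp only: p2_sq[of dl]) (simp only: alg)
 qed
 show "0 <= ?Q c d"
 proof (cases "dl = 0")
  case True
  hence "bt = 0" using assms by simp
  thus ?thesis using True assms(2) by simp
 next
  case False
  hence d: "0 < dl" using assms(3) by simp
  have "0 <= dl * ?Q c d" unfolding idQ[of c d] by (rule zero_le_power2)
  thus ?thesis using d by (metis mult_le_cancel_left_pos mult_zero_right)
 qed
 show "EX c d. (c, d) ~= (0, 0) & ?Q c d = 0"
 proof (cases "dl = 0")
  case True thus ?thesis using assms by (intro exI[of _ 0] exI[of _ 1]) simp
 next
  case False
  define d where "d = - bt/dl"
  have "dl * d + bt * 1 = 0" using False by (simp add: d_def)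
  hence "dl * ?Q 1 d = 0" unfolding idQ[of 1 d] by simp
  hence "?Q 1 d = 0" using False by (metis mult_eq_0_iff)
  moreover have "((1 :: complex), d) ~= (0, 0)" by simp
  ultimately show ?thesis by (intro exI conjI)
 qed
qed

text \<open>For \<open>l = exp (hyp_dist x y)\<close> the difference of \<open>l\<close> times the
  form of \<open>y\<close> and the form of \<open>x\<close> has determinant
  \<open>l^2 + 1 - 2 l cosh (hyp_dist x y) = 0\<close>. It is semidefinite with a null vector, so
  \<open>l\<close> is the largest ratio of the two forms.\<close>

lemma nf_extremal:
 assumes x: "x : hyp3" and y: "y : hyp3"
 shows "nf x c d <= exp (hyp_dist x y) * nf y c d"
  and "EX c d. (c, d) ~= (0, 0) & nf x c d = exp (hyp_dist x y) * nf y c d"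
proof -
 define z w t s where "z = cz x" "w = cz y" "t = x$3" "s = y$3"
 note defs = this
 have t: "0 < t" and s: "0 < s" using x y by (simp_all add: defs hyp3_pos)
 define l where "l = exp (hyp_dist x y)"
 have l1: "1 <= l" unfolding l_def using hyp_dist_nonneg[OF x y] by simp
 have "l + 1/l = 2 * hcosh x y" unfolding cosh_hyp_dist[OF x y, symmetric] l_def by (simp add: cosh_def exp_minus field_simps)
 also have "2 * hcosh x y = ((cmod (z - w))^2 + t^2 + s^2)/(t * s)" unfolding hcosh_def dist_pt using t s by (simp add: defs field_simps p2_sq)
 finally have l: "l + 1/l = ((cmod (z - w))^2 + t^2 + s^2)/(t * s)" .
 hence lq: "(l^2 + 1) * (t * s) = l * ((cmod (z - w))^2 + t^2 + s^2)" using l1 t s by (simp add: field_simps p2_sq)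
 define al bt dl where "al = l * ((cmod w)^2 + s^2)/s - ((cmod z)^2 + t^2)/t"
  "bt = l * w/s - z/t" "dl = l/s - 1/t"
 note abd = this
 have Q: "l * nf y c d - nf x c d = al * (cmod c)^2 + 2 * Re (bt * c * cnj d) + dl * (cmod d)^2" for c d
 proof -
  define R S q r where "R = Re (z * c * cnj d)" and "S = Re (w * c * cnj d)" and "q = (cmod c)^2" and "r = (cmod d)^2"
  note RS = this
  have "bt * c * cnj d = of_real (l/s) * (w * c * cnj d) - of_real (1/t) * (z * c * cnj d)" unfolding abd by (simp add: field_simps)
  hence b: "Re (bt * c * cnj d) = l/s * S - 1/t * R"
   unfolding R_def S_def by (simp only: minus_complex.sel Re_complex_of_real Im_complex_of_real times_complex.sel(1)[of "complex_of_real _"] mult_zero_left diff_zero)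
  have "nf x c d = ((cmod z)^2 + t^2)/t * q + 2 * R/t + r/t"
   "nf y c d = ((cmod w)^2 + s^2)/s * q + 2 * S/s + r/s" unfolding nf_expand RS defs by simp_all
  thus ?thesis unfolding b abd(1,3) RS(3,4)[symmetric] by (simp add: alg)
 qed
 have zw: "(cmod (z - w))^2 = (cmod z)^2 + (cmod w)^2 - 2 * Re (w * cnj z)" unfolding cmod_power2 by (simp add: p2_sq alg)
 have bet: "(cmod bt)^2 = l^2 * (cmod w)^2/s^2 + (cmod z)^2/t^2 - 2 * l/(s * t) * Re (w * cnj z)"
  unfolding abd cmod_power2 using s t by (simp add: p2_sq field_simps)
 have "al * dl - (cmod bt)^2 = l^2 + 1 - l * ((cmod (z - w))^2 + t^2 + s^2)/(t * s)"
  unfolding bet zw unfolding abd using s t by (simp add: field_simps p2_sq)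
 also have "... = 0" using lq t s by (simp add: field_simps)
 finally have det: "al * dl = (cmod bt)^2" by simp
 \<comment> \<open>This aims at \<open>s \<le> l t\<close>, the sign of the diagonal entry
   \<open>dl\<close>: the factors do not have opposite signs, and they are not both negative since
   \<open>l \<ge> 1\<close>.\<close>
 have "(l * t - s) * (l * s - t) \<ge> 0"
 proof -
  have "(l * t - s) * (l * s - t) = (l^2 + 1) * (t * s) - l * (t^2 + s^2)" by (simp add: p2_sq alg)
  thus ?thesis unfolding lq using l1 by (simp add: alg)
 qed
 moreover have "~ (l * t < s & l * s < t)"
 proof
  assume "l * t < s & l * s < t"
  moreover have "t <= l * t" "s <= l * s" using l1 t s by simp_all
  ultimately show False by linarith
 qed
 ultimately have "s <= l * t" by (smt (verit) mult_less_0_iff l1 mult_le_cancel_right1 s t zero_le_mult_iff)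
 hence d0: "0 <= dl" unfolding abd using s t by (simp add: field_simps)
 have a0: "0 <= al"
 proof (cases "dl = 0")
  case False
  have "0 <= al * dl" unfolding det by simp
  thus ?thesis using d0 False by (simp add: zero_le_mult_iff)
 next
  case True
  hence lt: "l * t = s" unfolding abd using s t by (simp add: field_simps)
  have "l = s/t" using lt t by (simp add: field_simps)
  moreover have "bt = 0" using det True by simp
  ultimately have "w = z" unfolding abd using s t by simp
  moreover have "t <= s" using lt l1 t mult_right_mono[of 1 l t] by linarith
  hence "t^2 <= s^2" using t by (intro power_mono) auto
  ultimately show ?thesis unfolding abd \<open>l = s / t\<close> using s t by (simp add: field_simps)
 qed
 show "nf x c d <= exp (hyp_dist x y) * nf y c d" using psd_form(1)[OF det a0 d0, of c d] Q[of c d] unfolding l_def by linarith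
 show "EX c d. (c, d) ~= (0, 0) & nf x c d = exp (hyp_dist x y) * nf y c d"
 proof -
  obtain c d where cd: "(c, d) ~= (0, 0)" "al * (cmod c)^2 + 2 * Re (bt * c * cnj d) + dl * (cmod d)^2 = 0"
   using psd_form(2)[OF det a0 d0] by (elim exE conjE)
  have "nf x c d = exp (hyp_dist x y) * nf y c d" using Q[of c d] cd(2) unfolding l_def by linarith
  thus ?thesis using cd(1) by (intro exI conjI)
 qed
qed

text \<open>Turns statements about distances into comparisons of forms: the triangle inequality
  becomes transitivity, and isometry a change of variables.\<close>

lemma hyp_dist_le_iff:
 assumes x: "x : hyp3" and y: "y : hyp3"
 shows "hyp_dist x y <= r \<longleftrightarrow> (ALL c d. nf x c d <= exp r * nf y c d)"
proof
 assume r: "hyp_dist x y <= r"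
 show "ALL c d. nf x c d <= exp r * nf y c d"
 proof (intro allI)
  fix c d
  have "exp (hyp_dist x y) * nf y c d <= exp r * nf y c d" using r nf_nonneg[OF y] by (intro mult_right_mono) auto
  thus "nf x c d <= exp r * nf y c d" using nf_extremal(1)[OF x y, of c d] by linarith
 qed
next
 assume r: "ALL c d. nf x c d <= exp r * nf y c d"
 obtain c d where cd: "(c, d) ~= (0, 0)" "nf x c d = exp (hyp_dist x y) * nf y c d" using nf_extremal(2)[OF x y] by blast
 have "exp (hyp_dist x y) * nf y c d <= exp r * nf y c d" using r cd(2) by metis
 thus "hyp_dist x y <= r" using nf_pos[OF y cd(1)] by simp
qed

lemma hyp_dist_triangle:
 assumes "x : hyp3" "y : hyp3" "z : hyp3"
 shows "hyp_dist x z <= hyp_dist x y + hyp_dist y z" unfolding hyp_dist_le_iff[OF assms(1,3)] exp_add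
proof (intro allI)
 fix c d
 have "nf x c d <= exp (hyp_dist x y) * nf y c d" by (rule nf_extremal(1)[OF assms(1,2)])
 also have "... <= exp (hyp_dist x y) * (exp (hyp_dist y z) * nf z c d)" by (rule mult_left_mono[OF nf_extremal(1)[OF assms(2,3)]]) simp
 finally show "nf x c d <= exp (hyp_dist x y) * exp (hyp_dist y z) * nf z c d" by simp
qed

lemma nf_determines:
 assumes "x : hyp3" "y : hyp3" "!!c d. nf x c d = nf y c d"
 shows "x = y" using hyp_dist_le_iff[OF assms(1,2), of 0] hyp_dist_nonneg[OF assms(1,2)] hyp_dist_0_iff[OF assms(1,2)] assms(3) by simp

lemma mob_1 [simp]: "mob 1 x = x" by (simp add: mob_def mden_def)

lemma mob_mult:
 assumes "x : hyp3" "det2 g = 1" "det2 h = 1"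
 shows "mob (g * h) x = mob g (mob h x)" by (rule nf_determines) (use assms in "simp_all add: mob_hyp3 nf_mob, simp add: alg")

lemma mob_inv2: "x : hyp3 ==> det2 g = 1 ==> mob (inv2 g) (mob g x) = x"
 "x : hyp3 ==> det2 g = 1 ==> mob g (mob (inv2 g) x) = x"
proof -
 have d: "det2 (inv2 g) = det2 g" by (simp add: det2_def alg)
 show "x : hyp3 ==> det2 g = 1 ==> mob (inv2 g) (mob g x) = x"
  "x : hyp3 ==> det2 g = 1 ==> mob g (mob (inv2 g) x) = x" using mob_mult[of x "inv2 g" g] mob_mult[of x g "inv2 g"] d inv2_mult[of g] by auto
qed

lemma mob_isometry:
 assumes x: "x : hyp3" and y: "y : hyp3" and g: "det2 g = 1"
 shows "hyp_dist (mob g x) (mob g y) = hyp_dist x y"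
proof -
 have le: "hyp_dist (mob g x) (mob g y) <= hyp_dist x y" if "x : hyp3" "y : hyp3" "det2 g = 1" for x y g unfolding hyp_dist_le_iff[OF mob_hyp3[OF that(1,3)] mob_hyp3[OF that(2,3)]]
  using that nf_extremal(1) by (simp add: nf_mob)
 have d: "det2 (inv2 g) = 1" using g by (simp add: det2_def alg)
 have "hyp_dist x y <= hyp_dist (mob g x) (mob g y)" using le[OF mob_hyp3[OF x g] mob_hyp3[OF y g] d] mob_inv2(1) x y g by simp
 thus ?thesis using le[OF x y g] by simp
qed

lemma continuous_on_mob: "det2 g = 1 ==> continuous_on hyp3 (mob g)" unfolding mob_def mden_def
 by (intro continuous_intros) (use mden_pos in "force simp: mden_def simp del: of_real_add of_real_mult of_real_power")+

lemma inj_on_mob: "det2 g = 1 ==> inj_on (mob g) hyp3" by (rule inj_on_inverseI[of _ "mob (inv2 g)"]) (rule mob_inv2)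

section \<open>The action on hyperbolic space\<close>

definition omc :: complex where "omc = Complex (- 1/2) (sqrt 3/2)"
definition emb :: "eis => complex" where "emb x = Complex (of_int (etr x)/2) (of_int (eb x) * sqrt 3/2)"
definition cm :: "eis mat2 => complex mat2" where "cm g = Mat (emb (m11 g)) (emb (m12 g)) (emb (m21 g)) (emb (m22 g))"
definition act :: "eis mat2 => R3 => R3" where "act g = mob (cm g)"

lemma emb_ring [simp]: "emb 0 = 0" "emb 1 = 1" "emb (x + y) = emb x + emb y" "emb (x - y) = emb x - emb y"
 "emb (- x) = - emb x" "emb (x * y) = emb x * emb y" "emb (ecnj x) = cnj (emb x)" "emb om = omc"
proof -
 show "emb (x * y) = emb x * emb y"
 proof -
  have "sqrt 3 * sqrt 3 = (3 :: real)" by simp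
  hence s: "sqrt 3 * (sqrt 3 * u) = 3 * u" for u :: real unfolding mult.assoc[symmetric] by simp
  show ?thesis by (simp add: emb_def complex_eq_iff etr_def field_simps s)
 qed
qed (simp_all add: emb_def omc_def complex_eq_iff etr_def field_simps)

lemma cmod_emb: "(cmod (emb x))^2 = of_int (enorm x)"
proof -
 have "4 * (real_of_int (enorm x)) = of_int (4 * enorm x)" by simp
 also have "... = (of_int (etr x))^2 + 3 * (of_int (eb x))^2" unfolding enorm_4 by simp
 finally show ?thesis unfolding cmod_power2 by (simp add: emb_def power_mult_distrib power_divide)
qed

lemma emb_eq_0 [simp]: "emb x = 0 \<longleftrightarrow> x = 0"
proof -
 have "emb x = 0 \<longleftrightarrow> (cmod (emb x))^2 = 0" by simp
 thus ?thesis unfolding cmod_emb by simp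
qed

lemma cm_sel [simp]: "m11 (cm g) = emb (m11 g)" "m12 (cm g) = emb (m12 g)" "m21 (cm g) = emb (m21 g)" "m22 (cm g) = emb (m22 g)" by (simp_all add: cm_def)

lemma cm_mult: "cm (g * h) = cm g * cm h" and cm_1: "cm 1 = 1" and cm_minus: "cm (- g) = - cm g" and cm_inv2: "cm (inv2 g) = inv2 (cm g)" by (simp_all add: mat2_eq_iff)

lemma det2_cm: "g : Gam ==> det2 (cm g) = 1"
proof -
 assume "g : Gam"
 hence "emb (det2 g) = 1" using Gam_det by simp
 thus ?thesis by (simp add: det2_def)
qed

lemma act_hyp3: "g : Gam ==> x : hyp3 ==> act g x : hyp3" unfolding act_def by (intro mob_hyp3 det2_cm)

lemma act_1 [simp]: "act 1 x = x" by (simp add: act_def cm_1)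

lemma act_mult: "g : Gam ==> h : Gam ==> x : hyp3 ==> act (g * h) x = act g (act h x)"
 unfolding act_def cm_mult by (intro mob_mult det2_cm)

lemma mob_minus: "mob (- g) x = mob g x"
proof -
 have "mden (- g) x = mden g x" by (simp add: mden_def) (metis add_uminus_conv_diff minus_add_distrib norm_minus_cancel)
 thus ?thesis by (simp add: mob_def alg)
qed

lemma act_minus [simp]: "act (- g) = act g" by (simp add: act_def cm_minus mob_minus fun_eq_iff)

lemma act_inv: "g : Gam ==> x : hyp3 ==> act (inv2 g) (act g x) = x" "g : Gam ==> x : hyp3 ==> act g (act (inv2 g) x) = x"
 unfolding act_def cm_inv2 by (intro mob_inv2 det2_cm; assumption)+

lemma act_isometry: "g : Gam ==> x : hyp3 ==> y : hyp3 ==> hyp_dist (act g x) (act g y) = hyp_dist x y"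
 unfolding act_def by (intro mob_isometry det2_cm)

lemma continuous_on_act: "g : Gam ==> continuous_on hyp3 (act g)" unfolding act_def by (intro continuous_on_mob det2_cm)

lemma nf_act: "g : Gam ==> x : hyp3 ==>
  nf (act g x) (emb p) (emb q) = nf x (emb (p * m11 g + q * m21 g)) (emb (p * m12 g + q * m22 g))" unfolding act_def using nf_mob[OF _ det2_cm] by simp

lemma act_height: "g : Gam ==> x : hyp3 ==> act g x$3 = 1/nf x (emb (m21 g)) (emb (m22 g))"
proof -
 assume g: "g : Gam" "x : hyp3"
 have "nf (act g x) (emb 0) (emb 1) = 1/act g x$3" by (simp add: nf_def)
 hence "1/act g x$3 = nf x (emb (m21 g)) (emb (m22 g))" using nf_act[OF g, of 0 1] by simp
 thus ?thesis by (metis div_by_1 divide_divide_eq_right mult_1)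
qed

lemma act_tmat: "x : hyp3 ==> act (tmat b) x = pt (cz x + emb b) (x$3)" by (simp add: act_def tmat_def mob_def mden_def)

section \<open>Discreteness, freeness and the heights of orbits\<close>

lemma finite_eis: "finite {x. real_of_int (enorm x) <= B}"
proof (rule finite_subset)
 let ?K = "{- 4 * \<lfloor>B\<rfloor> .. 4 * \<lfloor>B\<rfloor>}"
 show "{x. real_of_int (enorm x) <= B} <= (%(a, b). Eis a b) ` (?K \<times> ?K)"
 proof
  fix x assume "x : {x. real_of_int (enorm x) <= B}"
  hence x: "enorm x <= \<lfloor>B\<rfloor>" by (simp add: le_floor_iff)
  have s: "\<bar>k\<bar> <= k^2" for k :: int
  proof (cases "k = 0")
   case False
   hence "\<bar>k\<bar> * 1 <= \<bar>k\<bar> * \<bar>k\<bar>" by (intro mult_left_mono) auto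
   thus ?thesis unfolding p2_sq abs_mult_self_eq by simp
  qed simp
  have "\<bar>etr x\<bar> + 3 * \<bar>eb x\<bar> <= 4 * enorm x" unfolding enorm_4 using s[of "etr x"] s[of "eb x"] by linarith
  hence "\<bar>ea x\<bar> <= 4 * \<lfloor>B\<rfloor>" "\<bar>eb x\<bar> <= 4 * \<lfloor>B\<rfloor>" using x unfolding etr_def by linarith+
  thus "x : (%(a, b). Eis a b) ` (?K \<times> ?K)" by (intro image_eqI[of _ _ "(ea x, eb x)"]) (auto simp: eis_eq_iff abs_le_iff)
 qed
qed simp

lemma finite_nf: assumes x: "x : hyp3" shows "finite {(c, d). nf x (emb c) (emb d) <= K}"
proof -
 define t z where "t = x$3" and "z = cz x"
 have t: "0 < t" using x by (simp add: t_def hyp3_pos)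
 define B where "B = (sqrt (K * t) + sqrt (K/t) * cmod z)^2"
 have "{(c, d). nf x (emb c) (emb d) <= K} <= {c. real_of_int (enorm c) <= K/t} \<times> {d. real_of_int (enorm d) <= B}"
 proof clarsimp
  fix c d assume "nf x (emb c) (emb d) <= K"
  hence a: "(cmod (emb c * z + emb d))^2 + (cmod (emb c))^2 * t^2 <= K * t" using t by (simp add: nf_def t_def z_def field_simps)
  hence "(cmod (emb c))^2 * t^2 <= K * t" using zero_le_power2[of "cmod (emb c * z + emb d)"] by linarith
  hence c: "(cmod (emb c))^2 <= K/t" using t by (simp add: field_simps p2_sq)
  have "(cmod (emb c * z + emb d))^2 <= K * t" using a by (smt (verit) mult_nonneg_nonneg zero_le_power2)
  hence "cmod (emb c * z + emb d) <= sqrt (K * t)" by (rule real_le_rsqrt)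
  moreover have "cmod (emb c) <= sqrt (K/t)" using c by (rule real_le_rsqrt)
  hence "cmod (emb c * z) <= sqrt (K/t) * cmod z" unfolding norm_mult by (rule mult_right_mono) simp
  moreover have "cmod (emb d) <= cmod (emb c * z + emb d) + cmod (emb c * z)" using norm_triangle_ineq4[of "emb c * z + emb d" "emb c * z"] by simp
  ultimately have "cmod (emb d) <= sqrt (K * t) + sqrt (K/t) * cmod z" by linarith
  hence "(cmod (emb d))^2 <= B" unfolding B_def by (intro power_mono) auto
  thus "real_of_int (enorm c) <= K/t & real_of_int (enorm d) <= B" using c by (simp add: cmod_emb)
 qed
 thus ?thesis using finite_eis finite_subset by blast
qed

text \<open>The form of \<open>act g x\<close> takes at (1, 0) and (0, 1) the values of the form of
  \<open>x\<close> at the two rows of \<open>g\<close>. A bound on the distance bounds both values,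
  and this leaves finitely many rows.\<close>

lemma finite_act:
 assumes x: "x : hyp3" and y: "y : hyp3" shows "finite {g : Gam. hyp_dist y (act g x) <= R}"
proof -
 define K where "K = exp R * max (nf y 1 0) (nf y 0 1)"
 let ?F = "{(c, d). nf x (emb c) (emb d) <= K}"
 have "{g : Gam. hyp_dist y (act g x) <= R} <= (%((a, b), (c, d)). Mat a b c d) ` (?F \<times> ?F)"
 proof clarify
  fix g assume g: "g : Gam" "hyp_dist y (act g x) <= R"
  have n: "nf (act g x) c d <= exp R * nf y c d" for c d using g(2) unfolding hyp_dist_commute[of y] hyp_dist_le_iff[OF act_hyp3[OF g(1) x] y] by blast
  have "exp R * nf y 1 0 <= K" "exp R * nf y 0 1 <= K" unfolding K_def by (intro mult_left_mono; simp)+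
  hence "nf (act g x) (emb 1) (emb 0) <= K" "nf (act g x) (emb 0) (emb 1) <= K" using n[of 1 0] n[of 0 1] by simp_all
  hence "nf x (emb (m11 g)) (emb (m12 g)) <= K" "nf x (emb (m21 g)) (emb (m22 g)) <= K" unfolding nf_act[OF g(1) x] by simp_all
  thus "g : (%((a, b), (c, d)). Mat a b c d) ` (?F \<times> ?F)" by (intro image_eqI[of _ _ "((m11 g, m12 g), (m21 g, m22 g))"]) simp_all
 qed
 thus ?thesis using finite_nf[OF x] by (meson finite_SigmaI finite_imageI finite_subset)
qed

text \<open>A fixed point makes \<open>g\<close> unitary for the form of that point, so its trace is
  \<open>2 Re v\<close> with \<open>|v| \<le> 1\<close>. By \<open>Gam_trace\<close> a real trace
  has absolute value at least 2, which forces \<open>c = 0\<close>; and a translation with a fixed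
  point is trivial.\<close>

lemma act_free:
 assumes g: "g : Gam" and x: "x : hyp3" and fixed: "act g x = x"
 shows "g = 1 | g = - 1"
proof -
 define z t where "z = cz x" and "t = x$3"
 define a b c d where "a = emb (m11 g)" and "b = emb (m12 g)" and "c = emb (m21 g)" and "d = emb (m22 g)"
 note abcd = this
 define v u where "v = c * z + d" and "u = a * z + b"
 have t: "0 < t" using x by (simp add: t_def hyp3_pos)
 have D0: "0 < mden (cm g) x" using mden_pos[OF x det2_cm[OF g]] .
 have "t/mden (cm g) x = t" using arg_cong[OF fixed, of "%w. w$3"] by (simp add: act_def mob_def t_def)
 hence D: "mden (cm g) x = 1" using t D0 by (simp add: field_simps)
 hence n: "(cmod v)^2 + (cmod c)^2 * t^2 = 1" by (simp add: mden_def v_def abcd z_def t_def)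
 have nc: "v * cnj v + c * cnj c * t^2 = 1"
 proof -
  have "complex_of_real ((cmod v)^2 + (cmod c)^2 * t^2) = 1" unfolding n by simp
  thus ?thesis unfolding complex_norm_square[symmetric] by simp
 qed
 have m: "u * cnj v + a * cnj c * t^2 = z" using arg_cong[OF fixed, of cz] D by (simp add: act_def mob_def v_def u_def abcd z_def t_def)
 have det: "a * d - b * c = 1" using det2_cm[OF g] by (simp add: det2_def abcd)
 \<comment> \<open>The upper left entry after conjugation by the translation that moves
   \<open>z\<close> to 0; unitarity makes it the conjugate of \<open>v\<close>.\<close>
 define a' where "a' = a - c * z"
 have "a' = cnj v"
 proof -
  have 1: "(u - z * v) * cnj v + a' * cnj c * t^2 = 0"
  proof -
   have "(u - z * v) * cnj v + a' * cnj c * t^2 = (u * cnj v + a * cnj c * t^2) - z * (v * cnj v + c * cnj c * t^2)" unfolding a'_def by (simp add: alg)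
   thus ?thesis unfolding m nc by simp
  qed
  have 2: "a' * v - (u - z * v) * c = 1"
  proof -
   have "a' * v - (u - z * v) * c = a * d - b * c" unfolding a'_def u_def v_def by (simp add: alg)
   thus ?thesis using det by simp
  qed
  have "a' = a' * (v * cnj v + c * cnj c * t^2)" unfolding nc by simp
  also have "... = cnj v * (a' * v - (u - z * v) * c) + c * ((u - z * v) * cnj v + a' * cnj c * t^2)" by (simp add: alg)
  finally show ?thesis unfolding 1 2 by simp
 qed
 hence tr: "a + d = of_real (2 * Re v)" unfolding a'_def v_def by (auto simp: complex_eq_iff)
 define k where "k = m11 g + m22 g"
 have ek: "emb k = of_real (2 * Re v)" using tr unfolding k_def abcd by simp
 hence "eb k = 0" by (auto simp: emb_def complex_eq_iff)
 hence k: "k = of_int (ea k)" by (simp add: eis_eq_iff)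
 have "2 * Re v = of_int (ea k)" using ek \<open>eb k = 0\<close> by (auto simp: emb_def complex_eq_iff etr_def)
 moreover have "1 < \<bar>ea k\<bar>" using Gam_trace[OF g, of "ea k"] k unfolding k_def by simp
 ultimately have "1 <= \<bar>Re v\<bar>" by linarith
 hence "1 <= (Re v)^2" by (metis abs_le_square_iff abs_one one_power2)
 hence "(cmod c)^2 * t^2 = 0" using n zero_le_power2[of "Im v"] mult_nonneg_nonneg[OF zero_le_power2[of "cmod c"] zero_le_power2[of t]] unfolding cmod_power2[of v] by linarith
 hence c0: "m21 g = 0" using t by (simp add: abcd)
 obtain e where e: "ev e" "g = tmat e | g = - tmat e" using Gam_P_cases[OF g c0] .
 hence "act (tmat e) x = x" using fixed by auto
 from arg_cong[OF this, of cz] have "emb e = 0" unfolding act_tmat[OF x] by simp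
 thus ?thesis using e(2) by (auto simp: tmat_def mat2_eq_iff)
qed

text \<open>A non-zero Eisenstein integer has absolute value at least 1. Consequently the horoball
  above height 1 meets its image only under the stabiliser of infinity.\<close>

lemma act_horoball:
 assumes g: "g : Gam" "m21 g ~= 0" and x: "x : hyp3"
 shows "act g x$3 * x$3 <= 1"
proof -
 have t: "0 < x$3" using x by (simp add: hyp3_pos)
 have "1 <= (cmod (emb (m21 g)))^2" unfolding cmod_emb using enorm_pos[OF g(2)] by simp
 hence "1 * (x$3)^2 <= (cmod (emb (m21 g)))^2 * (x$3)^2" by (rule mult_right_mono) simp
 hence "(x$3)^2 <= (cmod (emb (m21 g) * cz x + emb (m22 g)))^2 + (cmod (emb (m21 g)))^2 * (x$3)^2"
  using zero_le_power2[of "cmod (emb (m21 g) * cz x + emb (m22 g))"] by linarith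
 hence "x$3 <= nf x (emb (m21 g)) (emb (m22 g))" using t by (simp add: nf_def field_simps p2_sq)
 thus ?thesis unfolding act_height[OF g(1) x] using t by (simp add: field_simps)
qed

text \<open>Both coordinates in the basis 1, \<omega> are rounded to within 1/2. The gap between 3/4
  and 1 is what gives the height bound 1/2 in \<open>act_reduce_height\<close>.\<close>

lemma eis_round: obtains w where "(cmod (z - emb w))^2 <= 3/4"
proof -
 define y where "y = 2 * Im z/sqrt 3"
 define x where "x = Re z + y/2"
 define p q where "p = x - of_int (round x)" and "q = y - of_int (round y)"
 have b: "\<bar>p\<bar> <= 1/2" "\<bar>q\<bar> <= 1/2" using of_int_round_abs_le[of x] of_int_round_abs_le[of y] unfolding p_def q_def by linarith+
 have "Re z = x - y/2" "Im z = y * sqrt 3/2" unfolding x_def y_def by simp_all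
 hence "z - emb (Eis (round x) (round y)) = Complex (p - q/2) (q * sqrt 3/2)" unfolding p_def q_def by (simp add: emb_def complex_eq_iff etr_def field_simps)
 hence "(cmod (z - emb (Eis (round x) (round y))))^2 = p^2 - p * q + q^2"
  unfolding cmod_power2 by (simp add: power_mult_distrib power_divide power2_diff) (simp add: power_divide field_simps)?
 moreover have "p^2 <= (1/2)^2" "q^2 <= (1/2)^2" using b abs_le_square_iff[of p "1/2"] abs_le_square_iff[of q "1/2"] by simp_all
 moreover have "\<bar>p * q\<bar> <= 1/2 * (1/2)" unfolding abs_mult using b by (intro mult_mono) auto
 ultimately have "(cmod (z - emb (Eis (round x) (round y))))^2 <= 3/4" by (simp add: p2_sq abs_le_iff)
 thus thesis by (rule that)
qed

text \<open>Heights in the orbit are the inverse values of the form at bottom rows, and finitely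
  many rows reach the height of \<open>x\<close>.\<close>

lemma act_maximal:
 assumes x: "x : hyp3"
 obtains g where "g : Gn n" "!!h. h : Gn n ==> act h x$3 <= act g x$3"
proof -
 define F where "F = (%g. (m21 g, m22 g)) ` {g : Gn n. x$3 <= act g x$3}"
 have "F <= {(c, d). nf x (emb c) (emb d) <= 1/x$3}"
 proof
  fix v assume "v : F"
  then obtain g where g: "g : Gn n" "x$3 <= act g x$3" "v = (m21 g, m22 g)" unfolding F_def by blast
  have "x$3 <= 1/nf x (emb (m21 g)) (emb (m22 g))" using g(2) unfolding act_height[OF Gn_Gam[OF g(1)] x] .
  thus "v : {(c, d). nf x (emb c) (emb d) <= 1/x$3}" using g(3) hyp3_pos[OF x] nf_nonneg[OF x, of "emb (m21 g)" "emb (m22 g)"]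
   by (cases "nf x (emb (m21 g)) (emb (m22 g)) = 0") (simp_all add: field_simps)
 qed
 hence f: "finite F" using finite_nf[OF x] finite_subset by blast
 have ne: "F ~= {}" unfolding F_def using Gn_1[of n] by force
 define h where "h = (%(c, d). 1/nf x (emb c) (emb d))"
 obtain v where v: "v : F" "!!w. w : F ==> h w <= h v"
 proof -
  have "Max (h ` F) : h ` F" using f ne by simp
  then obtain v where "v : F" "Max (h ` F) = h v" by blast
  thus thesis using that[of v] f Max_ge[of "h ` F"] by (metis finite_imageI imageI)
 qed
 obtain g where g: "g : Gn n" "x$3 <= act g x$3" "v = (m21 g, m22 g)" using v(1) unfolding F_def by blast
 have hg: "h (m21 k, m22 k) = act k x$3" if "k : Gn n" for k unfolding h_def using act_height[OF Gn_Gam[OF that] x] by simp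
 show thesis
 proof (rule that[OF g(1)])
  fix k assume k: "k : Gn n"
  show "act k x$3 <= act g x$3"
  proof (cases "x$3 <= act k x$3")
   case True
   hence "(m21 k, m22 k) : F" unfolding F_def using k by blast
   thus ?thesis using v(2) hg[OF k] hg[OF g(1)] g(3) by metis
  qed (use g(2) in simp)
 qed
qed

text \<open>At a highest orbit point \<open>y\<close> an element whose pole is the nearest integer
  \<open>w\<close> cannot raise the height, so \<open>|cz y - w|^2 + (y$3)^2 \<ge> 1\<close>. By
  \<open>Gn_pole\<close> every integer is a pole of an element of \<open>Gn n\<close>, and so one
  cusp suffices.\<close>

lemma act_reduce_height:
 assumes x: "x : hyp3" and n: "odd n"
 obtains g where "g : Gn n" "1/2 <= act g x$3"
proof -
 obtain g where g: "g : Gn n" "!!h. h : Gn n ==> act h x$3 <= act g x$3" using act_maximal[OF x] by blast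
 define y where "y = act g x"
 have y: "y : hyp3" unfolding y_def by (rule act_hyp3[OF Gn_Gam[OF g(1)] x])
 obtain w where w: "(cmod (cz y - emb w))^2 <= 3/4" using eis_round by blast
 obtain k where k: "k : Gn n" "enorm (m21 k) = 1" "m22 k = - (m21 k * w)" by (rule Gn_pole[OF n])
 have "act k y$3 <= y$3" using g(2)[OF Gn_mult[OF k(1) g(1)]] act_mult[OF Gn_Gam[OF k(1)] Gn_Gam[OF g(1)] x] unfolding y_def by simp
 moreover have "act k y$3 = y$3/((cmod (cz y - emb w))^2 + (y$3)^2)"
 proof -
  have u: "(cmod (emb (m21 k)))^2 = 1" unfolding cmod_emb k(2) by simp
  have "emb (m21 k) * cz y + emb (m22 k) = emb (m21 k) * (cz y - emb w)" unfolding k(3) by (simp add: alg)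
  thus ?thesis unfolding act_height[OF Gn_Gam[OF k(1)] y] nf_def by (simp add: norm_mult power_mult_distrib u)
 qed
 ultimately have "y$3/((cmod (cz y - emb w))^2 + (y$3)^2) <= y$3" by simp
 moreover have "0 < (cmod (cz y - emb w))^2 + (y$3)^2" using hyp3_pos[OF y] by (intro add_nonneg_pos) auto
 ultimately have "y$3 * 1 <= y$3 * ((cmod (cz y - emb w))^2 + (y$3)^2)" by (simp add: divide_le_eq)
 hence "1 <= (cmod (cz y - emb w))^2 + (y$3)^2" using hyp3_pos[OF y] mult_le_cancel_left_pos by blast
 moreover have "(1/2)^2 = (1/4 :: real)" by (simp add: power_divide)
 ultimately have "(1/2)^2 <= (y$3)^2" using w by linarith
 hence "1/2 <= y$3" using hyp3_pos[OF y] by (simp add: abs_le_square_iff[symmetric])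
 thus thesis using that[OF g(1)] unfolding y_def by blast
qed

text \<open>The sign of \<open>mob g\<close> is constant on the connected set \<open>hyp3\<close>,
  and its square is 1. Unipotent matrices are squares of unipotent ones and generate, which leads to
  \<open>lsg_mob\<close>.\<close>

lemma lsg_mob_square:
 assumes g: "det2 g = 1" and x: "x : hyp3" shows "lsg True (mob (g * g)) x"
proof -
 have c: "continuous_on hyp3 (mob g)" "inj_on (mob g) hyp3" using continuous_on_mob inj_on_mob g by auto
 obtain b where b: "lsg b (mob g) x" using lsg_cases[OF hyp3_open x c] by blast
 have "lsg b (mob g) (mob g x)" by (rule lsg_constant[OF hyp3_open convex_connected[OF hyp3_convex] c(1) _ b x mob_hyp3[OF x g]]) (use c hyp3_open in blast)
 hence "lsg True (mob g o mob g) x" using lsg_comp[OF b] by fastforce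
 thus ?thesis by (rule lsg_cong[OF _ hyp3_open x]) (simp add: mob_mult g)
qed

lemma lsg_mob:
 assumes g: "det2 g = 1" and x: "x : hyp3" shows "lsg True (mob g) x"
proof -
 define U where "U = (%s. Mat 1 s 0 (1 :: complex))"
 define L where "L = (%s. Mat 1 0 s (1 :: complex))"
 have dU: "det2 (U s) = 1" and dL: "det2 (L s) = 1" for s by (simp_all add: U_def L_def det2_def)
 have lU: "lsg True (mob (U s)) x" and lL: "lsg True (mob (L s)) x" if "x : hyp3" for s x using lsg_mob_square[OF dU[of "s/2"] that] lsg_mob_square[OF dL[of "s/2"] that]
  by (simp_all add: U_def L_def times_mat2_def)
 have comp: "lsg True (mob (h * k)) x" if "det2 h = 1" "det2 k = 1" "lsg True (mob h) (mob k x)" "lsg True (mob k) x" "x : hyp3" for h k x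
 proof -
  have "lsg True (mob h o mob k) x" using lsg_comp[OF that(4,3)] by simp
  thus ?thesis by (rule lsg_cong[OF _ hyp3_open that(5)]) (simp add: mob_mult that)
 qed
 have main: "lsg True (mob h) x" if h: "det2 h = 1" "m21 h ~= 0" and x: "x : hyp3" for h x
 proof -
  define a b c d where "a = m11 h" "b = m12 h" "c = m21 h" "d = m22 h"
  have ad: "a * d = 1 + b * c" using h(1) by (simp add: det2_def a_b_c_d_def diff_eq_eq)
  have e: "h = U ((a - 1)/c) * (L c * U ((d - 1)/c))" using h(2) ad by (simp add: U_def L_def mat2_eq_iff a_b_c_d_def[symmetric] field_simps)
  have d: "det2 (L c * U ((d - 1)/c)) = 1" by (simp add: dU dL)
  have "lsg True (mob (L c * U ((d - 1)/c))) x" by (rule comp[OF dL dU lL[OF mob_hyp3[OF x dU]] lU[OF x] x])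
  thus ?thesis unfolding e by (rule comp[OF dU d lU[OF mob_hyp3[OF x d]] _ x])
 qed
 show ?thesis
 proof (cases "m21 g = 0")
  case False thus ?thesis using main g x by blast
 next
  case True
  have e: "g = (g * L 1) * L (- 1)" by (simp add: L_def mat2_eq_iff)
  have "m22 g ~= 0" using g True by (auto simp: det2_def)
  hence "m21 (g * L 1) ~= 0" using True by (simp add: L_def)
  hence "lsg True (mob (g * L 1)) (mob (L (- 1)) x)" using main g dL mob_hyp3[OF x dL] by simp
  thus ?thesis using comp[of "g * L 1" "L (- 1)" x] g dL lL x e by simp
 qed
qed

lemma lsg_act: "g : Gam ==> x : hyp3 ==> lsg True (act g) x" unfolding act_def by (intro lsg_mob det2_cm)

definition sg :: "R3 => R3" where "sg x = pt (cnj (cz x) + omc) (x$3)"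

lemma sg_hyp3 [simp]: "sg x : hyp3 \<longleftrightarrow> x : hyp3" by (simp add: sg_def hyp3_def)

lemma sg_height [simp]: "sg x$3 = x$3" by (simp add: sg_def)

definition sgi :: "R3 => R3" where "sgi x = pt (cnj (cz x - omc)) (x$3)"

lemma sgi [simp]: "sgi (sg x) = x" "sg (sgi x) = x" "sgi x : hyp3 \<longleftrightarrow> x : hyp3" "sgi x$3 = x$3" by (simp_all add: sg_def sgi_def hyp3_def)

lemma lsg_sg: "lsg False sg x"
proof -
 have "lsg False ((%v. v + pt omc 0) o refl2) x" using lsg_comp[OF lsg_refl2 lsg_translation] by simp
 thus ?thesis by (rule lsg_cong[where T = UNIV]) (simp_all add: sg_def refl2_def pt_eq_iff cz_def complex_eq_iff)
qed

lemma sg_act: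
 assumes g: "g : Gam" and x: "x : hyp3"
 shows "sg (act g x) = act (smat g) (sg x)"
proof -
 define T where "T = (%s. Mat 1 s 0 (1 :: complex))"
 define C where "C = Mat (cnj (emb (m11 g))) (cnj (emb (m12 g))) (cnj (emb (m21 g))) (cnj (emb (m22 g)))"
 have mT: "mob (T s) y = pt (cz y + s) (y$3)" for s y by (simp add: T_def mob_def mden_def)
 have dT: "det2 (T s) = 1" for s by (simp add: T_def det2_def)
 have "det2 C = cnj (det2 (cm g))" by (simp add: det2_def C_def)
 hence dC: "det2 C = 1" using det2_cm[OF g] by simp
 define y where "y = pt (cnj (cz x)) (x$3)"
 have y: "y : hyp3" using x by (simp add: y_def hyp3_pos)
 have "cm (smat g) = T omc * (C * T (- omc))" by (simp add: mat2_eq_iff T_def C_def alg)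
 moreover have sx: "sg x : hyp3" using x by simp
 ultimately have "act (smat g) (sg x) = mob (T omc) (mob C (mob (T (- omc)) (sg x)))" unfolding act_def using dT dC mob_hyp3[OF sx] by (simp add: mob_mult)
 also have "mob (T (- omc)) (sg x) = y" by (simp add: mT sg_def y_def)
 also have "mob C y = pt (cnj (cz (act g x))) (act g x$3)"
 proof -
  have "cmod (cnj u * cnj v + cnj w) = cmod (u * v + w)" for u v w by (metis complex_cnj_add complex_cnj_mult complex_mod_cnj)
  hence "mden C y = mden (cm g) x" by (simp add: mden_def C_def y_def)
  thus ?thesis by (simp add: mob_def act_def C_def y_def)
 qed
 finally show ?thesis by (simp add: mT sg_def)
qed

subsection \<open>Hyperbolic balls\<close>

definition hball :: "R3 => real => R3 set" where "hball x r = {y : hyp3. hyp_dist x y < r}"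
definition hcball :: "R3 => real => R3 set" where "hcball x r = {y : hyp3. hyp_dist x y <= r}"
text \<open>The Euclidean centre of a hyperbolic ball, whose Euclidean radius is
  \<open>x$3 * sinh r\<close>; see \<open>hball_eq\<close>.\<close>

definition hcenter :: "R3 => real => R3" where "hcenter x r = pt (cz x) (x$3 * cosh r)"

lemma hcosh_hcenter:
 assumes "x : hyp3" "0 < y$3"
 shows "2 * x$3 * y$3 * (cosh r - hcosh x y) = (x$3 * sinh r)^2 - (dist (hcenter x r) y)^2"
proof -
 define A where "A = (cmod (cz x - cz y))^2"
 have "2 * x$3 * y$3 * hcosh x y = 2 * x$3 * y$3 + (A + (x$3 - y$3)^2)"
 proof -
  define k where "k = 2 * x$3 * y$3"
  have "k ~= 0" using assms by (simp add: hyp3_def k_def)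
  hence "k * (1 + q/k) = k + q" for q by (simp add: distrib_left)
  thus ?thesis unfolding hcosh_def dist_pt A_def k_def .
 qed
 moreover have "(dist (hcenter x r) y)^2 = A + (x$3 * cosh r - y$3)^2" unfolding dist_pt A_def hcenter_def by simp
 moreover have "(cosh r)^2 = (sinh r)^2 + 1" by (simp add: cosh_square_eq)
 hence "(x$3 * cosh r)^2 = (x$3 * sinh r)^2 + (x$3)^2" by (simp add: power_mult_distrib distrib_left)
 ultimately show ?thesis unfolding right_diff_distrib power2_diff by (simp add: alg)
qed

lemma hyp_dist_less_iff_hcosh:
 assumes "x : hyp3" "y : hyp3" "0 <= r"
 shows "hyp_dist x y < r \<longleftrightarrow> hcosh x y < cosh r" "hyp_dist x y <= r \<longleftrightarrow> hcosh x y <= cosh r"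
 using cosh_real_nonneg_less_iff[OF hyp_dist_nonneg[OF assms(1,2)] assms(3)]
  cosh_real_nonneg_le_iff[OF hyp_dist_nonneg[OF assms(1,2)] assms(3)] cosh_hyp_dist[OF assms(1,2)] by simp_all

lemma hcenter_ball_hyp3:
 assumes "x : hyp3" "dist (hcenter x r) y <= x$3 * sinh r"
 shows "y : hyp3"
proof -
 have "\<bar>(hcenter x r - y)$3\<bar> <= x$3 * sinh r" using assms(2) component_le_norm_cart[of "hcenter x r - y" 3] by (simp add: dist_norm)
 hence "x$3 * cosh r - x$3 * sinh r <= y$3" by (simp add: hcenter_def)
 moreover have "0 < x$3 * (cosh r - sinh r)" using assms(1) by (simp add: hyp3_def cosh_minus_sinh)
 ultimately show ?thesis by (simp add: hyp3_def right_diff_distrib)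
qed

lemma hball_eq:
 assumes x: "x : hyp3" and r: "0 < r"
 shows "hball x r = ball (hcenter x r) (x$3 * sinh r)" "hcball x r = cball (hcenter x r) (x$3 * sinh r)"
proof -
 have s: "0 <= x$3 * sinh r" using x r by (simp add: hyp3_def)
 have b: "(hyp_dist x y < r \<longleftrightarrow> dist (hcenter x r) y < x$3 * sinh r) & (hyp_dist x y <= r \<longleftrightarrow> dist (hcenter x r) y <= x$3 * sinh r)"
  if y: "y : hyp3" for y
 proof -
  have k: "0 < 2 * x$3 * y$3" using x y by (simp add: hyp3_def)
  have "hcosh x y < cosh r \<longleftrightarrow> 0 < 2 * x$3 * y$3 * (cosh r - hcosh x y)"
   "hcosh x y <= cosh r \<longleftrightarrow> 0 <= 2 * x$3 * y$3 * (cosh r - hcosh x y)"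
   using mult_less_cancel_left_pos[OF k, of 0 "cosh r - hcosh x y"] mult_le_cancel_left_pos[OF k, of 0 "cosh r - hcosh x y"] by simp_all
  moreover have "dist (hcenter x r) y < x$3 * sinh r \<longleftrightarrow> (dist (hcenter x r) y)^2 < (x$3 * sinh r)^2"
   "dist (hcenter x r) y <= x$3 * sinh r \<longleftrightarrow> (dist (hcenter x r) y)^2 <= (x$3 * sinh r)^2"
   using s abs_le_square_iff[of "dist (hcenter x r) y" "x$3 * sinh r"] abs_le_square_iff[of "x$3 * sinh r" "dist (hcenter x r) y"] by (simp_all add: not_le[symmetric])
  ultimately show ?thesis unfolding hyp_dist_less_iff_hcosh[OF x y less_imp_le[OF r]] hcosh_hcenter[OF x hyp3_pos[OF y], of r] by linarith
 qed
 show "hball x r = ball (hcenter x r) (x$3 * sinh r)" using b hcenter_ball_hyp3[OF x, of r] unfolding hball_def by (auto simp: mem_ball less_imp_le)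
 show "hcball x r = cball (hcenter x r) (x$3 * sinh r)" using b hcenter_ball_hyp3[OF x, of r] unfolding hcball_def by auto
qed

lemma hball_sub: "hball x r <= hcball x r" "hcball x r <= hyp3" "hball x r <= hyp3" by (auto simp: hball_def hcball_def)

lemma hball_center: "x : hyp3 ==> 0 < r ==> x : hball x r" using hyp_dist_0_iff[of x x] by (simp add: hball_def)

lemma open_hball: "x : hyp3 ==> open (hball x r)"
proof (cases "0 < r")
 case False
 assume "x : hyp3"
 hence "hball x r = {}" using hyp_dist_nonneg False by (force simp: hball_def)
 thus ?thesis by simp
qed (simp add: hball_eq)

lemma compact_hcball: "x : hyp3 ==> 0 < r ==> compact (hcball x r)" by (simp add: hball_eq)

lemma hcball_small:
 assumes x: "x : hyp3" and U: "open U" "x : U" and B: "0 < B"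
 obtains r where "0 < r" "hcball x r <= U" "r <= B"
proof -
 obtain e where e: "0 < e" "ball x e <= U" using U openE by blast
 have t: "0 < x$3" using x by (simp add: hyp3_pos)
 \<comment> \<open>The hyperbolic ball lies within Euclidean distance
   \<open>x$3 * (exp r - 1)\<close> of \<open>x\<close>, which for this radius is
   \<open>e / 2\<close>.\<close>
 define r0 where "r0 = ln (1 + e/(2 * x$3))"
 have r0: "0 < r0" unfolding r0_def using e t by (intro ln_gt_zero) simp
 define r where "r = min r0 B"
 have r: "0 < r" "r <= r0" "r <= B" using r0 B by (auto simp: r_def)
 have "hcball x r <= ball x e"
 proof
  fix y assume "y : hcball x r"
  hence d: "dist (hcenter x r) y <= x$3 * sinh r" unfolding hball_eq(2)[OF x r(1)] by simp
  have "dist x (hcenter x r) = x$3 * (cosh r - 1)"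
  proof -
   have "(dist x (hcenter x r))^2 = (x$3 * (cosh r - 1))^2" unfolding dist_pt hcenter_def by (simp add: p2_sq alg)
   thus ?thesis using t cosh_real_ge_1[of r] by (simp add: power2_eq_iff_nonneg)
  qed
  hence "dist x y <= x$3 * (cosh r - 1) + x$3 * sinh r" using d dist_triangle[of x y "hcenter x r"] by linarith
  also have "... = x$3 * (exp r - 1)" unfolding cosh_plus_sinh[of r, symmetric] by (simp add: alg)
  also have "... <= x$3 * (exp r0 - 1)" using r(2) t by (intro mult_left_mono) auto
  also have "... = e/2" unfolding r0_def using e t by (simp add: add_pos_pos)
  finally show "y : ball x e" using e by simp
 qed
 thus thesis using that[OF r(1) _ r(3)] e(2) by blast
qed

lemma hcball_chain:
 assumes "x : hyp3" "y : hyp3" "z : hyp3" "hyp_dist x y < r" "hyp_dist y z < s"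
 shows "hyp_dist x z < r + s" using hyp_dist_triangle[OF assms(1-3)] assms(4,5) by linarith

lemma hyp_isometry_inj: "fj ` U <= hyp3 ==> U <= hyp3 ==> (!!x y. x : U ==> y : U ==> hyp_dist (fj x) (fj y) = hyp_dist x y) ==> inj_on fj U"
 by (rule inj_onI) (metis hyp_dist_0_iff image_subset_iff subsetD)

lemma hyp_isometry_continuous:
 assumes "fj ` U <= hyp3" "U <= hyp3" "!!x y. x : U ==> y : U ==> hyp_dist (fj x) (fj y) = hyp_dist x y"
 shows "continuous_on U fj" unfolding continuous_on_topological
proof (intro ballI allI impI)
 fix x B assume x: "x : U" and B: "open B" "fj x : B"
 have fx: "fj x : hyp3" "x : hyp3" using assms x by auto
 obtain r where r: "0 < r" "hcball (fj x) r <= B" using hcball_small[OF fx(1) B zero_less_one] by blast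
 show "EX A. open A & x : A & (ALL y:U. y : A --> fj y : B)"
 proof (intro exI conjI ballI impI)
  show "open (hball x r)" "x : hball x r" using open_hball[OF fx(2)] hball_center[OF fx(2) r(1)] .
  fix y assume "y : U" "y : hball x r"
  hence "hyp_dist (fj x) (fj y) <= r" "fj y : hyp3" using assms x by (auto simp: hball_def)
  thus "fj y : B" using r(2) by (auto simp: hcball_def)
 qed
qed

section \<open>Manifolds obtained by gluing open sets\<close>

definition ftop :: "R3 set => (R3 => 'a) => 'a topology" where
 "ftop S pr = topology (%U. U <= pr ` S & open (S Int pr -` U))"

text \<open>Points are identified by local homeomorphisms of sign 1, so that
  \<open>ftop S pr\<close> is locally Euclidean, second countable and oriented. The Hausdorff
  property is a separate matter and is proved for each quotient.\<close>

definition atlas :: "R3 set => (R3 => 'a) => bool" where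
 "atlas S pr \<longleftrightarrow> open S & (ALL x:S. EX B. open B & x : B & B <= S & inj_on pr B) &
   (ALL x:S. ALL y:S. pr x = pr y -->
    (EX gm T. open T & x : T & lsg True gm x & gm x = y & (ALL z:T. pr (gm z) = pr z)))"

lemma openin_ftop:
 assumes "open S" shows "openin (ftop S pr) U \<longleftrightarrow> U <= pr ` S & open (S Int pr -` U)"
proof -
 have "istopology (%U. U <= pr ` S & open (S Int pr -` U))" unfolding istopology_def
 proof (intro conjI allI impI)
  fix A B assume "A <= pr ` S & open (S Int pr -` A)" "B <= pr ` S & open (S Int pr -` B)"
  moreover have "S Int pr -` (A Int B) = (S Int pr -` A) Int (S Int pr -` B)" by blast
  ultimately show "A Int B <= pr ` S" "open (S Int pr -` (A Int B))" by auto
 next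
  fix K assume K: "ALL U:K. U <= pr ` S & open (S Int pr -` U)"
  have "S Int pr -` (\<Union>K) = (UN U:K. S Int pr -` U)" by blast
  moreover have "open (UN U:K. S Int pr -` U)" using K by (intro open_UN) blast
  ultimately show "open (S Int pr -` (\<Union>K))" by simp
  show "\<Union>K <= pr ` S" using K by blast
 qed
 thus ?thesis unfolding ftop_def by simp
qed

lemma topspace_ftop [simp]: "open S ==> topspace (ftop S pr) = pr ` S"
proof -
 assume S: "open S"
 have "S Int pr -` (pr ` S) = S" by blast
 hence "openin (ftop S pr) (pr ` S)" using S by (simp add: openin_ftop)
 thus ?thesis using openin_ftop[OF S] openin_subset openin_topspace by (metis subset_antisym)
qed

lemma chart_on_interior:
 assumes c: "chart_on X pr B" and x: "x : B" shows "pr x : manifold_interior X"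
proof -
 have B: "open B" "openin X (pr ` B)" using c by (auto simp: chart_on_def open_map_def)
 have "embedding_map (tos B) X pr" by (rule injective_open_imp_embedding_map) (use c in "auto simp: chart_on_def")
 from embedding_map_imp_homeomorphic_space[OF this]
 have "tos B homeomorphic_space subtopology X (pr ` B)" by simp
 hence "subtopology X (pr ` B) homeomorphic_space tos B" using homeomorphic_space_sym by blast
 moreover have "pr x : topspace X" using openin_subset[OF B(2)] x by blast
 ultimately show ?thesis unfolding manifold_interior_def using B x by blast
qed

context
 fixes S :: "R3 set" and pr :: "R3 => 'a"
 assumes at: "atlas S pr"
begin

lemma atlas_open: "open S" using at by (simp add: atlas_def)

lemma ftop_continuous: "continuous_map (tos S) (ftop S pr) pr" unfolding continuous_map_def
proof (intro conjI allI impI)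
 fix U assume "openin (ftop S pr) U"
 hence "open (S Int pr -` U)" using openin_ftop[OF atlas_open] by blast
 moreover have "{x : topspace (tos S). pr x : U} = S Int pr -` U" by auto
 ultimately show "openin (tos S) {x : topspace (tos S). pr x : U}" by (simp add: openin_open_eq atlas_open)
qed (simp add: atlas_open)

lemma ftop_open_image: assumes "open O'" "O' <= S" shows "openin (ftop S pr) (pr ` O')" unfolding openin_ftop[OF atlas_open]
proof (intro conjI)
 show "open (S Int pr -` pr ` O')"
 proof (subst open_subopen, intro ballI)
  fix x assume "x : S Int pr -` pr ` O'"
  then obtain y where x: "x : S" and y: "y : O'" "pr x = pr y" by blast
  hence "y : S" using assms(2) by blast
  then obtain gm T where g: "open T" "x : T" "lsg True gm x" "gm x = y" "ALL z:T. pr (gm z) = pr z" using at x y(2) unfolding atlas_def by metis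
  have "open (T Int S)" "x : T Int S" using g x atlas_open by auto
  obtain V where V: "open V" "x : V" "V <= T Int S" "continuous_on V gm" "inj_on gm V"
   by (rule lsg_obtain[OF g(3) \<open>open (T Int S)\<close> \<open>x : T Int S\<close>])
  have "open (V Int gm -` O')" using continuous_open_preimage[OF V(4,1) assms(1)] .
  moreover have "V Int gm -` O' <= S Int pr -` pr ` O'"
  proof
   fix z assume z: "z : V Int gm -` O'"
   hence "pr (gm z) = pr z" using g(5) V(3) by blast
   hence "pr z : pr ` O'" using z by (metis IntD2 imageI vimageD)
   thus "z : S Int pr -` pr ` O'" using z V(3) by blast
  qed
  ultimately show "EX T. open T & x : T & T <= S Int pr -` pr ` O'" using V(2) g(4) y(1) by blast
 qed
qed (use assms in blast)

lemma ftop_open_map: "open_map (tos S) (ftop S pr) pr" unfolding open_map_def using ftop_open_image by (simp add: openin_open_eq atlas_open)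

lemma ftop_chart: "open B ==> B <= S ==> inj_on pr B ==> chart_on (ftop S pr) pr B" unfolding chart_on_def open_map_def
 using continuous_map_from_subtopology_mono[OF ftop_continuous] ftop_open_image by (simp add: openin_open_eq) (meson subset_trans)

lemma ftop_interior: "manifold_interior (ftop S pr) = pr ` S"
proof
 show "pr ` S <= manifold_interior (ftop S pr)"
 proof (rule image_subsetI)
  fix x assume x: "x : S"
  then obtain B where B: "open B" "x : B" "B <= S" "inj_on pr B" using at unfolding atlas_def by blast
  show "pr x : manifold_interior (ftop S pr)" by (rule chart_on_interior[OF ftop_chart[OF B(1,3,4)] B(2)])
 qed
qed (auto simp: manifold_interior_def atlas_open)

lemma ftop_oriented_cover: "oriented_cover (ftop S pr) pr S" unfolding oriented_cover_def ftop_interior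
proof (intro conjI ballI)
 fix x assume "x : S"
 then obtain B where "open B" "x : B" "B <= S" "inj_on pr B" using at unfolding atlas_def by blast
 thus "EX B. x : B & B <= S & chart_on (ftop S pr) pr B" using ftop_chart by (intro exI[of _ B]) auto
qed (use at in "auto simp: atlas_def")

lemma ftop_second_countable: "second_countable (ftop S pr)"
proof (rule second_countable_open_map_image[OF ftop_continuous ftop_open_map])
 have "second_countable (euclidean :: R3 topology)"
 proof -
  obtain \<B> :: "R3 set set" where B: "countable \<B>" "!!C. C : \<B> ==> open C" "!!S. open S ==> EX U. U <= \<B> & S = \<Union>U"
   using univ_second_countable by metis
  have "EX V:\<B>. x : V & V <= U" if "open U" "x : U" for U x using B(3)[OF that(1)] that(2) by blast
  thus ?thesis unfolding second_countable_def by (intro exI[of _ \<B>]) (use B(1,2) in auto)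
 qed
 thus "second_countable (tos S)" by (rule second_countable_subtopology)
qed (simp add: atlas_open)

end

text \<open>Charts in \<open>three_manifold\<close> are open in the half-space, so a small ball is
  lifted until the height of its centre equals its radius.\<close>

lemma interior_half_space_chart:
 assumes "x : manifold_interior X"
 shows "EX U V. openin X U & x : U & openin (tos half_space3) V & subtopology X U homeomorphic_space tos V"
proof -
 obtain U V f where U: "openin X U" "x : U" "open (V :: R3 set)" and f: "homeomorphic_map (subtopology X U) (tos V) f"
  using assms unfolding manifold_interior_def homeomorphic_space by blast
 have tU: "topspace (subtopology X U) = U" using openin_subset[OF U(1)] by (simp add: Int_absorb1)
 have fx: "f x : V" using homeomorphic_imp_surjective_map[OF f] U(2) unfolding tU by fastforce
 obtain r where r: "0 < r" "ball (f x) r <= V" using U(3) fx openE by blast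
 let ?B = "ball (f x) r"
 have hf: "f ` U = V" "inj_on f U" using homeomorphic_imp_surjective_map[OF f] homeomorphic_imp_injective_map[OF f] unfolding tU by simp_all
 define U' where "U' = {y : U. f y : ?B}"
 have "openin (tos V) ?B" using r U(3) by (simp add: openin_open_eq)
 hence "openin (subtopology X U) U'" using openin_continuous_map_preimage[OF homeomorphic_imp_continuous_map[OF f]] tU unfolding U'_def by metis
 hence U': "openin X U'" "U' <= U" using U(1) openin_open_subtopology by (blast, auto simp: U'_def)
 have "f ` U' = ?B" unfolding U'_def using hf r(2) by auto
 hence "homeomorphic_map (subtopology (subtopology X U) U') (subtopology (tos V) ?B) f"
  by (intro homeomorphic_map_subtopologies[OF f]) (use U'(2) r(2) tU in "simp add: Int_absorb1")
 hence 1: "subtopology X U' homeomorphic_space tos ?B" using U'(2) r(2) unfolding homeomorphic_space subtopology_subtopology by (metis inf.absorb2)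
 define w :: "R3" where "w = pt 0 (r - f x$3)"
 define V' where "V' = (%v. v + w) ` ?B"
 have "homeomorphic_maps (tos ?B) (tos V') (%v. v + w) (%v. v - w)" unfolding homeomorphic_maps_def V'_def continuous_map_subtopology_eu
  by (intro conjI ballI continuous_intros) auto
 hence 2: "tos ?B homeomorphic_space tos V'" unfolding homeomorphic_space_def by blast
 have oV: "open V'" unfolding V'_def using open_translation[of ?B w] by (simp add: add.commute)
 have "V' <= half_space3"
 proof
  fix v assume "v : V'"
  then obtain u where u: "v = u + w" "dist (f x) u < r" unfolding V'_def by auto
  have "\<bar>(f x - u)$3\<bar> < r" using u(2) component_le_norm_cart[of "f x - u" 3] by (simp add: dist_norm)
  thus "v : half_space3" using u(1) by (simp add: half_space3_def w_def)
 qed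
 hence "openin (tos half_space3) V'" using oV by (metis open_subset)
 moreover have "x : U'" using U(2) r(1) by (simp add: U'_def)
 ultimately show ?thesis using U'(1) homeomorphic_space_trans[OF 1 2] by blast
qed

lemma closed_manifoldI:
 assumes "atlas S pr" "S ~= {}" "connected_space (ftop S pr)" "Hausdorff_space (ftop S pr)"
 shows "three_manifold (ftop S pr)" "manifold_boundary (ftop S pr) = {}"
  and "is_orientation (ftop S pr) (cover_orientation (ftop S pr) pr S)"
proof -
 have o: "open S" using atlas_open[OF assms(1)] .
 show "three_manifold (ftop S pr)" unfolding three_manifold_def topspace_ftop[OF o] ftop_interior[OF assms(1), symmetric]
 proof (intro conjI ballI)
  show "manifold_interior (ftop S pr) ~= {}" using ftop_interior[OF assms(1)] assms(2) by simp
  fix x assume "x : manifold_interior (ftop S pr)"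
  from interior_half_space_chart[OF this]
  show "EX U V. openin (ftop S pr) U & x : U & openin (tos half_space3) V &
   subtopology (ftop S pr) U homeomorphic_space tos V" .
 qed (use assms ftop_second_countable[OF assms(1)] in auto)
 show "manifold_boundary (ftop S pr) = {}" unfolding manifold_boundary_def using ftop_interior[OF assms(1)] o by simp
 show "is_orientation (ftop S pr) (cover_orientation (ftop S pr) pr S)" using is_orientation_cover[OF Hausdorff_imp_t1_space[OF assms(4)] ftop_oriented_cover[OF assms(1)]] .
qed

section \<open>The hyperbolic manifolds\<close>

text \<open>An arbitrary injection, used to turn a point of each orbit into a point of the quotient.\<close>

definition code :: "R3 => real" where "code = (SOME f. inj f & (ALL x. 0 < f x))"

lemma code: "inj code" "0 < code x"
proof -
 have "|UNIV \<times> UNIV :: (real \<times> real) set| =o |UNIV :: real set|" by (rule card_of_Times_same_infinite) (rule infinite_UNIV_char_0)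
 then obtain f :: "real \<times> real => real" where f: "inj f" unfolding card_of_ordIso[symmetric] bij_betw_def by auto
 have "inj (%x :: R3. exp (f (x$1, f (x$2, x$3))))" by (rule injI) (auto dest!: injD[OF f] simp: vec_eq_iff forall_3)
 hence "EX h :: R3 => real. inj h & (ALL x. 0 < h x)" by (intro exI[of _ "%x. exp (f (x$1, f (x$2, x$3)))"]) simp
 from someI_ex[OF this, folded code_def] show "inj code" "0 < code x" by auto
qed

text \<open>The points of all the manifolds are real numbers. Orbits receive positive codes, which
  keeps the negative numbers free for the core circle of the filling, see
  \<open>kap\<close>.\<close>

definition q :: "nat => R3 => real" where "q n x = code (SOME y. EX g:Gn n. y = act g x)"

lemma Gn_act:
 assumes "g : Gn n" "x : hyp3"
 shows "act g x : hyp3" "h : Gn n ==> act (h * g) x = act h (act g x)" "act (inv2 g) (act g x) = x"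
 using act_hyp3[OF Gn_Gam[OF assms(1)] assms(2)] act_mult[OF Gn_Gam Gn_Gam[OF assms(1)] assms(2)]
  act_inv(1)[OF Gn_Gam[OF assms(1)] assms(2)] by auto

lemma q_eq_iff:
 assumes x: "x : hyp3" and y: "y : hyp3"
 shows "q n x = q n y \<longleftrightarrow> (EX g:Gn n. y = act g x)"
proof
 define O' where "O' = (%x y. EX g:Gn n. y = act g x)"
 have ex: "EX z. O' w z" for w unfolding O'_def using Gn_1 by blast
 assume "q n x = q n y"
 hence e: "(SOME z. O' x z) = (SOME z. O' y z)" unfolding q_def O'_def by (rule injD[OF code(1)])
 obtain g where g: "g : Gn n" "(SOME z. O' x z) = act g x" using someI_ex[OF ex, of x] unfolding O'_def by blast
 obtain h where h: "h : Gn n" "(SOME z. O' y z) = act h y" using someI_ex[OF ex, of y] unfolding O'_def by blast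
 have "y = act (inv2 h) (act h y)" using Gn_act(3)[OF h(1) y] by simp
 also have "act h y = act g x" using g h e by simp
 also have "act (inv2 h) (act g x) = act (inv2 h * g) x" by (rule Gn_act(2)[OF g(1) x Gn_inv[OF h(1)], symmetric])
 finally show "EX g:Gn n. y = act g x" using Gn_mult[OF Gn_inv[OF h(1)] g(1)] by blast
next
 assume "EX g:Gn n. y = act g x"
 then obtain g where g: "g : Gn n" "y = act g x" by blast
 have "(EX h:Gn n. z = act h x) \<longleftrightarrow> (EX h:Gn n. z = act h y)" for z
 proof
  assume "EX h:Gn n. z = act h x"
  then obtain h where h: "h : Gn n" "z = act h x" by blast
  have "act (h * inv2 g) y = act h (act (inv2 g) y)" by (rule Gn_act(2)[OF Gn_inv[OF g(1)] y h(1)])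
  also have "... = z" unfolding g(2) Gn_act(3)[OF g(1) x] by (rule h(2)[symmetric])
  finally show "EX h:Gn n. z = act h y" using Gn_mult[OF h(1) Gn_inv[OF g(1)]] by (intro bexI[of _ "h * inv2 g"]) auto
 next
  assume "EX h:Gn n. z = act h y"
  then obtain h where h: "h : Gn n" "z = act h y" by blast
  have "act (h * g) x = z" unfolding Gn_act(2)[OF g(1) x h(1)] g(2)[symmetric] by (rule h(2)[symmetric])
  thus "EX h:Gn n. z = act h x" using Gn_mult[OF h(1) g(1)] by (intro bexI[of _ "h * g"]) auto
 qed
 thus "q n x = q n y" unfolding q_def by simp
qed

lemma q_pos: "0 < q n x" unfolding q_def by (rule code(2))

lemma q_act: "g : Gn n ==> x : hyp3 ==> q n (act g x) = q n x" using q_eq_iff[OF _ act_hyp3[OF Gn_Gam]] by metis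

lemma injectivity_radius:
 assumes x: "x : hyp3"
 obtains r where "0 < r" "r <= 1"
  "!!y z g. y : hball x r ==> z : hball x r ==> g : Gam ==> hyp_dist y (act g z) < 2 * r ==> g = 1 | g = - 1"
proof -
 define F where "F = {g : Gam. hyp_dist x (act g x) <= 4} - {1, - 1}"
 have F: "finite F" unfolding F_def using finite_act[OF x x] by blast
 have pos: "0 < hyp_dist x (act g x)" if "g : F" for g
 proof -
  have g: "g : Gam" "~ (g = 1 | g = - 1)" using that by (auto simp: F_def)
  hence "act g x ~= x" using act_free[OF g(1) x] by blast
  hence "hyp_dist x (act g x) ~= 0" unfolding hyp_dist_0_iff[OF x act_hyp3[OF g(1) x]] by simp
  thus ?thesis using hyp_dist_nonneg[OF x act_hyp3[OF g(1) x]] by simp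
 qed
 \<comment> \<open>A quarter of the smallest displacement, since the triangle inequality below adds
   up \<open>r + 2 r + r\<close>. Displacements above 4 are harmless because
   \<open>r \<le> 1\<close>.\<close>
 define r where "r = Min (insert 1 ((%g. hyp_dist x (act g x)/4) ` F))"
 have r: "0 < r" "r <= 1" unfolding r_def using F pos by auto
 have rF: "4 * r <= hyp_dist x (act g x)" if "g : F" for g
 proof -
  have "r <= hyp_dist x (act g x)/4" unfolding r_def using F that by (intro Min_le) auto
  thus ?thesis by simp
 qed
 show thesis
 proof (rule that[OF r])
  fix y z g assume y: "y : hball x r" and z: "z : hball x r" and g: "g : Gam" and d: "hyp_dist y (act g z) < 2 * r"
  have h: "y : hyp3" "z : hyp3" "hyp_dist x y < r" "hyp_dist x z < r" using y z by (auto simp: hball_def)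
  have gx: "act g x : hyp3" "act g z : hyp3" using act_hyp3[OF g] x h by auto
  have "hyp_dist (act g z) (act g x) < r" using act_isometry[OF g h(2) x] h(4) by (simp add: hyp_dist_commute)
  hence "hyp_dist y (act g x) < 2 * r + r" by (rule hcball_chain[OF h(1) gx(2,1) d])
  hence l: "hyp_dist x (act g x) < r + (2 * r + r)" by (rule hcball_chain[OF x h(1) gx(1) h(3)])
  show "g = 1 | g = - 1"
  proof (rule ccontr)
   assume "~ (g = 1 | g = - 1)"
   hence "g : F" using g l r unfolding F_def by simp
   thus False using rF l by fastforce
  qed
 qed
qed

lemma atlas_q: "atlas hyp3 (q n)" unfolding atlas_def
proof (intro conjI ballI impI)
 show "open hyp3" by (rule hyp3_open)
next
 fix x assume x: "x : hyp3"
 obtain r where r: "0 < r" "!!y z g. y : hball x r ==> z : hball x r ==> g : Gam ==> hyp_dist y (act g z) < 2 * r ==> g = 1 | g = - 1"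
  using injectivity_radius[OF x] by metis
 have "inj_on (q n) (hball x r)"
 proof (rule inj_onI)
  fix y z assume y: "y : hball x r" and z: "z : hball x r" and e: "q n y = q n z"
  have h: "y : hyp3" "z : hyp3" using y z by (simp_all add: hball_def)
  obtain g where g: "g : Gn n" "z = act g y" using e q_eq_iff[OF h] by blast
  have "hyp_dist z (act g y) < 2 * r" using g(2) hyp_dist_0_iff[OF h(2) h(2)] r(1) by simp
  thus "y = z" using r(2)[OF z y Gn_Gam[OF g(1)]] g(2) by auto
 qed
 thus "EX B. open B & x : B & B <= hyp3 & inj_on (q n) B" using open_hball[OF x] hball_center[OF x r(1)] hball_sub(3) by blast
next
 fix x y assume x: "x : hyp3" and y: "y : hyp3" and "q n x = q n y"
 then obtain g where g: "g : Gn n" "y = act g x" using q_eq_iff by blast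
 thus "EX gm T. open T & x : T & lsg True gm x & gm x = y & (ALL z:T. q n (gm z) = q n z)"
  using lsg_act[OF Gn_Gam[OF g(1)] x] hyp3_open x q_act[OF g(1)] by blast
qed

text \<open>The distance of two orbits. The maximum with 0 settles arguments outside the quotient,
  where the infimum is that of the empty set; \<open>Metric_space\<close> demands non-negativity
  there as well.\<close>

definition wd :: "nat => real => real => real" where
 "wd n p p' = max 0 (Inf {hyp_dist x y | x y. x : hyp3 & y : hyp3 & q n x = p & q n y = p'})"

lemma wd_le: assumes "x : hyp3" "y : hyp3" shows "wd n (q n x) (q n y) <= hyp_dist x y"
proof -
 have "Inf {hyp_dist x' y' |x' y'. x' : hyp3 & y' : hyp3 & q n x' = q n x & q n y' = q n y} <= hyp_dist x y"
  by (rule cInf_lower) (use assms hyp_dist_nonneg in "auto intro!: bdd_belowI[of _ 0]")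
 thus ?thesis using hyp_dist_nonneg[OF assms] by (simp add: wd_def)
qed

text \<open>Finitely many orbit points of \<open>y\<close> are as close to \<open>x\<close> as
  \<open>y\<close> is, and isometries move any pair of representatives to one that starts at
  \<open>x\<close>.\<close>

lemma wd_attained:
 assumes x: "x : hyp3" and y: "y : hyp3"
 obtains g where "g : Gn n" "wd n (q n x) (q n y) = hyp_dist x (act g y)"
proof -
 define F where "F = {g : Gn n. hyp_dist x (act g y) <= hyp_dist x y}"
 have "F <= {g : Gam. hyp_dist x (act g y) <= hyp_dist x y}" unfolding F_def using Gn_Gam by blast
 hence F: "finite F" using finite_act[OF y x] finite_subset by blast
 have F1: "1 : F" unfolding F_def using Gn_1 by simp
 have "Min ((%g. hyp_dist x (act g y)) ` F) : (%g. hyp_dist x (act g y)) ` F" using F F1 by (intro Min_in) auto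
 then obtain g where g: "g : F" "hyp_dist x (act g y) = Min ((%g. hyp_dist x (act g y)) ` F)" by auto
 have min: "hyp_dist x (act g y) <= hyp_dist x (act h y)" if "h : Gn n" for h
 proof (cases "h : F")
  case True thus ?thesis unfolding g(2) using F by (intro Min_le) auto
 next
  case False
  thus ?thesis using that g(1) unfolding F_def by auto
 qed
 have gn: "g : Gn n" using g(1) by (simp add: F_def)
 have "Inf {hyp_dist x' y' |x' y'. x' : hyp3 & y' : hyp3 & q n x' = q n x & q n y' = q n y} = hyp_dist x (act g y)"
 proof (rule cInf_eq_minimum)
  show "hyp_dist x (act g y) : {hyp_dist x' y' |x' y'. x' : hyp3 & y' : hyp3 & q n x' = q n x & q n y' = q n y}"
   using x act_hyp3[OF Gn_Gam[OF gn] y] q_act[OF gn y] by blast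
  fix d assume "d : {hyp_dist x' y' |x' y'. x' : hyp3 & y' : hyp3 & q n x' = q n x & q n y' = q n y}"
  then obtain x' y' where d: "d = hyp_dist x' y'" "x' : hyp3" "y' : hyp3" "q n x' = q n x" "q n y' = q n y" by blast
  obtain h where h: "h : Gn n" "x = act h x'" using d(4) q_eq_iff[OF d(2) x] by blast
  obtain k where k: "k : Gn n" "y' = act k y" using d(5) q_eq_iff[OF y d(3)] by metis
  have "d = hyp_dist x (act h (act k y))" unfolding d(1) using act_isometry[OF Gn_Gam[OF h(1)] d(2,3)] h(2) k(2) by simp
  also have "act h (act k y) = act (h * k) y" using act_mult[OF Gn_Gam[OF h(1)] Gn_Gam[OF k(1)] y] by simp
  finally show "hyp_dist x (act g y) <= d" using min[OF Gn_mult[OF h(1) k(1)]] by simp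
 qed
 hence "wd n (q n x) (q n y) = hyp_dist x (act g y)" unfolding wd_def using hyp_dist_nonneg[OF x act_hyp3[OF Gn_Gam[OF gn] y]] by simp
 thus thesis using that[OF gn] by blast
qed

abbreviation Wn :: "nat => real topology" where "Wn n \<equiv> ftop hyp3 (q n)"

lemma topspace_Wn: "topspace (Wn n) = q n ` hyp3" by (simp add: hyp3_open)

lemma Wn_metric: "Metric_space (q n ` hyp3) (wd n)"
proof
 fix p p'
 show c: "wd n p p' = wd n p' p" for p p'
 proof -
  have "{hyp_dist x y | x y. x : hyp3 & y : hyp3 & q n x = p & q n y = p'} =
   {hyp_dist x y | x y. x : hyp3 & y : hyp3 & q n x = p' & q n y = p}" using hyp_dist_commute by blast
  thus ?thesis unfolding wd_def by simp
 qed
 show "0 <= wd n p p'" by (simp add: wd_def)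
next
 fix p p' assume "p : q n ` hyp3" "p' : q n ` hyp3"
 then obtain x y where xy: "x : hyp3" "y : hyp3" "p = q n x" "p' = q n y" by blast
 obtain g where g: "g : Gn n" "wd n (q n x) (q n y) = hyp_dist x (act g y)" by (rule wd_attained[OF xy(1,2)])
 show "wd n p p' = 0 \<longleftrightarrow> p = p'"
 proof
  assume "wd n p p' = 0"
  hence "x = act g y" using g(2) xy hyp_dist_0_iff[OF xy(1) act_hyp3[OF Gn_Gam[OF g(1)] xy(2)]] by simp
  thus "p = p'" using q_act[OF g(1) xy(2)] xy(3,4) by simp
 next
  assume "p = p'"
  hence "wd n p p' <= hyp_dist x x" using wd_le[OF xy(1,1), of n] xy(3) by simp
  moreover have "hyp_dist x x = 0" using hyp_dist_0_iff[OF xy(1,1)] by simp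
  moreover have "0 <= wd n p p'" using hyp_dist_nonneg[OF xy(1) act_hyp3[OF Gn_Gam[OF g(1)] xy(2)]] g(2) xy by simp
  ultimately show "wd n p p' = 0" by simp
 qed
next
 fix p p' p'' assume "p : q n ` hyp3" "p' : q n ` hyp3" "p'' : q n ` hyp3"
 then obtain x y z where xyz: "x : hyp3" "y : hyp3" "z : hyp3" "p = q n x" "p' = q n y" "p'' = q n z" by blast
 obtain g where g: "g : Gn n" "wd n (q n x) (q n y) = hyp_dist x (act g y)" by (rule wd_attained[OF xyz(1,2)])
 obtain h where h: "h : Gn n" "wd n (q n y) (q n z) = hyp_dist y (act h z)" by (rule wd_attained[OF xyz(2,3)])
 have G: "g : Gam" "h : Gam" using g h Gn_Gam by auto
 have "wd n p p'' <= hyp_dist x (act g (act h z))" using wd_le[OF xyz(1) act_hyp3[OF G(1) act_hyp3[OF G(2) xyz(3)]], of n]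
   q_act[OF g(1) act_hyp3[OF G(2) xyz(3)]] q_act[OF h(1) xyz(3)] xyz(4,6) by simp
 also have "... <= hyp_dist x (act g y) + hyp_dist (act g y) (act g (act h z))" by (intro hyp_dist_triangle act_hyp3 xyz G)
 also have "hyp_dist (act g y) (act g (act h z)) = hyp_dist y (act h z)" by (intro act_isometry act_hyp3 xyz G)
 finally show "wd n p p'' <= wd n p p' + wd n p' p''" using g(2) h(2) xyz(4-6) by simp
qed

lemma Wn_mtopology: "Metric_space.mtopology (q n ` hyp3) (wd n) = Wn n"
proof -
 interpret Metric_space "q n ` hyp3" "wd n" by (rule Wn_metric)
 show ?thesis unfolding topology_eq openin_mtopology openin_ftop[OF hyp3_open]
 proof (rule allI, rule iffI)
  fix U assume U: "U <= q n ` hyp3 & (ALL x. x : U --> (EX r>0. mball x r <= U))"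
  have "open (hyp3 Int q n -` U)"
  proof (subst open_subopen, intro ballI)
   fix x assume x: "x : hyp3 Int q n -` U"
   then obtain r where r: "r > 0" "mball (q n x) r <= U" using U by blast
   have "hball x r <= hyp3 Int q n -` U"
   proof
    fix y assume y: "y : hball x r"
    hence h: "y : hyp3" "hyp_dist x y < r" by (auto simp: hball_def)
    hence "wd n (q n x) (q n y) < r" using wd_le[of x y n] x by simp
    hence "q n y : U" using r(2) x h(1) by (auto simp: mball_def)
    thus "y : hyp3 Int q n -` U" using h by simp
   qed
   thus "EX T. open T & x : T & T <= hyp3 Int q n -` U" using x open_hball[of x r] hball_center[OF _ r(1), of x] by (intro exI[of _ "hball x r"]) simp
  qed
  thus "U <= q n ` hyp3 & open (hyp3 Int q n -` U)" using U by blast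
 next
  fix U assume U: "U <= q n ` hyp3 & open (hyp3 Int q n -` U)"
  have "ALL x. x : U --> (EX r>0. mball x r <= U)"
  proof (intro allI impI)
   fix p assume p: "p : U"
   then obtain x where x: "x : hyp3" "p = q n x" using U by blast
   have xp: "x : hyp3 Int q n -` U" using x p by simp
   obtain r where r: "0 < r" "hcball x r <= hyp3 Int q n -` U" using hcball_small[OF x(1) conjunct2[OF U] xp zero_less_one] by blast
   have "mball p r <= U"
   proof
    fix p' assume "p' : mball p r"
    then obtain y where y: "y : hyp3" "p' = q n y" "wd n (q n x) (q n y) < r" using x by (auto simp: mball_def)
    obtain g where g: "g : Gn n" "wd n (q n x) (q n y) = hyp_dist x (act g y)" by (rule wd_attained[OF x(1) y(1)])
    have "act g y : hcball x r" using g(2) y(3) act_hyp3[OF Gn_Gam[OF g(1)] y(1)] by (simp add: hcball_def)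
    thus "p' : U" using r(2) q_act[OF g(1) y(1)] y(2) by auto
   qed
   thus "EX r>0. mball p r <= U" using r(1) by blast
  qed
  thus "U <= q n ` hyp3 & (ALL x. x : U --> (EX r>0. mball x r <= U))" using U by blast
 qed
qed

lemma Wn_Hausdorff: "Hausdorff_space (Wn n)" using Metric_space.Hausdorff_space_mtopology[OF Wn_metric, of n] unfolding Wn_mtopology .

lemma Wn_connected: "connected_space (Wn n)"
proof -
 have "connectedin (Wn n) (q n ` hyp3)" by (rule connectedin_continuous_map_image[OF ftop_continuous[OF atlas_q]])
   (simp add: connectedin_subtopology convex_connected[OF hyp3_convex])
 thus ?thesis using topspace_Wn by (metis connectedin_topspace)
qed

lemma hyp3_nonempty: "hyp3 ~= {}"
proof -
 have "pt 0 1 : hyp3" by simp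
 thus ?thesis by blast
qed

lemma Wn_three_manifold: "three_manifold (Wn n)" "manifold_boundary (Wn n) = {}"
 "is_orientation (Wn n) (cover_orientation (Wn n) (q n) hyp3)" using closed_manifoldI[OF atlas_q hyp3_nonempty Wn_connected Wn_Hausdorff] .

lemma q_isometric_ball:
 assumes x: "x : hyp3"
 obtains r where "0 < r" "r <= 1" "!!y z. y : hball x r ==> z : hball x r ==> wd n (q n y) (q n z) = hyp_dist y z"
proof -
 obtain r where r: "0 < r" "r <= 1" "!!y z g. y : hball x r ==> z : hball x r ==> g : Gam ==> hyp_dist y (act g z) < 2 * r ==> g = 1 | g = - 1"
  using injectivity_radius[OF x] by metis
 have "wd n (q n y) (q n z) = hyp_dist y z" if y: "y : hball x r" and z: "z : hball x r" for y z
 proof -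
  have h: "y : hyp3" "z : hyp3" "hyp_dist y x < r" "hyp_dist x z < r" using y z by (auto simp: hball_def hyp_dist_commute)
  obtain g where g: "g : Gn n" "wd n (q n y) (q n z) = hyp_dist y (act g z)" by (rule wd_attained[OF h(1,2)])
  have "hyp_dist y (act g z) <= hyp_dist y z" using g(2) wd_le[OF h(1,2), of n] by simp
  also have "... < r + r" by (rule hcball_chain[OF h(1) x h(2-4)])
  finally have "g = 1 | g = - 1" by (intro r(3)[OF y z Gn_Gam[OF g(1)]]) simp
  thus ?thesis using g(2) by auto
 qed
 thus thesis using that[OF r(1,2)] by blast
qed

lemma Wn_chart:
 assumes x: "x : hyp3" and r: "0 < r" "!!y z. y : hball x r ==> z : hball x r ==> wd n (q n y) (q n z) = hyp_dist y z"
 shows "inj_on (q n) (hball x r)" "hyperbolic_chart (Wn n) (wd n) (q n ` hball x r) (inv_into (hball x r) (q n))"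
proof -
 show i: "inj_on (q n) (hball x r)"
 proof (rule inj_onI)
  fix y z assume yz: "y : hball x r" "z : hball x r" "q n y = q n z"
  hence "y : hyp3" "z : hyp3" by (simp_all add: hball_def)
  moreover have "wd n (q n y) (q n z) = 0" using Metric_space.zero[OF Wn_metric, of "q n y" n "q n z"] yz calculation by simp
  ultimately show "y = z" using r(2)[OF yz(1,2)] hyp_dist_0_iff by simp
 qed
 hence im: "inv_into (hball x r) (q n) ` q n ` hball x r = hball x r" by (simp add: inj_on_imp_bij_betw bij_betw_inv_into bij_betw_imp_surj_on)
 show "hyperbolic_chart (Wn n) (wd n) (q n ` hball x r) (inv_into (hball x r) (q n))" unfolding hyperbolic_chart_def im
  using ftop_open_image[OF atlas_q open_hball[OF x] hball_sub(3)] open_hball[OF x] hball_sub(3) r(2) i by simp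
qed

text \<open>A tail of a Cauchy sequence stays within distance 1 of one term and therefore lifts to a
  closed ball of radius 1, which is compact.\<close>

lemma Wn_complete: "Metric_space.mcomplete (q n ` hyp3) (wd n)"
proof -
 interpret Metric_space "q n ` hyp3" "wd n" by (rule Wn_metric)
 show ?thesis unfolding mcomplete_def
 proof (intro allI impI)
  fix s assume s: "MCauchy s"
  obtain N where N: "!!k l. N <= k ==> N <= l ==> wd n (s k) (s l) < 1" using s zero_less_one unfolding MCauchy_def by metis
  have rs: "range s <= q n ` hyp3" using s by (simp add: MCauchy_def)
  then obtain x where x: "x : hyp3" "s N = q n x" by blast
  have "EX y. y : hcball x 1 & q n y = s (N + k)" for k
  proof -
   obtain y where y: "y : hyp3" "s (N + k) = q n y" using rs by blast
   obtain g where g: "g : Gn n" "wd n (q n x) (q n y) = hyp_dist x (act g y)" by (rule wd_attained[OF x(1) y(1)])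
   have "hyp_dist x (act g y) < 1" using N[of N "N + k"] x(2) y(2) g(2) by simp
   thus ?thesis using act_hyp3[OF Gn_Gam[OF g(1)] y(1)] q_act[OF g(1) y(1)] y(2) by (intro exI[of _ "act g y"]) (simp add: hcball_def)
  qed
  then obtain y where y: "!!k. y k : hcball x 1" "!!k. q n (y k) = s (N + k)" by metis
  obtain l r where l: "l : hcball x 1" "strict_mono r" "(y o r) \<longlonglongrightarrow> l" using compact_hcball[OF x(1) zero_less_one] y(1) unfolding compact_def by metis
  have lh: "l : hyp3" using l(1) hball_sub(2) by blast
  have yh: "y k : hyp3" for k using y(1) hball_sub(2) by blast
  have "limitin (tos hyp3) (y o r) l sequentially" unfolding limitin_subtopology using l(3) lh yh by simp
  hence "limitin (Wn n) (q n o (y o r)) (q n l) sequentially" by (rule continuous_map_limit[OF ftop_continuous[OF atlas_q]])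
  moreover have "q n o (y o r) = s o (%k. N + r k)" using y(2) by (simp add: fun_eq_iff)
  ultimately have "limitin mtopology (s o (%k. N + r k)) (q n l) sequentially" unfolding Wn_mtopology by simp
  moreover have "strict_mono (%k. N + r k)" using l(2) by (simp add: strict_mono_def)
  ultimately show "EX x. limitin mtopology s x sequentially" using MCauchy_convergent_subsequence[OF s] by blast
 qed
qed

lemma Wn_complete_hyperbolic: "complete_hyperbolic_metric (Wn n) (wd n)" unfolding complete_hyperbolic_metric_def topspace_Wn
proof (intro conjI ballI)
 fix p assume "p : q n ` hyp3"
 then obtain x where x: "x : hyp3" "p = q n x" by blast
 obtain r where r: "0 < r" "r <= 1" "!!y z. y : hball x r ==> z : hball x r ==> wd n (q n y) (q n z) = hyp_dist y z"
  using q_isometric_ball[OF x(1)] by metis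
 show "EX U fj. p : U & hyperbolic_chart (Wn n) (wd n) U fj" using Wn_chart(2)[OF x(1) r(1,3)] hball_center[OF x(1) r(1)] x(2) by blast
next
 show "Metric_space (q n ` hyp3) (wd n)" by (rule Wn_metric)
 show "Metric_space.mtopology (q n ` hyp3) (wd n) = Wn n" by (rule Wn_mtopology)
 show "Metric_space.mcomplete (q n ` hyp3) (wd n)" by (rule Wn_complete)
qed

section \<open>Hyperbolic volume\<close>

definition hvol :: "R3 measure" where "hvol = density lborel (%x. ennreal (1/(x$3)^3))"

lemma sets_hvol [simp]: "sets hvol = sets borel" and space_hvol [simp]: "space hvol = UNIV" by (simp_all add: hvol_def)

lemma density3_measurable [measurable]: "(%x :: R3. ennreal (1/(x$3)^3)) : borel_measurable borel" by measurable

lemma emeasure_hvol: "A : sets borel ==> emeasure hvol A = hyp_volume A" by (simp add: hvol_def hyp_volume_def emeasure_density)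

lemma emeasure_hvol_null: "negligible A ==> A : sets borel ==> emeasure hvol A = 0"
proof -
 assume "negligible A" and A: "A : sets borel"
 hence "A : null_sets lborel" by (simp add: negligible_iff_null_sets null_sets_completion_iff)
 hence "A : null_sets hvol" unfolding hvol_def by (subst null_sets_density_iff) (auto simp: A AE_not_in intro: AE_mp[OF AE_not_in])
 thus ?thesis by auto
qed

lemma hvol_similarity:
 assumes c: "0 < c" and w: "w$3 = 0" and B: "B : sets borel"
 shows "emeasure hvol ((%x. w + c *\<^sub>R x) ` B) = emeasure hvol B"
proof -
 define T where "T = (%x :: R3. w + c *\<^sub>R x)"
 define f where "f = (%x :: R3. ennreal (1/(x$3)^3))"
 have [measurable]: "T : borel_measurable borel" "f : borel_measurable borel" unfolding T_def f_def by measurable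
 have inv: "T ` B = (%x. (1/c) *\<^sub>R (x - w)) -` B"
 proof (intro equalityI subsetI)
  fix y assume "y : (%x. (1/c) *\<^sub>R (x - w)) -` B"
  thus "y : T ` B" by (intro image_eqI[of _ _ "(1/c) *\<^sub>R (y - w)"]) (use c in "auto simp: T_def")
 qed (use c in "auto simp: T_def")
 have "(%x :: R3. (1/c) *\<^sub>R (x - w)) : borel_measurable borel" by measurable
 from measurable_sets[OF this B] have TB [measurable]: "T ` B : sets borel" unfolding inv by simp
 have inj: "T x : T ` B \<longleftrightarrow> x : B" for x using c by (auto simp: T_def)
 have "emeasure hvol (T ` B) = (\<integral>\<^sup>+x. f x * indicator (T ` B) x \<partial>lborel)" unfolding hvol_def f_def[symmetric] by (rule emeasure_density) (simp_all add: TB)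
 also have "... = (\<integral>\<^sup>+x. f x * indicator (T ` B) x \<partial>density (distr lborel borel T) (%_. ennreal (\<bar>c\<bar>^3)))"
  using lborel_affine[of c w] c unfolding T_def by simp
 also have "... = (\<integral>\<^sup>+x. ennreal (\<bar>c\<bar>^3) * (f x * indicator (T ` B) x) \<partial>distr lborel borel T)" by (subst nn_integral_density) simp_all
 also have "... = (\<integral>\<^sup>+x. ennreal (\<bar>c\<bar>^3) * (f (T x) * indicator (T ` B) (T x)) \<partial>lborel)" by (subst nn_integral_distr) simp_all
 also have "... = (\<integral>\<^sup>+x. f x * indicator B x \<partial>lborel)"
 proof (rule nn_integral_cong)
  fix x :: "R3"
  have "ennreal (\<bar>c\<bar>^3) * f (T x) = f x" using c w unfolding f_def T_def by (subst ennreal_mult'[symmetric]) (simp_all add: power_mult_distrib)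
  thus "ennreal (\<bar>c\<bar>^3) * (f (T x) * indicator (T ` B) (T x)) = f x * indicator B x" using inj[of x] by (simp add: mult.assoc[symmetric] indicator_def)
 qed
 also have "... = emeasure hvol B" unfolding hvol_def f_def[symmetric] by (rule emeasure_density[symmetric]) (simp_all add: B)
 finally show ?thesis unfolding T_def .
qed

text \<open>A horizontal translation composed with a scaling carries one ball to the other and
  preserves \<open>hvol\<close>.\<close>

lemma hvol_hball:
 assumes x: "x : hyp3" and y: "y : hyp3" and r: "0 < r"
 shows "emeasure hvol (hball x r) = emeasure hvol (hball y r)"
proof -
 have "emeasure hvol (hball x r) = emeasure hvol (hball (pt 0 1) r)" if x: "x : hyp3" for x
 proof -
  have e: "pt 0 1 : hyp3" by simp
  have t: "0 < x$3" using x by (simp add: hyp3_pos)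
  have "hball x r = ball (pt (cz x) 0 + x$3 *\<^sub>R hcenter (pt 0 1) r) (x$3 * sinh r)"
  proof -
   have "hcenter x r = pt (cz x) 0 + x$3 *\<^sub>R hcenter (pt 0 1) r" by (simp add: hcenter_def pt_eq_iff complex_eq_iff)
   thus ?thesis unfolding hball_eq(1)[OF x r] by simp
  qed
  also have "... = (%v. pt (cz x) 0 + x$3 *\<^sub>R v) ` ball (hcenter (pt 0 1) r) (sinh r)"
   using t ball_scale[of "x$3" "hcenter (pt 0 1) r" "sinh r"] ball_translation[of "pt (cz x) 0"] by (simp add: image_image[symmetric])
  also have "... = (%v. pt (cz x) 0 + x$3 *\<^sub>R v) ` hball (pt 0 1) r" unfolding hball_eq(1)[OF e r] by simp
  finally show ?thesis using hvol_similarity[OF t, of "pt (cz x) 0" "hball (pt 0 1) r"] open_hball[OF e] by simp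
 qed
 thus ?thesis using x y by metis
qed

section \<open>Invariance of volume under local isometries\<close>

lemma hyp_isometry_open_image:
 assumes "open U" "fj ` U <= hyp3" "U <= hyp3" "!!x y. x : U ==> y : U ==> hyp_dist (fj x) (fj y) = hyp_dist x y"
 shows "open (fj ` U)" using invariance_of_domain[OF hyp_isometry_continuous[OF assms(2-4)] assms(1) hyp_isometry_inj[OF assms(2-4)]] .

lemma hyp_isometry_dist:
 assumes "x : hyp3" "y : hyp3" "x' : hyp3" "y' : hyp3" "hyp_dist x' y' = hyp_dist x y"
 shows "(dist x' y')^2 = (dist x y)^2 * ((x'$3 * y'$3)/(x$3 * y$3))"
proof -
 have "hcosh x' y' = hcosh x y" using assms cosh_hyp_dist by metis
 thus ?thesis using assms(1-4) unfolding hcosh_def hyp3_def by (simp add: field_simps)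
qed

text \<open>By \<open>hyp_isometry_dist\<close> Euclidean distances change by a factor that depends
  on heights and is bounded near each point, so the map is locally Lipschitz.\<close>

lemma hyp_isometry_negligible:
 assumes "Z <= U" "fj ` U <= hyp3" "U <= hyp3" "!!x y. x : U ==> y : U ==> hyp_dist (fj x) (fj y) = hyp_dist x y"
  and "open U" "negligible Z"
 shows "negligible (fj ` Z)"
proof (rule negligible_locally_Lipschitz_image)
 fix x assume x: "x : Z"
 have c: "continuous_on U (%y. fj y$3)" using hyp_isometry_continuous[OF assms(2-4)] by (intro continuous_intros)
 have xh: "x : U" "x : hyp3" "fj x : hyp3" "0 < x$3" "0 < fj x$3" using x assms(1-3) by (auto simp: hyp3_def)
 define T where "T = (U Int (%y. fj y$3) -` {..< 2 * fj x$3}) Int {y. x$3/2 < y$3}"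
 have "open {y :: R3. x$3/2 < y$3}" by (intro open_Collect_less continuous_intros)
 hence "open T" unfolding T_def using continuous_open_preimage[OF c assms(5) open_lessThan] by (rule open_Int[rotated])
 moreover have "x : T" using xh by (simp add: T_def)
 moreover have "norm (fj y - fj x) <= (2 * fj x$3/x$3) * norm (y - x)" if y: "y : Z Int T" for y
 proof -
  have yh: "y : U" "y : hyp3" "fj y : hyp3" "x$3/2 < y$3" "fj y$3 < 2 * fj x$3" using y assms(1-3) by (auto simp: T_def)
  have "(fj y$3 * fj x$3)/(y$3 * x$3) <= ((2 * fj x$3) * fj x$3)/((x$3/2) * x$3)"
   using yh xh by (intro frac_le mult_right_mono mult_pos_pos) (auto simp: hyp3_def)
  also have "... = (2 * fj x$3/x$3)^2" by (simp add: p2_sq)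
  finally have "(dist y x)^2 * ((fj y$3 * fj x$3)/(y$3 * x$3)) <= (dist y x)^2 * (2 * fj x$3/x$3)^2" by (rule mult_left_mono) simp
  hence "(dist (fj y) (fj x))^2 <= (2 * fj x$3/x$3 * dist y x)^2" unfolding hyp_isometry_dist[OF yh(2) xh(2) yh(3) xh(3) assms(4)[OF yh(1) xh(1)]]
    power_mult_distrib[of "2 * fj x$3/x$3"] by (simp only: mult.commute)
  hence "dist (fj y) (fj x) <= 2 * fj x$3/x$3 * dist y x" by (rule power2_le_imp_le) (use xh in simp)
  thus ?thesis by (simp add: dist_norm)
 qed
 ultimately show "EX T B. open T & x : T & (ALL y:Z Int T. norm (fj y - fj x) <= B * norm (y - x))" by blast
qed (use assms in auto)

text \<open>A chart is known to preserve distances and nothing more. Vitali's theorem fills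
  \<open>U\<close> with disjoint hyperbolic balls up to a negligible set; each ball goes into a ball
  of the same radius, hence of the same volume, and the image of the negligible rest is
  negligible.\<close>

lemma hvol_isometry_le:
 assumes U: "open U" "fj ` U <= hyp3" "U <= hyp3" "!!x y. x : U ==> y : U ==> hyp_dist (fj x) (fj y) = hyp_dist x y"
 shows "emeasure hvol (fj ` U) <= emeasure hvol U"
proof -
 define K where "K = {(x, r). x : U & 0 < r & hcball x r <= U}"
 define a where "a = (%(x, r). hcenter x r)"
 define R where "R = (%(x :: R3, r). x$3 * sinh r)"
 have cov: "EX i. i : K & x : ball (a i) (R i) & R i < d" if x: "x : U" and d: "0 < d" for x d
 proof -
  have xh: "x : hyp3" using x U(3) by blast
  have t: "0 < x$3" using xh by (simp add: hyp3_pos)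
  obtain r where r: "0 < r" "hcball x r <= U" "r <= arsinh (d/(2 * x$3))"
   using hcball_small[OF xh U(1) x, of "arsinh (d/(2 * x$3))"] t d by (metis arsinh_real_pos_iff divide_pos_pos mult_pos_pos zero_less_numeral)
  have "sinh r <= sinh (arsinh (d/(2 * x$3)))" using r(3) by (simp only: sinh_real_le_iff)
  hence "sinh r <= d/(2 * x$3)" by (simp only: sinh_arsinh_real)
  hence "x$3 * sinh r <= d/2" using t by (simp add: field_simps)
  moreover have "x : ball (hcenter x r) (x$3 * sinh r)" using hball_center[OF xh r(1)] hball_eq(1)[OF xh r(1)] by simp
  ultimately show ?thesis using r x d by (intro exI[of _ "(x, r)"]) (simp add: K_def a_def R_def)
 qed
 obtain C where C: "countable C" "C <= K" "pairwise (%i j. disjnt (ball (a i) (R i)) (ball (a j) (R j))) C"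
  "negligible (U - (UN i:C. ball (a i) (R i)))" by (rule Vitali_covering_theorem_balls[OF cov])
 define H where "H = (%(x, r). hball x r)"
 have Hb: "H i = ball (a i) (R i)" if "i : C" for i
 proof -
  obtain x r where i: "i = (x, r)" by fastforce
  have "x : hyp3" "0 < r" using that C(2) U(3) by (auto simp: K_def i)
  thus ?thesis by (simp add: H_def a_def R_def i hball_eq)
 qed
 have Hs: "H i <= U & open (H i) & emeasure hvol (fj ` H i) <= emeasure hvol (H i)" if "i : C" for i
 proof -
  obtain x r where i: "i = (x, r)" by fastforce
  have xr: "x : U" "x : hyp3" "fj x : hyp3" "0 < r" "hcball x r <= U" using that C(2) U(2,3) by (auto simp: K_def i)
  have h: "hball x r <= U" using xr(5) hball_sub(1) by blast
  have "fj ` hball x r <= hball (fj x) r"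
  proof (rule image_subsetI)
   fix y assume y: "y : hball x r"
   hence "y : U" using h by blast
   thus "fj y : hball (fj x) r" using y U(2) U(4)[OF xr(1)] by (auto simp: hball_def)
  qed
  hence "emeasure hvol (fj ` hball x r) <= emeasure hvol (hball (fj x) r)" by (rule emeasure_mono) (simp add: open_hball[OF xr(3)])
  thus ?thesis using h open_hball[OF xr(2)] hvol_hball[OF xr(3,2,4)] by (simp add: H_def i)
 qed
 have oH: "open (fj ` H i)" if "i : C" for i
 proof (rule hyp_isometry_open_image)
  have s: "H i <= U" using Hs[OF that] by blast
  show "open (H i)" "fj ` H i <= hyp3" "H i <= hyp3" using Hs[OF that] U(2,3) by blast+
  show "hyp_dist (fj x) (fj y) = hyp_dist x y" if "x : H i" "y : H i" for x y using U(4)[of x y] that s by blast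
 qed
 have disj: "disjoint_family_on H C" using C(3) Hb unfolding disjoint_family_on_def pairwise_def disjnt_def by simp
 define Z where "Z = U - (UN i:C. H i)"
 have "negligible Z" using C(4) Hb unfolding Z_def by simp
 moreover have "Z <= U" unfolding Z_def by blast
 ultimately have nZ: "negligible (fj ` Z)" using hyp_isometry_negligible[OF _ U(2-4,1)] by simp
 define D where "D = fj ` U - (UN i:C. fj ` H i)"
 have "open (fj ` U)" by (rule hyp_isometry_open_image[OF U])
 hence D: "D : sets borel" unfolding D_def using oH by (intro sets.Diff borel_open open_UN) auto
 have "D <= fj ` Z" unfolding D_def Z_def by blast
 hence D0: "emeasure hvol D = 0" using emeasure_hvol_null[OF negligible_subset[OF nZ] D] by blast
 have bH: "(UN i:C. fj ` H i) : sets borel" using oH by (intro borel_open open_UN) auto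
 have "emeasure hvol (fj ` U) <= emeasure hvol ((UN i:C. fj ` H i) Un D)"
 proof (rule emeasure_mono)
  show "fj ` U <= (UN i:C. fj ` H i) Un D" unfolding D_def by blast
  show "(UN i:C. fj ` H i) Un D : sets hvol" using sets.Un[OF bH D] by simp
 qed
 also have "... <= emeasure hvol (UN i:C. fj ` H i) + emeasure hvol D" using bH D by (intro emeasure_subadditive) auto
 also have "... = emeasure hvol (UN i:C. fj ` H i)" using D0 by simp
 also have "... = (\<integral>\<^sup>+i. emeasure hvol (fj ` H i) \<partial>count_space C)"
 proof (rule emeasure_UN_countable)
  show "disjoint_family_on (%i. fj ` H i) C" unfolding disjoint_family_on_def
  proof (intro ballI impI)
   fix i j assume ij: "i : C" "j : C" "i ~= j"
   have "fj ` H i Int fj ` H j = fj ` (H i Int H j)" by (rule inj_on_image_Int[OF hyp_isometry_inj[OF U(2-4)], symmetric]) (use Hs ij in auto)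
   thus "fj ` H i Int fj ` H j = {}" using disj ij unfolding disjoint_family_on_def by simp
  qed
 qed (use oH C(1) in auto)
 also have "... <= (\<integral>\<^sup>+i. emeasure hvol (H i) \<partial>count_space C)" by (rule nn_integral_mono) (use Hs in simp)
 also have "... = emeasure hvol (UN i:C. H i)" by (rule emeasure_UN_countable[symmetric]) (use Hs disj C(1) in auto)
 also have "... <= emeasure hvol U" by (rule emeasure_mono) (use Hs U(1) in auto)
 finally show ?thesis .
qed

lemma hvol_isometry_open:
 assumes U: "open U" "fj ` U <= hyp3" "U <= hyp3" "!!x y. x : U ==> y : U ==> hyp_dist (fj x) (fj y) = hyp_dist x y"
 shows "emeasure hvol (fj ` U) = emeasure hvol U"
proof (rule antisym[OF hvol_isometry_le[OF U]])
 define ps where "ps = inv_into U fj"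
 have inv: "ps (fj x) = x" if "x : U" for x unfolding ps_def using hyp_isometry_inj[OF U(2-4)] that by simp
 have im: "ps ` fj ` U = U" using inv by (auto simp: image_image)
 have "emeasure hvol (ps ` (fj ` U)) <= emeasure hvol (fj ` U)"
 proof (rule hvol_isometry_le[OF hyp_isometry_open_image[OF U] _ U(2)])
  show "ps ` fj ` U <= hyp3" using im U(3) by simp
  fix x y assume "x : fj ` U" "y : fj ` U"
  thus "hyp_dist (ps x) (ps y) = hyp_dist x y" using inv U(4) by auto
 qed
 thus "emeasure hvol U <= emeasure hvol (fj ` U)" unfolding im .
qed

text \<open>From open sets to Borel sets: the volume on \<open>U\<close> and its pullback along
  \<open>fj\<close> are finite measures that agree on the open sets, a generator stable under
  intersection.\<close>

lemma hvol_isometry: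
 assumes U: "open U" "fj ` U <= hyp3" "U <= hyp3" "!!x y. x : U ==> y : U ==> hyp_dist (fj x) (fj y) = hyp_dist x y"
  and B: "B : sets borel" "B <= U"
 shows "fj ` B : sets borel" and "emeasure hvol U < \<infinity> ==> emeasure hvol (fj ` B) = emeasure hvol B"
proof -
 define ps where "ps = inv_into U fj"
 have inv: "ps (fj x) = x" if "x : U" for x unfolding ps_def using hyp_isometry_inj[OF U(2-4)] that by simp
 have im: "ps ` fj ` U = U" using inv by (auto simp: image_image)
 have oV: "open (fj ` U)" by (rule hyp_isometry_open_image[OF U])
 have "continuous_on (fj ` U) ps"
 proof (rule hyp_isometry_continuous[OF _ U(2)])
  show "ps ` fj ` U <= hyp3" using im U(3) by simp
  fix x y assume "x : fj ` U" "y : fj ` U"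
  thus "hyp_dist (ps x) (ps y) = hyp_dist x y" using inv U(4) by auto
 qed
 hence m: "ps : borel_measurable (restrict_space borel (fj ` U))" by (rule borel_measurable_continuous_on_restrict)
 have pre: "fj ` (X Int U) = ps -` X Int fj ` U" for X using inv by auto
 have bor: "fj ` (X Int U) : sets borel" if "X : sets borel" for X
  using measurable_sets[OF m that] oV unfolding pre by (simp add: sets_restrict_space_iff space_restrict_space)
 show "fj ` B : sets borel" using bor[OF B(1)] B(2) by (simp add: Int_absorb2)
 assume fin: "emeasure hvol U < \<infinity>"
 define M where "M = distr (restrict_space hvol (fj ` U)) borel ps"
 define N where "N = density hvol (indicator U)"
 have m': "ps : measurable (restrict_space hvol (fj ` U)) borel" using m by (simp cong: measurable_cong_sets sets_restrict_space_cong)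
 have M: "emeasure M X = emeasure hvol (fj ` (X Int U))" if "X : sets borel" for X unfolding M_def using that m' oV
  by (subst emeasure_distr) (auto simp: pre emeasure_restrict_space space_restrict_space)
 have N: "emeasure N X = emeasure hvol (X Int U)" if "X : sets borel" for X unfolding N_def using that U(1) by (subst emeasure_restricted) (auto simp: Int_commute)
 have "M = N"
 proof (rule measure_eqI_generator_eq[where E = "{X. open X}" and \<Omega> = UNIV and A = "%_. UNIV"])
  show "Int_stable {X :: R3 set. open X}" by (auto simp: Int_stable_def)
  fix X :: "R3 set" assume "X : {X. open X}"
  hence X: "open X" by simp
  have "emeasure hvol (fj ` (X Int U)) = emeasure hvol (X Int U)"
  proof (rule hvol_isometry_open)
   show "open (X Int U)" by (rule open_Int[OF X U(1)])
   show "fj ` (X Int U) <= hyp3" using U(2) by blast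
   show "X Int U <= hyp3" using U(3) by blast
   show "hyp_dist (fj x) (fj y) = hyp_dist x y" if "x : X Int U" "y : X Int U" for x y using U(4)[of x y] that by simp
  qed
  thus "emeasure M X = emeasure N X" using M N X by simp
 next
  show "emeasure M UNIV ~= \<infinity>" using M[of UNIV] hvol_isometry_open[OF U] fin by simp
 qed (auto simp: M_def N_def sets_borel)
 thus "emeasure hvol (fj ` B) = emeasure hvol B" using M[OF B(1)] N[OF B(1)] B(2) by (simp add: Int_absorb2)
qed

subsection \<open>A domain of finite volume\<close>

text \<open>The lattice vector \<open>i (n + \<i> sqrt 3) + j (n - \<i> sqrt 3)\<close> in the basis
  1, \<omega>.\<close>

definition lat :: "nat => int => int => eis" where
 "lat n i j = Eis (i * (int n + 1) + j * (int n - 1)) (2 * (i - j))"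

text \<open>The coordinates of a complex number with respect to the basis \<open>n \<plusminus> \<i> \<surd>3\<close> of the
  lattice of translations in \<open>Gn n\<close>.\<close>

definition ca :: "nat => complex => real" where "ca n z = (Re z/n + Im z/sqrt 3)/2"
definition cb :: "nat => complex => real" where "cb n z = (Re z/n - Im z/sqrt 3)/2"
definition czz :: "nat => real => real => complex" where "czz n a b = Complex ((a + b) * n) ((a - b) * sqrt 3)"

lemma ca_czz [simp]: "0 < n ==> ca n (czz n a b) = a" "0 < n ==> cb n (czz n a b) = b" "0 < n ==> czz n (ca n z) (cb n z) = z"
 by (simp_all add: ca_def cb_def czz_def complex_eq_iff field_simps)

lemma emb_lat: "emb (lat n i j) = czz n (of_int i) (of_int j)" by (simp add: emb_def lat_def czz_def complex_eq_iff etr_def field_simps)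

lemma czz_add: "czz n a b + czz n a' b' = czz n (a + a') (b + b')" by (simp add: czz_def complex_eq_iff alg)

lemma lat_Gn: "odd n ==> tmat (lat n i j) : Gn n"
proof -
 assume n: "odd n"
 have e: "ev (lat n i j)" using n by (simp add: lat_def ev_def)
 have "etr (lat n i j) = 2 * (int n * (i + j))" by (simp add: lat_def etr_def alg)
 hence "chi (tmat (lat n i j)) = int n * (i + j)" unfolding chi_tmat[OF e] by simp
 thus ?thesis unfolding Gn_def using tmat_Gam[OF e] by simp
qed

text \<open>A translation in \<open>Gn n\<close> is \<open>n m + k \<i> sqrt 3\<close>, its real
  part being the value of \<open>chi\<close>, with \<open>n m + k\<close> even. For odd
  \<open>n\<close> this makes \<open>m + k\<close> even, so that \<open>i = (m + k) / 2\<close> and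
  \<open>j = (m - k) / 2\<close> are integers.\<close>

lemma Gn_P_lat:
 assumes "odd n" "g : Gn n" "m21 g = 0"
 obtains i j where "g = tmat (lat n i j) | g = - tmat (lat n i j)"
proof -
 obtain b where b: "ev b" "g = tmat b | g = - tmat b" using Gam_P_cases[OF Gn_Gam[OF assms(2)] assms(3)] .
 have "chi g = etr b div 2" using b chi_tmat[OF b(1)] chi_minus[OF tmat_Gam[OF b(1)]] by auto
 moreover obtain k where k: "eb b = 2 * k" using b(1) by (auto simp: ev_def)
 ultimately have "int n dvd ea b - k" using assms(2) by (simp add: Gn_def etr_def)
 then obtain m where m: "ea b = int n * m + k" by (metis dvdE diff_add_cancel)
 have "even (int n * m + k)" using b(1) m by (simp add: ev_def)
 hence "even (m + k)" using assms(1) by simp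
 then obtain i where i: "m + k = 2 * i" by blast
 define j where "j = m - i"
 have ij: "m = i + j" "k = i - j" using i by (simp_all add: j_def)
 have "b = lat n i j" unfolding lat_def eis_eq_iff using m k unfolding ij by (simp add: alg)
 thus thesis using that b(2) by blast
qed

definition fdom :: "nat => R3 set" where
 "fdom n = {y. 1/2 <= y$3 & 0 <= ca n (cz y) & ca n (cz y) <= 1 & 0 <= cb n (cz y) & cb n (cz y) <= 1}"

lemma fdom_hyp3: "fdom n <= hyp3" by (auto simp: fdom_def hyp3_def)

lemma closed_dom: "closed (fdom n)" unfolding fdom_def ca_def cb_def divide_inverse by (intro closed_Collect_conj closed_Collect_le continuous_intros) auto

lemma q_dom:
 assumes x: "x : hyp3" and n: "odd n"
 obtains y where "y : fdom n" "q n y = q n x"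
proof -
 have n0: "0 < n" using n by (simp add: odd_pos)
 obtain g where g: "g : Gn n" "1/2 <= act g x$3" using act_reduce_height[OF x n] .
 define y where "y = act g x"
 have y: "y : hyp3" unfolding y_def by (rule Gn_act(1)[OF g(1) x])
 define a b where "a = ca n (cz y)" and "b = cb n (cz y)"
 define h where "h = tmat (lat n (- \<lfloor>a\<rfloor>) (- \<lfloor>b\<rfloor>))"
 have h: "h : Gn n" unfolding h_def by (rule lat_Gn[OF n])
 have "cz y = czz n a b" unfolding a_def b_def using n0 by simp
 hence "act h y = pt (czz n (frac a) (frac b)) (y$3)" unfolding h_def act_tmat[OF y] emb_lat by (simp add: czz_add frac_def)
 hence "act h y : fdom n" using g(2) n0 frac_lt_1[of a] frac_lt_1[of b] unfolding y_def[symmetric] by (simp add: fdom_def less_imp_le)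
 moreover have "q n (act h y) = q n x" using q_act[OF h y] q_act[OF g(1) x] unfolding y_def by simp
 ultimately show thesis by (rule that)
qed

lemma hvol_bound:
 assumes A: "A : sets borel" and c: "0 < c" "!!y. y : A ==> c <= y$3"
 shows "emeasure hvol A <= ennreal (1/c^3) * emeasure lborel A"
proof -
 have "emeasure hvol A = (\<integral>\<^sup>+x. ennreal (1/(x$3)^3) * indicator A x \<partial>lborel)" unfolding hvol_def by (rule emeasure_density) (simp_all add: A)
 also have "... <= (\<integral>\<^sup>+x. ennreal (1/c^3) * indicator A x \<partial>lborel)"
 proof (rule nn_integral_mono)
  fix x :: "R3"
  show "ennreal (1/(x$3)^3) * indicator A x <= ennreal (1/c^3) * indicator A x"
  proof (cases "x : A")
   case True
   hence "c <= x$3" by (rule c(2))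
   hence "1/(x$3)^3 <= 1/c^3" using c(1) by (intro frac_le power_mono) auto
   thus ?thesis using True by (simp add: ennreal_leI)
  qed simp
 qed
 also have "... = ennreal (1/c^3) * emeasure lborel A" using A by (simp add: nn_integral_cmult_indicator)
 finally show ?thesis .
qed

lemma power_two_bracket:
 assumes "1/2 <= (t :: real)" obtains j :: nat where "2^j/2 <= t" "t <= 2^j"
proof -
 define P where "P = (%j :: nat. t <= 2^j)"
 have ex: "EX j. P j" unfolding P_def using real_arch_pow[of 2 t] less_imp_le by fastforce
 define j where "j = (LEAST j. P j)"
 have Pj: "P j" unfolding j_def using ex by (rule LeastI_ex)
 have "2^j/2 <= t"
 proof (cases j)
  case (Suc i)
  hence "~ P i" unfolding j_def using not_less_Least[of i P] by simp
  thus ?thesis using Suc unfolding P_def by simp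
 qed (use assms in simp)
 thus thesis using that Pj unfolding P_def by blast
qed

lemma prod_UNIV_3: "prod f (UNIV :: 3 set) = f 1 * f 2 * (f 3 :: real)" unfolding UNIV_3 by simp

text \<open>Sliced at the heights \<open>2^j\<close>: over a fixed base a slab has Euclidean volume
  of order \<open>2^j\<close> and density of order \<open>8^(-j)\<close>, so a geometric series of
  ratio 1/4 bounds the volume.\<close>

lemma hvol_dom: assumes n: "0 < n" shows "emeasure hvol (fdom n) < \<infinity>"
proof -
 \<comment> \<open>Over the parallelogram the real part runs through \<open>[0, 2 n]\<close>, and
   the imaginary part is at most sqrt 3 < 2 in absolute value.\<close>
 define a b where "a = (%j. vector [0, -2, 2^j/2] :: R3)" and "b = (%j. vector [2 * real n, 2, 2^j] :: R3)"
 have "fdom n <= (\<Union>j. cbox (a j) (b j))"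
 proof
  fix y assume y: "y : fdom n"
  define u v where "u = ca n (cz y)" and "v = cb n (cz y)"
  have uv: "0 <= u" "u <= 1" "0 <= v" "v <= 1" "1/2 <= y$3" using y by (auto simp: fdom_def u_def v_def)
  have z: "cz y = czz n u v" unfolding u_def v_def using n by simp
  have y12: "y$1 = (u + v) * n" "y$2 = (u - v) * sqrt 3" using arg_cong[OF z, of Re] arg_cong[OF z, of Im] by (simp_all add: czz_def)
  have "0 <= y$1" "y$1 <= 2 * real n" unfolding y12 using uv n by (auto intro!: mult_right_mono)
  moreover have "\<bar>y$2\<bar> <= 1 * 2" unfolding y12 abs_mult by (intro mult_mono) (use uv real_le_lsqrt[of 2 3] in auto)
  moreover obtain j where "2^j/2 <= y$3" "y$3 <= 2^j" using power_two_bracket[OF uv(5)] .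
  ultimately have "y : cbox (a j) (b j)" by (simp add: mem_box_cart forall_3 a_def b_def abs_le_iff)
  thus "y : (\<Union>j. cbox (a j) (b j))" by blast
 qed
 hence "emeasure hvol (fdom n) <= emeasure hvol (\<Union>j. cbox (a j) (b j))" by (rule emeasure_mono) auto
 also have "... <= (suminf (%j. emeasure hvol (cbox (a j) (b j))))" by (rule emeasure_subadditive_countably) auto
 also have "... <= (suminf (%j. ennreal (32 * real n * (1/4)^j)))"
 proof (rule suminf_le)
  fix j
  have "(2 :: real)^j > 0" by simp
  have "cbox (a j) (b j) ~= {}" by (simp add: interval_ne_empty_cart forall_3 a_def b_def)
  hence "measure lborel (cbox (a j) (b j)) = 2 * real n * 4 * (2^j/2)" using content_cbox_cart[of "a j" "b j"] by (simp add: prod_UNIV_3 a_def b_def)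
  hence v: "emeasure lborel (cbox (a j) (b j)) = ennreal (2 * real n * 4 * (2^j/2))"
   using emeasure_eq_ennreal_measure[of lborel "cbox (a j) (b j)"] emeasure_lborel_cbox_finite[of "a j" "b j"] by simp
  have "emeasure hvol (cbox (a j) (b j)) <= ennreal (1/(2^j/2)^3) * emeasure lborel (cbox (a j) (b j))" by (rule hvol_bound) (auto simp: mem_box_cart forall_3 a_def)
  also have "... = ennreal (1/(2^j/2)^3 * (2 * real n * 4 * (2^j/2)))" unfolding v by (rule ennreal_mult[symmetric]) auto
  also have "1/(2^j/2)^3 * (2 * real n * 4 * (2^j/2)) = 32 * real n * (1/4)^j"
  proof -
   define w where "w = (2 :: real)^j"
   have "w^2 = 4^j" unfolding w_def p2_sq power_mult_distrib[symmetric] by simp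
   hence w: "w > 0" "(1/4)^j = 1/w^2" unfolding w_def power_one_over by simp_all
   show ?thesis unfolding w_def[symmetric] w(2) using w(1) by (simp add: field_simps p2_sq power3_eq_cube)
  qed
  finally show "emeasure hvol (cbox (a j) (b j)) <= ennreal (32 * real n * (1/4)^j)" .
 qed auto
 also have "... = ennreal (suminf (%j. 32 * real n * (1/4)^j))" by (rule suminf_ennreal2) (auto intro!: summable_mult summable_geometric)
 also have "... < \<infinity>" by simp
 finally show ?thesis .
qed

lemma hball_height: "x : hyp3 ==> y : hcball x r ==> x$3 * exp (- r) <= y$3"
proof -
 assume x: "x : hyp3" and "y : hcball x r"
 hence y: "y : hyp3" "hyp_dist y x <= r" by (auto simp: hcball_def hyp_dist_commute)
 hence "nf y 0 1 <= exp r * nf x 0 1" using hyp_dist_le_iff[OF y(1) x] by blast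
 thus ?thesis using hyp3_pos[OF x] hyp3_pos[OF y(1)] by (simp add: nf_def exp_minus field_simps)
qed

lemma hvol_hball_finite: assumes x: "x : hyp3" and r: "0 < r" shows "emeasure hvol (hball x r) < \<infinity>"
proof -
 have b: "hball x r : sets borel" using open_hball[OF x] by simp
 have "emeasure hvol (hball x r) <= ennreal (1/(x$3 * exp (- r))^3) * emeasure lborel (hball x r)"
 proof (rule hvol_bound[OF b])
  show "x$3 * exp (- r) <= y$3" if "y : hball x r" for y using hball_height[OF x, of y r] that hball_sub(1) by blast
 qed (use hyp3_pos[OF x] in simp)
 moreover have "emeasure lborel (hball x r) < \<infinity>" unfolding hball_eq(1)[OF x r] by (rule emeasure_bounded_finite) simp
 hence "ennreal (1/(x$3 * exp (- r))^3) * emeasure lborel (hball x r) < \<infinity>" by (simp add: ennreal_mult_less_top)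
 ultimately show ?thesis by (rule le_less_trans)
qed

lemma countable_Gn: "countable (Gn n)"
proof -
 have e: "pt 0 1 : hyp3" by simp
 have "Gn n <= (\<Union>k :: nat. {g : Gam. hyp_dist (pt 0 1) (act g (pt 0 1)) <= real k})"
 proof
  fix g assume "g : Gn n"
  moreover obtain k :: nat where "hyp_dist (pt 0 1) (act g (pt 0 1)) <= real k" using real_arch_simple by blast
  ultimately show "g : (\<Union>k :: nat. {g : Gam. hyp_dist (pt 0 1) (act g (pt 0 1)) <= real k})" using Gn_Gam by auto
 qed
 moreover have "countable (\<Union>k :: nat. {g : Gam. hyp_dist (pt 0 1) (act g (pt 0 1)) <= real k})" by (rule countable_UN) (auto intro: countable_finite finite_act[OF e e])
 ultimately show ?thesis using countable_subset by blast
qed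

lemma q_saturation_borel:
 assumes A: "A : sets borel" "A <= hyp3" shows "hyp3 Int q n -` (q n ` A) : sets borel"
proof -
 have "hyp3 Int q n -` (q n ` A) = (UN g:Gn n. act g ` A)"
 proof (intro equalityI subsetI)
  fix x assume "x : hyp3 Int q n -` (q n ` A)"
  then obtain y where y: "x : hyp3" "y : A" "q n y = q n x" by auto
  then obtain g where "g : Gn n" "x = act g y" using q_eq_iff[of y x n] A(2) by (metis subsetD)
  thus "x : (UN g:Gn n. act g ` A)" using y(2) by blast
 next
  fix x assume "x : (UN g:Gn n. act g ` A)"
  then obtain g y where "g : Gn n" "y : A" "x = act g y" by blast
  thus "x : hyp3 Int q n -` (q n ` A)" using Gn_act(1)[of g n y] q_act[of g n y] A(2) by auto
 qed
 moreover have "act g ` A : sets borel" if g: "g : Gn n" for g by (rule hvol_isometry(1)[OF hyp3_open _ order_refl _ A]) (use Gn_act(1)[OF g] act_isometry[OF Gn_Gam[OF g]] in auto)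
 ultimately show ?thesis using countable_Gn by (auto intro!: sets.countable_UN')
qed

text \<open>The measure is the image of \<open>hvol\<close> on a Borel set \<open>FF\<close> inside
  \<open>fdom\<close> that meets every orbit once. On each of its countably many pieces a chart
  composed with \<open>q n\<close> is an isometry, so the volumes of the pieces agree and add
  up.\<close>

lemma Wn_finite_volume:
 assumes n: "odd n" shows "finite_volume_hyperbolic (Wn n)"
proof -
 define \<F> where "\<F> = {hball x r | x r. x : hyp3 & 0 < r & (ALL y:hball x r. ALL z:hball x r. wd n (q n y) (q n z) = hyp_dist y z)}"
 have cov: "EX A:\<F>. x : A" if x: "x : hyp3" for x
 proof -
  obtain r where "0 < r" "!!y z. y : hball x r ==> z : hball x r ==> wd n (q n y) (q n z) = hyp_dist y z" using q_isometric_ball[OF x] by metis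
  thus ?thesis unfolding \<F>_def using x hball_center[OF x] by blast
 qed
 have "!!A. A : \<F> ==> open A" unfolding \<F>_def using open_hball by auto
 then obtain \<C> where C: "\<C> <= \<F>" "countable \<C>" "\<Union>\<C> = \<Union>\<F>" by (rule Lindelof)
 have "\<C> ~= {}" using C(3) cov hyp3_nonempty by blast
 define A where "A = from_nat_into \<C>"
 have A: "A k : \<F>" for k using from_nat_into[OF \<open>\<C> ~= {}\<close>] C(1) unfolding A_def by blast
 have Ao: "open (A k)" "A k <= hyp3" "emeasure hvol (A k) < \<infinity>" for k
 proof -
  obtain x r where "x : hyp3" "0 < r" "A k = hball x r" using A[of k] unfolding \<F>_def by blast
  thus "open (A k)" "A k <= hyp3" "emeasure hvol (A k) < \<infinity>" using open_hball hball_sub(3)[of x r] hvol_hball_finite by auto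
 qed
 have Ai: "wd n (q n y) (q n z) = hyp_dist y z" if "y : A k" "z : A k" for y z k using A[of k] that unfolding \<F>_def by auto
 have Ac: "EX k. x : A k" if x: "x : hyp3" for x
 proof -
  have "x : \<Union>\<C>" using cov[OF x] C(3) by blast
  then obtain D where D: "D : \<C>" "x : D" by blast
  thus ?thesis using from_nat_into_surj[OF C(2) D(1)] unfolding A_def by metis
 qed
 define S where "S = (%k. hyp3 Int q n -` (q n ` (A k Int fdom n)))"
 \<comment> \<open>Of each orbit the representative in the first ball that meets it inside
   \<open>fdom\<close> is kept; it is unique because \<open>q n\<close> is injective on that
   ball.\<close>
 define F where "F = (%k. A k Int fdom n - (\<Union>j<k. S j))"
 have bA: "A k Int fdom n : sets borel" for k using Ao(1) closed_dom by (intro sets.Int borel_open borel_closed) auto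
 have bS: "S k : sets borel" for k unfolding S_def by (rule q_saturation_borel[OF bA]) (use Ao(2) in blast)
 have bF: "F k : sets borel" for k unfolding F_def using bA bS by (intro sets.Diff sets.finite_UN) auto
 have Fs: "F k <= A k" "F k <= fdom n" for k unfolding F_def by auto
 have Fd: "k = l" if xy: "x : F k" "y : F l" "q n x = q n y" for x y k l
 proof -
  have lt: "~ k < l" if "x : F k" "y : F l" "q n x = q n y" for x y k l
  proof
   assume "k < l"
   have "y : hyp3" "x : A k Int fdom n" using that Fs(1)[of l] Ao(2)[of l] Fs[of k] by blast+
   hence "y : S k" unfolding S_def using that(3) by (metis IntI imageI vimageI)
   thus False using that(2) \<open>k < l\<close> unfolding F_def by blast
  qed
  show ?thesis using lt[OF xy] lt[OF xy(2,1) xy(3)[symmetric]] by simp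
 qed
 have Fc: "EX k x. x : F k & q n x = p" if p: "p : q n ` hyp3" for p
 proof -
  obtain x0 where x0: "x0 : hyp3" "q n x0 = p" using p by blast
  obtain x where "x : fdom n" "q n x = q n x0" by (rule q_dom[OF x0(1) n])
  hence x: "x : fdom n" "q n x = p" using x0(2) by simp_all
  define P where "P = (%k. EX x. x : A k Int fdom n & q n x = p)"
  have "EX k. P k" unfolding P_def using x Ac[of x] fdom_hyp3 by blast
  then obtain k where k: "P k" "!!j. j < k ==> ~ P j" using exists_least_iff[of P] by blast
  then obtain y where y: "y : A k Int fdom n" "q n y = p" unfolding P_def by blast
  have "y \<notin> S j" if "j < k" for j using k(2)[OF that] y(2) unfolding P_def S_def by auto
  hence "y : F k" unfolding F_def using y(1) by blast
  thus ?thesis using y(2) by blast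
 qed
 define FF where "FF = (\<Union>k. F k)"
 have bFF: "FF : sets borel" unfolding FF_def using bF by auto
 have FFs: "FF <= fdom n" "FF <= hyp3" unfolding FF_def using Fs fdom_hyp3 by blast+
 define m0 where "m0 = restrict_space (density hvol (indicator FF)) hyp3"
 define m where "m = distr m0 (sigma (q n ` hyp3) {U. openin (Wn n) U}) (q n)"
 have opW: "{U. openin (Wn n) U} <= Pow (q n ` hyp3)" using openin_subset topspace_Wn by blast
 have sm: "sets m = sigma_sets (q n ` hyp3) {U. openin (Wn n) U}" "space m = q n ` hyp3" unfolding m_def using opW by (simp_all add: space_measure_of)
 have sp: "space m0 = hyp3" "sets m0 = sets (restrict_space borel hyp3)" unfolding m0_def by (simp_all add: space_restrict_space cong: sets_restrict_space_cong)
 have qm: "q n : measurable m0 (sigma (q n ` hyp3) {U. openin (Wn n) U})"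
 proof (rule measurable_sigma_sets[OF _ opW])
  show "sets (sigma (q n ` hyp3) {U. openin (Wn n) U}) = sigma_sets (q n ` hyp3) {U. openin (Wn n) U}" using opW by simp
  show "q n : space m0 \<rightarrow> q n ` hyp3" unfolding sp by simp
  fix U assume "U : {U. openin (Wn n) U}"
  hence "open (hyp3 Int q n -` U)" using openin_ftop[OF hyp3_open] by blast
  thus "q n -` U Int space m0 : sets m0" unfolding sp using hyp3_open by (simp add: sets_restrict_space_iff Int_commute)
 qed
 have bq: "hyp3 Int q n -` B : sets borel" if "B : sets m" for B
 proof -
  have "B : sets (sigma (q n ` hyp3) {U. openin (Wn n) U})" using that unfolding m_def by simp
  from measurable_sets[OF qm this] have "q n -` B Int hyp3 : sets (restrict_space borel hyp3)" unfolding sp .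
  thus ?thesis using hyp3_open by (simp add: sets_restrict_space_iff Int_commute)
 qed
 have em: "emeasure m B = emeasure hvol (FF Int q n -` B)" if B: "B : sets m" for B
 proof -
  have B': "B : sets (sigma (q n ` hyp3) {U. openin (Wn n) U})" using B unfolding m_def by simp
  have "emeasure m B = emeasure m0 (q n -` B Int hyp3)" unfolding m_def using emeasure_distr[OF qm B'] sp by simp
  also have "... = emeasure (density hvol (indicator FF)) (hyp3 Int q n -` B)" unfolding m0_def Int_commute[of "q n -` B"] using hyp3_open by (intro emeasure_restrict_space) auto
  also have "... = emeasure hvol (FF Int (hyp3 Int q n -` B))" by (rule emeasure_restricted) (use bFF bq[OF B] in auto)
  also have "FF Int (hyp3 Int q n -` B) = FF Int q n -` B" using FFs(2) by blast
  finally show ?thesis .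
 qed
 have "is_volume_measure (Wn n) (wd n) m" unfolding is_volume_measure_def topspace_Wn
 proof (intro conjI allI impI)
  fix U fj B assume "hyperbolic_chart (Wn n) (wd n) U fj & B : sets m & B <= U"
  hence ch: "openin (Wn n) U" "fj ` U <= hyp3" "!!x y. x : U ==> y : U ==> hyp_dist (fj x) (fj y) = wd n x y"
   and B: "B : sets m" "B <= U" by (auto simp: hyperbolic_chart_def)
  have US: "U <= q n ` hyp3" "open (hyp3 Int q n -` U)" using ch(1) unfolding openin_ftop[OF hyp3_open] by simp_all
  define E where "E = (%k. F k Int (hyp3 Int q n -` B))"
  define O' where "O' = (%k. A k Int (hyp3 Int q n -` U))"
  have bE: "E k : sets borel" for k unfolding E_def by (rule sets.Int[OF bF bq[OF B(1)]])
  have EO: "E k <= O' k" for k unfolding E_def O'_def using Fs(1) B(2) by blast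
  have O1: "open (O' k)" for k unfolding O'_def by (intro open_Int Ao(1) US(2))
  have O1': "O' k <= hyp3" "(fj o q n) ` O' k <= hyp3" for k using ch(2) unfolding O'_def by (auto simp: image_subset_iff)
  have O2: "hyp_dist ((fj o q n) x) ((fj o q n) y) = hyp_dist x y" if "x : O' k" "y : O' k" for x y k
   using that ch(3)[of "q n x" "q n y"] Ai[of x k y] unfolding O'_def by simp
  have O3: "emeasure hvol (O' k) < \<infinity>" for k
  proof -
   have "emeasure hvol (O' k) <= emeasure hvol (A k)" unfolding O'_def using Ao(1) by (intro emeasure_mono) auto
   thus ?thesis using Ao(3) by (rule le_less_trans)
  qed
  have iso: "(fj o q n) ` E k : sets borel" "emeasure hvol ((fj o q n) ` E k) = emeasure hvol (E k)" for k
   using hvol_isometry[OF O1[of k] O1'(2,1)[of k] O2[of _ k] bE[of k] EO[of k]] O3[of k] by auto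
  have injU: "inj_on fj U"
  proof (rule inj_onI)
   fix x y assume xy: "x : U" "y : U" "fj x = fj y"
   have "wd n x y = hyp_dist (fj x) (fj x)" using ch(3)[OF xy(1,2)] xy(3) by simp
   also have "... = 0" using hyp_dist_0_iff[of "fj x" "fj x"] ch(2) xy(1) by auto
   finally show "x = y" using Metric_space.zero[OF Wn_metric, of x n y] xy US(1) by blast
  qed
  have un: "fj ` B = (\<Union>k. (fj o q n) ` E k)"
  proof (intro equalityI subsetI)
   fix v assume "v : fj ` B"
   then obtain p where p: "p : B" "v = fj p" by blast
   then obtain k x where "x : F k" "q n x = p" using Fc[of p] B(2) US(1) by blast
   hence "x : E k" unfolding E_def using p(1) Fs(1) Ao(2) by blast
   thus "v : (\<Union>k. (fj o q n) ` E k)" using p(2) \<open>q n x = p\<close> by auto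
  qed (auto simp: E_def)
  have dis: "disjoint_family (%k. (fj o q n) ` E k)" unfolding disjoint_family_on_def
  proof (intro ballI impI)
   fix k l :: nat assume kl: "k ~= l"
   show "(fj o q n) ` E k Int (fj o q n) ` E l = {}"
   proof (rule ccontr)
    assume "~ ?thesis"
    then obtain x y where xy: "x : E k" "y : E l" "fj (q n x) = fj (q n y)" by auto
    hence "q n x = q n y" using inj_onD[OF injU] B(2) unfolding E_def by blast
    thus False using Fd[of x k y l] xy kl unfolding E_def by blast
   qed
  qed
  have "emeasure hvol (fj ` B) = (suminf (%k. emeasure hvol ((fj o q n) ` E k)))" unfolding un by (rule suminf_emeasure[symmetric]) (use iso(1) dis in auto)
  also have "... = (suminf (%k. emeasure hvol (E k)))" using iso(2) by simp
  also have "... = emeasure hvol (\<Union>k. E k)"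
  proof (rule suminf_emeasure)
   show "disjoint_family E" unfolding disjoint_family_on_def E_def using Fd by blast
  qed (use bE in auto)
  also have "(\<Union>k. E k) = FF Int (hyp3 Int q n -` B)" unfolding E_def FF_def by blast
  also have "... = FF Int q n -` B" using FFs(2) by blast
  finally have "emeasure hvol (fj ` B) = emeasure m B" using em[OF B(1)] by simp
  moreover have "fj ` B : sets borel" unfolding un using iso(1) by auto
  ultimately show "emeasure m B = hyp_volume (fj ` B)" using emeasure_hvol by simp
 qed (use sm in auto)
 moreover have "emeasure m (topspace (Wn n)) < \<infinity>"
 proof -
  have "q n ` hyp3 : sets m" using sets.top[of m] sm(2) by simp
  hence "emeasure m (topspace (Wn n)) = emeasure hvol (FF Int q n -` (q n ` hyp3))" unfolding topspace_Wn by (rule em)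
  also have "... <= emeasure hvol (fdom n)" using FFs(1) closed_dom by (intro emeasure_mono) auto
  also have "... < \<infinity>" using hvol_dom n by (simp add: odd_pos)
  finally show ?thesis .
 qed
 ultimately show ?thesis unfolding finite_volume_hyperbolic_def using Wn_complete_hyperbolic by blast
qed

section \<open>The cusp and its filling\<close>

text \<open>The product of the heights exceeds 1, so by \<open>act_horoball\<close> the connecting
  element fixes infinity, and \<open>Gn_P_lat\<close> makes it a lattice translation.\<close>

lemma cusp_eq:
 assumes n: "odd n" and x: "1 < x$3" and y: "1 <= y$3" and e: "q n x = q n y"
 obtains i j :: int where "y = pt (cz x + czz n (of_int i) (of_int j)) (x$3)"
proof -
 have h: "x : hyp3" "y : hyp3" using x y by (auto simp: hyp3_def)
 obtain g where g: "g : Gn n" "y = act g x" using e q_eq_iff[OF h] by blast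
 have "m21 g = 0"
 proof (rule ccontr)
  assume "m21 g ~= 0"
  hence "y$3 * x$3 <= 1" using act_horoball[OF Gn_Gam[OF g(1)] _ h(1)] g(2) by simp
  moreover have "1 * x$3 <= y$3 * x$3" using x y by (intro mult_right_mono) auto
  ultimately show False using x by simp
 qed
 then obtain i j where "g = tmat (lat n i j) | g = - tmat (lat n i j)" using Gn_P_lat[OF n g(1)] by metis
 thus thesis using that g(2) act_tmat[OF h(1)] by (auto simp: emb_lat)
qed

lemma q_lat: "odd n ==> 0 < t ==> q n (pt (z + czz n (of_int i) (of_int j)) t) = q n (pt z t)"
 using q_act[OF lat_Gn, of n "pt z t" i j] by (simp add: act_tmat emb_lat)

text \<open>Solid torus coordinates on the cusp: the first lattice coordinate becomes the angle of
  \<open>w\<close>, so that its circle bounds a disc, the height \<open>t\<close> becomes the radius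
  \<open>4 / t\<close>, and the second lattice coordinate is kept. Height 4 is the boundary
  \<open>|w| = 1\<close>, height 1 the outer limit \<open>|w| = 4\<close>, and infinity the core
  \<open>w = 0\<close>.\<close>

definition Em :: "real => nat => R3 => R3" where
 "Em e n v = pt (of_real (4/v$3) * cis (2 * pi * (e * ca n (cz v)))) (cb n (cz v))"

definition high :: "R3 set" where "high = {v. 1 < v$3}"

lemma high_facts: "open high" "connected high" "high <= hyp3"
proof -
 show "open high" unfolding high_def by (intro open_Collect_less continuous_intros)
 have "high = {x. axis 3 1 \<bullet> x > 1}" by (simp add: high_def inner_axis')
 thus "connected high" using convex_connected[OF convex_halfspace_gt] by metis
qed (auto simp: high_def hyp3_def)

lemma continuous_on_ca [continuous_intros]:
 "continuous_on S f ==> continuous_on S (%x. ca n (f x))" "continuous_on S f ==> continuous_on S (%x. cb n (f x))"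
 unfolding ca_def cb_def divide_inverse by (intro continuous_intros; assumption)+

lemma continuous_on_Em: "continuous_on high (Em e n)" unfolding Em_def by (intro continuous_intros) (auto simp: high_def)

lemma cis_2pi_eq: "cis (2 * pi * a) = cis (2 * pi * b) \<longleftrightarrow> a - b : \<int>"
proof -
 have "cis (2 * pi * a) = cis (2 * pi * b) \<longleftrightarrow> cis (2 * pi * (a - b)) = 1" by (simp add: cis_divide[symmetric] right_diff_distrib)
 also have "... \<longleftrightarrow> (EX k :: int. 2 * pi * (a - b) = 2 * pi * of_int k)"
  unfolding cis.ctr complex_eq_iff by (simp add: cos_one_2pi_int sin_times_pi_eq_0) (metis cos_one_2pi_int mult.commute mult.left_commute sin_int_2pin)
 finally show ?thesis by (auto simp: Ints_def)
qed

lemma Em_eq: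
 assumes "1 < u$3" "1 < v$3" "e = 1 | e = - 1" "Em e n u = Em e n v"
 shows "u$3 = v$3" "cb n (cz u) = cb n (cz v)" "ca n (cz u) - ca n (cz v) : \<int>"
proof -
 have z: "of_real (4/u$3) * cis (2 * pi * (e * ca n (cz u))) = of_real (4/v$3) * cis (2 * pi * (e * ca n (cz v)))"
  and "cb n (cz u) = cb n (cz v)" using assms(4) unfolding Em_def by (auto simp: pt_eq_iff)
 thus "cb n (cz u) = cb n (cz v)" by simp
 have "4/u$3 = 4/v$3" using arg_cong[OF z, of cmod] assms(1,2) unfolding norm_mult norm_cis norm_of_real by simp
 thus uv: "u$3 = v$3" using assms(1,2) by (simp add: field_simps)
 hence "cis (2 * pi * (e * ca n (cz u))) = cis (2 * pi * (e * ca n (cz v)))" using z assms(2) by simp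
 hence "e * ca n (cz u) - e * ca n (cz v) : \<int>" unfolding cis_2pi_eq .
 thus "ca n (cz u) - ca n (cz v) : \<int>" using assms(3) minus_in_Ints_iff[of "ca n (cz u) - ca n (cz v)"] by auto
qed

lemma coords_eq: "0 < n ==> u$3 = v$3 ==> ca n (cz u) = ca n (cz v) ==> cb n (cz u) = cb n (cz v) ==> u = v"
proof -
 assume n: "0 < n" and t: "u$3 = v$3" and c: "ca n (cz u) = ca n (cz v)" "cb n (cz u) = cb n (cz v)"
 have "czz n (ca n (cz u)) (cb n (cz u)) = czz n (ca n (cz v)) (cb n (cz v))" by (simp only: c)
 thus "u = v" unfolding ca_czz(3)[OF n] pt_eq_iff using t by simp
qed

lemma Em_locally_inj:
 assumes n: "0 < n" and e: "e = 1 | e = - 1" and v: "v : high"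
 shows "EX B. open B & v : B & B <= high & inj_on (Em e n) B"
proof (intro exI conjI)
 define B where "B = high Int {u. \<bar>ca n (cz u) - ca n (cz v)\<bar> < 1/2}"
 have "open {u. \<bar>ca n (cz u) - ca n (cz v)\<bar> < 1/2}" by (intro open_Collect_less continuous_intros)
 thus "open B" unfolding B_def using high_facts(1) by (intro open_Int)
 show "v : B" "B <= high" using v by (auto simp: B_def)
 show "inj_on (Em e n) B"
 proof (rule inj_onI)
  fix u w assume u: "u : B" and w: "w : B" and eq: "Em e n u = Em e n w"
  have "1 < u$3" "1 < w$3" using u w by (auto simp: B_def high_def)
  note E = Em_eq[OF this e eq]
  have "\<bar>ca n (cz u) - ca n (cz v)\<bar> < 1/2" "\<bar>ca n (cz w) - ca n (cz v)\<bar> < 1/2" using u w unfolding B_def by auto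
  hence "\<bar>ca n (cz u) - ca n (cz w)\<bar> < 1" by linarith
  hence "ca n (cz u) = ca n (cz w)" using Ints_nonzero_abs_less1[OF E(3)] by linarith
  thus "u = w" by (rule coords_eq[OF n E(1) _ E(2)])
 qed
qed

text \<open>The sign makes the coordinate change preserve the orientation.\<close>

lemma Em_sign:
 assumes n: "0 < n"
 shows "EX e. (e = 1 | e = - 1) & (ALL v:high. lsg True (Em e n) v)"
proof -
 have ph: "pt 0 2 : high" by (simp add: high_def)
 obtain B where B: "open B" "pt 0 2 : B" "B <= high" "inj_on (Em 1 n) B" using Em_locally_inj[OF n _ ph, of 1] by auto
 obtain b where b: "lsg b (Em 1 n) (pt 0 2)" using lsg_cases[OF B(1,2) continuous_on_subset[OF continuous_on_Em B(3)] B(4)] by blast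
 have all: "lsg b (Em 1 n) v" if "v : high" for v by (rule lsg_constant[OF high_facts(1,2) continuous_on_Em Em_locally_inj[OF n] b ph that]) auto
 show ?thesis
 proof (cases b)
  case True thus ?thesis using all by auto
 next
  case False
  have "lsg True (Em (- 1) n) v" if v: "v : high" for v
  proof (rule lsg_cong[OF lsg_comp[OF all[OF v] lsg_refl2[of "Em 1 n v"], unfolded eq_False[THEN iffD2, OF False] refl simp_thms]])
   show "(refl2 o Em 1 n) u = Em (- 1) n u" for u by (simp add: refl2_def Em_def pt_eq_iff cz_def complex_eq_iff pt_def)
  qed (use high_facts v in auto)
  thus ?thesis by auto
 qed
qed

definition eps :: "nat => real" where
 "eps n = (SOME e. (e = 1 | e = - 1) & (ALL v:high. lsg True (Em e n) v))"

lemma eps: "0 < n ==> eps n = 1 | eps n = - 1" "0 < n ==> v : high ==> lsg True (Em (eps n) n) v"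
 using someI_ex[OF Em_sign] unfolding eps_def[symmetric] by auto

text \<open>The point of the filling with solid torus coordinates \<open>w\<close> and
  \<open>s\<close>. Off the core it is a point of the cusp; the core circle is realised by the
  numbers above -2 and at most -1.\<close>

definition kap :: "nat => complex => real => real" where
 "kap n w s = (if w = 0 then - 1 - frac s else q n (pt (czz n (eps n * (Arg w/(2 * pi))) s) (4/cmod w)))"

text \<open>Placed below height 0 so as to be disjoint from \<open>hyp3\<close> in the same space.
  The coordinate \<open>s\<close> counts modulo 1, so negative values reach everything.\<close>

definition low :: "R3 set" where "low = {x. x$3 < 0 & cmod (cz x) < 4}"
definition SN :: "R3 set" where "SN = hyp3 Un low"
definition piN :: "nat => R3 => real" where "piN n x = (if 0 < x$3 then q n x else kap n (cz x) (x$3))"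

abbreviation Nn :: "nat => real topology" where "Nn n \<equiv> ftop SN (piN n)"

lemma open_low: "open low" and open_SN: "open SN"
proof -
 show "open low" unfolding low_def by (intro open_Collect_conj open_Collect_less continuous_intros)
 thus "open SN" unfolding SN_def using hyp3_open by blast
qed

lemma piN_simps: "x : hyp3 ==> piN n x = q n x" "x : low ==> piN n x = kap n (cz x) (x$3)" by (auto simp: piN_def hyp3_def low_def)

text \<open>On the overlap \<open>Em\<close> is the change between the two parametrisations.
  \<open>Arg\<close> may differ from the angle used by full turns, and a lattice translation absorbs
  these.\<close>

lemma kap_Em:
 assumes n: "odd n" and v: "0 < v$3"
 shows "kap n (cz (Em (eps n) n v)) (Em (eps n) n v$3) = q n v"
proof -
 have n0: "0 < n" using n by (simp add: odd_pos)
 define a b where "a = ca n (cz v)" and "b = cb n (cz v)"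
 define w where "w = complex_of_real (4/v$3) * cis (2 * pi * (eps n * a))"
 have w1: "cmod w = 4/v$3" unfolding w_def norm_mult norm_cis norm_of_real using v by simp
 hence w: "cmod w = 4/v$3" "w ~= 0" using v by auto
 have "sgn w = cis (2 * pi * (eps n * a))" unfolding sgn_div_norm w1 unfolding w_def using v by (simp add: scaleR_conv_of_real)
 hence "cis (Arg w) = cis (2 * pi * (eps n * a))" using w(2) by (simp add: cis_Arg)
 hence "cis (2 * pi * (Arg w/(2 * pi))) = cis (2 * pi * (eps n * a))" by simp
 hence "Arg w/(2 * pi) - eps n * a : \<int>" unfolding cis_2pi_eq .
 then obtain k where k: "Arg w/(2 * pi) = eps n * a + of_int k" by (metis Ints_cases diff_eq_eq add.commute)
 obtain k' where "eps n * (Arg w/(2 * pi)) = a + of_int k'"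
 proof (cases "eps n = 1")
  case False
  hence "eps n = - 1" using eps(1)[OF n0] by simp
  thus thesis using that[of "- k"] k by simp
 qed (use that[of k] k in simp)
 hence "czz n (eps n * (Arg w/(2 * pi))) b = cz v + czz n (of_int k') (of_int 0)" using czz_add[of n a b "of_int k'" 0] ca_czz(3)[OF n0, of "cz v"] unfolding a_def b_def by simp
 hence "kap n w b = q n (pt (cz v) (v$3))" unfolding kap_def using w q_lat[OF n v, of "cz v" k' 0] by (simp add: w)
 thus ?thesis unfolding Em_def w_def a_def b_def by simp
qed

text \<open>The bound 4 puts the corresponding cusp points above height 1, where
  \<open>cusp_eq\<close> leaves lattice translations only; negativity tells the core apart.\<close>

lemma kap_eq:
 assumes n: "odd n" and w: "cmod w < 4" "cmod w' < 4"
 shows "kap n w s = kap n w' s' \<longleftrightarrow> w = w' & s - s' : \<int>"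
proof
 have n0: "0 < n" using n by (simp add: odd_pos)
 assume k: "kap n w s = kap n w' s'"
 have z: "kap n w s < 0 \<longleftrightarrow> w = 0" for w s
 proof (cases "w = 0")
  case True
  thus ?thesis using frac_ge_0[of s] by (simp add: kap_def add.commute[of _ "frac s"] less_le_trans[of "- 1" 0])
 next
  case False
  thus ?thesis using q_pos[of n "pt (czz n (eps n * (Arg w/(2 * pi))) s) (4/cmod w)"] by (simp add: kap_def)
 qed
 show "w = w' & s - s' : \<int>"
 proof (cases "w = 0")
  case True
  hence "w' = 0" using z k by metis
  hence "frac s = frac s'" using k True by (simp add: kap_def)
  hence "s - s' = of_int (\<lfloor>s\<rfloor> - \<lfloor>s'\<rfloor>)" by (simp add: frac_def)
  thus ?thesis using True \<open>w' = 0\<close> by (metis Ints_of_int)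
 next
  case False
  hence w0: "w ~= 0" "w' ~= 0" using z k by metis+
  define x y where "x = pt (czz n (eps n * (Arg w/(2 * pi))) s) (4/cmod w)" and "y = pt (czz n (eps n * (Arg w'/(2 * pi))) s') (4/cmod w')"
  have "1 < x$3" "1 <= y$3" using w w0 unfolding x_def y_def by (simp_all add: less_imp_le)
  moreover have "q n x = q n y" using k w0 unfolding kap_def x_def y_def by simp
  ultimately obtain i j :: int where ij: "y = pt (cz x + czz n (of_int i) (of_int j)) (x$3)" using cusp_eq[OF n] by metis
  have "y$3 = x$3" "cz y = cz x + czz n (of_int i) (of_int j)" unfolding ij by (rule pt_simps)+
  hence yx: "4/cmod w' = 4/cmod w"
   "czz n (eps n * (Arg w'/(2 * pi))) s' = czz n (eps n * (Arg w/(2 * pi))) s + czz n (of_int i) (of_int j)" unfolding x_def y_def pt_simps .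
  hence m: "cmod w' = cmod w" using w0 by (simp add: field_simps)
  have c: "czz n (eps n * (Arg w'/(2 * pi))) s' = czz n (eps n * (Arg w/(2 * pi)) + of_int i) (s + of_int j)" using yx(2) unfolding czz_add .
  have s: "s' = s + of_int j" using arg_cong[OF c, of "cb n"] unfolding ca_czz(2)[OF n0] .
  have "eps n * (Arg w'/(2 * pi)) = eps n * (Arg w/(2 * pi)) + of_int i" using arg_cong[OF c, of "ca n"] unfolding ca_czz(1)[OF n0] .
  hence "Arg w'/(2 * pi) - Arg w/(2 * pi) = of_int i | Arg w'/(2 * pi) - Arg w/(2 * pi) = of_int (- i)" using eps(1)[OF n0] by auto
  hence "cis (2 * pi * (Arg w'/(2 * pi))) = cis (2 * pi * (Arg w/(2 * pi)))" unfolding cis_2pi_eq by (metis Ints_of_int)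
  hence "cis (Arg w') = cis (Arg w)" by simp
  hence "sgn w' = sgn w" using w0 by (simp add: cis_Arg)
  hence "w' = w" using m w0 by (simp add: sgn_div_norm)
  thus ?thesis using s by (metis Ints_of_int add_diff_cancel_left' Ints_minus minus_diff_eq)
 qed
next
 assume *: "w = w' & s - s' : \<int>"
 then obtain j where "s - s' = of_int j" by (metis Ints_cases)
 hence j: "s = s' + of_int j" by simp
 show "kap n w s = kap n w' s'"
 proof (cases "w = 0")
  case True
  thus ?thesis using * j by (simp add: kap_def frac_def)
 next
  case False
  thus ?thesis using * j q_lat[OF n, of "4/cmod w" "czz n (eps n * (Arg w/(2 * pi))) s'" 0 j] by (simp add: kap_def czz_add)
 qed
qed

lemma lsg_local_inverse:
 assumes B: "open B" "x : B" "continuous_on B f" "inj_on f B" and l: "lsg b f x"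
 obtains T where "open T" "f x : T" "T = f ` B" "lsg b (inv_into B f) (f x)" "!!y. y : T ==> inv_into B f y : B & f (inv_into B f y) = y"
proof -
 define fj where "fj = inv_into B f"
 have o: "open (f ` B)" using invariance_of_domain B by blast
 have c: "continuous_on (f ` B) fj" unfolding fj_def
  by (rule continuous_on_inverse_open_map[OF B(3)]) (use B open_map_E3[OF B(1,3,4)] o in "auto simp: open_map_def openin_open_eq")
 have i: "inj_on fj (f ` B)" unfolding fj_def by (rule inj_on_inv_into) simp
 obtain b' where b': "lsg b' fj (f x)" using lsg_cases[OF o _ c i] B(2) by blast
 have "lsg (b = b') (fj o f) x" by (rule lsg_comp[OF l b'])
 hence "lsg (b = b') id x" by (rule lsg_cong[OF _ B(1,2)]) (simp add: fj_def B(4))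
 hence "b = b'" using lsg_id lsg_not_both by (metis (full_types))
 thus thesis using that[of "f ` B"] o B(2) b' unfolding fj_def by (auto simp: inv_into_into f_inv_into_f)
qed

context
 fixes n :: nat
 assumes n: "odd n"
begin

lemma n0: "0 < n" using n by (simp add: odd_pos)

text \<open>The transition clause of \<open>atlas\<close>. Being symmetric and transitive, it
  reduces to group elements, the coordinate change \<open>Em\<close> and translations in
  \<open>s\<close>; a mixed pair is joined through a point of \<open>high\<close>.\<close>

definition trans_rel :: "R3 => R3 => bool" where
 "trans_rel x y \<longleftrightarrow> (EX gm T. open T & x : T & lsg True gm x & gm x = y & (ALL z:T. piN n (gm z) = piN n z))"

lemma trans_rel_sym: "trans_rel x y ==> trans_rel y x"
proof -
 assume "trans_rel x y"
 then obtain gm T where g: "open T" "x : T" "lsg True gm x" "gm x = y" "!!z. z : T ==> piN n (gm z) = piN n z"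
  unfolding trans_rel_def by blast
 obtain B where B: "open B" "x : B" "B <= T" "continuous_on B gm" "inj_on gm B" by (rule lsg_obtain[OF g(3,1,2)])
 obtain V where V: "open V" "gm x : V" "V = gm ` B" "lsg True (inv_into B gm) (gm x)"
  "!!z. z : V ==> inv_into B gm z : B & gm (inv_into B gm z) = z" using lsg_local_inverse[OF B(1,2,4,5) g(3)] by metis
 have "piN n (inv_into B gm z) = piN n z" if z: "z : V" for z
 proof -
  have "inv_into B gm z : T" using V(5)[OF z] B(3) by blast
  thus ?thesis using g(5) V(5)[OF z] by metis
 qed
 thus ?thesis unfolding trans_rel_def using V(1,2,4) g(4) inv_into_f_f[OF B(5,2)] by (intro exI[of _ "inv_into B gm"] exI[of _ V]) simp
qed

lemma trans_rel_trans: "trans_rel x y ==> trans_rel y z ==> trans_rel x z"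
proof -
 assume "trans_rel x y" "trans_rel y z"
 then obtain gm T gm' T' where g: "open T" "x : T" "lsg True gm x" "gm x = y" "!!z. z : T ==> piN n (gm z) = piN n z"
  and g': "open T'" "y : T'" "lsg True gm' y" "gm' y = z" "!!z. z : T' ==> piN n (gm' z) = piN n z" unfolding trans_rel_def by blast
 obtain B where B: "open B" "x : B" "B <= T" "continuous_on B gm" "inj_on gm B" by (rule lsg_obtain[OF g(3,1,2)])
 have o: "open (B Int gm -` T')" by (rule continuous_open_preimage[OF B(4,1) g'(1)])
 have l: "lsg True (gm' o gm) x" using lsg_comp[OF g(3), of True gm'] g(4) g'(3) by simp
 have "piN n ((gm' o gm) v) = piN n v" if v: "v : B Int gm -` T'" for v
 proof -
  have "v : T" "gm v : T'" using v B(3) by auto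
  thus ?thesis using g(5) g'(5) by simp
 qed
 thus ?thesis unfolding trans_rel_def using o l B(2) g(4) g'(2,4) by (intro exI[of _ "gm' o gm"] exI[of _ "B Int gm -` T'"]) simp
qed

lemma trans_rel_hyp3: "x : hyp3 ==> y : hyp3 ==> q n x = q n y ==> trans_rel x y"
proof -
 assume x: "x : hyp3" and y: "y : hyp3" and "q n x = q n y"
 then obtain g where g: "g : Gn n" "y = act g x" using q_eq_iff by blast
 have "piN n (act g z) = piN n z" if "z : hyp3" for z using piN_simps(1) Gn_act(1)[OF g(1) that] q_act[OF g(1) that] that by simp
 thus ?thesis unfolding trans_rel_def using lsg_act[OF Gn_Gam[OF g(1)] x] hyp3_open x g(2) by blast
qed

lemma Em_low: "v : high ==> cb n (cz v) < 0 ==> Em e n v : low"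
proof -
 assume "v : high" "cb n (cz v) < 0"
 moreover have "cmod (of_real (4/v$3) * cis (2 * pi * (e * ca n (cz v)))) = 4/\<bar>v$3\<bar>" unfolding norm_mult norm_cis norm_of_real by simp
 ultimately show ?thesis unfolding low_def Em_def mem_Collect_eq pt_simps by (simp add: high_def divide_less_eq)
qed

lemma trans_rel_Em: assumes v: "v : high" "cb n (cz v) < 0" shows "trans_rel v (Em (eps n) n v)" unfolding trans_rel_def
proof (intro exI conjI ballI)
 define T where "T = high Int {v. cb n (cz v) < 0}"
 have "open {v. cb n (cz v) < 0}" by (intro open_Collect_less continuous_intros)
 thus "open T" unfolding T_def using high_facts(1) by (intro open_Int)
 show "v : T" using v by (simp add: T_def)
 show "lsg True (Em (eps n) n) v" by (rule eps(2)[OF n0 v(1)])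
 fix z assume z: "z : T"
 hence zh: "z : hyp3" "0 < z$3" using high_facts(3) hyp3_pos by (auto simp: T_def)
 have "Em (eps n) n z : low" using z Em_low by (simp add: T_def)
 thus "piN n (Em (eps n) n z) = piN n z" using piN_simps zh kap_Em[OF n zh(2)] by simp
qed simp

lemma kap_q:
 assumes "w ~= 0" "cmod w < 4"
 obtains v where "v : high" "v$3 = 4/cmod w" "kap n w s = q n v" "Em (eps n) n v = pt w s" "cb n (cz v) = s"
proof
 define v where "v = pt (czz n (eps n * (Arg w/(2 * pi))) s) (4/cmod w)"
 show "v : high" "v$3 = 4/cmod w" using assms by (simp_all add: v_def high_def)
 show "kap n w s = q n v" using assms by (simp add: kap_def v_def)
 show "cb n (cz v) = s" using n0 by (simp add: v_def)
 have e: "eps n * (eps n * a) = a" for a using eps(1)[OF n0] by auto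
 have "complex_of_real (4/(4/cmod w)) * cis (2 * pi * (eps n * (eps n * (Arg w/(2 * pi))))) = w" unfolding e using assms rcis_cmod_Arg[of w] by (simp add: rcis_def)
 thus "Em (eps n) n v = pt w s" unfolding Em_def v_def pt_simps ca_czz[OF n0] by simp
qed

lemma trans_rel_mixed: assumes x: "x : hyp3" and y: "y : low" and e: "q n x = kap n (cz y) (y$3)" shows "trans_rel x y"
proof -
 have y': "cmod (cz y) < 4" "y$3 < 0" using y by (auto simp: low_def)
 have "cz y ~= 0"
 proof
  assume "cz y = 0"
  hence "q n x = - 1 - frac (y$3)" using e by (simp add: kap_def)
  thus False using q_pos[of n x] frac_ge_0[of "y$3"] by linarith
 qed
 then obtain v where v: "v : high" "kap n (cz y) (y$3) = q n v" "Em (eps n) n v = pt (cz y) (y$3)" "cb n (cz v) = y$3" using kap_q[OF _ y'(1)] by metis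
 have "trans_rel x v" using trans_rel_hyp3[OF x] v(1,2) high_facts(3) e by auto
 moreover have "trans_rel v y" using trans_rel_Em[OF v(1)] v(3,4) y'(2) by simp
 ultimately show ?thesis by (rule trans_rel_trans)
qed

lemma trans_rel_low:
 assumes x: "x : low" and y: "y : low" and e: "kap n (cz x) (x$3) = kap n (cz y) (y$3)" shows "trans_rel x y"
proof -
 have c: "cmod (cz x) < 4" "cmod (cz y) < 4" using x y by (auto simp: low_def)
 have xy: "cz x = cz y" "x$3 - y$3 : \<int>" using e kap_eq[OF n c] by auto
 define w where "w = y - x"
 have w: "cz w = 0" "w$3 = y$3 - x$3" using xy(1) by (simp_all add: w_def cz_def complex_eq_iff)
 have zw: "cz (z + w) = cz z" "(z + w)$3 = z$3 + (y$3 - x$3)" for z using w by (simp_all add: cz_def complex_eq_iff)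
 define T where "T = low Int {z. z$3 + (y$3 - x$3) < 0}"
 have "open {z :: R3. z$3 + (y$3 - x$3) < 0}" by (intro open_Collect_less continuous_intros)
 hence T: "open T" unfolding T_def using open_low by (intro open_Int)
 have "piN n (z + w) = piN n z" if z: "z : T" for z
 proof -
  have zl: "z : low" "z + w : low" using z zw by (auto simp: T_def low_def)
  have "cmod (cz z) < 4" using zl by (simp add: low_def)
  hence "kap n (cz z) (z$3 + (y$3 - x$3)) = kap n (cz z) (z$3)" using xy(2) by (simp add: kap_eq[OF n]) (metis Ints_minus minus_diff_eq)
  thus ?thesis unfolding piN_simps(2)[OF zl(1)] piN_simps(2)[OF zl(2)] zw .
 qed
 moreover have "x : T" using x y by (simp add: T_def low_def)
 moreover have "x + w = y" by (simp add: w_def)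
 ultimately show ?thesis unfolding trans_rel_def using T lsg_translation[of w x] by (intro exI[of _ "%v. v + w"] exI[of _ T]) simp
qed

lemma atlas_N: "atlas SN (piN n)" unfolding atlas_def
proof (intro conjI ballI impI)
 show "open SN" by (rule open_SN)
next
 fix x assume "x : SN"
 then consider "x : hyp3" | "x : low" unfolding SN_def by blast
 thus "EX B. open B & x : B & B <= SN & inj_on (piN n) B"
 proof cases
  case 1
  then obtain B where B: "open B" "x : B" "B <= hyp3" "inj_on (q n) B" using atlas_q[of n] unfolding atlas_def by blast
  have "inj_on (piN n) B \<longleftrightarrow> inj_on (q n) B" by (rule inj_on_cong) (use piN_simps B(3) in auto)
  thus ?thesis using B unfolding SN_def by blast
 next
  case 2
  define B where "B = low Int {z. \<bar>z$3 - x$3\<bar> < 1/2}"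
  have "open {z :: R3. \<bar>z$3 - x$3\<bar> < 1/2}" by (intro open_Collect_less continuous_intros)
  hence "open B" unfolding B_def using open_low by (intro open_Int)
  moreover have "inj_on (piN n) B"
  proof (rule inj_onI)
   fix y z assume yz: "y : B" "z : B" "piN n y = piN n z"
   hence l: "y : low" "z : low" "\<bar>y$3 - x$3\<bar> < 1/2" "\<bar>z$3 - x$3\<bar> < 1/2" by (simp_all add: B_def)
   have "cz y = cz z & y$3 - z$3 : \<int>" using yz(3) l(1,2) unfolding piN_simps(2)[OF l(1)] piN_simps(2)[OF l(2)] by (subst (asm) kap_eq[OF n]) (auto simp: low_def)
   moreover have "\<bar>y$3 - z$3\<bar> < 1" using l(3,4) by linarith
   ultimately show "y = z" using Ints_nonzero_abs_less1[of "y$3 - z$3"] by (simp add: pt_eq_iff)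
  qed
  ultimately show ?thesis using 2 unfolding SN_def B_def by (intro exI[of _ B]) (auto simp: B_def)
 qed
next
 fix x y assume x: "x : SN" and y: "y : SN" and e: "piN n x = piN n y"
 have "trans_rel x y"
 proof (cases "x : hyp3"; cases "y : hyp3")
  assume h: "x : hyp3" "y : hyp3"
  thus ?thesis using e trans_rel_hyp3 piN_simps(1) by simp
 next
  assume h: "x : hyp3" "y \<notin> hyp3"
  hence "y : low" using y by (simp add: SN_def)
  thus ?thesis using e trans_rel_mixed[OF h(1)] piN_simps h(1) by simp
 next
  assume h: "x \<notin> hyp3" "y : hyp3"
  hence "x : low" using x by (simp add: SN_def)
  thus ?thesis using e trans_rel_sym[OF trans_rel_mixed[OF h(2)]] piN_simps h(2) by simp
 next
  assume h: "x \<notin> hyp3" "y \<notin> hyp3"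
  hence "x : low" "y : low" using x y by (simp_all add: SN_def)
  thus ?thesis using e trans_rel_low piN_simps(2) by simp
 qed
 thus "EX gm T. open T & x : T & lsg True gm x & gm x = y & (ALL z:T. piN n (gm z) = piN n z)" unfolding trans_rel_def .
qed

lemma kap_normal: assumes "cmod w < 4" shows "EX s':{-2..-1}. kap n w s = kap n w s'"
proof
 have "s - (frac s - 2) = of_int (\<lfloor>s\<rfloor> + 2)" by (simp add: frac_def)
 hence "s - (frac s - 2) : \<int>" by (metis Ints_of_int)
 thus "kap n w s = kap n w (frac s - 2)" by (simp add: kap_eq[OF n assms assms])
 show "frac s - 2 : {-2..-1}" using frac_lt_1[of s] by (simp add: less_imp_le)
qed

lemma piN_low_kap: "cmod w < 4 ==> EX x:low. cz x = w & x$3 : {-2..-1} & piN n x = kap n w s"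
proof -
 assume w: "cmod w < 4"
 obtain s' where s: "s' : {-2..-1}" "kap n w s = kap n w s'" using kap_normal[OF w] by blast
 have "pt w s' : low" using w s(1) by (simp add: low_def)
 thus ?thesis using s piN_simps(2)[of "pt w s'"] by (intro bexI[of _ "pt w s'"]) auto
qed

lemma topspace_N: "topspace (Nn n) = q n ` hyp3 Un piN n ` low"
proof -
 have "piN n ` hyp3 = q n ` hyp3" by (rule image_cong) (simp_all add: piN_simps)
 thus ?thesis unfolding topspace_ftop[OF open_SN] by (simp add: SN_def image_Un)
qed

lemma q_kap: assumes x: "1 < x$3" shows "EX y:low. cz y ~= 0 & cmod (cz y) = 4/x$3 & y$3 : {-2..-1} & piN n y = q n x"
proof -
 define w where "w = cz (Em (eps n) n x)"
 have w: "cmod w = 4/x$3" unfolding w_def Em_def pt_simps norm_mult norm_cis norm_of_real using x by simp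
 hence "cmod w < 4" "w ~= 0" using x by (auto simp: divide_less_eq)
 moreover have "kap n w (Em (eps n) n x$3) = q n x" unfolding w_def using kap_Em[OF n, of x] x by simp
 moreover obtain y where "y : low" "cz y = w" "y$3 : {-2..-1}" "piN n y = kap n w (Em (eps n) n x$3)" using piN_low_kap[OF \<open>cmod w < 4\<close>] by blast
 ultimately show ?thesis using w by (intro bexI[of _ y]) auto
qed

section \<open>Global topology of the filling\<close>

lemma N_connected: "connected_space (Nn n)"
proof -
 have c: "connectedin (Nn n) (piN n ` C)" if "connected C" "C <= SN" for C
  by (rule connectedin_continuous_map_image[OF ftop_continuous[OF atlas_N]]) (use that in "simp add: connectedin_subtopology")
 have low_Int: "low = {x. x$3 < 0} Int cz -` ball 0 4" by (auto simp: low_def)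
 have cx: "convex {x :: R3. x$3 < 0}"
 proof -
  have "{x :: R3. x$3 < 0} = {x. axis 3 1 \<bullet> x < 0}" by (simp add: inner_axis')
  thus ?thesis by (simp only: convex_halfspace_lt)
 qed
 have "linear cz" by (rule linearI) (auto simp: cz_def complex_eq_iff)
 hence "convex (cz -` ball 0 4)" by (rule convex_linear_vimage) simp
 from convex_Int[OF cx this] have "convex low" unfolding low_Int .
 hence "connected low" by (rule convex_connected)
 hence 1: "connectedin (Nn n) (piN n ` low)" by (rule c) (simp add: SN_def)
 have 2: "connectedin (Nn n) (piN n ` hyp3)" by (rule c[OF convex_connected[OF hyp3_convex]]) (simp add: SN_def)
 obtain y where "y : low" "piN n y = q n (pt 0 2)" using q_kap[of "pt 0 2"] by auto
 moreover have "pt 0 2 : hyp3" by simp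
 moreover have "piN n (pt 0 2) = q n (pt 0 2)" by (rule piN_simps(1)) simp
 ultimately have "q n (pt 0 2) : piN n ` low Int piN n ` hyp3" by (metis IntI imageI)
 hence "piN n ` low Int piN n ` hyp3 ~= {}" by blast
 from connectedin_Un[OF 1 2 this] have "connectedin (Nn n) (piN n ` low Un piN n ` hyp3)" .
 moreover have "topspace (Nn n) = piN n ` low Un piN n ` hyp3" unfolding topspace_ftop[OF open_SN] by (simp add: SN_def image_Un Un_commute)
 ultimately show ?thesis unfolding connectedin_topspace[symmetric] by (simp only:)
qed

lemma orbit_height_bound:
 assumes x: "x : hyp3" and d: "!!g. g : Gn n ==> act g x$3 <= h" and y: "y : hcball x r" and g: "g : Gn n"
 shows "act g y$3 <= exp r * h"
proof -
 have yh: "y : hyp3" "hyp_dist y x <= r" using y by (auto simp: hcball_def hyp_dist_commute)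
 have "act g x : hcball (act g y) r" using Gn_act(1)[OF g] x yh act_isometry[OF Gn_Gam[OF g] yh(1) x] by (simp add: hcball_def)
 hence "act g y$3 * exp (- r) <= act g x$3" by (rule hball_height[OF Gn_act(1)[OF g yh(1)]])
 hence "act g y$3 * exp (- r) <= h" using d[OF g] by linarith
 thus ?thesis by (simp add: exp_minus field_simps)
qed

lemma openin_N_W: assumes X: "openin (Wn n) X" shows "openin (Nn n) X"
proof -
 have o: "X <= q n ` hyp3" "open (hyp3 Int q n -` X)" using X unfolding openin_ftop[OF hyp3_open] by simp_all
 have "piN n ` (hyp3 Int q n -` X) = q n ` (hyp3 Int q n -` X)" by (rule image_cong) (auto simp: piN_simps)
 also have "... = X" using o(1) by blast
 finally have e: "piN n ` (hyp3 Int q n -` X) = X" .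
 have "hyp3 Int q n -` X <= SN" by (auto simp: SN_def)
 from ftop_open_image[OF atlas_N o(2) this] show ?thesis unfolding e .
qed

text \<open>Two points of the cusped manifold are separated there. Near such a point the orbit
  heights are bounded by some \<open>H\<close>, so the region \<open>|w| < 4 / H\<close> around the
  core stays away from it. Two core points are separated by their second coordinates modulo
  1.\<close>

lemma N_Hausdorff: "Hausdorff_space (Nn n)" unfolding Hausdorff_space_def
proof (intro allI impI)
 let ?sep = "%p p'. EX U V. openin (Nn n) U & openin (Nn n) V & p : U & p' : V & disjnt U V"
 have sep_sym: "?sep p p'"
  if ex: "?sep p' p" for p p'
 proof -
  obtain U V where "openin (Nn n) U" "openin (Nn n) V" "p' : U" "p : V" "disjnt U V" using ex by blast
  thus ?thesis by (intro exI[of _ V] exI[of _ U] conjI) (simp_all add: disjnt_def Int_commute)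
 qed
 have core: "?sep p p'"
  if p: "p = piN n x" "x : low" "cz x = 0" and p': "p' : q n ` hyp3" for p p' x
 proof -
  obtain y where y: "y : hyp3" "p' = q n y" using p' by blast
  obtain g where g: "g : Gn n" "!!h. h : Gn n ==> act h y$3 <= act g y$3" using act_maximal[OF y(1)] by blast
  define H where "H = max 1 (exp 1 * act g y$3)"
  have bd: "act h z$3 <= H" if "z : hball y 1" "h : Gn n" for z h
  proof -
   have "z : hcball y 1" using that(1) hball_sub(1) by blast
   from orbit_height_bound[OF y(1) g(2) this that(2)] show ?thesis unfolding H_def by simp
  qed
  define O1 where "O1 = low Int cz -` ball 0 (4/H)"
  have H: "1 <= H" by (simp add: H_def)
  have o: "open O1" unfolding O1_def by (rule open_Int[OF open_low]) (intro open_vimage open_ball continuous_intros)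
  have x1: "x : O1" using p H by (simp add: O1_def)
  have hs: "hball y 1 <= SN" using hball_sub(3) SN_def by blast
  have "disjnt (piN n ` O1) (piN n ` hball y 1)" unfolding disjnt_def
  proof (rule ccontr)
   assume "piN n ` O1 Int piN n ` hball y 1 ~= {}"
   then obtain u z where uz: "u : O1" "z : hball y 1" "piN n u = piN n z" by auto
   have zh: "z : hyp3" using uz(2) hball_sub(3) by blast
   have u: "u : low" "cmod (cz u) < 4/H" using uz(1) by (auto simp: O1_def)
   have k: "kap n (cz u) (u$3) = q n z" using uz(3) piN_simps(1)[OF zh] piN_simps(2)[OF u(1)] by metis
   have u0: "cz u ~= 0"
   proof
    assume "cz u = 0"
    hence "q n z = - 1 - frac (u$3)" using k by (simp add: kap_def)
    thus False using q_pos[of n z] frac_ge_0[of "u$3"] by linarith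
   qed
   have "cmod (cz u) < 4" using u(1) by (simp add: low_def)
   then obtain v where v: "v : high" "v$3 = 4/cmod (cz u)" "q n z = q n v" using kap_q[OF u0] k by metis
   obtain h where h: "h : Gn n" "v = act h z" using v(1,3) q_eq_iff[OF zh] high_facts(3) by blast
   have "v$3 <= H" using bd[OF uz(2) h(1)] h(2) by simp
   moreover have "H < 4/cmod (cz u)" using u(2) u0 H by (simp add: field_simps)
   ultimately show False using v(2) by simp
  qed
  moreover have "O1 <= SN" by (auto simp: O1_def SN_def)
  hence "openin (Nn n) (piN n ` O1)" by (rule ftop_open_image[OF atlas_N o])
  moreover have "openin (Nn n) (piN n ` hball y 1)" by (rule ftop_open_image[OF atlas_N open_hball[OF y(1)] hs])
  moreover have "p : piN n ` O1" "p' : piN n ` hball y 1" using x1 p(1) y(2) piN_simps(1)[OF y(1), of n] hball_center[OF y(1) zero_less_one] by (blast, metis imageI)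
  ultimately show ?thesis by blast
 qed
 fix p p' assume "p : topspace (Nn n) & p' : topspace (Nn n) & p ~= p'"
 hence pp: "p : q n ` hyp3 Un piN n ` low" "p' : q n ` hyp3 Un piN n ` low" "p ~= p'" unfolding topspace_N by auto
 have cases: "p : q n ` hyp3 | (EX x:low. p = piN n x & cz x = 0)" if p: "p : q n ` hyp3 Un piN n ` low" for p
 proof (cases "p : q n ` hyp3")
  case False
  then obtain x where x: "x : low" "p = piN n x" using p by blast
  have "cz x = 0"
  proof (rule ccontr)
   assume "cz x ~= 0"
   then obtain v where "v : high" "kap n (cz x) (x$3) = q n v" using kap_q[of "cz x"] x(1) unfolding low_def by blast
   hence "p = q n v" "v : hyp3" using x piN_simps(2)[OF x(1), of n] high_facts(3) by auto
   thus False using False by simp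
  qed
  thus ?thesis using x by blast
 qed simp
 consider "p : q n ` hyp3" "p' : q n ` hyp3" | x where "x : low" "p = piN n x" "cz x = 0" "p' : q n ` hyp3"
  | x where "x : low" "p' = piN n x" "cz x = 0" "p : q n ` hyp3"
  | x y where "x : low" "p = piN n x" "cz x = 0" "y : low" "p' = piN n y" "cz y = 0" using cases[OF pp(1)] cases[OF pp(2)] by blast
 thus "?sep p p'"
 proof cases
  case 1
  then obtain U V where UV: "openin (Wn n) U" "openin (Wn n) V" "p : U" "p' : V" "disjnt U V" using Wn_Hausdorff[of n] pp(3) unfolding Hausdorff_space_def topspace_Wn by metis
  thus ?thesis using openin_N_W[OF UV(1)] openin_N_W[OF UV(2)] by (intro exI[of _ U] exI[of _ V]) simp
 next
  case 2 show ?thesis by (rule core[OF 2(2,1,3,4)])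
 next
  case 3 show ?thesis by (rule sep_sym[OF core[OF 3(2,1,3,4)]])
 next
  case (4 x y)
  define f where "f = frac (x$3 - y$3)"
  have f0: "f ~= 0"
  proof
   assume "f = 0"
   hence "kap n (cz x) (x$3) = kap n (cz y) (y$3)" using 4 by (subst kap_eq[OF n]) (auto simp: f_def frac_eq_0_iff)
   thus False using pp(3) 4 piN_simps(2)[OF 4(1)] piN_simps(2)[OF 4(4)] by simp
  qed
  hence f: "0 < f" "f < 1" using frac_ge_0[of "x$3 - y$3"] frac_lt_1[of "x$3 - y$3"] unfolding f_def by linarith+
  \<comment> \<open>\<open>f\<close> and \<open>1 - f\<close> are the lengths of the two arcs
    between the coordinates on the circle; intervals of this radius are disjoint modulo 1.\<close>
  define dl where "dl = min f (1 - f)/2"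
  have d: "0 < dl" "2 * dl <= f" "2 * dl <= 1 - f" using f by (auto simp: dl_def)
  define A where "A = (%c :: real. low Int {z. \<bar>z$3 - c\<bar> < dl})"
  have "open {z :: R3. \<bar>z$3 - c\<bar> < dl}" for c by (intro open_Collect_less continuous_intros)
  hence A: "openin (Nn n) (piN n ` A c)" for c unfolding A_def using open_low by (intro ftop_open_image[OF atlas_N] open_Int) (auto simp: SN_def)
  have "disjnt (piN n ` A (x$3)) (piN n ` A (y$3))" unfolding disjnt_def
  proof (rule ccontr)
   assume "piN n ` A (x$3) Int piN n ` A (y$3) ~= {}"
   then obtain u v where uv: "u : low" "v : low" "\<bar>u$3 - x$3\<bar> < dl" "\<bar>v$3 - y$3\<bar> < dl" "piN n u = piN n v" unfolding A_def by auto
   have c: "cmod (cz u) < 4" "cmod (cz v) < 4" using uv(1,2) by (auto simp: low_def)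
   have "u$3 - v$3 : \<int>" using uv(5) kap_eq[OF n c] unfolding piN_simps(2)[OF uv(1)] piN_simps(2)[OF uv(2)] by blast
   then obtain k where k: "u$3 - v$3 = of_int k" by (rule Ints_cases)
   have "\<bar>of_int k - (of_int \<lfloor>x$3 - y$3\<rfloor> + f)\<bar> < 2 * dl" using uv(3,4) k unfolding f_def frac_def by linarith
   hence "real_of_int \<lfloor>x$3 - y$3\<rfloor> < real_of_int k" "real_of_int k < real_of_int (\<lfloor>x$3 - y$3\<rfloor> + 1)" using d by simp_all
   thus False unfolding of_int_less_iff by linarith
  qed
  thus ?thesis using A 4 d(1) by (intro exI[of _ "piN n ` A (x$3)"] exI[of _ "piN n ` A (y$3)"]) (auto simp: A_def)
 qed
qed

text \<open>\<open>K1\<close> contains the part of \<open>fdom\<close> up to height 4, and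
  \<open>K2\<close> is one period of the closed solid torus \<open>|w| \<le> 1\<close>, which takes
  up the rest of the cusp.\<close>

definition K1 :: "R3 set" where "K1 = (%(a, b, t). pt (czz n a b) t) ` ({0..1} \<times> {0..1} \<times> {1/2..4})"
definition K2 :: "R3 set" where "K2 = {x. cmod (cz x) <= 1 & x$3 : {-2..-1}}"

lemma K12: "compact K1" "compact K2" "K1 <= hyp3" "K2 <= low"
proof -
 have "continuous_on S (%(a, b, t). pt (czz n a b) t)" for S
 proof -
  have "czz n a b = of_real ((a + b) * n) + \<i> * of_real ((a - b) * sqrt 3)" for a b by (simp add: czz_def complex_eq_iff)
  thus ?thesis unfolding case_prod_beta by (auto intro!: continuous_intros)
 qed
 thus "compact K1" unfolding K1_def by (intro compact_continuous_image compact_Times compact_Icc)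
 have "K2 = (%(w, s). pt w s) ` (cball 0 1 \<times> {-2..-1})"
 proof (intro equalityI subsetI)
  fix x assume "x : K2"
  thus "x : (%(w, s). pt w s) ` (cball 0 1 \<times> {-2..-1})" by (intro image_eqI[of _ _ "(cz x, x$3)"]) (auto simp: K2_def)
 qed (auto simp: K2_def)
 moreover have "continuous_on S (%(w, s). pt w s)" for S unfolding case_prod_beta by (intro continuous_intros)
 ultimately show "compact K2" by (metis compact_continuous_image compact_Times compact_Icc compact_cball)
qed (auto simp: K1_def K2_def low_def)

lemma K1_q: assumes "x : hyp3" obtains y where "y : hyp3" "q n y = q n x" "y : K1 | 4 < y$3"
proof -
 obtain y where y: "y : fdom n" "q n y = q n x" by (rule q_dom[OF assms n])
 have "y : K1" if "~ 4 < y$3" unfolding K1_def using that y(1) n0 by (intro image_eqI[of _ _ "(ca n (cz y), cb n (cz y), y$3)"]) (auto simp: fdom_def)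
 thus thesis using that y fdom_hyp3 by blast
qed

lemma N_compact: "compact_space (Nn n)"
proof -
 have c: "compactin (Nn n) (piN n ` K)" if "compact K" "K <= SN" for K
  by (rule image_compactin[OF _ ftop_continuous[OF atlas_N]]) (use that in "simp add: compactin_subtopology")
 have "compactin (Nn n) (piN n ` K1)" "compactin (Nn n) (piN n ` K2)" using c K12 unfolding SN_def by blast+
 hence cp: "compactin (Nn n) (piN n ` K1 Un piN n ` K2)" by (rule compactin_Un)
 have sub: "topspace (Nn n) <= piN n ` K1 Un piN n ` K2"
 proof
  fix p assume "p : topspace (Nn n)"
  then consider x where "x : hyp3" "p = q n x" | x where "x : low" "p = piN n x" "1 < cmod (cz x)" | x where "x : low" "p = piN n x" "cmod (cz x) <= 1"
   unfolding topspace_N by force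
  thus "p : piN n ` K1 Un piN n ` K2"
  proof cases
   have W: "q n x : piN n ` K1 Un piN n ` K2" if x: "x : hyp3" for x
   proof -
    obtain y where y: "y : hyp3" "q n y = q n x" "y : K1 | 4 < y$3" by (rule K1_q[OF x])
    show ?thesis
    proof (cases "y : K1")
     case True thus ?thesis using y piN_simps(1)[OF y(1)] by (metis UnI1 imageI)
    next
     case False
     hence y4: "4 < y$3" using y(3) by blast
     then obtain z where "z : low" "cmod (cz z) = 4/y$3" "z$3 : {-2..-1}" "piN n z = q n y" using q_kap[of y] by auto
     moreover have "4/y$3 <= 1" using y4 by simp
     ultimately have "z : K2" "piN n z = q n x" using y(2) by (auto simp: K2_def)
     thus ?thesis by (metis UnI2 imageI)
    qed
   qed
   { case 1 thus ?thesis using W by simp }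
   { case (2 x)
    hence "cz x ~= 0" "cmod (cz x) < 4" by (auto simp: low_def)
    then obtain v where "v : high" "kap n (cz x) (x$3) = q n v" using kap_q by metis
    thus ?thesis using W[of v] high_facts(3) 2 piN_simps(2)[OF 2(1)] by auto }
   { case (3 x)
    hence "cmod (cz x) < 4" by (auto simp: low_def)
    then obtain y where y: "y : low" "cz y = cz x" "y$3 : {-2..-1}" "piN n y = kap n (cz x) (x$3)" using piN_low_kap by metis
    hence "y : K2" "piN n y = p" using 3 piN_simps(2)[OF 3(1)] by (auto simp: K2_def)
    thus ?thesis by blast }
  qed
 qed
 have "piN n ` K1 Un piN n ` K2 = topspace (Nn n)" using sub compactin_subset_topspace[OF cp] by blast
 thus ?thesis using cp unfolding compact_space_def by simp
qed

lemma N_manifold: "three_manifold (Nn n)" "manifold_boundary (Nn n) = {}" "is_orientation (Nn n) (cover_orientation (Nn n) (piN n) SN)"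
proof -
 have "SN ~= {}" using hyp3_nonempty by (simp add: SN_def)
 note m = closed_manifoldI[OF atlas_N this N_connected N_Hausdorff]
 show "three_manifold (Nn n)" "manifold_boundary (Nn n) = {}" "is_orientation (Nn n) (cover_orientation (Nn n) (piN n) SN)" by (rule m)+
qed

end

section \<open>Maps between the manifolds\<close>

definition lifts :: "bool => R3 set => (R3 => 'a) => R3 set => (R3 => 'a) => bool" where
 "lifts b B G S pr \<longleftrightarrow> (ALL x:B. loc_lift b x S pr G)"

lemma lifts_maps:
 assumes at: "atlas S pr" and B: "open B" and l: "lifts b B G S pr"
 shows "continuous_map (tos B) (ftop S pr) G" "open_map (tos B) (ftop S pr) G"
proof -
 have nb: "EX gm V. open V & x : V & V <= O' & continuous_on V gm & inj_on gm V & gm ` V <= S & (ALL z:V. pr (gm z) = G z)"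
  if x: "x : O'" "open O'" "O' <= B" for x O'
 proof -
  obtain gm T where g: "open T" "x : T" "lsg b gm x" "gm x : S" "ALL z:T. pr (gm z) = G z" using l x unfolding lifts_def by blast
  have "open (T Int O')" "x : T Int O'" using g x by auto
  then obtain V where V: "open V" "x : V" "V <= T Int O'" "continuous_on V gm" "inj_on gm V" using lsg_obtain[OF g(3)] by metis
  have "open (V Int gm -` S)" by (rule continuous_open_preimage[OF V(4,1) atlas_open[OF at]])
  thus ?thesis using V g(4,5) by (intro exI[of _ gm] exI[of _ "V Int gm -` S"])
    (auto intro: continuous_on_subset inj_on_subset)
 qed
 have img: "G x : pr ` S" if "x : B" for x using nb[OF that B order_refl] by (metis image_eqI image_subset_iff)
 show "continuous_map (tos B) (ftop S pr) G" unfolding continuous_map_def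
 proof (intro conjI allI impI)
  show "G : topspace (tos B) \<rightarrow> topspace (ftop S pr)" using img atlas_open[OF at] by simp
  fix U assume U: "openin (ftop S pr) U"
  have oU: "open (S Int pr -` U)" using U openin_ftop[OF atlas_open[OF at]] by blast
  have "open {x : B. G x : U}"
  proof (subst open_subopen, intro ballI)
   fix x assume x: "x : {x : B. G x : U}"
   obtain gm V where V: "open V" "x : V" "V <= B" "continuous_on V gm" "gm ` V <= S" "ALL z:V. pr (gm z) = G z"
    using nb[of x B] x B by blast
   have "open (V Int gm -` (S Int pr -` U))" by (rule continuous_open_preimage[OF V(4,1) oU])
   moreover have "x : V Int gm -` (S Int pr -` U)" using V x by auto
   moreover have "V Int gm -` (S Int pr -` U) <= {x : B. G x : U}" using V by auto
   ultimately show "EX T. open T & x : T & T <= {x : B. G x : U}" by blast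
  qed
  thus "openin (tos B) {x : topspace (tos B). G x : U}" using B by (simp add: openin_open_eq)
 qed
 show "open_map (tos B) (ftop S pr) G" unfolding open_map_def
 proof (intro allI impI)
  fix O' assume "openin (tos B) O'"
  hence O': "open O'" "O' <= B" using B by (auto simp: openin_open_eq)
  show "openin (ftop S pr) (G ` O')"
  proof (subst openin_subopen, intro ballI)
   fix p assume "p : G ` O'"
   then obtain x where x: "x : O'" "p = G x" by blast
   obtain gm V where V: "open V" "x : V" "V <= O'" "continuous_on V gm" "inj_on gm V" "gm ` V <= S" "ALL z:V. pr (gm z) = G z"
    using nb[OF x(1) O'] by blast
   have "openin (ftop S pr) (pr ` gm ` V)" using ftop_open_image[OF at invariance_of_domain[OF V(4,1,5)] V(6)] .
   moreover have "pr ` gm ` V = G ` V" unfolding image_image by (rule image_cong) (use V(7) in auto)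
   ultimately show "EX T. openin (ftop S pr) T & p : T & T <= G ` O'" using x(2) V(2,3) by (intro exI[of _ "G ` V"]) auto
  qed
 qed
qed

lemma ftop_map:
 assumes at: "atlas S pr"
 shows "continuous_map (tos S) Y (F o pr) ==> continuous_map (ftop S pr) Y F"
  and "open_map (tos S) Y (F o pr) ==> open_map (ftop S pr) Y F"
proof -
 note o = atlas_open[OF at]
 show "continuous_map (ftop S pr) Y F" if c: "continuous_map (tos S) Y (F o pr)" unfolding continuous_map_def
 proof (intro conjI allI impI)
  show "F : topspace (ftop S pr) \<rightarrow> topspace Y" using c o by (auto simp: continuous_map_def Pi_iff)
  fix U assume "openin Y U"
  hence "openin (tos S) {x : topspace (tos S). (F o pr) x : U}" by (rule openin_continuous_map_preimage[OF c])
  hence "open {x : S. F (pr x) : U}" using o by (simp add: openin_open_eq)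
  moreover have "S Int pr -` {x : topspace (ftop S pr). F x : U} = {x : S. F (pr x) : U}" using o by auto
  ultimately show "openin (ftop S pr) {x : topspace (ftop S pr). F x : U}" unfolding openin_ftop[OF o] using o by auto
 qed
 show "open_map (ftop S pr) Y F" if c: "open_map (tos S) Y (F o pr)" unfolding open_map_def
 proof (intro allI impI)
  fix U assume "openin (ftop S pr) U"
  hence U: "U <= pr ` S" "open (S Int pr -` U)" unfolding openin_ftop[OF o] by simp_all
  hence "openin Y ((F o pr) ` (S Int pr -` U))" using c o by (simp add: open_map_def openin_open_eq)
  moreover have "(F o pr) ` (S Int pr -` U) = F ` U" using U(1) by (auto simp: image_iff) blast
  ultimately show "openin Y (F ` U)" by simp
 qed
qed

lemma lifts_chart: "atlas S pr ==> open B ==> lifts b B G S pr ==> inj_on G B ==> chart_on (ftop S pr) G B"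
 unfolding chart_on_def using lifts_maps by blast

lemma lifts_subset: "lifts b B G S pr ==> C <= B ==> lifts b C G S pr" unfolding lifts_def by blast

text \<open>The stretching of the cusp that embeds the manifold as the complement of \<open>t \<ge> 4\<close>.\<close>

definition hs :: "real => real" where "hs t = (if t <= 2 then t else 4 - 4/t)"
definition vs :: "R3 => R3" where "vs x = pt (cz x) (hs (x$3))"
definition stretch :: "nat => real => real" where
 "stretch n p = (if EX x:high. q n x = p then q n (vs (SOME x. x : high & q n x = p)) else p)"

lemma hs: "1 < t ==> 1 < hs t" "hs t < 4" "1 < t ==> 1 < u ==> hs t = hs u ==> t = u"
 "1 < t ==> t < 4 ==> EX u>1. hs u = t"
proof -
 show 1: "1 < hs t" if "1 < t" using that by (auto simp: hs_def field_simps)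
 show "hs t < 4" by (auto simp: hs_def)
 have b: "2 < 4 - 4/t \<longleftrightarrow> 2 < t" if "1 < t" for t :: real using that by (simp add: field_simps)
 have le: "hs t <= 2 \<longleftrightarrow> t <= 2" if "1 < t" for t using b[OF that] by (simp add: hs_def not_le[symmetric])
 show "t = u" if tu: "1 < t" "1 < u" "hs t = hs u"
 proof (cases "t <= 2")
  case True
  hence "u <= 2" using le[OF tu(1)] le[OF tu(2)] tu(3) by simp
  thus ?thesis using True tu(3) by (simp add: hs_def)
 next
  case False
  hence "~ u <= 2" using le[OF tu(1)] le[OF tu(2)] tu(3) by simp
  hence "4/t = 4/u" using False tu(3) by (simp add: hs_def)
  thus ?thesis using tu by (simp add: field_simps)
 qed
 show "EX u>1. hs u = t" if "1 < t" "t < 4"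
 proof (cases "t <= 2")
  case True thus ?thesis using that by (intro exI[of _ t]) (simp add: hs_def)
 next
  case False
  thus ?thesis using that by (intro exI[of _ "4/(4 - t)"]) (auto simp: hs_def field_simps)
 qed
qed

lemma vs_high: "x : high ==> vs x : high" "vs x$3 < 4" using hs by (simp_all add: high_def vs_def)

lemma inj_vs: "inj_on vs high"
proof (rule inj_onI)
 fix x y assume "x : high" "y : high" "vs x = vs y"
 hence "1 < x$3" "1 < y$3" "cz x = cz y" "hs (x$3) = hs (y$3)" unfolding high_def vs_def pt_eq_iff by simp_all
 thus "x = y" using hs(3) by (simp add: pt_eq_iff)
qed

lemma continuous_vs: "continuous_on high vs"
proof -
 have "continuous_on {1..} hs"
 proof -
  have "continuous_on ({1..2} Un {2..}) hs" unfolding hs_def by (rule continuous_on_If) (auto intro!: continuous_intros)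
  moreover have "{1 :: real..} = {1..2} Un {2..}" by auto
  ultimately show ?thesis by simp
 qed
 hence "continuous_on high (%x. hs (x$3))" by (rule continuous_on_compose2) (auto simp: high_def intro!: continuous_intros)
 thus ?thesis unfolding vs_def by (intro continuous_intros)
qed

lemma lsg_vs: assumes "x : high" shows "lsg True vs x"
proof -
 have "pt 0 (3/2) : high" by (simp add: high_def)
 moreover have "lsg True vs (pt 0 (3/2))"
 proof (rule lsg_cong[OF lsg_id])
  show "open {x :: R3. x$3 < 2}" by (intro open_Collect_less continuous_intros)
  show "id z = vs z" if "z : {x. x$3 < 2}" for z using that by (simp add: vs_def hs_def)
 qed simp
 moreover have inj: "EX B. open B & y : B & B <= high & inj_on vs B" if "y : high" for y using that high_facts(1) inj_vs by (intro exI[of _ high]) simp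
 ultimately show ?thesis using lsg_constant[OF high_facts(1,2) continuous_vs inj _ _ assms] by simp
qed

context
 fixes n :: nat
 assumes n: "odd n"
begin

lemma q_high_eq:
 assumes "x : high" "1 <= y$3" "q n x = q n y"
 shows "y$3 = x$3" "0 < t ==> q n (pt (cz y) t) = q n (pt (cz x) t)"
proof -
 obtain i j :: int where y: "y = pt (cz x + czz n (of_int i) (of_int j)) (x$3)" using cusp_eq[OF n _ assms(2,3)] assms(1) unfolding high_def by blast
 show "y$3 = x$3" unfolding y by simp
 show "q n (pt (cz y) t) = q n (pt (cz x) t)" if "0 < t" unfolding y pt_simps by (rule q_lat[OF n that])
qed

lemma stretch_high: assumes "x : high" shows "stretch n (q n x) = q n (vs x)"
proof -
 define y where "y = (SOME y. y : high & q n y = q n x)"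
 have y: "y : high" "q n y = q n x" using someI[of "%y. y : high & q n y = q n x" x] assms unfolding y_def by auto
 have "stretch n (q n x) = q n (vs y)" unfolding stretch_def y_def using assms by auto
 also have "... = q n (vs x)"
 proof -
  have y1: "1 <= y$3" using y(1) by (simp add: high_def)
  have "1 < hs (x$3)" using assms hs(1) by (simp add: high_def)
  thus ?thesis unfolding vs_def q_high_eq(1)[OF assms y1 y(2)[symmetric]] by (intro q_high_eq(2)[OF assms y1 y(2)[symmetric]]) simp
 qed
 finally show ?thesis .
qed

lemma stretch_low: assumes x: "x : hyp3" and h: "!!g. g : Gn n ==> act g x$3 <= 2" shows "stretch n (q n x) = q n x"
proof (cases "EX y:high. q n y = q n x")
 case True
 then obtain y where y: "y : high" "q n y = q n x" by blast
 obtain g where "g : Gn n" "y = act g x" using q_eq_iff[OF x, of y n] y high_facts(3) by (metis subsetD)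
 hence "vs y = y" using h by (simp add: vs_def hs_def)
 thus ?thesis using stretch_high[OF y(1)] y(2) by simp
qed (simp add: stretch_def)

lemma high_or_low:
 assumes x: "x : hyp3"
 obtains g where "g : Gn n" "act g x : high" | "!!g. g : Gn n ==> act g x$3 <= 1" unfolding high_def using not_le by blast

lemma lifts_stretch: "lifts True hyp3 (stretch n o q n) hyp3 (q n)" unfolding lifts_def
proof
 fix x assume x: "x : hyp3"
 show "loc_lift True x hyp3 (q n) (stretch n o q n)"
 proof (rule high_or_low[OF x])
  fix g assume g: "g : Gn n" "act g x : high"
  define T where "T = hyp3 Int act g -` high"
  have "open T" unfolding T_def by (rule continuous_open_preimage[OF continuous_on_act[OF Gn_Gam[OF g(1)]] hyp3_open high_facts(1)])
  moreover have "lsg True (vs o act g) x" using lsg_comp[OF lsg_act[OF Gn_Gam[OF g(1)] x] lsg_vs[OF g(2)]] by simp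
  moreover have "q n (vs (act g z)) = stretch n (q n z)" if "z : T" for z using stretch_high[of "act g z"] q_act[OF g(1), of z] that by (simp add: T_def)
  ultimately show ?thesis using x g(2) vs_high(1)[OF g(2)] high_facts(3) by (intro exI[of _ "vs o act g"] exI[of _ T]) (auto simp: T_def)
 next
  assume h: "!!g. g : Gn n ==> act g x$3 <= 1"
  \<comment> \<open>Within distance \<open>ln 2\<close> the heights of orbit points at most double.
    They stay at most 2, where \<open>hs\<close> is the identity.\<close>
  have l2: "0 < ln (2 :: real)" by simp
  have "q n (id z) = stretch n (q n z)" if z: "z : hball x (ln 2)" for z
  proof -
   have "z : hcball x (ln 2)" "z : hyp3" using z hball_sub by blast+
   moreover have "act g z$3 <= 2" if g: "g : Gn n" for g using orbit_height_bound[OF n x h calculation(1) g] by simp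
   ultimately show ?thesis using stretch_low[of z] by simp
  qed
  thus ?thesis using x open_hball[OF x, of "ln 2"] hball_center[OF x l2] lsg_id by (intro exI[of _ id] exI[of _ "hball x (ln 2)"]) simp
 qed
qed

section \<open>The compact core, cut off at height 4, and its interior\<close>

definition Ms :: "real set" where "Ms = q n ` hyp3 - q n ` {x. 4 < x$3}"
definition Is :: "real set" where "Is = q n ` hyp3 - q n ` {x. 4 <= x$3}"
definition SI :: "R3 set" where "SI = {x : hyp3. q n x : Is}"

lemma q_high_Ms: assumes "x : high" shows "q n x : Ms \<longleftrightarrow> x$3 <= 4" "q n x : Is \<longleftrightarrow> x$3 < 4"
proof -
 have xh: "x : hyp3" using assms high_facts(3) by blast
 have e: "y$3 = x$3" if "4 <= y$3" "q n x = q n y" for y using q_high_eq(1)[OF assms _ that(2)] that(1) by simp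
 show "q n x : Ms \<longleftrightarrow> x$3 <= 4" unfolding Ms_def using xh e by (force simp: not_less image_iff)
 show "q n x : Is \<longleftrightarrow> x$3 < 4" unfolding Is_def using xh e by (force simp: not_le image_iff)
qed

lemma q_low_Is: assumes x: "x : hyp3" and h: "!!g. g : Gn n ==> act g x$3 < 4" shows "q n x : Is" unfolding Is_def
proof
 show "q n x \<notin> q n ` {x. 4 <= x$3}"
 proof
  assume "q n x : q n ` {x. 4 <= x$3}"
  then obtain y where y: "4 <= y$3" "q n x = q n y" by blast
  hence "y : hyp3" by (simp add: hyp3_def)
  then obtain g where "g : Gn n" "y = act g x" using q_eq_iff[OF x] y(2) by blast
  thus False using h y(1) by force
 qed
qed (use x in simp)

lemma Is_Ms: "Is <= Ms" "Ms <= q n ` hyp3" "Ms = Is Un q n ` {x. x$3 = 4}"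
proof -
 show "Is <= Ms" "Ms <= q n ` hyp3" unfolding Is_def Ms_def by force+
 have "q n x : Ms" if "x$3 = 4" for x using q_high_Ms(1)[of x] that by (simp add: high_def)
 moreover have "p : Is Un q n ` {x. x$3 = 4}" if "p : Ms" for p using that unfolding Ms_def Is_def by (force simp: not_less)
 ultimately show "Ms = Is Un q n ` {x. x$3 = 4}" using \<open>Is <= Ms\<close> by blast
qed

lemma stretch_image: "stretch n ` (q n ` hyp3) = Is"
proof (intro equalityI subsetI)
 fix p assume "p : stretch n ` (q n ` hyp3)"
 then obtain x where x: "x : hyp3" "p = stretch n (q n x)" by blast
 show "p : Is"
 proof (rule high_or_low[OF x(1)])
  fix g assume g: "g : Gn n" "act g x : high"
  hence "p = q n (vs (act g x))" using x stretch_high[OF g(2)] q_act[OF g(1) x(1)] by simp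
  thus ?thesis using q_high_Ms(2)[OF vs_high(1)[OF g(2)]] vs_high(2) by simp
 next
  assume h: "!!g. g : Gn n ==> act g x$3 <= 1"
  have "p = q n x" unfolding x(2) by (rule stretch_low[OF x(1)]) (use h in force)
  moreover have "q n x : Is" by (rule q_low_Is[OF x(1)]) (use h in force)
  ultimately show ?thesis by simp
 qed
next
 fix p assume p: "p : Is"
 then obtain x where x: "x : hyp3" "p = q n x" unfolding Is_def by blast
 show "p : stretch n ` (q n ` hyp3)"
 proof (rule high_or_low[OF x(1)])
  fix g assume g: "g : Gn n" "act g x : high"
  have pg: "p = q n (act g x)" using q_act[OF g(1) x(1)] x(2) by simp
  hence "act g x$3 < 4" using q_high_Ms(2)[OF g(2)] p by simp
  then obtain u where u: "1 < u" "hs u = act g x$3" using hs(4) g(2) unfolding high_def by blast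
  define y where "y = pt (cz (act g x)) u"
  have "y : high" "vs y = act g x" using u by (simp_all add: y_def high_def vs_def)
  hence "p = stretch n (q n y)" using stretch_high pg by simp
  thus ?thesis using \<open>y : high\<close> high_facts(3) by blast
 next
  assume h: "!!g. g : Gn n ==> act g x$3 <= 1"
  have "stretch n (q n x) = q n x" by (rule stretch_low[OF x(1)]) (use h in force)
  thus ?thesis using x by force
 qed
qed

lemma inj_stretch: "inj_on (stretch n) (q n ` hyp3)"
proof -
 define P where "P = (%p. EX x:high. q n x = p)"
 have P1: "P (stretch n p)" if "P p" for p using that stretch_high vs_high(1) unfolding P_def by metis
 have P2: "stretch n p = p" if "~ P p" for p using that unfolding P_def stretch_def by simp
 have P3: "p = p'" if pp: "P p" "P p'" "stretch n p = stretch n p'" for p p'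
 proof -
  obtain x y where xy: "x : high" "q n x = p" "y : high" "q n y = p'" using pp unfolding P_def by blast
  have e: "q n (vs x) = q n (vs y)" using pp(3) stretch_high xy by metis
  have v: "vs x : high" "1 <= vs y$3" "1 < x$3" "1 < y$3" using vs_high xy unfolding high_def by (auto simp: less_imp_le)
  have "hs (y$3) = hs (x$3)" using q_high_eq(1)[OF v(1,2) e] by (simp add: vs_def)
  hence "y$3 = x$3" using hs(3) v by blast
  moreover have "q n (pt (cz (vs y)) (x$3)) = q n (pt (cz (vs x)) (x$3))" by (rule q_high_eq(2)[OF v(1,2) e]) (use v(3) in simp)
  ultimately have "q n (pt (cz y) (y$3)) = q n (pt (cz x) (x$3))" by (simp add: vs_def del: pt_simps(5))
  thus ?thesis unfolding pt_simps(5) xy(2,4) by (rule sym)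
 qed
 show ?thesis by (rule inj_onI) (metis P1 P2 P3)
qed

abbreviation Mn :: "real topology" where "Mn \<equiv> subtopology (Wn n) Ms"

lemma topspace_M: "topspace Mn = Ms" using Is_Ms(2) topspace_Wn by (metis inf.absorb2 topspace_subtopology)

lemma stretch_maps: "continuous_map (Wn n) (Wn n) (stretch n)" "open_map (Wn n) (Wn n) (stretch n)" using ftop_map[OF atlas_q] lifts_maps[OF atlas_q hyp3_open lifts_stretch] by blast+

lemma openin_M: "openin (Wn n) U ==> U <= Ms ==> openin Mn U" by (metis inf.absorb1 openin_subtopology)

lemma Is_open: "openin (Wn n) Is" using stretch_maps(2) stretch_image topspace_Wn unfolding open_map_def by (metis openin_topspace)

lemma open_SI: "open SI"
proof -
 have "SI = hyp3 Int q n -` Is" by (auto simp: SI_def)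
 thus ?thesis using Is_open openin_ftop[OF hyp3_open] by metis
qed

lemma stretch_M: "continuous_map (Wn n) Mn (stretch n)" "open_map (Wn n) Mn (stretch n)" "embedding_map (Wn n) Mn (stretch n)"
proof -
 have im: "stretch n ` topspace (Wn n) <= Is" using stretch_image topspace_Wn by simp
 hence im': "stretch n ` topspace (Wn n) <= Ms" using Is_Ms(1) by blast
 show c: "continuous_map (Wn n) Mn (stretch n)" using stretch_maps(1) im' unfolding cm_sub image_subset_iff_funcset by blast
 show o: "open_map (Wn n) Mn (stretch n)" unfolding open_map_def
 proof (intro allI impI)
  fix U assume U: "openin (Wn n) U"
  have "openin (Wn n) (stretch n ` U)" by (rule stretch_maps(2)[unfolded open_map_def, rule_format, OF U])
  moreover have "stretch n ` U <= Ms" using im' openin_subset[OF U] by blast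
  ultimately show "openin Mn (stretch n ` U)" by (rule openin_M)
 qed
 show "embedding_map (Wn n) Mn (stretch n)" by (rule injective_open_imp_embedding_map[OF c o]) (use inj_stretch topspace_Wn in simp)
qed

lemma M_chart:
 assumes B: "open B" "B <= SI" "inj_on (q n) B" shows "chart_on Mn (q n) B"
proof -
 have Bh: "B <= hyp3" "q n ` B <= Ms" using B(2) Is_Ms(1) by (auto simp: SI_def)
 have c: "chart_on (Wn n) (q n) B" by (rule ftop_chart[OF atlas_q B(1) Bh(1) B(3)])
 show ?thesis unfolding chart_on_def
 proof (intro conjI B(1,3))
  show "continuous_map (tos B) Mn (q n)" using c Bh(2) by (simp add: chart_on_def cm_sub image_subset_iff_funcset[symmetric])
  have om: "open_map (tos B) (Wn n) (q n)" using c by (simp add: chart_on_def)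
  show "open_map (tos B) Mn (q n)" unfolding open_map_def
  proof (intro allI impI)
   fix U assume U: "openin (tos B) U"
   have "openin (Wn n) (q n ` U)" by (rule om[unfolded open_map_def, rule_format, OF U])
   moreover have "U <= B" using openin_subset[OF U] by simp
   hence "q n ` U <= Ms" using Bh(2) by blast
   ultimately show "openin Mn (q n ` U)" by (rule openin_M)
  qed
 qed
qed

lemma q_ball: assumes "x : hyp3" "open O'" "x : O'"
 obtains B where "open B" "x : B" "B <= O'" "B <= hyp3" "inj_on (q n) B"
proof -
 obtain B where B: "open B" "x : B" "B <= hyp3" "inj_on (q n) B" using atlas_q[of n] assms(1) unfolding atlas_def by blast
 have "inj_on (q n) (B Int O')" by (rule inj_on_subset[OF B(4)]) simp
 moreover have "open (B Int O')" using B(1) assms(2) by (rule open_Int)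
 ultimately show thesis using that[of "B Int O'"] B(2,3) assms(3) by auto
qed

text \<open>At a point of height 4, a Euclidean chart followed by a local inverse of
  \<open>q n\<close> would be injective and continuous. By invariance of domain its image is open,
  yet it contains a point of height 4 and none above.\<close>

lemma M_interior: "manifold_interior Mn = Is"
proof
 show "Is <= manifold_interior Mn"
 proof
  fix p assume p: "p : Is"
  then obtain x where x: "x : SI" "p = q n x" unfolding SI_def Is_def by blast
  have "x : hyp3" using x(1) by (simp add: SI_def)
  then obtain B where B: "open B" "x : B" "B <= SI" "inj_on (q n) B" using q_ball[OF _ open_SI x(1)] by metis
  show "p : manifold_interior Mn" unfolding x(2) by (rule chart_on_interior[OF M_chart[OF B(1,3,4)] B(2)])
 qed
 show "manifold_interior Mn <= Is"
 proof
  fix p assume p: "p : manifold_interior Mn"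
  hence pM: "p : Ms" using topspace_M by (auto simp: manifold_interior_def)
  show "p : Is"
  proof (rule ccontr)
   assume "p \<notin> Is"
   then obtain x where x: "x$3 = 4" "p = q n x" using pM Is_Ms(3) by blast
   have xh: "x : hyp3" "x : high" using x(1) by (simp_all add: hyp3_def high_def)
   obtain U V fj where U: "openin Mn U" "p : U" "open (V :: R3 set)" and f: "homeomorphic_map (tos V) (subtopology Mn U) fj"
    proof -
    obtain U V where UV: "openin Mn U" "p : U" "open (V :: R3 set)" "subtopology Mn U homeomorphic_space tos V" using p unfolding manifold_interior_def by blast
    hence "tos V homeomorphic_space subtopology Mn U" using homeomorphic_space_sym by blast
    thus thesis using that UV unfolding homeomorphic_space by blast
   qed
   obtain B where B: "open B" "x : B" "B <= high" "inj_on (q n) B" using q_ball[OF xh(1) high_facts(1) xh(2)] by metis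
   have Bh: "B <= hyp3" using B(3) high_facts(3) by blast
   define ps where "ps = inv_into B (q n)"
   have ps: "ps (q n y) = y" if "y : B" for y unfolding ps_def using B(4) that by simp
   have tU: "topspace (subtopology Mn U) = U" using openin_subset[OF U(1)] by (simp add: Int_absorb1)
   have f1: "fj ` V = U" "inj_on fj V" using homeomorphic_imp_surjective_map[OF f] homeomorphic_imp_injective_map[OF f] tU by simp_all
   have pre: "open {v : V. fj v : q n ` O'}" if O': "open O'" "O' <= B" for O'
   proof -
    have "openin (Wn n) (q n ` O')" by (rule ftop_open_image[OF atlas_q O'(1)]) (use O'(2) Bh in blast)
    hence "openin (subtopology Mn U) (U Int (Ms Int q n ` O'))" by (simp add: openin_subtopology_Int2)
    from openin_continuous_map_preimage[OF homeomorphic_imp_continuous_map[OF f] this]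
    have "open {v : V. fj v : U Int (Ms Int q n ` O')}" using U(3) by (simp add: openin_open_eq)
    moreover have "{v : V. fj v : U Int (Ms Int q n ` O')} = {v : V. fj v : q n ` O'}" using f1(1) openin_subset[OF U(1)] topspace_M by auto
    ultimately show ?thesis by simp
   qed
   define G where "G = {v : V. fj v : q n ` B}"
   have oG: "open G" unfolding G_def by (rule pre[OF B(1) order_refl])
   have "continuous_on G (ps o fj)" unfolding continuous_on_open_invariant
   proof (intro allI impI)
    fix O' :: "R3 set" assume O': "open O'"
    have "open {v : V. fj v : q n ` (B Int O')}" by (rule pre) (use O' B(1) in auto)
    moreover have "{v : V. fj v : q n ` (B Int O')} Int G = (ps o fj) -` O' Int G" unfolding G_def using ps by force
    ultimately show "EX A. open A & A Int G = (ps o fj) -` O' Int G" by blast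
   qed
   moreover have "inj_on (ps o fj) G"
   proof (rule inj_onI)
    fix u v assume uv: "u : G" "v : G" "(ps o fj) u = (ps o fj) v"
    hence "fj u = fj v" using ps unfolding G_def by force
    thus "u = v" using inj_onD[OF f1(2)] uv unfolding G_def by blast
   qed
   ultimately have "open ((ps o fj) ` G)" using invariance_of_domain oG by blast
   moreover have "x : (ps o fj) ` G"
   proof -
    obtain v where v: "v : V" "fj v = p" using f1(1) U(2) by blast
    thus ?thesis unfolding G_def using x(2) B(2) ps[OF B(2)] by (intro image_eqI[of _ _ v]) auto
   qed
   ultimately obtain e where e: "0 < e" "ball x e <= (ps o fj) ` G" using openE by blast
   define y where "y = x + pt 0 (e/2)"
   have "dist x y = e/2" using e(1) by (simp add: y_def dist_norm norm_vec3)
   hence "y : (ps o fj) ` G" using e by auto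
   then obtain v where v: "v : G" "y = ps (fj v)" by auto
   then obtain u where u: "u : B" "fj v = q n u" unfolding G_def by blast
   hence yu: "y = u" using v(2) ps by simp
   have "q n u : Ms" using u(2) v(1) f1(1) openin_subset[OF U(1)] topspace_M unfolding G_def by auto
   hence "u$3 <= 4" using q_high_Ms(1)[of u] u(1) B(3) by blast
   moreover have "4 < y$3" using x(1) e(1) by (simp add: y_def)
   ultimately show False using yu by simp
  qed
 qed
qed
end

section \<open>The core as a manifold with torus boundary inside the filling\<close>

context
 fixes n :: nat
 assumes n: "odd n"
begin

lemma N_sub_W: "subtopology (Nn n) (q n ` hyp3) = Wn n" unfolding topology_eq
proof (intro allI iffI)
 fix U assume "openin (subtopology (Nn n) (q n ` hyp3)) U"
 then obtain V where V: "openin (Nn n) V" "U = V Int q n ` hyp3" by (auto simp: openin_subtopology)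
 have "open (SN Int piN n -` V)" using V(1) unfolding openin_ftop[OF open_SN] by simp
 hence "open (hyp3 Int (SN Int piN n -` V))" using hyp3_open by (rule open_Int[rotated])
 moreover have "hyp3 Int q n -` U = hyp3 Int (SN Int piN n -` V)" using V(2) piN_simps(1) by (auto simp: SN_def)
 ultimately show "openin (Wn n) U" unfolding openin_ftop[OF hyp3_open] using V(2) by simp
next
 fix U assume U: "openin (Wn n) U"
 hence "U = U Int q n ` hyp3" using openin_subset topspace_Wn by blast
 thus "openin (subtopology (Nn n) (q n ` hyp3)) U" using openin_N_W[OF n U] unfolding openin_subtopology by blast
qed

abbreviation "M \<equiv> Mn n"
abbreviation "Ts \<equiv> q n ` {x. x$3 = 4}"

lemma M_sub_N: "M = subtopology (Nn n) (Ms n)" using N_sub_W Is_Ms(2)[OF n] subtopology_subtopology by (metis inf.absorb2)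

lemma low_q: assumes y: "y : low" "cz y ~= 0"
 obtains v where "v : high" "v$3 = 4/cmod (cz y)" "piN n y = q n v" using kap_q[OF n y(2), of "y$3"] y(1) piN_simps(2)[OF y(1), of n] unfolding low_def by auto

lemma low_core: "y : low ==> cz y = 0 ==> piN n y \<notin> q n ` hyp3"
proof
 assume y: "y : low" "cz y = 0" and "piN n y : q n ` hyp3"
 then obtain x where "q n x = - 1 - frac (y$3)" using piN_simps(2)[OF y(1)] by (auto simp: kap_def)
 thus False using q_pos[of n x] frac_ge_0[of "y$3"] by linarith
qed

lemma low_Ms: assumes y: "y : low" shows "piN n y : Ms n \<longleftrightarrow> 1 <= cmod (cz y)" "piN n y : Ts \<longleftrightarrow> cmod (cz y) = 1"
proof -
 have Tsh: "Ts <= q n ` hyp3" by (auto simp: hyp3_def)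
 have "(piN n y : Ms n \<longleftrightarrow> 1 <= cmod (cz y)) & (piN n y : Ts \<longleftrightarrow> cmod (cz y) = 1)"
 proof (cases "cz y = 0")
  case True
  thus ?thesis using low_core[OF y True] Is_Ms(2)[OF n] Tsh by auto
 next
  case False
  obtain v where v: "v : high" "v$3 = 4/cmod (cz y)" "piN n y = q n v" by (rule low_q[OF y False])
  have 1: "v$3 <= 4 \<longleftrightarrow> 1 <= cmod (cz y)" "v$3 = 4 \<longleftrightarrow> cmod (cz y) = 1" unfolding v(2) using False by (auto simp: field_simps)
  have "x$3 = v$3" if "x$3 = 4" "q n v = q n x" for x using q_high_eq(1)[OF n v(1) _ that(2)] that(1) by simp
  hence "q n v : Ts \<longleftrightarrow> v$3 = 4" by force
  thus ?thesis unfolding v(3) using q_high_Ms(1)[OF n v(1)] 1 by simp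
 qed
 thus "piN n y : Ms n \<longleftrightarrow> 1 <= cmod (cz y)" "piN n y : Ts \<longleftrightarrow> cmod (cz y) = 1" by blast+
qed

lemma N_minus_M: "topspace (Nn n) - Ms n = piN n ` (low Int cz -` ball 0 1)"
proof (intro equalityI subsetI)
 fix p assume p: "p : topspace (Nn n) - Ms n"
 show "p : piN n ` (low Int cz -` ball 0 1)"
 proof (cases "p : q n ` hyp3")
  case True
  then obtain x where x: "4 < x$3" "p = q n x" using p unfolding Ms_def[OF n] by blast
  obtain y where "y : low" "cmod (cz y) = 4/x$3" "piN n y = p" using q_kap[OF n, of x] x by auto
  thus ?thesis using x(1) by (intro image_eqI[of _ _ y]) auto
 next
  case False
  then obtain y where y: "y : low" "p = piN n y" using p topspace_N[OF n] by blast
  thus ?thesis using low_Ms(1)[OF y(1)] p by (intro image_eqI[of _ _ y]) auto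
 qed
next
 fix p assume "p : piN n ` (low Int cz -` ball 0 1)"
 then obtain y where y: "y : low" "cmod (cz y) < 1" "p = piN n y" by auto
 thus "p : topspace (Nn n) - Ms n" using low_Ms(1)[OF y(1)] topspace_N[OF n] by auto
qed

lemma M_closed: "closedin (Nn n) (Ms n)"
proof -
 have "open (low Int cz -` ball 0 1)" by (rule open_Int[OF open_low]) (intro open_vimage open_ball continuous_intros)
 hence "openin (Nn n) (topspace (Nn n) - Ms n)" unfolding N_minus_M by (rule ftop_open_image[OF atlas_N[OF n]]) (auto simp: SN_def)
 moreover have "Ms n <= topspace (Nn n)" using Is_Ms(2)[OF n] topspace_N[OF n] by blast
 ultimately show ?thesis by (simp add: closedin_def)
qed

lemma M_compact: "compact_space M" unfolding M_sub_N using closedin_compact_space[OF N_compact[OF n] M_closed] compact_space_subtopology by blast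

lemma M_Hausdorff: "Hausdorff_space M" using Wn_Hausdorff Hausdorff_space_subtopology by blast

text \<open>The interior is the image of the connected manifold under \<open>stretch n\<close>, and
  points of height 4 are limits of lower ones.\<close>

lemma M_connected: "connected_space M"
proof -
 have "connectedin (Wn n) (stretch n ` topspace (Wn n))"
  using connectedin_continuous_map_image[OF stretch_maps(1)[OF n], of "topspace (Wn n)"] Wn_connected by (simp add: connectedin_topspace)
 hence 1: "connectedin (Wn n) (Is n)" using stretch_image[OF n] topspace_Wn by metis
 have "Ms n <= Wn n closure_of Is n"
 proof
  fix p assume p: "p : Ms n"
  show "p : Wn n closure_of Is n" unfolding in_closure_of
  proof (intro conjI allI impI)
   show "p : topspace (Wn n)" using p Is_Ms(2)[OF n] topspace_Wn by blast
   fix U assume U: "p : U & openin (Wn n) U"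
   show "EX y. y : Is n & y : U"
   proof (cases "p : Is n")
    case False
    then obtain x where x: "x$3 = 4" "p = q n x" using p Is_Ms(3)[OF n] by blast
    have xh: "x : hyp3 Int q n -` U" using x U by (simp add: hyp3_def)
    have "open (hyp3 Int q n -` U)" using U openin_ftop[OF hyp3_open] by blast
    then obtain e where e: "0 < e" "ball x e <= hyp3 Int q n -` U" using xh openE by blast
    define y where "y = x + pt 0 (- min (e/2) 1)"
    have "dist x y = min (e/2) 1" using e(1) by (simp add: y_def dist_norm norm_vec3)
    hence "y : ball x e" using e(1) by simp
    moreover have "y : high" "y$3 < 4" using x(1) e(1) by (simp_all add: y_def high_def)
    ultimately show ?thesis using q_high_Ms(2)[OF n, of y] e(2) by blast
   qed (use U in blast)
  qed
 qed
 from connectedin_intermediate_closure_of[OF 1 Is_Ms(1)[OF n] this] show ?thesis unfolding connectedin_def by blast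
qed

lemma M_boundary_chart:
 assumes p: "p : Ts"
 shows "EX U V. openin M U & p : U & openin (tos half_space3) V & subtopology M U homeomorphic_space tos V"
proof -
 obtain x where x: "x$3 = 4" "p = q n x" using p by blast
 have xh: "x : hyp3" "x : high" using x(1) by (simp_all add: hyp3_def high_def)
 obtain B where B: "open B" "x : B" "B <= high" "inj_on (q n) B" using q_ball[OF n xh(1) high_facts(1) xh(2)] by metis
 have Bh: "B <= hyp3" using B(3) high_facts(3) by blast
 have c: "chart_on (Wn n) (q n) B" by (rule ftop_chart[OF atlas_q B(1) Bh B(4)])
 have oB: "openin (Wn n) (q n ` B)" by (rule ftop_open_image[OF atlas_q B(1) Bh])
 have "embedding_map (tos B) (Wn n) (q n)" by (rule injective_open_imp_embedding_map) (use c B(4) in "auto simp: chart_on_def")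
 hence hm: "homeomorphic_map (tos B) (subtopology (Wn n) (q n ` B)) (q n)" by (simp add: embedding_map_def)
 have tB: "topspace (subtopology (Wn n) (q n ` B)) = q n ` B" using openin_subset[OF oB] by (simp add: Int_absorb1)
 have "q n ` (topspace (tos B) Int {y. y$3 <= 4}) = topspace (subtopology (Wn n) (q n ` B)) Int Ms n"
  unfolding tB using B(3) q_high_Ms(1)[OF n] by (auto simp: image_iff subset_iff)
 from homeomorphic_map_subtopologies[OF hm this]
 have "subtopology (tos B) {y. y$3 <= 4} homeomorphic_space subtopology (subtopology (Wn n) (q n ` B)) (Ms n)" unfolding homeomorphic_space by blast
 hence 1: "subtopology M (Ms n Int q n ` B) homeomorphic_space tos (B Int {y. y$3 <= 4})"
  unfolding subtopology_subtopology by (metis Int_commute inf.left_idem homeomorphic_space_sym)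
 \<comment> \<open>Turns heights at most 4 into non-negative ones, as the half-space
   requires.\<close>
 define fl where "fl = (%y :: R3. pt (cz y) (4 - y$3))"
 have fl: "fl (fl y) = y" "continuous_on S fl" for y S unfolding fl_def by (simp, intro continuous_intros)
 define V where "V = fl ` (B Int {y. y$3 <= 4})"
 have "homeomorphic_maps (tos (B Int {y. y$3 <= 4})) (tos V) fl fl"
  unfolding homeomorphic_maps_def V_def continuous_map_subtopology_eu by (intro conjI ballI fl(2)) (auto simp: fl(1))
 hence 2: "tos (B Int {y. y$3 <= 4}) homeomorphic_space tos V" unfolding homeomorphic_space_def by blast
 have "V = half_space3 Int fl -` B"
 proof (intro equalityI subsetI)
  fix v assume v: "v : half_space3 Int fl -` B"
  hence "fl v : B Int {y. y$3 <= 4}" by (simp add: fl_def half_space3_def)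
  thus "v : V" unfolding V_def by (metis fl(1) imageI)
 next
  fix v assume "v : V"
  then obtain y where y: "y : B" "y$3 <= 4" "v = fl y" unfolding V_def by auto
  hence "fl v : B" using fl(1) by simp
  moreover have "v : half_space3" using y(2) unfolding y(3) by (simp add: fl_def half_space3_def)
  ultimately show "v : half_space3 Int fl -` B" by blast
 qed
 moreover have "open (fl -` B)" using open_vimage[OF B(1) fl(2)[of UNIV]] .
 ultimately have "openin (tos half_space3) V" by (auto simp: openin_open)
 moreover have "openin M (Ms n Int q n ` B)" using oB by (simp add: openin_subtopology_Int2)
 moreover have "p : Ms n Int q n ` B" using x(2) B(2) p Is_Ms(3)[OF n] by blast
 ultimately show ?thesis using homeomorphic_space_trans[OF 1 2] by blast
qed

lemma M_boundary: "manifold_boundary M = Ts"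
proof -
 have "Ts Int Is n = {}"
 proof (rule ccontr)
  assume "Ts Int Is n ~= {}"
  then obtain x where "x$3 = 4" "q n x : Is n" by blast
  thus False using q_high_Ms(2)[OF n, of x] by (simp add: high_def)
 qed
 hence "Ms n - Is n = Ts" using Is_Ms(3)[OF n] by blast
 thus ?thesis unfolding manifold_boundary_def M_interior[OF n] topspace_M[OF n] .
qed

lemma M_three_manifold: "three_manifold M" unfolding three_manifold_def
proof (intro conjI ballI)
 have "q n (pt 0 4) : Ts" by auto
 hence "Ms n ~= {}" using Is_Ms(3)[OF n] by blast
 thus "topspace M ~= {}" unfolding topspace_M[OF n] .
 show "second_countable M" using ftop_second_countable[OF atlas_q] second_countable_subtopology by blast
 fix p assume p: "p : topspace M"
 show "EX U V. openin M U & p : U & openin (tos half_space3) V & subtopology M U homeomorphic_space tos V"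
 proof (cases "p : Ts")
  case True thus ?thesis by (rule M_boundary_chart)
 next
  case False
  hence "p : manifold_interior M" using p M_boundary by (auto simp: manifold_boundary_def)
  from interior_half_space_chart[OF this] show ?thesis .
 qed
qed (rule M_connected M_Hausdorff)+

lemma SI_hyp3: "SI n <= hyp3" by (auto simp: SI_def[OF n])

lemma M_oriented_cover: "oriented_cover M (q n) (SI n)" unfolding oriented_cover_def M_interior[OF n]
proof (intro conjI ballI impI)
 show "open (SI n)" by (rule open_SI[OF n])
 show "q n ` SI n = Is n" using Is_Ms(1,2)[OF n] by (auto simp: SI_def[OF n])
 show "EX B. x : B & B <= SI n & chart_on M (q n) B" if x: "x : SI n" for x
 proof -
  have "x : hyp3" using x SI_hyp3 by blast
  then obtain B where B: "open B" "x : B" "B <= SI n" "inj_on (q n) B" using q_ball[OF n _ open_SI[OF n] x] by metis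
  show ?thesis using M_chart[OF n B(1,3,4)] B(2,3) by (intro exI[of _ B]) simp
 qed
 show "EX gm T. open T & x : T & lsg True gm x & gm x = y & (ALL z:T. q n (gm z) = q n z)"
  if xy: "x : SI n" "y : SI n" "q n x = q n y" for x y
 proof -
  have "x : hyp3" "y : hyp3" using xy SI_hyp3 by auto
  thus ?thesis using conjunct2[OF conjunct2[OF atlas_q[of n, unfolded atlas_def]]] xy(3) by simp
 qed
qed

abbreviation "oW \<equiv> cover_orientation (Wn n) (q n) hyp3"
abbreviation "oM \<equiv> cover_orientation M (q n) (SI n)"
abbreviation "oN \<equiv> cover_orientation (Nn n) (piN n) SN"

lemma M_oriented: "oriented_three_manifold (M, oM)" unfolding oriented_three_manifold_def
 using M_three_manifold is_orientation_cover[OF Hausdorff_imp_t1_space[OF M_Hausdorff] M_oriented_cover] by simp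

lemma W_interior_M: "oriented_interior_of (Wn n, oW) (M, oM)" unfolding oriented_interior_of_def fst_conv
proof (intro exI conjI)
 show "embedding_map (Wn n) M (stretch n)" by (rule stretch_M(3)[OF n])
 show "stretch n ` topspace (Wn n) = manifold_interior M" unfolding M_interior[OF n] topspace_Wn by (rule stretch_image[OF n])
 show "preserves_orientation (Wn n, oW) (M, oM) (stretch n)" unfolding preserves_orientation_def fst_conv snd_conv
 proof
  fix p assume p: "p : manifold_interior (Wn n)"
  note m = cover_orientation_map[OF ftop_oriented_cover[OF atlas_q] M_oriented_cover stretch_M(1)[OF n], where b = True]
  have inj: "inj_on (stretch n) (topspace (Wn n))" using inj_stretch[OF n] topspace_Wn by simp
  have "hi3 (Wn n) (topspace (Wn n) - {p}) M (topspace M - {stretch n p}) (stretch n) (oW p)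
   = (if True then oM (stretch n p) else inv\<^bsub>lhom M (stretch n p)\<^esub> (oM (stretch n p)))"
  proof (rule m[OF inj _ _ p])
   fix x assume x: "x : hyp3"
   obtain gm T where g: "open T" "x : T" "lsg True gm x" "gm x : hyp3" "ALL z:T. q n (gm z) = (stretch n o q n) z"
    using lifts_stretch[OF n] x unfolding lifts_def by blast
   have "q n (gm x) : Is n" using g(2,5) x stretch_image[OF n] by auto
   thus "loc_lift True x (SI n) (q n) (%z. stretch n (q n z))" using g by (intro exI[of _ gm] exI[of _ T]) (simp add: SI_def[OF n])
  next
   fix B assume B: "chart_on (Wn n) (q n) B" "B <= hyp3"
   show "chart_on M (stretch n o q n) B" unfolding chart_on_def
   proof (intro conjI)
    show "continuous_map (tos B) M (stretch n o q n)" by (rule continuous_map_compose[OF _ stretch_M(1)[OF n]]) (use B in "simp add: chart_on_def")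
    show "open_map (tos B) M (stretch n o q n)" by (rule open_map_compose[OF _ stretch_M(2)[OF n]]) (use B in "simp add: chart_on_def")
    show "inj_on (stretch n o q n) B" by (rule comp_inj_on) (use B inj_on_subset[OF inj_stretch[OF n] image_mono[OF B(2)]] in "auto simp: chart_on_def")
   qed (use B in "simp add: chart_on_def")
  qed
  thus "hi3 (Wn n) (topspace (Wn n) - {p}) M (topspace M - {stretch n p}) (stretch n) (oW p) = oM (stretch n p)" by simp
 qed
qed

subsection \<open>The solid torus\<close>

text \<open>\<open>Arg\<close> jumps, so continuity comes from the quotient map \<open>tt\<close> of
  the compact period \<open>K2\<close> onto the solid torus, over which \<open>gt\<close> becomes
  \<open>piN n\<close>.\<close>

definition gt :: "complex \<times> complex => real" where "gt y = kap n (fst y) (Arg (snd y)/(2 * pi))"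
definition tt :: "R3 => complex \<times> complex" where "tt x = (cz x, cis (2 * pi * x$3))"

lemma topspace_solid: "topspace solid_torus = cball 0 1 \<times> sphere 0 1" "topspace torus_space = sphere 0 1 \<times> sphere 0 1" by (simp_all add: solid_torus_def torus_space_def)

lemma solid_eq: "solid_torus = tos (cball 0 1 \<times> sphere 0 1)" "torus_space = tos (sphere 0 1 \<times> sphere 0 1)" by (simp_all add: solid_torus_def torus_space_def)

lemma torus_sub: "torus_space = subtopology solid_torus (sphere 0 1 \<times> sphere 0 1)"
proof -
 have "(cball 0 1 \<times> sphere 0 1) Int (sphere 0 1 \<times> sphere 0 1) = sphere (0 :: complex) 1 \<times> sphere (0 :: complex) 1" by auto
 thus ?thesis unfolding solid_eq subtopology_subtopology by simp
qed

lemma solid_Hausdorff: "Hausdorff_space solid_torus" "compact_space solid_torus" "compact_space torus_space"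
 unfolding solid_eq by (simp_all add: Hausdorff_space_subtopology compact_space_subtopology compact_Times)

lemma cis_frac: "b : sphere 0 1 ==> cis (2 * pi * (Arg b/(2 * pi))) = b"
 by (simp add: cis_Arg sgn_div_norm) (metis cis_Arg norm_zero sgn_div_norm inverse_1 scaleR_one zero_neq_one)

lemma K2_quotient: "quotient_map (tos K2) solid_torus tt"
proof (rule continuous_imp_quotient_map)
 have im: "tt ` K2 = cball 0 1 \<times> sphere 0 1"
 proof (intro equalityI subsetI)
  fix y :: "complex \<times> complex" assume y: "y : cball 0 1 \<times> sphere 0 1"
  obtain w b where wb: "y = (w, b)" by fastforce
  define s where "s = frac (Arg b/(2 * pi)) - 2"
  have "s - Arg b/(2 * pi) = of_int (- \<lfloor>Arg b/(2 * pi)\<rfloor> - 2)" by (simp add: s_def frac_def)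
  hence "s - Arg b/(2 * pi) : \<int>" by (metis Ints_of_int)
  hence "cis (2 * pi * s) = b" using cis_frac[of b] y wb by (simp add: cis_2pi_eq[of s, symmetric])
  moreover have "pt w s : K2" using y wb frac_lt_1[of "Arg b/(2 * pi)"] frac_ge_0[of "Arg b/(2 * pi)"] by (auto simp: K2_def[OF n] s_def)
  ultimately show "y : tt ` K2" using wb by (intro image_eqI[of _ _ "pt w s"]) (simp_all add: tt_def)
 qed (auto simp: tt_def K2_def[OF n])
 show "tt ` topspace (tos K2) = topspace solid_torus" using im topspace_solid by simp
 have "continuous_on K2 (%x. cz x)" "continuous_on K2 (%x. cis (2 * pi * x$3))" by (intro continuous_intros)+
 thus "continuous_map (tos K2) solid_torus tt" unfolding solid_eq continuous_map_subtopology_eu tt_def by (auto simp: K2_def[OF n] intro!: continuous_on_Pair)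
 show "compact_space (tos K2)" using K12(2)[OF n] by (simp add: compact_space_subtopology)
qed (rule solid_Hausdorff)

lemma gt_tt: "x : K2 ==> gt (tt x) = piN n x"
proof -
 assume x: "x : K2"
 hence xl: "x : low" "cmod (cz x) < 4" using K12(4)[OF n] by (auto simp: low_def)
 have "cis (2 * pi * (Arg (cis (2 * pi * x$3))/(2 * pi))) = cis (2 * pi * x$3)" by (rule cis_frac) simp
 thus ?thesis unfolding cis_2pi_eq piN_simps(2)[OF xl(1)] gt_def tt_def fst_conv snd_conv by (simp add: kap_eq[OF n xl(2) xl(2)])
qed

lemma gt_continuous: "continuous_map solid_torus (Nn n) gt"
proof (rule continuous_compose_quotient_map[OF K2_quotient])
 have "continuous_map (tos K2) (Nn n) (piN n)" by (rule continuous_map_from_subtopology_mono[OF ftop_continuous[OF atlas_N[OF n]]]) (use K12(4)[OF n] SN_def in blast)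
 thus "continuous_map (tos K2) (Nn n) (gt o tt)" by (rule continuous_map_eq) (simp add: gt_tt)
qed

lemma solid_tt: assumes "y : topspace solid_torus" obtains x where "x : K2" "x : low" "y = tt x" "gt y = piN n x" "cz x = fst y"
proof -
 have "y : tt ` K2" using assms quotient_imp_surjective_map[OF K2_quotient] by simp
 then obtain x where "x : K2" "y = tt x" by blast
 thus thesis using that gt_tt K12(4)[OF n] by (auto simp: tt_def)
qed

lemma gt_inj: "inj_on gt (topspace solid_torus)"
proof (rule inj_onI)
 fix y y' assume y: "y : topspace solid_torus" "y' : topspace solid_torus" and e: "gt y = gt y'"
 have c: "cmod (fst y) < 4" "cmod (fst y') < 4" "snd y : sphere 0 1" "snd y' : sphere 0 1" using y by (auto simp: topspace_solid)
 have "fst y = fst y'" "Arg (snd y)/(2 * pi) - Arg (snd y')/(2 * pi) : \<int>" using e kap_eq[OF n c(1,2)] unfolding gt_def by auto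
 thus "y = y'" using cis_frac[OF c(3)] cis_frac[OF c(4)] unfolding cis_2pi_eq[symmetric] by (simp add: prod_eq_iff)
qed

lemma gt_Ms: assumes y: "y : topspace solid_torus" shows "gt y : Ms n \<longleftrightarrow> y : topspace torus_space" "gt y : Ts \<longleftrightarrow> y : topspace torus_space"
proof -
 obtain x where x: "x : K2" "x : low" "y = tt x" "gt y = piN n x" "cz x = fst y" by (rule solid_tt[OF y])
 have "y : topspace torus_space \<longleftrightarrow> cmod (cz x) = 1" using y x(5) by (auto simp: topspace_solid)
 thus "gt y : Ms n \<longleftrightarrow> y : topspace torus_space" "gt y : Ts \<longleftrightarrow> y : topspace torus_space"
  using low_Ms[OF x(2)] x(1,4) by (auto simp: K2_def[OF n])
qed

lemma N_cover: "topspace (Nn n) = Ms n Un gt ` topspace solid_torus"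
proof (intro equalityI subsetI)
 fix p assume p: "p : topspace (Nn n)"
 show "p : Ms n Un gt ` topspace solid_torus"
 proof (cases "p : Ms n")
  case False
  hence "p : piN n ` (low Int cz -` ball 0 1)" using p N_minus_M by blast
  then obtain y where y: "y : low" "cmod (cz y) < 1" "p = piN n y" by auto
  obtain x where x: "x : low" "cz x = cz y" "x$3 : {-2..-1}" "piN n x = kap n (cz y) (y$3)" using piN_low_kap[OF n, of "cz y"] y(2) by fastforce
  hence "x : K2" "piN n x = p" using y piN_simps(2)[OF y(1)] by (auto simp: K2_def[OF n])
  thus ?thesis using gt_tt quotient_imp_surjective_map[OF K2_quotient] by (metis UnI2 imageI topspace_euclidean_subtopology)
 qed simp
next
 fix p assume "p : Ms n Un gt ` topspace solid_torus"
 thus "p : topspace (Nn n)" using Is_Ms(2)[OF n] topspace_N[OF n] continuous_map_image_subset_topspace[OF gt_continuous] by blast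
qed

lemma boundary_M: "boundary_space M = subtopology (Nn n) Ts"
proof -
 have "Ms n Int Ts = Ts" using Is_Ms(3)[OF n] by blast
 hence "subtopology (subtopology (Nn n) (Ms n)) Ts = subtopology (Nn n) Ts" unfolding subtopology_subtopology by simp
 thus ?thesis unfolding M_boundary unfolding M_sub_N .
qed

lemma gt_torus: "homeomorphic_map torus_space (boundary_space M) gt" unfolding boundary_M
proof (rule continuous_imp_homeomorphic_map)
 have Tsub: "Ts <= topspace (Nn n)" using N_cover Is_Ms(3)[OF n] by blast
 have t: "topspace torus_space <= topspace solid_torus" by (auto simp: topspace_solid)
 have im: "gt ` topspace torus_space = Ts"
 proof (intro equalityI subsetI)
  fix p assume p: "p : Ts"
  then obtain x where x: "x$3 = 4" "p = q n x" by blast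
  then obtain y where y: "y : low" "cmod (cz y) = 1" "y$3 : {-2..-1}" "piN n y = p" using q_kap[OF n, of x] by auto
  hence "y : K2" by (simp add: K2_def[OF n])
  hence "gt (tt y) = p" "tt y : topspace solid_torus" using y(4) gt_tt quotient_imp_surjective_map[OF K2_quotient] by auto
  thus "p : gt ` topspace torus_space" using gt_Ms(2) p by blast
 qed (use gt_Ms(2) t in blast)
 show "continuous_map torus_space (subtopology (Nn n) Ts) gt" using continuous_map_from_subtopology[OF gt_continuous, of "sphere 0 1 \<times> sphere 0 1"] im
  unfolding cm_sub torus_sub[symmetric] by blast
 show "gt ` topspace torus_space = topspace (subtopology (Nn n) Ts)" using im Tsub by (simp add: Int_absorb1)
 show "inj_on gt (topspace torus_space)" using inj_on_subset[OF gt_inj t] .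
qed (use solid_Hausdorff N_Hausdorff[OF n] Hausdorff_space_subtopology in auto)

lemma M_torus: "compact_with_torus_boundary (M, oM)" unfolding compact_with_torus_boundary_def fst_conv
 using M_oriented M_compact gt_torus homeomorphic_space_sym unfolding homeomorphic_space by blast
end

section \<open>The symmetry\<close>

lemma lsg_sgi: "lsg False sgi x"
proof -
 have "lsg False (refl2 o (%v. v + pt (- omc) 0)) x" using lsg_comp[OF lsg_translation lsg_refl2] by simp
 thus ?thesis by (rule lsg_cong[where T = UNIV]) (simp_all add: sgi_def refl2_def pt_eq_iff cz_def complex_eq_iff)
qed

text \<open>The square of the reflection translates by \<open>\<omega> + cnj \<omega> = -1\<close>.
  Its power \<open>4 n\<close> therefore translates by \<open>- 2 n\<close>, the negative sum of the
  two lattice vectors, so that \<open>Fs n\<close> has finite order on the quotient and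
  \<open>Fi n\<close> is its inverse.\<close>

lemma sg_power: "(sg ^^ (2 * k)) x = pt (cz x - of_nat k) (x$3)"
proof (induction k)
 case (Suc k)
 have c: "cnj (cnj z + omc) + omc = z - 1" for z by (simp add: omc_def complex_eq_iff)
 have "(sg ^^ (2 * Suc k)) x = sg (sg (pt (cz x - of_nat k) (x$3)))" using Suc by simp
 also have "... = pt (cz x - of_nat (Suc k)) (x$3)" unfolding sg_def pt_simps c by (simp add: diff_diff_eq add.commute)
 finally show ?case .
qed simp

definition Fs :: "nat => real => real" where "Fs n p = q n (sg (SOME x. x : hyp3 & q n x = p))"
definition Fi :: "nat => real => real" where "Fi n = Fs n ^^ (4 * n - 1)"

lemma Fs_q: "x : hyp3 ==> Fs n (q n x) = q n (sg x)"
proof -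
 assume x: "x : hyp3"
 define y where "y = (SOME y. y : hyp3 & q n y = q n x)"
 have y: "y : hyp3" "q n y = q n x" using someI[of "%y. y : hyp3 & q n y = q n x" x] x unfolding y_def by auto
 then obtain g where g: "g : Gn n" "y = act g x" using q_eq_iff[OF x y(1), of n] by auto
 have "q n (sg y) = q n (act (smat g) (sg x))" unfolding g(2) by (simp add: sg_act[OF Gn_Gam[OF g(1)] x])
 also have "... = q n (sg x)" by (rule q_act[OF smat_Gn[OF g(1)]]) (simp add: x)
 finally show ?thesis unfolding Fs_def y_def .
qed

context
 fixes n :: nat
 assumes n: "odd n"
begin

lemma Fs_power: "x : hyp3 ==> (Fs n ^^ k) (q n x) = q n ((sg ^^ k) x) & (sg ^^ k) x : hyp3" by (induction k) (auto simp: Fs_q)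

lemma Fs_Fi: assumes p: "p : q n ` hyp3" shows "Fi n (Fs n p) = p" "Fs n (Fi n p) = p"
proof -
 obtain x where x: "x : hyp3" "p = q n x" using p by blast
 have "czz n (- 1) (- 1) = - of_nat (2 * n)" by (simp add: czz_def complex_eq_iff)
 hence "q n ((sg ^^ (2 * (2 * n))) x) = q n x" unfolding sg_power using q_lat[OF n hyp3_pos[OF x(1)], of "cz x" "- 1" "- 1"] by (simp del: of_nat_mult)
 hence "(Fs n ^^ (4 * n)) p = p" using Fs_power[OF x(1), of "2 * (2 * n)"] x(2) by (simp add: mult.assoc[symmetric])
 moreover have "4 * n = Suc (4 * n - 1)" using n by (simp add: odd_pos)
 ultimately have "(Fs n ^^ Suc (4 * n - 1)) p = p" by metis
 thus "Fs n (Fi n p) = p" "Fi n (Fs n p) = p" unfolding Fi_def by (simp, simp only: funpow_Suc_right o_def)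
qed

lemma Fi_q: "x : hyp3 ==> Fi n (q n x) = q n (sgi x)" using Fs_Fi(1)[of "q n (sgi x)"] Fs_q[of "sgi x" n] by auto

lemma lifts_Fs: "lifts False hyp3 (Fs n o q n) hyp3 (q n)" and lifts_Fi: "lifts False hyp3 (Fi n o q n) hyp3 (q n)"
proof -
 show "lifts False hyp3 (Fs n o q n) hyp3 (q n)" unfolding lifts_def
 proof
  fix x assume "x : hyp3"
  thus "loc_lift False x hyp3 (q n) (Fs n o q n)" using hyp3_open by (intro exI[of _ sg] exI[of _ hyp3]) (simp add: lsg_sg Fs_q)
 qed
 show "lifts False hyp3 (Fi n o q n) hyp3 (q n)" unfolding lifts_def
 proof
  fix x assume "x : hyp3"
  thus "loc_lift False x hyp3 (q n) (Fi n o q n)" using hyp3_open by (intro exI[of _ sgi] exI[of _ hyp3]) (simp add: lsg_sgi Fi_q)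
 qed
qed

lemma Fs_homeo: "homeomorphic_maps (Wn n) (Wn n) (Fs n) (Fi n)" unfolding homeomorphic_maps_def topspace_Wn using ftop_map(1)[OF atlas_q lifts_maps(1)[OF atlas_q hyp3_open lifts_Fs]]
  ftop_map(1)[OF atlas_q lifts_maps(1)[OF atlas_q hyp3_open lifts_Fi]] Fs_Fi by blast

lemma inj_FsFi: "inj_on (Fs n) (q n ` hyp3)" "inj_on (Fi n) (q n ` hyp3)" using Fs_Fi by (auto intro: inj_on_inverseI)

lemma W_achiral: "achiral (Wn n, oW n)" unfolding achiral_def orientation_reversingly_homeomorphic_def fst_conv
proof (intro exI conjI)
 show "homeomorphic_map (Wn n) (Wn n) (Fs n)" using Fs_homeo homeomorphic_map_maps by blast
 show "reverses_orientation (Wn n, oW n) (Wn n, oW n) (Fs n)" unfolding reverses_orientation_def fst_conv snd_conv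
 proof
  fix p assume p: "p : manifold_interior (Wn n)"
  have "hi3 (Wn n) (topspace (Wn n) - {p}) (Wn n) (topspace (Wn n) - {Fs n p}) (Fs n) (oW n p)
   = (if False then oW n (Fs n p) else inv\<^bsub>lhom (Wn n) (Fs n p)\<^esub> (oW n (Fs n p)))"
  proof (rule cover_orientation_map[OF ftop_oriented_cover[OF atlas_q] ftop_oriented_cover[OF atlas_q] _ _ _ _ p])
   show "continuous_map (Wn n) (Wn n) (Fs n)" using Fs_homeo by (simp add: homeomorphic_maps_def)
   show "inj_on (Fs n) (topspace (Wn n))" unfolding topspace_Wn by (rule inj_FsFi)
   show "loc_lift False x hyp3 (q n) (%z. Fs n (q n z))" if "x : hyp3" for x using lifts_Fs that unfolding lifts_def by simp
   fix B assume B: "chart_on (Wn n) (q n) B" "B <= hyp3"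
   show "chart_on (Wn n) (Fs n o q n) B" by (rule lifts_chart[OF atlas_q _ lifts_subset[OF lifts_Fs B(2)]])
     (use B inj_on_subset[OF inj_FsFi(1) image_mono[OF B(2)]] in "auto simp: chart_on_def intro: comp_inj_on")
  qed
  thus "hi3 (Wn n) (topspace (Wn n) - {p}) (Wn n) (topspace (Wn n) - {Fs n p}) (Fs n) (oW n p)
   = inv\<^bsub>lhom (Wn n) (Fs n p)\<^esub> (oW n (Fs n p))" by simp
 qed
qed

lemma W_one_cusped: "one_cusped_hyperbolic (Wn n, oW n)" unfolding one_cusped_hyperbolic_def oriented_three_manifold_def fst_conv snd_conv
 using Wn_three_manifold[of n] Wn_finite_volume[OF n] M_torus[OF n] W_interior_M[OF n] by blast

lemma M_homeo: "homeomorphic_maps (Mn n) (Mn n) (Fs n) (Fi n)" "Fs n ` Ts n = Ts n"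
proof -
 have h: "x : hyp3" if "4 < x$3 | x$3 = 4" for x using that by (auto simp: hyp3_def)
 have "Fs n ` (q n ` {x. 4 < x$3}) <= q n ` {x. 4 < x$3}" "Fi n ` (q n ` {x. 4 < x$3}) <= q n ` {x. 4 < x$3}" using Fs_q Fi_q h by (auto intro!: imageI)
 hence H: "Fs n p : q n ` {x. 4 < x$3}" "Fi n p : q n ` {x. 4 < x$3}" if "p : q n ` {x. 4 < x$3}" for p using that by blast+
 have W: "Fs n p : q n ` hyp3" "Fi n p : q n ` hyp3" if "p : q n ` hyp3" for p using that Fs_homeo unfolding homeomorphic_maps_def continuous_map_def topspace_Wn by auto
 have m: "Fi n p : Ms n" "Fs n p : Ms n" if p: "p : Ms n" for p
 proof -
  have p1: "p : q n ` hyp3" "p \<notin> q n ` {x. 4 < x$3}" using p by (simp_all add: Ms_def[OF n])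
  have "Fi n p \<notin> q n ` {x. 4 < x$3}" using H(1)[of "Fi n p"] Fs_Fi(2)[OF p1(1)] p1(2) by metis
  moreover have "Fs n p \<notin> q n ` {x. 4 < x$3}" using H(2)[of "Fs n p"] Fs_Fi(1)[OF p1(1)] p1(2) by metis
  ultimately show "Fi n p : Ms n" "Fs n p : Ms n" using W[OF p1(1)] by (simp_all add: Ms_def[OF n])
 qed
 show "homeomorphic_maps (Mn n) (Mn n) (Fs n) (Fi n)" by (rule homeomorphic_maps_subtopologies_alt[OF Fs_homeo]) (use m in auto)
 have "Fs n ` Ts n = (%x. q n (sg x)) ` {x. x$3 = 4}" unfolding image_image by (rule image_cong) (use Fs_q h in auto)
 also have "... = q n ` sg ` {x. x$3 = 4}" by (simp add: image_image)
 also have "sg ` {x. x$3 = 4} = {x. x$3 = 4}"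
 proof (intro equalityI subsetI)
  fix x :: "R3" assume "x : {x. x$3 = 4}"
  thus "x : sg ` {x. x$3 = 4}" by (intro image_eqI[of _ _ "sgi x"]) simp_all
 qed auto
 finally show "Fs n ` Ts n = Ts n" .
qed

subsection \<open>The two fillings\<close>

abbreviation T where "T \<equiv> boundary_space (Mn n)"

text \<open>One closed space is a filling along several slopes, depending on the homeomorphism
  \<open>ta\<close> through which the core enters it: the attaching map of the solid torus is then
  \<open>ta' o gt n\<close>.\<close>

lemma filling:
 assumes h: "homeomorphic_maps (Mn n) (Mn n) ta ta'" and b: "homeomorphic_map T T ta'" and o: "is_orientation (Nn n) o'"
  and p: "preserves_orientation (Mn n, oM n) (Nn n, o') ta" and g: "ta' ` gt n ` meridian : gm"
 shows "dehn_filling (Mn n, oM n) gm (Nn n, o')" unfolding dehn_filling_def oriented_three_manifold_def fst_conv snd_conv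
proof (intro conjI exI)
 note tM = topspace_M[OF n]
 have tt': "ta ` Ms n <= Ms n" "ta' ` Ms n <= Ms n" "!!x. x : Ms n ==> ta' (ta x) = x" "!!x. x : Ms n ==> ta (ta' x) = x"
  using h unfolding homeomorphic_maps_def continuous_map_def tM by (auto simp: Pi_iff)
 have t: "ta ` Ms n = Ms n" using tt' by (metis image_image image_mono image_subset_iff subsetI subset_antisym imageI)
 show "three_manifold (Nn n)" "compact_space (Nn n)" "manifold_boundary (Nn n) = {}" using N_manifold[OF n] N_compact[OF n] by auto
 show "is_orientation (Nn n) o'" by (rule o)
 show "homeomorphic_map torus_space T (ta' o gt n)" by (rule homeomorphic_map_compose[OF gt_torus[OF n] b])
 show "(ta' o gt n) ` meridian : gm" using g by (simp add: image_comp)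
 show "inj_on ta (topspace (Mn n))" unfolding tM by (rule inj_on_inverseI[of _ ta']) (rule tt')
 show "inj_on (gt n) (topspace solid_torus)" by (rule gt_inj[OF n])
 show "ALL x:topspace (Mn n). ALL y:topspace solid_torus. ta x = gt n y \<longleftrightarrow> y : topspace torus_space & x = (ta' o gt n) y"
  unfolding tM
 proof (intro ballI)
  fix x y assume x: "x : Ms n" and y: "y : topspace solid_torus"
  show "ta x = gt n y \<longleftrightarrow> y : topspace torus_space & x = (ta' o gt n) y" using gt_Ms(1)[OF n y] tt' x by (metis image_subset_iff o_apply)
 qed
 show "topspace (Nn n) = ta ` topspace (Mn n) Un gt n ` topspace solid_torus" unfolding tM t by (rule N_cover[OF n])
 show "\<forall>U\<subseteq>topspace (Nn n). openin (Nn n) U \<longleftrightarrow> openin (Mn n) {x : topspace (Mn n). ta x : U} &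
   openin solid_torus {y : topspace solid_torus. gt n y : U}"
 proof (intro allI impI iffI conjI)
  fix U assume U: "U <= topspace (Nn n)" "openin (Nn n) U"
  have "continuous_map (Mn n) (Nn n) ta" using h unfolding homeomorphic_maps_def M_sub_N[OF n] cm_sub by blast
  thus "openin (Mn n) {x : topspace (Mn n). ta x : U}" using U(2) by (rule openin_continuous_map_preimage)
  show "openin solid_torus {y : topspace solid_torus. gt n y : U}" by (rule openin_continuous_map_preimage[OF gt_continuous[OF n] U(2)])
 next
  fix U assume U: "U <= topspace (Nn n)"
   and O': "openin (Mn n) {x : topspace (Mn n). ta x : U} & openin solid_torus {y : topspace solid_torus. gt n y : U}"
  \<comment> \<open>Openness is checked on the complement of \<open>U\<close>, the union of a closed
    subset of the core and the image of a compact subset of the solid torus; both are closed in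
    \<open>Nn n\<close>.\<close>
  have "open_map (Mn n) (Mn n) ta" using h homeomorphic_map_maps homeomorphic_imp_open_map by blast
  hence "openin (Mn n) (ta ` {x : topspace (Mn n). ta x : U})" using O' unfolding open_map_def by blast
  moreover have "ta ` {x : topspace (Mn n). ta x : U} = Ms n Int U"
  proof (intro equalityI subsetI)
   fix y assume "y : Ms n Int U"
   thus "y : ta ` {x : topspace (Mn n). ta x : U}" unfolding tM using tt' by (intro image_eqI[of _ _ "ta' y"]) auto
  qed (use tt'(1) tM in auto)
  ultimately have "openin (Mn n) (Ms n Int U)" by (simp only:)
  from closedin_diff[OF closedin_topspace this] have "closedin (Mn n) (Ms n - U)" unfolding tM by (simp only: Diff_Int Diff_cancel Un_empty_left)
  hence 1: "closedin (Nn n) (Ms n - U)" unfolding M_sub_N[OF n] by (rule closedin_trans_full[OF _ M_closed[OF n]])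
  have "closedin solid_torus (topspace solid_torus - {y : topspace solid_torus. gt n y : U})" by (rule closedin_diff[OF closedin_topspace conjunct2[OF O']])
  hence "compactin solid_torus (topspace solid_torus - {y : topspace solid_torus. gt n y : U})" by (rule closedin_compact_space[OF solid_Hausdorff(2)[OF n]])
  hence "closedin (Nn n) (gt n ` (topspace solid_torus - {y : topspace solid_torus. gt n y : U}))"
   by (intro compactin_imp_closedin[OF N_Hausdorff[OF n]] image_compactin[OF _ gt_continuous[OF n]])
  from closedin_Un[OF 1 this] have "closedin (Nn n) ((Ms n - U) Un gt n ` (topspace solid_torus - {y : topspace solid_torus. gt n y : U}))" .
  moreover have "(Ms n - U) Un gt n ` (topspace solid_torus - {y : topspace solid_torus. gt n y : U}) = topspace (Nn n) - U" using N_cover[OF n] by blast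
  ultimately show "openin (Nn n) U" using openin_closedin[OF U] by simp
 qed
qed (rule p)

lemma M_N_orientation:
 assumes l: "lifts b (SI n) (ta o q n) SN (piN n)" and c: "continuous_map (Mn n) (Nn n) ta" and i: "inj_on ta (Ms n)"
  and p: "p : manifold_interior (Mn n)"
 shows "hi3 (Mn n) (topspace (Mn n) - {p}) (Nn n) (topspace (Nn n) - {ta p}) ta (oM n p)
   = (if b then oN n (ta p) else inv\<^bsub>lhom (Nn n) (ta p)\<^esub> (oN n (ta p)))"
proof (rule cover_orientation_map[OF M_oriented_cover[OF n] ftop_oriented_cover[OF atlas_N[OF n]] c _ _ _ p])
 show "inj_on ta (topspace (Mn n))" using i topspace_M[OF n] by simp
 show "loc_lift b x SN (piN n) (%z. ta (q n z))" if "x : SI n" for x using l that unfolding lifts_def by simp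
 fix B assume B: "chart_on (Mn n) (q n) B" "B <= SI n"
 have "q n ` B <= Ms n" using B(2) Is_Ms(1)[OF n] by (auto simp: SI_def[OF n])
 thus "chart_on (Nn n) (ta o q n) B" by (intro lifts_chart[OF atlas_N[OF n] _ lifts_subset[OF l B(2)]])
   (use B inj_on_subset[OF i] in "auto simp: chart_on_def intro: comp_inj_on")
qed

lemma lifts_N: "lifts b hyp3 G hyp3 (q n) ==> lifts b (SI n) G SN (piN n)" unfolding lifts_def
proof
 fix x assume l: "ALL x:hyp3. loc_lift b x hyp3 (q n) G" and "x : SI n"
 hence x: "x : hyp3" using SI_hyp3[OF n] by blast
 then obtain gm T where g: "open T" "x : T" "lsg b gm x" "gm x : hyp3" "ALL z:T. q n (gm z) = G z" using l by blast
 obtain V where V: "open V" "x : V" "V <= T" "continuous_on V gm" "inj_on gm V" by (rule lsg_obtain[OF g(3,1,2)])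
 have "open (V Int gm -` hyp3)" by (rule continuous_open_preimage[OF V(4,1) hyp3_open])
 thus "loc_lift b x SN (piN n) G" using V(2,3) g(3-5) piN_simps(1) by (intro exI[of _ gm] exI[of _ "V Int gm -` hyp3"]) (auto simp: SN_def)
qed

definition iN :: "real orientation" where "iN p = inv\<^bsub>lhom (Nn n) p\<^esub> (oN n p)"

lemma iN_orientation: "is_orientation (Nn n) iN" unfolding is_orientation_def
proof (intro conjI ballI)
 note o = N_manifold(3)[OF n, unfolded is_orientation_def]
 fix p assume p: "p : manifold_interior (Nn n)"
 have g: "group (lhom (Nn n) p)" by (rule grp_rel)
 have c: "oN n p : carrier (lhom (Nn n) p)" and ge: "generate (lhom (Nn n) p) {oN n p} = carrier (lhom (Nn n) p)" using o p by blast+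
 show i: "iN p : carrier (lhom (Nn n) p)" unfolding iN_def by (rule group.inv_closed[OF g c])
 have "oN n p : generate (lhom (Nn n) p) {iN p}" using generate.inv[of "iN p" "{iN p}" "lhom (Nn n) p"] group.inv_inv[OF g c] by (simp add: iN_def)
 hence "generate (lhom (Nn n) p) {oN n p} <= generate (lhom (Nn n) p) {iN p}"
  using group.generate_subgroup_incl[OF g _ group.generate_is_subgroup[OF g]] i by simp
 thus "generate (lhom (Nn n) p) {iN p} = carrier (lhom (Nn n) p)" using ge group.generate_incl[OF g, of "{iN p}"] i by auto
 obtain U a where U: "openin (Nn n) U" "p : U" "U <= manifold_interior (Nn n)" "a : carrier (rh3 (Nn n) (topspace (Nn n) - U))"
  "!!y. y : U ==> hi3 (Nn n) (topspace (Nn n) - U) (Nn n) (topspace (Nn n) - {y}) id a = oN n y" using o p by metis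
 have "hi3 (Nn n) (topspace (Nn n) - U) (Nn n) (topspace (Nn n) - {y}) id
   (inv\<^bsub>rh3 (Nn n) (topspace (Nn n) - U)\<^esub> a) = iN y" if "y : U" for y unfolding iN_def U(5)[OF that, symmetric]
  by (rule group_hom.hom_inv[OF _ U(4)]) (simp add: group_hom_def group_hom_axioms_def hom_induced_hom grp_rel)
 thus "EX U a. openin (Nn n) U & p : U & U <= manifold_interior (Nn n) &
   a : carrier (rh3 (Nn n) (topspace (Nn n) - U)) &
   (ALL y:U. hi3 (Nn n) (topspace (Nn n) - U) (Nn n) (topspace (Nn n) - {y}) id a = iN y)" using U(1-3) group.inv_closed[OF grp_rel U(4)]
  by (intro exI[of _ U] exI[of _ "inv\<^bsub>rh3 (Nn n) (topspace (Nn n) - U)\<^esub> a"]) simp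
qed

definition slope1 where "slope1 = {C. isotopic_in T (gt n ` meridian) C}"
definition slope2 where "slope2 = {C. isotopic_in T (Fs n ` gt n ` meridian) C}"

lemma isotopic_refl: "isotopic_in X C C" unfolding isotopic_in_def by (intro exI[of _ id]) simp

lemma T_homeo: "homeomorphic_maps T T (Fs n) (Fi n)"
proof -
 have T: "T = subtopology (Mn n) (Ts n)" by (simp only: M_boundary[OF n])
 have "Ts n <= topspace (Mn n)" using Is_Ms(3)[OF n] topspace_M[OF n] by blast
 thus ?thesis unfolding T by (intro homeomorphic_maps_subtopologies[OF M_homeo(1)]) (simp add: Int_absorb1 M_homeo(2))
qed

text \<open>The second filling is the same space with the opposite orientation \<open>iN\<close>,
  the core entering through \<open>Fi n\<close>. Both the map and the orientation are reversed, so
  the embedding is orientation-preserving, and the identity of \<open>Nn n\<close> reverses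
  orientation between the fillings. The slope filled is the image of the meridian under
  \<open>Fs n\<close>.\<close>

lemma cosmetic: "chirally_cosmetic (Mn n, oM n) slope1 slope2" unfolding chirally_cosmetic_def
proof (intro exI conjI)
 have id: "continuous_map (Mn n) (Nn n) id" unfolding M_sub_N[OF n] by (rule continuous_map_from_subtopology) simp
 have "lifts True hyp3 (id o q n) hyp3 (q n)" unfolding lifts_def using lsg_id by (auto intro!: exI[of _ id] exI[of _ UNIV])
 from M_N_orientation[OF lifts_N[OF this] id]
 have "preserves_orientation (Mn n, oM n) (Nn n, oN n) id" unfolding preserves_orientation_def by simp
 thus "dehn_filling (Mn n, oM n) slope1 (Nn n, oN n)" by (intro filling[of id id]) (use N_manifold(3)[OF n] isotopic_refl in "auto simp: slope1_def homeomorphic_maps_id")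
 have "continuous_map (Mn n) (Mn n) (Fi n)" using M_homeo(1) by (simp add: homeomorphic_maps_def)
 hence c: "continuous_map (Mn n) (Nn n) (Fi n)" unfolding M_sub_N[OF n] cm_sub by blast
 have "preserves_orientation (Mn n, oM n) (Nn n, iN) (Fi n)" using M_N_orientation[OF lifts_N[OF lifts_Fi] c inj_on_subset[OF inj_FsFi(2) Is_Ms(2)[OF n]]]
  unfolding preserves_orientation_def iN_def by simp
 moreover have "homeomorphic_maps (Mn n) (Mn n) (Fi n) (Fs n)" using M_homeo(1) homeomorphic_maps_sym by blast
 moreover have "homeomorphic_map T T (Fs n)" using T_homeo homeomorphic_map_maps by blast
 ultimately show "dehn_filling (Mn n, oM n) slope2 (Nn n, iN)" by (intro filling[of "Fi n" "Fs n"] iN_orientation) (simp_all add: slope2_def isotopic_refl)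
 show "orientation_reversingly_homeomorphic (Nn n, oN n) (Nn n, iN)" unfolding orientation_reversingly_homeomorphic_def reverses_orientation_def fst_conv snd_conv
 proof (intro exI conjI ballI)
  show "homeomorphic_map (Nn n) (Nn n) id" by simp
  fix p assume "p : manifold_interior (Nn n)"
  hence c: "oN n p : carrier (lhom (Nn n) p)" using N_manifold(3)[OF n] unfolding is_orientation_def by blast
  show "hi3 (Nn n) (topspace (Nn n) - {p}) (Nn n) (topspace (Nn n) - {id p}) id (oN n p) = inv\<^bsub>lhom (Nn n) (id p)\<^esub> (iN (id p))"
   using hom_induced_id[OF c] group.inv_inv[OF grp_rel c] by (simp add: iN_def)
 qed
qed
end

section \<open>Slopes\<close>

lemma circle_not_nullhomotopic: "~ homotopic_with (%_. True) circle_space circle_space id (%_. a)"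
proof
 assume "homotopic_with (%_. True) circle_space circle_space id (%_. a)"
 hence "contractible (sphere (0 :: complex) 1)" unfolding contractible_def by (auto simp: id_def)
 thus False by (simp add: contractible_sphere)
qed

lemma circle_missing_point:
 assumes f: "continuous_map X circle_space f" "!!x. x : topspace X ==> f x ~= a" and a: "a : sphere 0 1"
 shows "EX c. homotopic_with (%_. True) X circle_space f (%_. c)"
proof -
 have "sphere (0 :: complex) 1 - {a} homeomorphic {x. a \<bullet> x = 0}" by (rule homeomorphic_punctured_sphere_hyperplane) (use a in auto)
 hence "contractible (sphere 0 1 - {a}) \<longleftrightarrow> contractible {x. a \<bullet> x = 0}" by (rule homeomorphic_contractible_eq)
 hence "contractible_space (tos (sphere 0 1 - {a}))" by (simp add: convex_imp_contractible convex_hyperplane)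
 moreover have "continuous_map X (tos (sphere 0 1 - {a})) f" using f by (auto simp: cm_sub)
 ultimately obtain c where "homotopic_with (%_. True) X (tos (sphere 0 1 - {a})) f (%_. c)" using nullhomotopic_into_contractible_space by metis
 moreover have "continuous_map (tos (sphere 0 1 - {a})) circle_space id" by (auto simp: cm_sub)
 ultimately have "homotopic_with (%_. True) X circle_space (id o f) (id o (%_. c))" by (rule homotopic_with_compose_continuous_map_left) simp
 thus ?thesis by (auto simp: o_def)
qed

text \<open>A null-homotopy of the curve, composed with \<open>r\<close>, would contract the
  circle.\<close>

lemma retract_curve:
 assumes c: "continuous_map circle_space X c" and r: "continuous_map X circle_space r" and rc: "!!w. w : sphere 0 1 ==> r (c w) = w"
 shows "simple_closed_curve X (c ` sphere 0 1)" "nontrivial_curve X (c ` sphere 0 1)"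
proof -
 define C where "C = c ` sphere 0 1"
 have C: "C <= topspace X" unfolding C_def using continuous_map_image_subset_topspace[OF c] by simp
 have c': "continuous_map circle_space (subtopology X C) c" using c by (auto simp: cm_sub C_def)
 have "homeomorphic_maps circle_space (subtopology X C) c r" unfolding homeomorphic_maps_def using c' continuous_map_from_subtopology[OF r] rc by (auto simp: C_def)
 thus "simple_closed_curve X (c ` sphere 0 1)" unfolding simple_closed_curve_def C_def[symmetric] using C homeomorphic_maps_sym homeomorphic_space_def by blast
 show "nontrivial_curve X (c ` sphere 0 1)" unfolding nontrivial_curve_def C_def[symmetric]
 proof
  assume "EX a. homotopic_with (%_. True) (subtopology X C) X id (%_. a)"
  then obtain a where h: "homotopic_with (%_. True) (subtopology X C) X id (%_. a)" by blast
  have "homotopic_with (%_. True) circle_space circle_space (r o (id o c)) (r o ((%_. a) o c))"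
   by (rule homotopic_with_compose_continuous_map_left[OF homotopic_with_compose_continuous_map_right[OF h c'] r]) auto
  hence "homotopic_with (%_. True) circle_space circle_space id (%_. r a)" by (rule homotopic_with_eq) (auto simp: rc)
  thus False using circle_not_nullhomotopic by blast
 qed
qed

context
 fixes n :: nat
 assumes n: "odd n"
begin

text \<open>\<open>a0\<close> and \<open>b0\<close> are the lattice coordinates
  \<open>ca n omc\<close> and \<open>cb n omc\<close> of \<omega>, the offsets that the reflection
  adds after exchanging the two coordinates.\<close>

definition a0 where "a0 = 1/4 - 1/(4 * real n)"
definition b0 where "b0 = - 1/4 - 1/(4 * real n)"
definition u0 where "u0 = cis (2 * pi * (eps n * a0))"

lemma gt_cis: "cmod w = 1 ==> gt n (w, cis (2 * pi * s)) = kap n w s"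
proof -
 assume w: "cmod w = 1"
 have "Arg (cis (2 * pi * s))/(2 * pi) - s : \<int>" unfolding cis_2pi_eq[symmetric] by (rule cis_frac[OF n]) simp
 thus ?thesis unfolding gt_def[OF n] using w by (simp add: kap_eq[OF n])
qed

text \<open>Complex conjugation exchanges \<open>ca\<close> and \<open>cb\<close>, hence the
  directions of the two factors of the torus; \<omega> contributes the offsets and
  \<open>eps n\<close> the sense of the angle.\<close>

lemma Fs_gt:
 assumes w: "cmod w = 1"
 shows "Fs n (gt n (w, cis (2 * pi * s))) = gt n (cis (2 * pi * (eps n * (s + a0))), cis (2 * pi * (eps n * (Arg w/(2 * pi)) + b0)))"
proof -
 note n0 = n0[OF n]
 define a where "a = eps n * (Arg w/(2 * pi))"
 define v where "v = pt (czz n (s + a0) (a + b0)) 4"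
 have "gt n (w, cis (2 * pi * s)) = q n (pt (czz n a s) 4)" unfolding gt_cis[OF w] using w by (auto simp: kap_def a_def)
 moreover have "sg (pt (czz n a s) 4) = v" unfolding sg_def v_def pt_simps using n0 by (simp add: pt_eq_iff czz_def omc_def a0_def b0_def complex_eq_iff field_simps)
 ultimately have "Fs n (gt n (w, cis (2 * pi * s))) = q n v" using Fs_q[of "pt (czz n a s) 4" n] by simp
 also have "... = kap n (cis (2 * pi * (eps n * (s + a0)))) (a + b0)" using kap_Em[OF n, of v] unfolding Em_def v_def pt_simps ca_czz[OF n0] by simp
 also have "... = gt n (cis (2 * pi * (eps n * (s + a0))), cis (2 * pi * (a + b0)))" by (rule gt_cis[symmetric]) simp
 finally show ?thesis unfolding a_def .
qed

lemma curve2: "Fs n ` gt n ` meridian = gt n ` ({u0} \<times> sphere 0 1)"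
proof (intro equalityI subsetI)
 fix p assume "p : Fs n ` gt n ` meridian"
 then obtain w where w: "cmod w = 1" "p = Fs n (gt n (w, cis (2 * pi * 0)))" unfolding meridian_def by auto
 thus "p : gt n ` ({u0} \<times> sphere 0 1)" unfolding w(2) Fs_gt[OF w(1)] u0_def by simp
next
 fix p assume "p : gt n ` ({u0} \<times> sphere 0 1)"
 then obtain b where b: "b : sphere 0 1" "p = gt n (u0, b)" by auto
 define bt where "bt = Arg b/(2 * pi)"
 have bb: "b = cis (2 * pi * bt)" unfolding bt_def by (rule cis_frac[OF n b(1), symmetric])
 define w where "w = cis (2 * pi * (eps n * (bt - b0)))"
 have "cis (2 * pi * (Arg w/(2 * pi))) = cis (2 * pi * (eps n * (bt - b0)))" unfolding w_def by (rule cis_frac[OF n]) simp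
 hence "Arg w/(2 * pi) - eps n * (bt - b0) : \<int>" unfolding cis_2pi_eq .
 hence "eps n * (Arg w/(2 * pi)) + b0 - bt : \<int>" using eps(1)[OF n0[OF n]] minus_in_Ints_iff[of "Arg w/(2 * pi) - eps n * (bt - b0)"] by (auto simp: alg)
 hence "cis (2 * pi * (eps n * (Arg w/(2 * pi)) + b0)) = b" unfolding bb cis_2pi_eq[symmetric] .
 hence "Fs n (gt n (w, cis (2 * pi * 0))) = p" using Fs_gt[of w 0] b(2) by (simp add: w_def u0_def)
 thus "p : Fs n ` gt n ` meridian" by (auto simp: meridian_def w_def intro!: image_eqI[of p "Fs n"] imageI)
qed

text \<open>In torus coordinates the curves run along the two factors and meet once. If isotopic
  copies were disjoint, undoing the second isotopy would make the first curve homotopic to one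
  missing the second. Projected to the first factor, this is a map of the circle homotopic to the
  identity that omits \<open>u0\<close>, hence null-homotopic, which is impossible.\<close>

lemma slope_facts:
 "is_slope (T n) (slope1 n)" "is_slope (T n) (slope2 n)" "slope_distance (slope1 n) (slope2 n) = 1"
proof -
 obtain k where k: "homeomorphic_maps torus_space (T n) (gt n) k" using gt_torus[OF n] homeomorphic_map_maps by blast
 have ck: "continuous_map (T n) torus_space k" "continuous_map torus_space (T n) (gt n)"
  and kg: "!!y. y : sphere 0 1 \<times> sphere 0 1 ==> k (gt n y) = y" "!!p. p : topspace (T n) ==> gt n (k p) = p"
  using k unfolding homeomorphic_maps_def topspace_solid[OF n] by auto
 have u0: "u0 : sphere 0 1" by (simp add: u0_def)
 define c1 c2 where "c1 = (%w. gt n (w, 1))" and "c2 = (%b. gt n (u0, b))"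
 have c: "continuous_map circle_space (T n) c1" "continuous_map circle_space (T n) c2"
 proof -
  have "continuous_map circle_space torus_space (%w. (w, 1))" "continuous_map circle_space torus_space (%b. (u0, b))"
   unfolding torus_space_def by (intro continuous_map_pairedI continuous_map_id[unfolded id_def] continuous_map_const[THEN iffD2] disjI2, use u0 in simp)+
  from this[THEN continuous_map_compose[OF _ ck(2)]]
  show "continuous_map circle_space (T n) c1" "continuous_map circle_space (T n) c2" unfolding c1_def c2_def o_def .
 qed
 note r = ck(1)[unfolded torus_space_def continuous_map_pairwise, THEN conjunct1]
  ck(1)[unfolded torus_space_def continuous_map_pairwise, THEN conjunct2]
 have C1: "gt n ` meridian = c1 ` sphere 0 1" unfolding meridian_def c1_def by auto
 have C2: "Fs n ` gt n ` meridian = c2 ` sphere 0 1" unfolding curve2 c2_def by auto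
 have S: "slope1 n = {C. isotopic_in (T n) (c1 ` sphere 0 1) C}" "slope2 n = {C. isotopic_in (T n) (c2 ` sphere 0 1) C}"
  unfolding slope1_def[OF n] slope2_def[OF n] C1[symmetric] C2[symmetric] by (rule refl)+
 note s1 = retract_curve[OF c(1) r(1), folded C1] and s2 = retract_curve[OF c(2) r(2), folded C2]
 show "is_slope (T n) (slope1 n)" unfolding is_slope_def slope1_def[OF n] by (intro exI[of _ "gt n ` meridian"] conjI s1) (simp_all add: c1_def kg)
 show "is_slope (T n) (slope2 n)" unfolding is_slope_def slope2_def[OF n] by (intro exI[of _ "Fs n ` gt n ` meridian"] conjI s2) (use u0 in "simp_all add: c2_def kg")
 show "slope_distance (slope1 n) (slope2 n) = 1" unfolding slope_distance_def
 proof (rule Least_equality)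
  have i: "c1 ` sphere 0 1 Int c2 ` sphere 0 1 = {gt n (u0, 1)}"
  proof (intro equalityI subsetI)
   fix p assume "p : c1 ` sphere 0 1 Int c2 ` sphere 0 1"
   then obtain w b where wb: "w : sphere 0 1" "b : sphere 0 1" "p = gt n (w, 1)" "p = gt n (u0, b)" unfolding c1_def c2_def by auto
   hence "(w, 1) = (u0, b)" using kg(1)[of "(w, 1)"] kg(1)[of "(u0, b)"] u0 by auto
   thus "p : {gt n (u0, 1)}" using wb by simp
  qed (use u0 in "auto simp: c1_def c2_def")
  show "EX C:slope1 n. EX C':slope2 n. finite (C Int C') & card (C Int C') = 1"
   unfolding S by (intro bexI[of _ "c1 ` sphere 0 1"] bexI[of _ "c2 ` sphere 0 1"])
    (simp_all add: i isotopic_refl[OF n])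
  fix m assume "EX C:slope1 n. EX C':slope2 n. finite (C Int C') & card (C Int C') = m"
  then obtain C C' where CC: "isotopic_in (T n) (c1 ` sphere 0 1) C" "isotopic_in (T n) (c2 ` sphere 0 1) C'"
   and mm: "finite (C Int C')" "card (C Int C') = m" unfolding S by (elim bexE conjE CollectE)
  obtain g where g1: "homotopic_with (homeomorphic_map (T n) (T n)) (T n) (T n) id g" "C = g ` c1 ` sphere 0 1" using CC(1) unfolding isotopic_in_def by (elim exE conjE) simp
  obtain g' where g2: "homotopic_with (homeomorphic_map (T n) (T n)) (T n) (T n) id g'" "C' = g' ` c2 ` sphere 0 1" using CC(2) unfolding isotopic_in_def by (elim exE conjE) simp
  note g = g1(1) g2(1) and m = mm[unfolded g1(2) g2(2)]
  show "1 <= m"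
  proof (rule ccontr)
   assume "~ 1 <= m"
   hence dis: "g ` c1 ` sphere 0 1 Int g' ` c2 ` sphere 0 1 = {}" using m(2) card_0_eq[OF m(1)] by linarith
   have "homeomorphic_map (T n) (T n) g'" using g(2) homotopic_with_imp_property by blast
   then obtain h where h: "homeomorphic_maps (T n) (T n) g' h" using homeomorphic_map_maps by blast
   have ch: "continuous_map (T n) (T n) h" and hg: "!!p. p : topspace (T n) ==> h (g' p) = p" "!!p. p : topspace (T n) ==> g' (h p) = p"
    using h unfolding homeomorphic_maps_def by auto
   have cg: "continuous_map (T n) (T n) g" by (rule homotopic_with_imp_continuous_maps[OF g(1), THEN conjunct2])
   \<comment> \<open>The inverse \<open>h\<close> of the end map \<open>g'\<close> of the isotopy is
     itself homotopic to the identity, and so is \<open>h o g\<close>.\<close>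
   have "homotopic_with (%_. True) (T n) (T n) (h o id) (h o g')" by (rule homotopic_with_compose_continuous_map_left[OF g(2) ch]) (rule TrueI)
   hence 1: "homotopic_with (%_. True) (T n) (T n) (h o id) id" by (rule homotopic_with_eq) (simp_all add: hg)
   have "homotopic_with (%_. True) (T n) (T n) (h o id) (h o g)" by (rule homotopic_with_compose_continuous_map_left[OF g(1) ch]) (rule TrueI)
   hence "homotopic_with (%_. True) (T n) (T n) id (h o g)" by (rule homotopic_with_trans[OF homotopic_with_symD[OF 1]])
   hence "homotopic_with (%_. True) circle_space circle_space ((fst o k) o (id o c1)) ((fst o k) o ((h o g) o c1))"
    by (rule homotopic_with_compose_continuous_map_left[OF homotopic_with_compose_continuous_map_right[OF _ c(1) TrueI] r(1) TrueI])
   hence 2: "homotopic_with (%_. True) circle_space circle_space id ((fst o k) o ((h o g) o c1))" by (rule homotopic_with_eq) (simp_all add: c1_def kg)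
   have "((fst o k) o ((h o g) o c1)) w ~= u0" if w: "w : topspace circle_space" for w
   proof
    assume e: "((fst o k) o ((h o g) o c1)) w = u0"
    define p where "p = h (g (c1 w))"
    have T: "c1 w : topspace (T n)" "g (c1 w) : topspace (T n)" "p : topspace (T n)" unfolding p_def using c(1) cg ch w unfolding continuous_map_def Pi_iff by auto
    hence "k p : sphere 0 1 \<times> sphere 0 1" using ck(1) unfolding continuous_map_def topspace_solid[OF n] Pi_iff by blast
    hence "snd (k p) : sphere 0 1" "k p = (u0, snd (k p))" using e[unfolded o_def, folded p_def] unfolding mem_Times_iff prod_eq_iff by simp_all
    hence "p = c2 (snd (k p))" unfolding c2_def using kg(2)[OF T(3)] by simp
    hence "p : c2 ` sphere 0 1" using \<open>snd (k p) : sphere 0 1\<close> by blast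
    moreover have "g' p = g (c1 w)" unfolding p_def by (rule hg(2)[OF T(2)])
    ultimately have "g (c1 w) : g' ` c2 ` sphere 0 1" by (metis imageI)
    moreover have "g (c1 w) : g ` c1 ` sphere 0 1" using w by (intro imageI) simp
    ultimately show False using dis by (metis IntI empty_iff)
   qed
   then obtain a where "homotopic_with (%_. True) circle_space circle_space ((fst o k) o ((h o g) o c1)) (%_. a)"
    using circle_missing_point[OF homotopic_with_imp_continuous_maps[OF 2, THEN conjunct2] _ u0] by metis
   from homotopic_with_trans[OF 2 this] show False using circle_not_nullhomotopic by (rule notE[rotated])
  qed
 qed
qed
end

section \<open>The covering and the fundamental group\<close>

text \<open>The library states lifting for coverings between subsets of normed spaces, so \<open>Wn n\<close> is embedded into
  the bounded functions by distances to the points of hyperbolic space.\<close>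

definition kur :: "nat => real => (R3 \<Rightarrow>\<^sub>C real)" where
 "kur n p = Bcontfun (%y. min 1 (wd n p (q n (pt (cz y) (exp (y$3))))))"

lemma continuous_on_hyp_dist_le:
 fixes f :: "'a :: topological_space => 'b :: metric_space"
 assumes g: "continuous_on A g" "g ` A <= hyp3" and le: "!!y z. y : A ==> z : A ==> dist (f y) (f z) <= hyp_dist (g y) (g z)"
 shows "continuous_on A f" unfolding continuous_on_topological
proof (intro ballI allI impI)
 fix x B assume x: "x : A" and B: "open B" "f x : B"
 have gx: "g x : hyp3" using g(2) x by blast
 obtain e where e: "0 < e" "ball (f x) e <= B" using B openE by blast
 obtain U where U: "open U" "x : U" "!!y. y : A ==> y : U ==> g y : hball (g x) e"
  using g(1) x open_hball[OF gx] hball_center[OF gx e(1)] unfolding continuous_on_topological by metis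
 have "f y : B" if "y : A" "y : U" for y
 proof -
  have "dist (f x) (f y) < e" using le[OF x that(1)] U(3)[OF that] by (simp add: hball_def)
  thus ?thesis using e(2) by auto
 qed
 thus "EX U. open U & x : U & (ALL y:A. y : U --> f y : B)" using U(1,2) by blast
qed

lemma kur:
 assumes p: "p : q n ` hyp3"
 shows "apply_bcontfun (kur n p) y = min 1 (wd n p (q n (pt (cz y) (exp (y$3)))))"
proof -
 interpret Metric_space "q n ` hyp3" "wd n" by (rule Wn_metric)
 let ?g = "%y :: R3. pt (cz y) (exp (y$3))"
 have "continuous_on UNIV ?g" by (intro continuous_intros)
 moreover have "?g ` UNIV <= hyp3" by auto
 moreover have "dist (min 1 (wd n p (q n (?g y)))) (min 1 (wd n p (q n (?g z)))) <= hyp_dist (?g y) (?g z)" for y z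
 proof -
  have "wd n (q n (?g y)) (q n (?g z)) <= hyp_dist (?g y) (?g z)" by (rule wd_le) simp_all
  moreover have "wd n p (q n (?g y)) <= wd n p (q n (?g z)) + wd n (q n (?g z)) (q n (?g y))" by (rule triangle) (use p in simp_all)
  moreover have "wd n p (q n (?g z)) <= wd n p (q n (?g y)) + wd n (q n (?g y)) (q n (?g z))" by (rule triangle) (use p in simp_all)
  ultimately show ?thesis unfolding dist_real_def commute[of "q n (?g z)"] by linarith
 qed
 ultimately have "continuous_on UNIV (%y. min 1 (wd n p (q n (?g y))))" by (rule continuous_on_hyp_dist_le)
 hence "(%y. min 1 (wd n p (q n (?g y)))) : bcontfun" by (rule bcontfun_normI[of _ 1]) (use nonneg in auto)
 thus ?thesis unfolding kur_def by (simp add: Bcontfun_inverse)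
qed

lemma dist_kur:
 assumes p: "p : q n ` hyp3" "p' : q n ` hyp3"
 shows "dist (kur n p) (kur n p') <= wd n p p'" "min 1 (wd n p p') <= dist (kur n p) (kur n p')"
proof -
 interpret Metric_space "q n ` hyp3" "wd n" by (rule Wn_metric)
 show "dist (kur n p) (kur n p') <= wd n p p'"
 proof (rule dist_bound)
  fix y :: "R3"
  let ?y = "q n (pt (cz y) (exp (y$3)))"
  have y: "?y : q n ` hyp3" by simp
  show "dist (kur n p y) (kur n p' y) <= wd n p p'" unfolding kur[OF p(1)] kur[OF p(2)] dist_real_def using triangle[OF p y] triangle[OF p(2,1) y] commute[of p p'] by linarith
 qed
 obtain x where x: "x : hyp3" "p' = q n x" using p by blast
 \<comment> \<open>The logarithm undoes the exponential by which all of space parametrises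
   \<open>hyp3\<close>. The test point is \<open>p'\<close> itself, where the two functions differ
   by \<open>min 1 (wd n p p')\<close>.\<close>
 define y where "y = pt (cz x) (ln (x$3))"
 have "pt (cz y) (exp (y$3)) = x" unfolding y_def using hyp3_pos[OF x(1)] by simp
 hence "kur n p y = min 1 (wd n p p')" "kur n p' y = 0" using kur p x(2) zero[OF p(2,2)] by simp_all
 thus "min 1 (wd n p p') <= dist (kur n p) (kur n p')" using dist_fun_lt_imp_dist_val_lt dist_bounded[of "kur n p" y "kur n p'"] nonneg[of p p'] by (simp add: dist_real_def)
qed

lemma kur_inj: "p : q n ` hyp3 ==> p' : q n ` hyp3 ==> kur n p = kur n p' ==> p = p'"
 using dist_kur(2)[of p n p'] Metric_space.zero[OF Wn_metric, of p n p'] Metric_space.nonneg[OF Wn_metric, of n p p'] by auto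

lemma continuous_kur_q: "continuous_on hyp3 (%x. kur n (q n x))" by (rule continuous_on_hyp_dist_le[OF continuous_on_id]) (auto intro: order_trans[OF dist_kur(1) wd_le])

lemma continuous_kur: "continuous_map (Wn n) euclidean (kur n)" by (rule ftop_map(1)[OF atlas_q]) (simp add: continuous_kur_q o_def)

lemma kur_open:
 assumes U: "open U" "U <= hyp3"
 shows "openin (tos ((%x. kur n (q n x)) ` hyp3)) ((%x. kur n (q n x)) ` U)" unfolding openin_euclidean_subtopology_iff
proof (intro conjI ballI image_mono U(2))
 fix v assume "v : (%x. kur n (q n x)) ` U"
 then obtain x where x: "x : U" "v = kur n (q n x)" by blast
 have xh: "x : hyp3" using x U by blast
 obtain r where r: "0 < r" "hcball x r <= U" "r <= 1" by (rule hcball_small[OF xh U(1) x(1) zero_less_one])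
 have "w : (%x. kur n (q n x)) ` U" if w: "w : (%x. kur n (q n x)) ` hyp3" "dist w v < r" for w
 proof -
  obtain z where z: "z : hyp3" "w = kur n (q n z)" using w by blast
  obtain g where g: "g : Gn n" "wd n (q n x) (q n z) = hyp_dist x (act g z)" by (rule wd_attained[OF xh z(1)])
  have "min 1 (wd n (q n x) (q n z)) < r" using dist_kur(2)[OF imageI[OF xh] imageI[OF z(1)], of n] w(2) unfolding z(2) x(2) dist_commute[of "kur n (q n z)"] by linarith
  hence "act g z : hcball x r" using g r(3) act_hyp3[OF Gn_Gam[OF g(1)] z(1)] by (simp add: hcball_def)
  hence "act g z : U" using r(2) by blast
  moreover have "w = kur n (q n (act g z))" using q_act[OF g(1) z(1)] z(2) by simp
  ultimately show ?thesis by blast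
 qed
 thus "EX e>0. ALL w:(%x. kur n (q n x)) ` hyp3. dist w v < e --> w : (%x. kur n (q n x)) ` U" using r(1) by blast
qed

lemma inv2_eq_pm:
 assumes h: "h : Gam" and e: "inv2 h * g = 1 | inv2 h * g = - 1"
 shows "g = h | g = - h"
proof -
 have m: "h * (inv2 h * g) = g" using inv2_mult[OF Gam_det[OF h]] by (simp add: mult.assoc[symmetric])
 from e show ?thesis
 proof
  assume a: "inv2 h * g = 1"
  show ?thesis using m[unfolded a] by simp
 next
  assume a: "inv2 h * g = - 1"
  show ?thesis using m[unfolded a] by simp
 qed
qed

text \<open>Over the image of a ball within the injectivity radius, the sheets are the translates
  under \<open>Gn n\<close>. Since \<open>g\<close> and \<open>- g\<close> give the same sheet, the
  family is taken as a set of balls and not indexed by the group.\<close>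

lemma covering_q: "covering_space hyp3 (%x. kur n (q n x)) ((%x. kur n (q n x)) ` hyp3)"
proof
 let ?E = "%x. kur n (q n x)"
 show "continuous_on hyp3 ?E" by (rule continuous_kur_q)
 show "?E ` hyp3 = ?E ` hyp3" by (rule refl)
 fix v assume "v : ?E ` hyp3"
 then obtain x where x: "x : hyp3" "v = ?E x" by blast
 obtain r where r: "0 < r" "r <= 1" "!!y z g. y : hball x r ==> z : hball x r ==> g : Gam ==> hyp_dist y (act g z) < 2 * r ==> g = 1 | g = - 1"
  using injectivity_radius[OF x(1)] by metis
 define B where "B = (%g. act g ` hball x r)"
 have B: "B g = hball (act g x) r" "B g <= hyp3" "open (B g)" if g: "g : Gn n" for g
 proof -
  have G: "g : Gam" "inv2 g : Gam" using g Gn_Gam Gn_inv by auto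
  show e: "B g = hball (act g x) r"
  proof (intro equalityI subsetI)
   fix y assume "y : B g"
   thus "y : hball (act g x) r" unfolding B_def hball_def using act_isometry[OF G(1) x(1)] act_hyp3[OF G(1)] by auto
  next
   fix y assume y: "y : hball (act g x) r"
   hence yh: "y : hyp3" by (simp add: hball_def)
   have "hyp_dist x (act (inv2 g) y) = hyp_dist (act g x) (act g (act (inv2 g) y))" by (intro act_isometry[symmetric] G x act_hyp3 yh)
   hence "act (inv2 g) y : hball x r" using y act_hyp3[OF G(2) yh] act_inv(2)[OF G(1) yh] by (simp add: hball_def)
   thus "y : B g" unfolding B_def using act_inv(2)[OF G(1) yh] by (metis imageI)
  qed
  show "B g <= hyp3" "open (B g)" unfolding e using open_hball act_hyp3[OF G(1) x(1)] hball_sub by blast+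
 qed
 have T: "?E ` B g = ?E ` hball x r" if "g : Gn n" for g unfolding B_def image_image using q_act[OF that] hball_sub(3)[of x r] by (intro image_cong) auto
 show "EX T. v : T & openin (tos (?E ` hyp3)) T & (EX V. \<Union> V = hyp3 Int ?E -` T &
   (ALL u:V. openin (tos hyp3) u) & pairwise disjnt V & (ALL u:V. Ex (homeomorphism u T ?E)))"
 proof (intro exI[of _ "?E ` hball x r"] exI[of _ "B ` Gn n"] conjI ballI)
  show "v : ?E ` hball x r" unfolding x(2) by (rule imageI[OF hball_center[OF x(1) r(1)]])
  show "openin (tos (?E ` hyp3)) (?E ` hball x r)" by (rule kur_open[of "hball x r" n, OF open_hball[OF x(1)] hball_sub(3)])
  show "\<Union> (B ` Gn n) = hyp3 Int ?E -` (?E ` hball x r)"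
  proof (intro equalityI subsetI)
   fix y assume "y : \<Union> (B ` Gn n)"
   then obtain g where g: "g : Gn n" "y : B g" by blast
   hence "?E y : ?E ` B g" by blast
   thus "y : hyp3 Int ?E -` (?E ` hball x r)" unfolding T[OF g(1)] using B(2)[OF g(1)] g(2) by blast
  next
   fix y assume "y : hyp3 Int ?E -` (?E ` hball x r)"
   then obtain z where z: "y : hyp3" "z : hball x r" "?E y = ?E z" by auto
   have zh: "z : hyp3" using z hball_sub by blast
   have "q n z = q n y" by (rule kur_inj[OF imageI[OF zh] imageI[OF z(1)] z(3)[symmetric]])
   then obtain g where "g : Gn n" "y = act g z" unfolding q_eq_iff[OF zh z(1)] by (elim bexE)
   thus "y : \<Union> (B ` Gn n)" unfolding B_def using z(2) by (intro UN_I[of g]) simp_all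
  qed
  have eq: "g = h | g = - h" if gh: "g : Gn n" "h : Gn n" "y : hball x r" "z : hball x r" "act g y = act h z" for g h y z
  proof -
   have yz: "y : hyp3" "z : hyp3" by (rule subsetD[OF hball_sub(3) gh(3)], rule subsetD[OF hball_sub(3) gh(4)])
   note G = Gn_Gam[OF gh(1)] Gn_Gam[OF gh(2)] Gn_Gam[OF Gn_inv[OF gh(2)]]
   have "act (inv2 h * g) y = z" unfolding act_mult[OF G(3,1) yz(1)] gh(5) by (rule act_inv(1)[OF G(2) yz(2)])
   hence "hyp_dist z (act (inv2 h * g) y) < 2 * r" using r(1) hyp_dist_0_iff[OF yz(2,2)] by simp
   thus ?thesis by (intro inv2_eq_pm[OF G(2)] r(3)[OF gh(4,3) Gam_mult[OF G(3,1)]])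
  qed
  show "pairwise disjnt (B ` Gn n)"
  proof (rule pairwiseI)
   fix U V assume "U : B ` Gn n" "V : B ` Gn n" "U ~= V"
   then obtain g h where gh: "g : Gn n" "h : Gn n" "U = B g" "V = B h" "B g ~= B h" by blast
   show "disjnt U V"
   proof (rule ccontr)
    assume "~ disjnt U V"
    then obtain y z where "y : hball x r" "z : hball x r" "act g y = act h z" unfolding gh disjnt_def B_def by blast
    hence "g = h | g = - h" by (rule eq[OF gh(1,2)])
    thus False using gh(5) by (auto simp: B_def)
   qed
  qed
  fix U assume "U : B ` Gn n"
  then obtain g where g: "g : Gn n" "U = B g" by blast
  show "openin (tos hyp3) U" using B(2,3)[OF g(1)] unfolding g(2) by (simp add: openin_open_eq hyp3_open)
  have "continuous_on U ?E" using continuous_on_subset[OF continuous_kur_q] B(2)[OF g(1)] g(2) by simp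
  moreover have "?E ` U = ?E ` hball x r" unfolding g(2) by (rule T[OF g(1)])
  moreover have "inj_on ?E U"
  proof (rule inj_onI)
   fix y z assume yz: "y : U" "z : U" "?E y = ?E z"
   hence h: "y : hyp3" "z : hyp3" using B(2)[OF g(1)] g(2) by auto
   have "q n y = q n z" by (rule kur_inj[OF imageI[OF h(1)] imageI[OF h(2)] yz(3)])
   then obtain k where k: "k : Gn n" "z = act k y" unfolding q_eq_iff[OF h] by (elim bexE)
   obtain y' z' where y': "y' : hball x r" "y = act g y'" "z' : hball x r" "z = act g z'" using yz(1,2) unfolding g(2) B_def by blast
   have h': "y' : hyp3" "z' : hyp3" by (rule subsetD[OF hball_sub(3) y'(1)], rule subsetD[OF hball_sub(3) y'(3)])
   have "act g z' = act (k * g) y'" using k(2) y'(2,4) Gn_act(2)[OF g(1) h'(1) k(1)] by simp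
   hence "g = k * g | g = - (k * g)" by (rule eq[OF g(1) Gn_mult[OF k(1) g(1)] y'(3,1)])
   hence "act g = act (k * g)" by (metis act_minus)
   thus "y = z" unfolding k(2) y'(2) Gn_act(2)[OF g(1) h'(1) k(1), symmetric] by (rule fun_cong)
  qed
  moreover have "openin (tos (?E ` hball x r)) (?E ` V)" if "openin (tos U) V" for V
  proof -
   have V: "open V" "V <= U" using that B(3)[OF g(1)] unfolding g(2) by (auto simp: openin_open_eq)
   hence "openin (tos (?E ` hyp3)) (?E ` V)" using B(2)[OF g(1)] g(2) by (intro kur_open) auto
   moreover have "?E ` V <= ?E ` hball x r" using V(2) T[OF g(1)] g(2) by blast
   moreover have "?E ` hball x r <= ?E ` hyp3" using hball_sub(3) by blast
   ultimately show ?thesis by (rule openin_subset_trans)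
  qed
  ultimately show "Ex (homeomorphism U (?E ` hball x r) ?E)" by (metis homeomorphism_injective_open_map)
 qed
qed

section \<open>Lifting homeomorphisms to hyperbolic space\<close>

definition lift_map :: "(R3 => R3) => bool" where
 "lift_map L \<longleftrightarrow> continuous_on hyp3 L & L : hyp3 \<rightarrow> hyp3"

lemma lift_exists:
 assumes F: "continuous_map (Wn n) (Wn m) F" and x: "x : hyp3" and y: "y : hyp3" and e: "F (q n x) = q m y"
 obtains L where "lift_map L" "L x = y" "!!z. z : hyp3 ==> q m (L z) = F (q n z)"
proof -
 have Fm: "F (q n z) : q m ` hyp3" if "z : hyp3" for z using F that unfolding continuous_map_def Pi_iff topspace_Wn by blast
 have "continuous_map (tos hyp3) euclidean (kur m o (F o q n))"
  by (intro continuous_map_compose[OF continuous_map_compose[OF ftop_continuous[OF atlas_q] F] continuous_kur])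
 hence "continuous_on hyp3 (kur m o (F o q n))" by simp
 moreover have "kur m o (F o q n) : hyp3 \<rightarrow> (%x. kur m (q m x)) ` hyp3" using Fm by (force simp: image_iff)
 moreover have "(kur m o (F o q n)) x = kur m (q m y)" using e by simp
 ultimately obtain L where L: "continuous_on hyp3 L" "L : hyp3 \<rightarrow> hyp3" "L x = y" "!!z. z : hyp3 ==> kur m (q m (L z)) = (kur m o (F o q n)) z"
  using covering_space_lift_strong[OF covering_q y x convex_imp_simply_connected[OF hyp3_convex] convex_imp_locally_path_connected[OF hyp3_convex]] by metis
 have "q m (L z) = F (q n z)" if z: "z : hyp3" for z by (rule kur_inj) (use L(2,4) Fm z in "auto simp: Pi_iff")
 thus thesis using that[of L] L(1-3) unfolding lift_map_def by blast
qed

lemma lift_unique: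
 assumes L: "lift_map L" "lift_map L'" and a: "a : hyp3" "L a = L' a"
  and e: "!!z. z : hyp3 ==> q m (L z) = q m (L' z)" and z: "z : hyp3"
 shows "L z = L' z"
proof (rule covering_space_lift_unique[OF covering_q, where T = hyp3 and ?g1.0 = L and ?g2.0 = L' and a = a and f = "%x. kur m (q m (L x))"])
 show "continuous_on hyp3 (%x. kur m (q m (L x)))" using L(1) continuous_on_compose2[OF continuous_kur_q] unfolding lift_map_def by blast
qed (use L a e z convex_connected[OF hyp3_convex] in "auto simp: lift_map_def Pi_iff")

lemma lift_act: "g : Gam ==> lift_map (act g)" unfolding lift_map_def using continuous_on_act act_hyp3 by blast

lemma lift_comp: "lift_map L ==> lift_map L' ==> lift_map (%x. L (L' x))" unfolding lift_map_def by (auto intro: continuous_on_compose2)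

text \<open>A deck transformation is chosen to match the lifts at one point; uniqueness of lifts
  does the rest.\<close>

lemma lift_deck:
 assumes L: "lift_map L" "lift_map L'" and e: "!!z. z : hyp3 ==> q m (L z) = q m (L' z)"
 shows "EX h:Gn m. ALL z:hyp3. L' z = act h (L z)"
proof -
 obtain a where a: "a : hyp3" using hyp3_nonempty by blast
 have m: "L z : hyp3" "L' z : hyp3" if "z : hyp3" for z using L that unfolding lift_map_def by auto
 obtain h where h: "h : Gn m" "L' a = act h (L a)" using q_eq_iff[OF m[OF a]] e[OF a] by blast
 have "L' z = act h (L z)" if z: "z : hyp3" for z by (rule lift_unique[OF L(2) lift_comp[OF lift_act[OF Gn_Gam[OF h(1)]] L(1)] a h(2) _ z, of m]) (use e m q_act[OF h(1)] in simp)
 thus ?thesis using h(1) by blast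
qed

lemma act_eq:
 assumes g: "g : Gam" "h : Gam" and x: "x : hyp3" and e: "act g x = act h x"
 shows "g = h | g = - h"
proof -
 have i: "inv2 h : Gam" by (rule Gam_inv[OF g(2)])
 have "act (inv2 h * g) x = x" unfolding act_mult[OF i g(1) x] e by (rule act_inv(1)[OF g(2) x])
 thus ?thesis by (intro inv2_eq_pm[OF g(2)] act_free[OF Gam_mult[OF i g(1)] x])
qed

text \<open>A lift \<open>L\<close> intertwines the two actions by
  \<open>L (act g z) = act (Ph g) (L z)\<close>, where the matrix \<open>Ph g\<close> is determined
  up to sign. So \<open>Ph\<close> is multiplicative and surjective up to sign. A homomorphism
  modulo an odd \<open>p\<close> does not see the sign, and both homomorphisms can be pulled back
  along \<open>Ph\<close>.\<close>

lemma homeomorphic_two_homs: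
 assumes hom: "Wn n homeomorphic_space Wn m" and p: "odd p" and two: "two_homs p m"
 shows "two_homs p n"
proof -
 obtain F F' where FF: "homeomorphic_maps (Wn n) (Wn m) F F'" using hom unfolding homeomorphic_space_def by blast
 hence F: "continuous_map (Wn n) (Wn m) F" "continuous_map (Wn m) (Wn n) F'"
  and FF': "!!x. x : hyp3 ==> F' (F (q n x)) = q n x" "!!y. y : hyp3 ==> F (F' (q m y)) = q m y"
  unfolding homeomorphic_maps_def topspace_Wn by blast+
 obtain a where a: "a : hyp3" using hyp3_nonempty by blast
 have "F (q n a) : q m ` hyp3" using F(1) a unfolding continuous_map_def Pi_iff topspace_Wn by blast
 then obtain b where b: "b : hyp3" "F (q n a) = q m b" by blast
 have b': "F' (q m b) = q n a" using FF'(1)[OF a] b(2) by simp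
 obtain L where L: "lift_map L" "L a = b" "!!z. z : hyp3 ==> q m (L z) = F (q n z)" using lift_exists[OF F(1) a b] by metis
 obtain L' where L': "lift_map L'" "L' b = a" "!!z. z : hyp3 ==> q n (L' z) = F' (q m z)" using lift_exists[OF F(2) b(1) a b'] by metis
 have m: "L z : hyp3" "L' z : hyp3" if "z : hyp3" for z using L(1) L'(1) that unfolding lift_map_def by auto
 have id: "lift_map (%x. x)" by (simp add: lift_map_def)
 have LL': "L (L' z) = z" if z: "z : hyp3" for z by (rule lift_unique[OF lift_comp[OF L(1) L'(1)] id b(1) _ _ z, of m]) (use L L' m FF' in simp_all)
 have "EX h:Gn m. ALL z:hyp3. L (act g z) = act h (L z)" if g: "g : Gn n" for g
  by (rule lift_deck[OF L(1) lift_comp[OF L(1) lift_act[OF Gn_Gam[OF g]]]]) (use L(3) q_act[OF g] act_hyp3[OF Gn_Gam[OF g]] in simp)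
 then obtain Ph where Ph: "!!g. g : Gn n ==> Ph g : Gn m" "!!g z. g : Gn n ==> z : hyp3 ==> L (act g z) = act (Ph g) (L z)"
  by metis
 have "EX h:Gn n. ALL z:hyp3. L' (act g z) = act h (L' z)" if g: "g : Gn m" for g
  by (rule lift_deck[OF L'(1) lift_comp[OF L'(1) lift_act[OF Gn_Gam[OF g]]]]) (use L'(3) q_act[OF g] act_hyp3[OF Gn_Gam[OF g]] in simp)
 hence surj: "EX g:Gn n. Ph g = h | Ph g = - h" if h: "h : Gn m" for h
 proof -
  obtain g where g: "g : Gn n" "!!z. z : hyp3 ==> L' (act h z) = act g (L' z)"
   using h \<open>!!g. g : Gn m ==> EX h:Gn n. ALL z:hyp3. L' (act g z) = act h (L' z)\<close> by blast
  have "act (Ph g) b = L (act g a)" using Ph(2)[OF g(1) a] L(2) by simp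
  also have "... = L (L' (act h b))" using g(2)[OF b(1)] L'(2) by simp
  also have "... = act h b" by (rule LL'[OF act_hyp3[OF Gn_Gam[OF h] b(1)]])
  finally show ?thesis using act_eq[OF Gn_Gam[OF Ph(1)[OF g(1)]] Gn_Gam[OF h] b(1)] g(1) by blast
 qed
 have mult: "Ph (g * h) = Ph g * Ph h | Ph (g * h) = - (Ph g * Ph h)" if gh: "g : Gn n" "h : Gn n" for g h
 proof (rule act_eq[OF Gn_Gam[OF Ph(1)[OF Gn_mult[OF gh]]] Gn_Gam[OF Gn_mult[OF Ph(1)[OF gh(1)] Ph(1)[OF gh(2)]]] b(1)])
  have "act (Ph (g * h)) b = L (act g (act h a))" using Ph(2)[OF Gn_mult[OF gh] a] L(2) Gn_act(2)[OF gh(2) a gh(1)] by simp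
  also have "... = act (Ph g) (act (Ph h) b)" using Ph(2)[OF gh(1) Gn_act(1)[OF gh(2) a]] Ph(2)[OF gh(2) a] L(2) by simp
  finally show "act (Ph (g * h)) b = act (Ph g * Ph h) b" using Gn_act(2)[OF Ph(1)[OF gh(2)] b(1) Ph(1)[OF gh(1)]] by simp
 qed
 have sgn: "[th (- h) = th h] (mod p)" if th: "hom_mod p m th" and h: "h : Gn m" for th h
 proof -
  have d: "p dvd th (g * h) - (th g + th h)" if "g : Gn m" "h : Gn m" for g h using th that unfolding hom_mod_def cong_iff_dvd_diff by blast
  have 1: "1 : Gn m" "- 1 : Gn m" using Gn_1 Gn_minus by auto
  have "p dvd th 1" using d[OF 1(1,1)] by simp
  from dvd_diff[OF this d[OF 1(2,2)]] have "p dvd 2 * th (-1)" by simp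
  hence "p dvd th (-1)" using p by (simp add: coprime_dvd_mult_right_iff)
  moreover have "p dvd th (- h) - (th (-1) + th h)" using d[OF 1(2) h] by simp
  ultimately show ?thesis unfolding cong_iff_dvd_diff using dvd_add[of p "th (- h) - (th (-1) + th h)" "th (-1)"] by simp
 qed
 have pull: "hom_mod p n (%g. th (Ph g))" if th: "hom_mod p m th" for th unfolding hom_mod_def
 proof (intro ballI)
  fix g h assume gh: "g : Gn n" "h : Gn n"
  have "[th (Ph g * Ph h) = th (Ph g) + th (Ph h)] (mod p)"
   by (rule bspec[OF bspec[OF th[unfolded hom_mod_def] Ph(1)[OF gh(1)]] Ph(1)[OF gh(2)]])
  thus "[th (Ph (g * h)) = th (Ph g) + th (Ph h)] (mod p)"
   using mult[OF gh] cong_trans[OF sgn[OF th Gn_mult[OF Ph(1)[OF gh(1)] Ph(1)[OF gh(2)]]]] by (elim disjE) simp_all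
 qed
 obtain th1 th2 c d where t: "hom_mod p m th1" "hom_mod p m th2" "c : Gn m" "d : Gn m"
   "[th1 c = 1] (mod p)" "[th1 d = 0] (mod p)" "[th2 c = 0] (mod p)" "[th2 d = 1] (mod p)" using two unfolding two_homs_def by blast
 obtain c' d' where c': "c' : Gn n" "Ph c' = c | Ph c' = - c" and d': "d' : Gn n" "Ph d' = d | Ph d' = - d" using surj t(3,4) by metis
 have v: "[th (Ph g) = k] (mod p)" if "hom_mod p m th" "h : Gn m" "Ph g = h | Ph g = - h" "[th h = k] (mod p)" for th g h k
  using that sgn[OF that(1,2)] cong_trans by metis
 show ?thesis unfolding two_homs_def by (intro exI[of _ "%g. th1 (Ph g)"] exI[of _ "%g. th2 (Ph g)"] exI[of _ c'] exI[of _ d'] conjI pull t c' d'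
    v[OF t(1,3) c'(2) t(5)] v[OF t(1,4) d'(2) t(6)] v[OF t(2,3) c'(2) t(7)] v[OF t(2,4) d'(2) t(8)])
qed

lemma Wn_not_homeomorphic:
 assumes "prime n" "prime m" "7 <= n" "7 <= m" "n ~= m"
 shows "~ Wn n homeomorphic_space Wn m"
proof
 assume "Wn n homeomorphic_space Wn m"
 hence "Wn m homeomorphic_space Wn n" by (rule homeomorphic_space_sym[THEN iffD1])
 moreover obtain p where "odd p" "two_homs p n" "~ two_homs p m" using two_homs_distinguish[OF assms] by blast
 ultimately show False using homeomorphic_two_homs by blast
qed

theorem corollary4p7:
  shows "\<exists>\<W> :: real oriented set.
    infinite \<W> \<and>
    pairwise (\<lambda>W W'. \<not> fst W homeomorphic_space fst W') \<W> \<and>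
    (\<forall>W\<in>\<W>. one_cusped_hyperbolic W \<and> achiral W \<and>
      (\<exists>M :: real oriented. compact_with_torus_boundary M \<and> oriented_interior_of W M \<and>
        (\<exists>\<gamma>\<^sub>1 \<gamma>\<^sub>2. is_slope (boundary_space (fst M)) \<gamma>\<^sub>1 \<and> is_slope (boundary_space (fst M)) \<gamma>\<^sub>2 \<and>
          slope_distance \<gamma>\<^sub>1 \<gamma>\<^sub>2 = 1 \<and> chirally_cosmetic M \<gamma>\<^sub>1 \<gamma>\<^sub>2)))"

proof -
 \<comment> \<open>Distinct primes have coprime Fibonacci numbers; from 7 on they are odd, differ
   from 3 and 5, and have \<open>fib n > 1\<close>.\<close>
 define P :: "nat set" where "P = {n. prime n & 7 <= n}"
 define W where "W = (%n. (Wn n, oW n))"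
 have sep: "~ Wn n homeomorphic_space Wn m" if "n : P" "m : P" "n ~= m" for n m using Wn_not_homeomorphic that unfolding P_def by simp
 have "inj_on W P" unfolding W_def by (rule inj_onI, rule ccontr) (metis sep homeomorphic_space_refl prod.inject)
 moreover have "infinite P"
 proof
  assume "finite P"
  moreover have "{p :: nat. prime p} <= P Un {..<7}" unfolding P_def by auto
  ultimately show False using primes_infinite finite_subset by blast
 qed
 ultimately have "infinite (W ` P)" by (simp add: finite_image_iff)
 moreover have "pairwise (%W W'. ~ fst W homeomorphic_space fst W') (W ` P)" unfolding pairwise_image by (rule pairwiseI) (simp add: W_def sep)
 moreover have "ALL w:W ` P. one_cusped_hyperbolic w & achiral w &
   (EX M :: real oriented. compact_with_torus_boundary M & oriented_interior_of w M &
    (\<exists>gm\<^sub>1 gm\<^sub>2. is_slope (boundary_space (fst M)) gm\<^sub>1 & is_slope (boundary_space (fst M)) gm\<^sub>2 &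
     slope_distance gm\<^sub>1 gm\<^sub>2 = 1 & chirally_cosmetic M gm\<^sub>1 gm\<^sub>2))"
  (is "ALL w:_. ?Q w")
 proof
  fix w assume w: "w : W ` P"
  obtain n where n: "prime n" "7 <= n" "w = (Wn n, oW n)" using w unfolding P_def W_def by auto
  have o: "odd n" using prime_odd_nat[OF n(1)] n(2) by simp
  have "is_slope (boundary_space (fst (Mn n, oM n))) (slope1 n)" "is_slope (boundary_space (fst (Mn n, oM n))) (slope2 n)" using slope_facts[OF o] by simp_all
  thus "?Q w" unfolding n(3) using W_one_cusped[OF o] W_achiral[OF o] M_torus[OF o] W_interior_M[OF o] cosmetic[OF o] slope_facts(3)[OF o]
   by (intro conjI exI[of _ "(Mn n, oM n)"] exI[of _ "slope1 n"] exI[of _ "slope2 n"]) assumption+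
 qed
 ultimately show ?thesis by (intro exI[of _ "W ` P"] conjI)
qed
end
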